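(* Let $\nu_0$ be a probability measure on $\mathbb{R}$, and let $(N,C,A_1,A_2,\ldots)$ be a random vector with values in $\{0,1,2,\ldots\}\times\mathbb{R}\times(0,\infty)^{\mathbb{N}}$ such that (i) $\int_{1-\varepsilon}^1 \frac{\mathrm{d}s}{s-\mathbb{E}[s^N]}=\infty$ for all sufficiently small $\varepsilon>0$; (ii) $\mathbb{P}[A_1>0,\ldots,A_m>0\mid N=m]=1$ for every $m\in\mathbb{N}$; (iii) for some $m$ with $\mathbb{P}[N=m]>0$ one has $\mathbb{P}[A_1=1,\ldots,A_m=1\mid N=m]<1$; (iv) $\mathbb{E}[N]\in(1,\infty]$. Use the notation of the context ($W_t$, $\Phi$, $\mu$, $\mathcal{D}$, $M_\infty$, the classes $\mathcal{H}_\gamma$ and the functions $\hat g_\gamma$). Let $\gamma\in\mathcal{D}$, $\gamma>0$, and suppose that one of the following sets of conditions holds: 1. $\mathbb{E}[C]\ne0$, $\mathbb{E}|C|^p<\infty$ for some $p>1$, $1\in\mathrm{int}(\mathcal{D})$, $\mu'(1)<0$, $\Phi(1)>0$; and $\nu_0\in\mathcal{H}_\gamma$ with $\gamma<1$; 2. $\mathbb{E}[C]\ne0$, $\mathbb{E}|C|^p<\infty$ for some $p>1$, $1\in\mathrm{int}(\mathcal{D})$, $\mu'(1)<0$, $\Phi(1)=0$; and $\nu_0\in\mathcal{H}_\gamma$ with $\gamma<1$; 3. $\mathbb{E}[C]\ne0$, $\mathbb{E}|C|^p<\infty$ for some $p>1$, $1\in\mathrm{int}(\mathcal{D})$, $\mu'(1)<0$,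 $\Phi(1)<0$; and $\nu_0\in\mathcal{H}_\gamma$ with $\gamma<1$ and $\Phi(\gamma)>0$; 4. $\mathbb{E}[C]=0$, $\mu'(1)<0$, for some $p\in(1,2]$ both $\mathbb{E}[|C|^p]<\infty$ and $\Phi(p)<0$; and $\nu_0\in\mathcal{H}_\gamma$ with $\gamma<p$ and $\Phi(\gamma)>0$; 5. $\mathbb{E}[C]=0$, $2\in\mathrm{int}(\mathcal{D})$, $\Phi(2)>0$, $\mu'(2)<0$, $\mathbb{E}[C^2]\in(0,\infty)$; and $\nu_0\in\mathcal{H}_\gamma$ with $\gamma<2$. Let $\phi_t(\xi)=\mathbb{E}[e^{i\xi W_t}]$. Then, for every $\xi\in\mathbb{R}$, $$\phi_t(\xi e^{-\mu(\gamma)t})\to\mathbb{E}\big[\hat g_\gamma(\xi M_\infty^{1/\gamma}(\gamma))\big],\qquad t\to\infty.$$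
   Context: Notation: $\Phi(s)=\mathbb{E}\big[\sum_{k=1}^N A_k^s\big]-1$ for $s\ge0$; $\mathcal{D}=\{s>0:\mathbb{E}[\sum_{k=1}^N A_k^s]<\infty\}$; $\mu(s)=\Phi(s)/s$ for $s\in\mathcal{D}$. Writing $\mu'(s)<0$ presupposes that $s\in\mathcal{D}$ and that this derivative exists. Marked continuous-time branching random walk. Let $E$ be a unit mean exponential random variable and $R$ a random variable with distribution $\nu_0$, such that $E$, $R$ and $(N,C,A_1,A_2,\ldots)$ are independent. Let $\bigcup_{n\ge0}\mathbb{N}^n$ ($\mathbb{N}^0=\{\varnothing\}$) be the set of Ulam-Harris labels and equip the vertices $x$ with independent copies $(E(x),R(x),N(x),C(x),A_1(x),A_2(x),\ldots)$ of $(E,R,N,C,A_1,A_2,\ldots)$. The full Galton-Watson tree $\mathcal{T}_\infty$ contains $\varnothing$, and for each $x\in\mathcal{T}_\infty$ the children of $x$ in $\mathcal{T}_\infty$ are $xi$, $1\le i\le N(x)$. Birth times $B$, death times $D$ and positions $V$ are defined by $B(\varnothing)=0$, $D(x)=B(x)+E(x)$, $B(xi)=D(x)$, $V(\varnothing)=0$, $V(xi)=V(x)+\log A_i(x)$. For $t\ge0$ let $\partial\mathcal{T}_t=\{x\in\mathcal{T}_\infty: B(x)\le t<D(x)\}$ and $\mathcal{T}_t^o=\{x\in\mathcal{T}_\infty: D(x)\le t\}$. Put $$W_t=\sum_{x\in\partial\mathcal{T}_t}e^{V(x)}R(x)+\sum_{x\in\mathcal{T}_t^o}e^{V(x)}C(x),\qquad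 M_t(\gamma)=e^{-\Phi(\gamma)t}\sum_{x\in\partial\mathcal{T}_t}e^{\gamma V(x)},\quad\gamma\in\mathcal{D}.$$ ($\phi_t$ is then the unique solution of $\partial_t\phi_t=\widehat{\mathcal{Q}}\phi_t-\phi_t$, $\widehat{\mathcal{Q}}\psi(\xi)=\mathbb{E}[e^{i\xi C}\prod_{k=1}^N\psi(A_k\xi)]$, with $\phi_0$ the characteristic function of $\nu_0$.) $(M_t(\gamma))_{t\ge0}$ is a nonnegative martingale, $M_\infty(\gamma)$ denotes its a.s. limit as $t\to\infty$, and $M_\infty^{1/\gamma}(\gamma)=(M_\infty(\gamma))^{1/\gamma}$. Classes $\mathcal{H}_\gamma$, $\gamma\in(0,2)$, of probability measures $\nu_0$ and the functions $\hat g_\gamma$: - $\gamma=1$: $\nu_0\in\mathcal{H}_1$ iff either (a) $\int|x|\,\nu_0(\mathrm{d}x)<\infty$, in which case $m_0=\int x\,\nu_0(\mathrm{d}x)$ and $\hat g_1(\xi)=e^{im_0\xi}$; or (b) $\lim_{x\to+\infty}x\nu_0(x,+\infty)=\lim_{x\to-\infty}|x|\nu_0(-\infty,x)=c_0\in(0,\infty)$ and $\lim_{T\to+\infty}\int_{[-T,T]}x\,\nu_0(\mathrm{d}x)=m_0\in(-\infty,\infty)$, in which case $\hat g_1(\xi)=e^{im_0\xi-\pi c_0|\xi|}$. - $\gamma\in(0,1)\cup(1,2)$: $\nu_0\in\mathcal{H}_\gamma$ iff $\lim_{x\to+\infty}x^\gamma\nu_0(x,+\infty)=c_0^+$ and $\lim_{x\to-\infty}|x|^\gamma\nu_0(-\infty,x)=c_0^-$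 with $c_0^\pm$ finite and $c_0^++c_0^->0$, and, if $\gamma>1$, moreover $\int x\,\nu_0(\mathrm{d}x)=0$; then $\hat g_\gamma(\xi)=\exp\{-k_0|\xi|^\gamma(1-ib_0\tan(\pi\gamma/2)\,\mathrm{sgn}(\xi))\}$ with $k_0=(c_0^++c_0^-)\frac{\pi}{2\Gamma(\gamma)\sin(\pi\gamma/2)}$ and $b_0=\frac{c_0^+-c_0^-}{c_0^++c_0^-}$. *)

theory Defs
  imports "HOL-Probability.Probability"
begin

section \<open>The random vector and its moment function\<close>

text \<open>Only the indices \<open>i \<ge> 1\<close> of a weight sequence \<open>A\<close> are meaningful, hence the
  restriction of the last component to \<open>{1..}\<close>.\<close>

definition offspring_space :: "(nat \<times> real \<times> (nat \<Rightarrow> real)) measure" where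
  "offspring_space = count_space UNIV \<Otimes>\<^sub>M borel \<Otimes>\<^sub>M (\<Pi>\<^sub>M i\<in>{1..}. borel)"

definition offspring ::
  "('a \<Rightarrow> nat) \<Rightarrow> ('a \<Rightarrow> real) \<Rightarrow> (nat \<Rightarrow> 'a \<Rightarrow> real) \<Rightarrow> 'a \<Rightarrow> nat \<times> real \<times> (nat \<Rightarrow> real)" where
  "offspring N C A \<omega> = (N \<omega>, C \<omega>, \<lambda>i\<in>{1..}. A i \<omega>)"

text \<open>Extended-real valued: \<open>Phi s = \<infinity>\<close> if the moment diverges, so that \<open>Phi s < 0\<close> entails finiteness.\<close>

definition Phi :: "'a measure \<Rightarrow> ('a \<Rightarrow> nat) \<Rightarrow> (nat \<Rightarrow> 'a \<Rightarrow> real) \<Rightarrow> real \<Rightarrow> ereal" where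
  "Phi P N A s = enn2ereal (\<integral>\<^sup>+ \<omega>. ennreal (\<Sum>k=1..N \<omega>. A k \<omega> powr s) \<partial>P) - 1"

definition Dom :: "'a measure \<Rightarrow> ('a \<Rightarrow> nat) \<Rightarrow> (nat \<Rightarrow> 'a \<Rightarrow> real) \<Rightarrow> real set" where
  "Dom P N A = {s. 0 < s \<and> (\<integral>\<^sup>+ \<omega>. ennreal (\<Sum>k=1..N \<omega>. A k \<omega> powr s) \<partial>P) < \<infinity>}"

definition mu :: "'a measure \<Rightarrow> ('a \<Rightarrow> nat) \<Rightarrow> (nat \<Rightarrow> 'a \<Rightarrow> real) \<Rightarrow> real \<Rightarrow> real" where
  "mu P N A s = real_of_ereal (Phi P N A s) / s"

text \<open>\<open>\<mu>'(s) < 0\<close>, where \<open>\<mu>\<close> is a function on \<open>Dom\<close>; the values of \<open>mu\<close> outside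
  \<open>Dom\<close> are junk and do not enter.  At interior points this is the ordinary two-sided derivative.\<close>

definition mu_deriv_neg :: "'a measure \<Rightarrow> ('a \<Rightarrow> nat) \<Rightarrow> (nat \<Rightarrow> 'a \<Rightarrow> real) \<Rightarrow> real \<Rightarrow> bool" where
  "mu_deriv_neg P N A s \<longleftrightarrow>
     s \<in> Dom P N A \<and> (\<exists>d<0. (mu P N A has_real_derivative d) (at s within Dom P N A))"


section \<open>The marked continuous-time branching random walk\<close>

text \<open>An Ulam-Harris label is a list of positive integers with the youngest generation first:
  the \<open>i\<close>-th child of \<open>x\<close> is \<open>i # x\<close>.\<close>

definition labels :: "nat list set" where
  "labels = lists {1..}"

primrec in_tree :: "(nat list \<Rightarrow> 'a \<Rightarrow> nat) \<Rightarrow> nat list \<Rightarrow> 'a \<Rightarrow> bool" where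
  "in_tree N [] \<omega> \<longleftrightarrow> True"
| "in_tree N (i # x) \<omega> \<longleftrightarrow> in_tree N x \<omega> \<and> 1 \<le> i \<and> i \<le> N x \<omega>"

primrec birth :: "(nat list \<Rightarrow> 'a \<Rightarrow> real) \<Rightarrow> nat list \<Rightarrow> 'a \<Rightarrow> real" where
  "birth E [] \<omega> = 0"
| "birth E (i # x) \<omega> = birth E x \<omega> + E x \<omega>"

definition death :: "(nat list \<Rightarrow> 'a \<Rightarrow> real) \<Rightarrow> nat list \<Rightarrow> 'a \<Rightarrow> real" where
  "death E x \<omega> = birth E x \<omega> + E x \<omega>"

primrec position :: "(nat list \<Rightarrow> nat \<Rightarrow> 'a \<Rightarrow> real) \<Rightarrow> nat list \<Rightarrow> 'a \<Rightarrow> real" where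
  "position A [] \<omega> = 0"
| "position A (i # x) \<omega> = position A x \<omega> + ln (A x i \<omega>)"

definition alive ::
  "(nat list \<Rightarrow> 'a \<Rightarrow> real) \<Rightarrow> (nat list \<Rightarrow> 'a \<Rightarrow> nat) \<Rightarrow> real \<Rightarrow> 'a \<Rightarrow> nat list set" where
  "alive E N t \<omega> = {x. in_tree N x \<omega> \<and> birth E x \<omega> \<le> t \<and> t < death E x \<omega>}"

definition dead ::
  "(nat list \<Rightarrow> 'a \<Rightarrow> real) \<Rightarrow> (nat list \<Rightarrow> 'a \<Rightarrow> nat) \<Rightarrow> real \<Rightarrow> 'a \<Rightarrow> nat list set" where
  "dead E N t \<omega> = {x. in_tree N x \<omega> \<and> death E x \<omega> \<le> t}"

text \<open>The index sets below are almost surely finite when the process does not explode;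
  on infinite sets the library's \<open>sum\<close> is 0.\<close>

definition W ::
  "(nat list \<Rightarrow> 'a \<Rightarrow> real) \<Rightarrow> (nat list \<Rightarrow> 'a \<Rightarrow> real) \<Rightarrow> (nat list \<Rightarrow> 'a \<Rightarrow> nat) \<Rightarrow>
   (nat list \<Rightarrow> 'a \<Rightarrow> real) \<Rightarrow> (nat list \<Rightarrow> nat \<Rightarrow> 'a \<Rightarrow> real) \<Rightarrow> real \<Rightarrow> 'a \<Rightarrow> real" where
  "W E R N C A t \<omega> =
     (\<Sum>x\<in>alive E N t \<omega>. exp (position A x \<omega>) * R x \<omega>) +
     (\<Sum>x\<in>dead E N t \<omega>. exp (position A x \<omega>) * C x \<omega>)"

text \<open>\<open>M\<^sub>t(\<gamma>)\<close>: the factor \<open>\<Phi>(\<gamma>)\<close> is computed from the generic vector \<open>(N, A)\<close> on \<open>P\<close>,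
  the sum runs over the particles alive at time \<open>t\<close>.\<close>

definition brw_martingale ::
  "'b measure \<Rightarrow> ('b \<Rightarrow> nat) \<Rightarrow> (nat \<Rightarrow> 'b \<Rightarrow> real) \<Rightarrow>
   (nat list \<Rightarrow> 'a \<Rightarrow> real) \<Rightarrow> (nat list \<Rightarrow> 'a \<Rightarrow> nat) \<Rightarrow>
   (nat list \<Rightarrow> nat \<Rightarrow> 'a \<Rightarrow> real) \<Rightarrow> real \<Rightarrow> real \<Rightarrow> 'a \<Rightarrow> real" where
  "brw_martingale P N A Ev Nv Av \<gamma> t \<omega> =
     exp (- real_of_ereal (Phi P N A \<gamma>) * t) *
     (\<Sum>x\<in>alive Ev Nv t \<omega>. exp (\<gamma> * position Av x \<omega>))"

text \<open>\<open>(N, C, A)\<close> is the generic vector on \<open>P\<close>; the family \<open>(Ev x, Rv x, Nv x, Cv x, Av x)\<close>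
  of the marks lives on \<open>M\<close>.  The product form of the law of the marks expresses that the
  exponential time, the variable with law \<open>\<nu>\<^sub>0\<close> and the vector are independent.\<close>

locale marked_brw = prob_space M
  for P :: "'b measure" and N :: "'b \<Rightarrow> nat" and C :: "'b \<Rightarrow> real" and A :: "nat \<Rightarrow> 'b \<Rightarrow> real"
    and \<nu>\<^sub>0 :: "real measure"
    and M :: "'a measure"
    and Ev Rv :: "nat list \<Rightarrow> 'a \<Rightarrow> real" and Nv :: "nat list \<Rightarrow> 'a \<Rightarrow> nat"
    and Cv :: "nat list \<Rightarrow> 'a \<Rightarrow> real" and Av :: "nat list \<Rightarrow> nat \<Rightarrow> 'a \<Rightarrow> real" +
  assumes indep_marks:
    "indep_vars (\<lambda>_. borel \<Otimes>\<^sub>M borel \<Otimes>\<^sub>M offspring_space)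
       (\<lambda>x \<omega>. (Ev x \<omega>, Rv x \<omega>, offspring (Nv x) (Cv x) (Av x) \<omega>)) labels"
  and law_marks: "\<And>x. x \<in> labels \<Longrightarrow>
    distr M (borel \<Otimes>\<^sub>M borel \<Otimes>\<^sub>M offspring_space)
      (\<lambda>\<omega>. (Ev x \<omega>, Rv x \<omega>, offspring (Nv x) (Cv x) (Av x) \<omega>)) =
    density lborel (exponential_density 1) \<Otimes>\<^sub>M \<nu>\<^sub>0 \<Otimes>\<^sub>M distr P offspring_space (offspring N C A)"


section \<open>The classes of initial distributions\<close>

definition right_tail :: "real \<Rightarrow> real measure \<Rightarrow> real \<Rightarrow> real" where
  "right_tail \<gamma> \<nu> x = x powr \<gamma> * measure \<nu> {x<..}"

definition left_tail :: "real \<Rightarrow> real measure \<Rightarrow> real \<Rightarrow> real" where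
  "left_tail \<gamma> \<nu> x = \<bar>x\<bar> powr \<gamma> * measure \<nu> {..<x}"

definition trunc_mean :: "real measure \<Rightarrow> real \<Rightarrow> real" where
  "trunc_mean \<nu> T = (LINT x:{-T..T}|\<nu>. x)"

definition \<H> :: "real \<Rightarrow> real measure set" where
  "\<H> \<gamma> = {\<nu>. real_distribution \<nu> \<and> 0 < \<gamma> \<and> \<gamma> < 2 \<and>
     (if \<gamma> = 1 then
        integrable \<nu> (\<lambda>x. x) \<or>
        ((\<exists>c>0. (right_tail 1 \<nu> \<longlongrightarrow> c) at_top \<and> (left_tail 1 \<nu> \<longlongrightarrow> c) at_bot) \<and>
         (\<exists>m. (trunc_mean \<nu> \<longlongrightarrow> m) at_top))
      else
        (\<exists>cp cm. (right_tail \<gamma> \<nu> \<longlongrightarrow> cp) at_top \<and> (left_tail \<gamma> \<nu> \<longlongrightarrow> cm) at_bot \<and> cp + cm > 0) \<and>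
        (\<gamma> > 1 \<longrightarrow> has_bochner_integral \<nu> (\<lambda>x. x) 0))}"

text \<open>For \<open>\<nu> \<in> \<H> 1\<close> the two alternatives exclude each other, since \<open>c > 0\<close> forces
  an infinite first absolute moment.\<close>

definition g_hat :: "real \<Rightarrow> real measure \<Rightarrow> real \<Rightarrow> complex" where
  "g_hat \<gamma> \<nu> \<xi> =
     (let cp = Lim at_top (right_tail \<gamma> \<nu>); cm = Lim at_bot (left_tail \<gamma> \<nu>) in
      if \<gamma> = 1 then
        (if integrable \<nu> (\<lambda>x. x) then exp (\<i> * complex_of_real ((\<integral>x. x \<partial>\<nu>) * \<xi>))
         else exp (\<i> * complex_of_real (Lim at_top (trunc_mean \<nu>) * \<xi>)
                   - complex_of_real (pi * cp * \<bar>\<xi>\<bar>)))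
      else
        (let k = (cp + cm) * (pi / (2 * Gamma \<gamma> * sin (pi * \<gamma> / 2)));
             b = (cp - cm) / (cp + cm)
         in exp (- complex_of_real (k * \<bar>\<xi>\<bar> powr \<gamma>) *
                 (1 - \<i> * complex_of_real (b * tan (pi * \<gamma> / 2) * sgn \<xi>)))))"

end

theory Submission
  imports Defs "HOL-Real_Asymp.Real_Asymp"
begin

text \<open>
  Put \<open>\<mu> = \<mu>(\<gamma>)\<close>. Under each of the five sets of conditions there is an exponent
  \<open>p > \<gamma>\<close> in the domain with \<open>\<mu>(p) < \<mu>\<close>, \<open>\<mu> > 0\<close>, \<open>E |C|\<^sup>p < \<infinity>\<close> and either \<open>p = 1\<close>, or \<open>1 < p \<le> 2\<close> and
  \<open>E C = 0\<close>. One takes \<open>p = 1\<close> in the first three cases, the given \<open>p\<close> in the fourth and \<open>p = 2\<close> in the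
  fifth. In the fourth case \<open>\<mu>(p) < 0 < \<mu>\<close>; in the others \<open>\<mu>(p) < \<mu>\<close> because \<open>\<Phi>\<close> is convex, so that a
  negative derivative of \<open>\<mu> = \<Phi> / id\<close> at \<open>p\<close> forces larger values everywhere to the left
  (lemma \<open>mu_greater_left_of_decrease\<close>).

  Split \<open>e\<^bsup>-\<mu>t\<^esup> W\<^sub>t\<close> into the contributions of the dead and of the living particles.

  The dead particles contribute nothing in the limit. The value \<open>C(x)\<close> may depend on the
  number and the weights of the children of \<open>x\<close>, but neither on \<open>V(x)\<close> nor on whether \<open>x\<close> is dead by time \<open>t\<close>.
  So if \<open>E C = 0\<close> and the labels are added in the order of their generations, the partial sums form a
  martingale. Hence the \<open>p\<close>-th absolute moment of the dead sum is at most a constant times the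
  expected value of \<open>\<Sum> e\<^bsup>pV(x)\<^esup>\<close> over the particles born by time \<open>t\<close>, which is \<open>O(e\<^bsup>ct\<^esup>)\<close> for every
  \<open>c > max (\<Phi>(p)) 0\<close> (lemma \<open>dead_sum_moment\<close>). Since \<open>\<Phi>(p) = p \<mu>(p) < p \<mu>\<close>, the number \<open>c\<close> can be chosen
  below \<open>p \<mu>\<close>, and the normalisation \<open>e\<^bsup>-p\<mu>t\<^esup>\<close> wins.

  The living particles carry the limit. Integrating out the variables \<open>R(x)\<close>, which do not influence the
  tree, turns the characteristic function of their contribution into the expectation of
  \<open>\<Prod> \<phi>\<^sub>0(\<xi> a\<^sub>x)\<close> with \<open>a\<^sub>x = e\<^bsup>V(x) - \<mu>t\<^esup>\<close> (lemma \<open>alive_char\<close>). For \<open>\<nu>\<^sub>0 \<in> \<H> \<gamma>\<close> an Abelian theorem gives a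
  complex \<open>\<kappa>\<close> with \<open>\<phi>\<^sub>0(\<xi> a) = exp (- \<kappa> a\<^sup>\<gamma>) + o(a\<^sup>\<gamma>)\<close> as \<open>a\<close> decreases to \<open>0\<close>, and \<open>\<kappa>\<close> is exactly the
  constant for which \<open>exp (- \<kappa> m)\<close> equals the limit function at \<open>\<xi> m\<^bsup>1/\<gamma>\<^esup>\<close> (lemma \<open>H_char_expansion\<close>). The
  remainder is at most \<open>\<epsilon> a\<^sup>\<gamma> + K a\<^sup>p\<close> for all \<open>a > 0\<close>. All factors have modulus at most \<open>1\<close>, so the
  product differs from \<open>exp (- \<kappa> \<Sum> a\<^sub>x\<^sup>\<gamma>)\<close> by at most \<open>\<epsilon> \<Sum> a\<^sub>x\<^sup>\<gamma> + K \<Sum> a\<^sub>x\<^sup>p\<close>. Here \<open>\<Sum> a\<^sub>x\<^sup>\<gamma>\<close> is the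
  martingale \<open>M\<^sub>t(\<gamma>)\<close>, of mean at most \<open>1\<close>, and \<open>\<Sum> a\<^sub>x\<^sup>p\<close> has mean at most \<open>e\<^bsup>-p(\<mu> - \<mu>(p))t\<^esup>\<close>, which vanishes
  (lemma \<open>alive_product_approximation\<close>). It remains to let \<open>M\<^sub>t(\<gamma>)\<close> converge under the bounded function
  \<open>exp (- \<kappa> m)\<close> (lemma \<open>martingale_limit_functional\<close>).

  The sums run over infinitely many labels, so one needs that almost surely only finitely many particles are
  born by time \<open>t\<close>. This is where the divergence of the integral of \<open>1 / (s - E s\<^sup>N)\<close> near \<open>1\<close> is used: it is the
  Osgood condition which makes the constant \<open>1\<close> the only solution, started at \<open>1\<close>, of the differential
  equation \<open>q' = E q\<^sup>N - q\<close> satisfied by the non-explosion probability (lemmas \<open>osgood_uniqueness\<close> and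
  \<open>finitely_many_births\<close>).

  The probabilistic arguments are carried out on the product space of all marks. Conditional expectations
  are replaced by a resampling identity: replacing the mark of one label by an independent copy preserves
  the law, and the data of a particle do not depend on the marks of labels of the same or of later
  generations. Infinite sums and products are handled through finite boxes of labels, with
  bounds that do not depend on the box.
\<close>

section \<open>Mellin transforms of the trigonometric kernels\<close>

lemma set_integrable_powr_near_0:
  fixes p :: real
  assumes "p > -1"
  shows "set_integrable lborel {0<..1} (\<lambda>x::real. x powr p)"
proof -
  have "(\<lambda>x::real. x powr p) integrable_on {0..1}"
    using integrable_on_powr_from_0[of p 1] assms by simp
  then have "(\<lambda>x::real. x powr p) absolutely_integrable_on {0..1}"
    by (intro nonnegative_absolutely_integrable_1) auto
  then have "set_integrable lebesgue {0<..1} (\<lambda>x::real. x powr p)"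
    by (rule set_integrable_subset) auto
  then show ?thesis
    unfolding set_integrable_def by (subst (asm) integrable_completion) auto
qed

lemma set_integrable_powr_at_infinity:
  fixes p :: real
  assumes "p < -1"
  shows "set_integrable lborel {1<..} (\<lambda>x::real. x powr p)"
proof -
  have "(\<lambda>x::real. x powr p) integrable_on {1..}"
    using has_integral_powr_to_inf[of p 1] assms by (auto simp: integrable_on_def)
  then have "(\<lambda>x::real. x powr p) absolutely_integrable_on {1..}"
    by (intro nonnegative_absolutely_integrable_1) auto
  then have "set_integrable lebesgue {1<..} (\<lambda>x::real. x powr p)"
    by (rule set_integrable_subset) auto
  then show ?thesis
    unfolding set_integrable_def by (subst (asm) integrable_completion) auto
qed

text \<open>Comparison with \<open>w\<^bsup>a-c-1\<^esup>\<close> on \<open>(0, 1]\<close> and with \<open>w\<^bsup>b-c-1\<^esup>\<close> on \<open>(1, \<infinity>)\<close>.\<close>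

lemma set_integrable_between_powers:
  fixes f :: "real \<Rightarrow> real"
  assumes [measurable]: "f \<in> borel_measurable borel"
    and "b < c" "c < a"
    and fa: "\<And>w. w > 0 \<Longrightarrow> \<bar>f w\<bar> \<le> B * w powr a"
    and fb: "\<And>w. w > 0 \<Longrightarrow> \<bar>f w\<bar> \<le> B * w powr b"
  shows "set_integrable lborel {0<..} (\<lambda>w. f w * w powr (- c - 1))"
proof -
  have "set_integrable lborel {0<..1} (\<lambda>w. f w * w powr (- c - 1))"
    unfolding set_integrable_def
  proof (rule Bochner_Integration.integrable_bound)
    show "integrable lborel (\<lambda>w. B * (indicat_real {0<..1} w *\<^sub>R w powr (a - c - 1)))"
      using set_integrable_powr_near_0[of "a - c - 1"] \<open>c < a\<close>
      unfolding set_integrable_def by auto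
    have "\<bar>f w\<bar> * w powr (- c - 1) \<le> B * w powr (a - c - 1)" if "w > 0" for w
      using mult_right_mono[OF fa[OF that], of "w powr (-c-1)"]
      by (simp add: powr_add[symmetric] mult.assoc algebra_simps)
    then show "AE x in lborel. norm (indicat_real {0<..1} x *\<^sub>R (f x * x powr (- c - 1)))
        \<le> norm (B * (indicat_real {0<..1} x *\<^sub>R x powr (a - c - 1)))"
      by (intro AE_I2) (auto simp: indicator_def abs_mult intro!: order_trans[OF _ mult_right_mono[OF abs_ge_self]])
  qed measurable
  moreover have "set_integrable lborel {1<..} (\<lambda>w. f w * w powr (- c - 1))"
    unfolding set_integrable_def
  proof (rule Bochner_Integration.integrable_bound)
    show "integrable lborel (\<lambda>w. B * (indicat_real {1<..} w *\<^sub>R w powr (b - c - 1)))"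
      using set_integrable_powr_at_infinity[of "b - c - 1"] \<open>b < c\<close>
      unfolding set_integrable_def by auto
    have "\<bar>f w\<bar> * w powr (- c - 1) \<le> B * w powr (b - c - 1)" if "w > 0" for w
      using mult_right_mono[OF fb[OF that], of "w powr (-c-1)"]
      by (simp add: powr_add[symmetric] mult.assoc algebra_simps)
    then show "AE x in lborel. norm (indicat_real {1<..} x *\<^sub>R (f x * x powr (- c - 1)))
        \<le> norm (B * (indicat_real {1<..} x *\<^sub>R x powr (b - c - 1)))"
      by (intro AE_I2) (auto simp: indicator_def abs_mult intro!: order_trans[OF _ mult_right_mono[OF abs_ge_self]])
  qed measurable
  ultimately have "set_integrable lborel ({0<..1} \<union> {1<..}) (\<lambda>w. f w * w powr (- c - 1))"
    by (intro set_integrable_Un) auto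
  also have "{0<..1} \<union> {1<..} = {0::real<..}" by auto
  finally show ?thesis .
qed

lemma has_bochner_integral_Gamma_scaled:
  fixes a w :: real
  assumes "a > 0" "w > 0"
  shows "has_bochner_integral lborel (\<lambda>s. indicator {0<..} s * (s powr (a - 1) * exp (- s * w)))
           (Gamma a * w powr (- a))"
proof -
  have *: "indicator {0..} s * s powr (a - 1) / exp s = indicator {0<..} s * (s powr (a - 1) * exp (- s))"
    for s :: real by (auto simp: indicator_def exp_minus field_simps)
  have "(\<integral>\<^sup>+ s. ennreal (indicator {0<..} s * (s powr (a - 1) * exp (- s))) \<partial>lborel) = ennreal (Gamma a)"
    using Gamma_conv_nn_integral_real[OF \<open>a > 0\<close>] unfolding * by simp
  then have 1: "has_bochner_integral lborel (\<lambda>s. indicator {0<..} s * (s powr (a - 1) * exp (- s))) (Gamma a)"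
    using \<open>a > 0\<close> by (intro has_bochner_integral_nn_integral) (auto intro: Gamma_real_nonneg)
  have "has_bochner_integral lborel (\<lambda>s. indicator {0<..} (0 + w * s) * ((0 + w * s) powr (a - 1) * exp (- (0 + w * s)))) (Gamma a /\<^sub>R \<bar>w\<bar>)"
    using lborel_has_bochner_integral_real_affine_iff[of w "\<lambda>s. indicator {0<..} s * (s powr (a - 1) * exp (- s))" "Gamma a" 0] \<open>w > 0\<close> 1
    by simp
  then have "has_bochner_integral lborel (\<lambda>s. w powr (1 - a) * (indicator {0<..} (0 + w * s) * ((0 + w * s) powr (a - 1) * exp (- (0 + w * s))))) (w powr (1 - a) * (Gamma a /\<^sub>R \<bar>w\<bar>))"
    by (rule has_bochner_integral_mult_right)
  also have "(\<lambda>s. w powr (1 - a) * (indicator {0<..} (0 + w * s) * ((0 + w * s) powr (a - 1) * exp (- (0 + w * s)))))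
     = (\<lambda>s. indicator {0<..} s * (s powr (a - 1) * exp (- s * w)))"
  proof
    fix s :: real
    have "w powr (1 - a) * (w powr (a - 1)) = 1" using \<open>w > 0\<close> by (simp add: powr_add[symmetric])
    then have "w powr (1 - a) * ((w * s) powr (a - 1) * e) = s powr (a - 1) * e" if "s > 0" for e :: real
      using that \<open>w > 0\<close> by (simp add: powr_mult mult.assoc[symmetric])
    then show "w powr (1 - a) * (indicator {0<..} (0 + w * s) * ((0 + w * s) powr (a - 1) * exp (- (0 + w * s))))
       = indicator {0<..} s * (s powr (a - 1) * exp (- s * w))"
      using \<open>w > 0\<close> by (cases "s > 0") (auto simp: indicator_def zero_less_mult_iff mult.commute)
  qed
  also have "w powr (1 - a) * (Gamma a /\<^sub>R \<bar>w\<bar>) = Gamma a * w powr (- a)"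
    using \<open>w > 0\<close> by (simp add: powr_diff powr_minus field_simps)
  finally show ?thesis .
qed

text \<open>Writing \<open>\<Gamma>(c+1) w\<^bsup>-c-1\<^esup>\<close> as the integral of \<open>s\<^sup>c e\<^bsup>-sw\<^esup>\<close> and exchanging the integrals reduces a Mellin
  transform of \<open>f\<close> to one of its Laplace transform. For the trigonometric kernels the latter is rational.\<close>

lemma Gamma_times_Mellin_eq_Mellin_Laplace:
  fixes f :: "real \<Rightarrow> real"
  assumes [measurable]: "f \<in> borel_measurable borel" and "c > -1"
    and int: "set_integrable lborel {0<..} (\<lambda>w. f w * w powr (- c - 1))"
  shows "Gamma (c + 1) * (LBINT w:{0<..}. f w * w powr (- c - 1)) =
         (LBINT s:{0<..}. s powr c * (LBINT w:{0<..}. f w * exp (- s * w)))"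
proof -
  define h where "h = (\<lambda>(w, s). indicator {0<..} w * f w * (indicator {0<..} s * (s powr c * exp (- s * w))) :: real)"
  have G: "has_bochner_integral lborel (\<lambda>s. indicator {0<..} s * (s powr c * exp (- s * w)))
           (Gamma (c + 1) * w powr (- c - 1))" if "w > 0" for w :: real
    using has_bochner_integral_Gamma_scaled[of "c+1" w] that \<open>c > -1\<close> by simp
  have [measurable]: "h \<in> borel_measurable (lborel \<Otimes>\<^sub>M lborel)"
    unfolding h_def by measurable
  have i1: "(LBINT s. h (w, s)) = Gamma (c + 1) * (indicator {0<..} w *\<^sub>R (f w * w powr (- c - 1)))" for w
    using has_bochner_integral_integral_eq[OF G, of w]
    by (cases "w > 0") (auto simp: h_def)
  have i2: "(LBINT s. norm (h (w, s))) = Gamma (c + 1) * norm (indicator {0<..} w *\<^sub>R (f w * w powr (- c - 1)))" for w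
    using has_bochner_integral_integral_eq[OF G, of w]
    by (cases "w > 0") (auto simp: h_def abs_mult)
  have int_h: "integrable (lborel \<Otimes>\<^sub>M lborel) h"
  proof (rule lborel_pair.Fubini_integrable)
    show "integrable lborel (\<lambda>w. LBINT s. norm (h (w, s)))"
      unfolding i2 using int unfolding set_integrable_def
      by (intro integrable_mult_right integrable_norm)
    have "integrable lborel (\<lambda>s. h (w, s))" for w
      using G[of w] by (cases "w > 0") (auto simp: h_def has_bochner_integral_iff)
    then show "AE x in lborel. integrable lborel (\<lambda>y. h (x, y))" by simp
  qed measurable
  have "Gamma (c + 1) * (LBINT w:{0<..}. f w * w powr (- c - 1)) = (LBINT w. LBINT s. h (w, s))"
    unfolding i1 set_lebesgue_integral_def by simp
  also have "\<dots> = (LBINT s. LBINT w. h (w, s))"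
    using lborel_pair.Fubini_integral[of "\<lambda>w s. h (w, s)"] int_h by simp
  also have "(\<lambda>s. LBINT w. h (w, s)) =
      (\<lambda>s. indicator {0<..} s *\<^sub>R (s powr c * (LBINT w:{0<..}. f w * exp (- s * w))))"
  proof
    fix s :: real
    have "(LBINT w. h (w, s)) = (LBINT w. (indicator {0<..} s * s powr c) * (indicator {0<..} w *\<^sub>R (f w * exp (- s * w))))"
      by (intro Bochner_Integration.integral_cong) (auto simp: h_def)
    then show "(LBINT w. h (w, s)) = indicator {0<..} s *\<^sub>R (s powr c * (LBINT w:{0<..}. f w * exp (- s * w)))"
      unfolding set_lebesgue_integral_def by simp
  qed
  finally show ?thesis unfolding set_lebesgue_integral_def .
qed

lemma laplace_const:
  assumes "s > (0::real)"
  shows "set_integrable lborel {0<..} (\<lambda>w::real. exp (- s * w))"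
    and "(LBINT w:{0<..}. exp (- s * w)) = 1 / s"
proof -
  have "has_bochner_integral lborel (\<lambda>w. indicator {0<..} w *\<^sub>R exp (- s * w)) (1 / s)"
  proof -
    have e: "(\<lambda>w. indicator {0<..} w * (w powr (1 - 1) * exp (- w * s))) = (\<lambda>w. indicator {0<..} w *\<^sub>R exp (- s * w))"
      by (auto simp: fun_eq_iff indicator_def mult.commute)
    moreover have "s powr (-1) = 1 / s"
      using assms by (simp add: powr_minus_divide)
    ultimately show ?thesis
      using has_bochner_integral_Gamma_scaled[of 1 s] assms unfolding e by simp
  qed
  then show "set_integrable lborel {0<..} (\<lambda>w::real. exp (- s * w))"
    and "(LBINT w:{0<..}. exp (- s * w)) = 1 / s"
    by (auto simp: has_bochner_integral_iff set_integrable_def set_lebesgue_integral_def)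
qed

lemma laplace_id:
  assumes "s > (0::real)"
  shows "set_integrable lborel {0<..} (\<lambda>w::real. w * exp (- s * w))"
    and "(LBINT w:{0<..}. w * exp (- s * w)) = 1 / s\<^sup>2"
proof -
  have "s powr (-2) = 1 / s\<^sup>2" using assms by (simp add: powr_minus powr_numeral field_simps)
  then have "has_bochner_integral lborel (\<lambda>w. indicator {0<..} w *\<^sub>R (w * exp (- s * w))) (1 / s\<^sup>2)"
  proof -
    have e: "(\<lambda>w. indicator {0<..} w * (w powr (2 - 1) * exp (- w * s))) = (\<lambda>w. indicator {0<..} w *\<^sub>R (w * exp (- s * w)))"
      by (auto simp: fun_eq_iff indicator_def mult.commute)
    moreover have "Gamma (2::real) = 1"
      using Gamma_fact[of 1, where 'a = real] by simp
    ultimately show ?thesis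
      using has_bochner_integral_Gamma_scaled[of 2 s] assms \<open>s powr (-2) = 1 / s\<^sup>2\<close> unfolding e by simp
  qed
  then show "set_integrable lborel {0<..} (\<lambda>w::real. w * exp (- s * w))"
    and "(LBINT w:{0<..}. w * exp (- s * w)) = 1 / s\<^sup>2"
    by (auto simp: has_bochner_integral_iff set_integrable_def set_lebesgue_integral_def)
qed

lemma laplace_trig:
  assumes "s > (0::real)"
  shows "set_integrable lborel {0<..} (\<lambda>w::real. sin w * exp (- s * w))"
    and "(LBINT w:{0<..}. sin w * exp (- s * w)) = 1 / (1 + s\<^sup>2)"
    and "set_integrable lborel {0<..} (\<lambda>w::real. cos w * exp (- s * w))"
    and "(LBINT w:{0<..}. cos w * exp (- s * w)) = s / (1 + s\<^sup>2)"
proof -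
  have pos: "1 + s\<^sup>2 > 0" by (simp add: add_pos_nonneg)
  have "((\<lambda>w::real. exp (- s * w)) \<longlongrightarrow> 0) at_top"
    using assms by real_asymp
  then have dec: "((\<lambda>w. g w * exp (- s * w)) \<longlongrightarrow> 0) at_top" if "\<And>w. \<bar>g w\<bar> \<le> 1 + s" for g :: "real \<Rightarrow> real"
    using that assms
    by (intro Lim_null_comparison[where g = "\<lambda>w. (1 + s) * exp (- s * w)" and f = "\<lambda>w. g w * exp (- s * w)"])
       (auto simp: abs_mult intro!: tendsto_mult_right_zero always_eventually mult_right_mono)
  have bnd: "set_integrable lborel {0<..} (\<lambda>w::real. g w * exp (- s * w))"
    if [measurable]: "g \<in> borel_measurable borel" and "\<And>w. \<bar>g w\<bar> \<le> 1" for g :: "real \<Rightarrow> real"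
    unfolding set_integrable_def
    by (rule Bochner_Integration.integrable_bound[OF laplace_const(1)[OF assms, unfolded set_integrable_def]])
       (use that(2) in \<open>auto simp: abs_mult indicator_def intro!: mult_left_le_one_le\<close>)
  show i1: "set_integrable lborel {0<..} (\<lambda>w::real. sin w * exp (- s * w))"
    and i2: "set_integrable lborel {0<..} (\<lambda>w::real. cos w * exp (- s * w))"
    by (rule bnd; simp)+
  have FTC: "(LBINT w:{0<..}. f w) = - F 0"
    if "\<And>w. (F has_vector_derivative f w) (at w)" and "\<And>w. isCont f w" "set_integrable lborel {0<..} f"
      "(F \<longlongrightarrow> 0) at_top" for F f :: "real \<Rightarrow> real"
  proof -
    have c: "isCont F 0" using that(1)[of 0] has_vector_derivative_continuous by blast
    have "(LBINT x=0..\<infinity>. f x) = 0 - F 0"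
    proof (rule interval_integral_FTC_integrable)
      show "set_integrable lborel (einterval 0 \<infinity>) f"
        using that(3) by (simp add: zero_ereal_def)
      show "((F \<circ> real_of_ereal) \<longlongrightarrow> F 0) (at_right 0)"
        using c unfolding zero_ereal_def ereal_tendsto_simps
        by (simp add: isCont_def filterlim_at_split)
      show "((F \<circ> real_of_ereal) \<longlongrightarrow> 0) (at_left \<infinity>)"
        using that(4) unfolding ereal_tendsto_simps by simp
    qed (use that in auto)
    then show ?thesis by (simp add: interval_lebesgue_integral_0_infty)
  qed
  have "(LBINT w:{0<..}. sin w * exp (- s * w)) = - ((\<lambda>w. (- (s * sin w + cos w) / (1 + s\<^sup>2)) * exp (- s * w)) 0)"
  proof (rule FTC[OF _ _ i1])
    show "((\<lambda>w. (- (s * sin w + cos w) / (1 + s\<^sup>2)) * exp (- s * w)) has_vector_derivative sin w * exp (- s * w)) (at w)" for w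
    proof -
      have "((\<lambda>w. (- (s * sin w + cos w)) * exp (- s * w)) has_real_derivative (sin w * exp (- s * w)) * (1 + s\<^sup>2)) (at w)"
        by (auto intro!: derivative_eq_intros simp: algebra_simps power2_eq_square)
      from DERIV_cdivide[OF this, of "1 + s\<^sup>2"] show ?thesis
        unfolding has_real_derivative_iff_has_vector_derivative[symmetric] using pos by simp
    qed
    have "\<bar>- (s * sin w + cos w) / (1 + s\<^sup>2)\<bar> \<le> 1 + s" for w
    proof -
      have "\<bar>s * sin w + cos w\<bar> \<le> s * 1 + 1"
        using assms by (intro order_trans[OF abs_triangle_ineq] add_mono) (auto simp: abs_mult)
      then have "\<bar>s * sin w + cos w\<bar> / (1 + s\<^sup>2) \<le> (s + 1) / 1"
        using assms by (intro frac_le) auto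
      then show ?thesis using pos
        by (simp only: abs_divide abs_minus_cancel abs_of_pos) (simp add: add.commute)
    qed
    then show "((\<lambda>w. (- (s * sin w + cos w) / (1 + s\<^sup>2)) * exp (- s * w)) \<longlongrightarrow> 0) at_top"
      by (rule dec)
  qed auto
  then show "(LBINT w:{0<..}. sin w * exp (- s * w)) = 1 / (1 + s\<^sup>2)" by simp
  have "(LBINT w:{0<..}. cos w * exp (- s * w)) = - ((\<lambda>w. ((sin w - s * cos w) / (1 + s\<^sup>2)) * exp (- s * w)) 0)"
  proof (rule FTC[OF _ _ i2])
    show "((\<lambda>w. ((sin w - s * cos w) / (1 + s\<^sup>2)) * exp (- s * w)) has_vector_derivative cos w * exp (- s * w)) (at w)" for w
    proof -
      have "((\<lambda>w. (sin w - s * cos w) * exp (- s * w)) has_real_derivative (cos w * exp (- s * w)) * (1 + s\<^sup>2)) (at w)"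
        by (auto intro!: derivative_eq_intros simp: algebra_simps power2_eq_square)
      from DERIV_cdivide[OF this, of "1 + s\<^sup>2"] show ?thesis
        unfolding has_real_derivative_iff_has_vector_derivative[symmetric] using pos by simp
    qed
    have "\<bar>(sin w - s * cos w) / (1 + s\<^sup>2)\<bar> \<le> 1 + s" for w
    proof -
      have "\<bar>sin w - s * cos w\<bar> \<le> 1 + s * 1"
        using assms by (intro order_trans[OF abs_triangle_ineq4] add_mono) (auto simp: abs_mult)
      then have "\<bar>sin w - s * cos w\<bar> / (1 + s\<^sup>2) \<le> (1 + s) / 1"
        using assms by (intro frac_le) auto
      then show ?thesis using pos by (simp add: abs_divide)
    qed
    then show "((\<lambda>w. ((sin w - s * cos w) / (1 + s\<^sup>2)) * exp (- s * w)) \<longlongrightarrow> 0) at_top"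
      by (rule dec)
  qed auto
  then show "(LBINT w:{0<..}. cos w * exp (- s * w)) = s / (1 + s\<^sup>2)" by simp
qed

lemma Gamma_reflection_real:
  "Gamma a * Gamma (1 - a) = pi / sin (pi * a)" for a :: real
proof -
  have "complex_of_real (Gamma a * Gamma (1 - a)) = Gamma (of_real a) * Gamma (1 - of_real a)"
    by (simp add: Gamma_complex_of_real[symmetric])
  also have "\<dots> = of_real (pi / sin (pi * a))"
    by (simp add: Gamma_reflection_complex sin_of_real[symmetric])
  finally show ?thesis using of_real_eq_iff by blast
qed

text \<open>This is \<open>\<Gamma>(a) \<Gamma>(1-a)\<close>, obtained from the previous exchange applied to \<open>f(w) = e\<^bsup>-w\<^esup>\<close>, whose Laplace transform is
  \<open>1 / (1 + s)\<close>; the reflection formula evaluates it.\<close>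

lemma integral_powr_over_one_plus:
  assumes "0 < a" "a < (1::real)"
  shows "set_integrable lborel {0<..} (\<lambda>t::real. t powr (a - 1) / (1 + t))"
    and "(LBINT t:{0<..}. t powr (a - 1) / (1 + t)) = pi / sin (pi * a)"
proof -
  have "set_integrable lborel {0<..} (\<lambda>t::real. (1 / (1 + \<bar>t\<bar>)) * t powr (- (- a) - 1))"
  proof (rule set_integrable_between_powers[where a = 0 and b = "-1" and B = 1])
    show "\<bar>1 / (1 + \<bar>w\<bar>)\<bar> \<le> 1 * w powr -1" if "w > 0" for w :: real
      using that by (auto simp: powr_minus field_simps)
  qed (use assms in auto)
  then show "set_integrable lborel {0<..} (\<lambda>t::real. t powr (a - 1) / (1 + t))"
    by (rule set_integrable_cong[THEN iffD1, rotated -1]) auto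
  have si: "set_integrable lborel {0<..} (\<lambda>w::real. exp (- w) * w powr (- (a - 1) - 1))"
    using has_bochner_integral_Gamma_scaled[of "1 - a" 1] assms
    unfolding set_integrable_def has_bochner_integral_iff by (simp add: mult.commute)
  have "Gamma a * Gamma (1 - a) = Gamma ((a - 1) + 1) * (LBINT w:{0<..}. exp (- w) * w powr (- (a - 1) - 1))"
    using has_bochner_integral_Gamma_scaled[of "1 - a" 1] assms
    unfolding set_lebesgue_integral_def has_bochner_integral_iff by (simp add: mult.commute)
  also have "\<dots> = (LBINT s:{0<..}. s powr (a - 1) * (LBINT w:{0<..}. exp (- w) * exp (- s * w)))"
    by (rule Gamma_times_Mellin_eq_Mellin_Laplace) (use assms si in auto)
  also have "\<dots> = (LBINT s:{0<..}. s powr (a - 1) / (1 + s))"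
  proof (rule set_lebesgue_integral_cong)
    have "(LBINT w:{0<..}. exp (- w) * exp (- s * w)) = 1 / (1 + s)" if "s > 0" for s :: real
      using laplace_const(2)[of "1 + s"] that by (simp add: exp_add[symmetric] algebra_simps)
    then show "\<forall>s. s \<in> {0<..} \<longrightarrow> s powr (a - 1) * (LBINT w:{0<..}. exp (- w) * exp (- s * w)) = s powr (a - 1) / (1 + s)"
      by auto
  qed auto
  finally show "(LBINT t:{0<..}. t powr (a - 1) / (1 + t)) = pi / sin (pi * a)"
    by (simp add: Gamma_reflection_real)
qed

text \<open>Substitute \<open>t = s\<^sup>2\<close> in \<open>integral_powr_over_one_plus\<close> with \<open>a = b / 2\<close>.\<close>

lemma integral_powr_over_one_plus_square:
  assumes "0 < b" "b < (2::real)"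
  shows "(LBINT s:{0<..}. s powr (b - 1) / (1 + s\<^sup>2)) = pi / (2 * sin (pi * b / 2))"
proof -
  define f where "f = (\<lambda>t::real. t powr (b / 2 - 1) / (1 + t))"
  have ab: "0 < b / 2" "b / 2 < 1" using assms by auto
  have inj: "inj_on (\<lambda>s::real. s\<^sup>2) {0<..}"
    by (auto simp: inj_on_def)
  have img: "(\<lambda>s::real. s\<^sup>2) ` {0<..} = {0<..}"
  proof safe
    show "x \<in> (\<lambda>s. s\<^sup>2) ` {0<..}" if "x > 0" for x :: real
      using that by (intro image_eqI[of _ _ "sqrt x"]) auto
  qed auto
  have fi: "set_integrable lborel {0<..} f"
    and fb: "(LBINT t:{0<..}. f t) = pi / sin (pi * (b / 2))"
    using integral_powr_over_one_plus[OF ab] unfolding f_def by auto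
  have "f absolutely_integrable_on {0<..}"
    using fi unfolding set_integrable_def by (subst integrable_completion) auto
  moreover have "integral {0<..} f = pi / sin (pi * (b / 2))"
    using set_borel_integral_eq_integral(2)[OF fi] fb by simp
  ultimately have hh: "f absolutely_integrable_on {0<..} \<and> integral {0<..} f = pi / sin (pi * (b / 2))"
    by blast
  then have cv: "(\<lambda>s. \<bar>2 * s\<bar> * f (s\<^sup>2)) absolutely_integrable_on {0<..} \<and>
      integral {0<..} (\<lambda>s. \<bar>2 * s\<bar> * f (s\<^sup>2)) = pi / sin (pi * (b / 2))"
  proof -
    have "((\<lambda>s. s\<^sup>2) has_field_derivative 2 * x) (at x within {0<..})" for x :: real
      by (auto intro!: derivative_eq_intros)
    then show ?thesis
      using has_absolute_integral_change_of_variables_1'[of "{0<..}" "\<lambda>s. s\<^sup>2" "\<lambda>s. 2 * s" f] inj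
        hh unfolding img by auto
  qed
  have [measurable]: "f \<in> borel_measurable borel" unfolding f_def by measurable
  have si: "set_integrable lborel {0<..} (\<lambda>s. \<bar>2 * s\<bar> * f (s\<^sup>2))"
    using cv unfolding set_integrable_def by (subst (asm) integrable_completion) auto
  have "2 * (LBINT s:{0<..}. s powr (b - 1) / (1 + s\<^sup>2)) = (LBINT s:{0<..}. \<bar>2 * s\<bar> * f (s\<^sup>2))"
    unfolding set_integral_mult_right[symmetric]
  proof (rule set_lebesgue_integral_cong)
    have "s * (s\<^sup>2) powr (b / 2 - 1) = s powr (b - 1)" if "s > 0" for s :: real
    proof -
      have "(s\<^sup>2) powr (b / 2 - 1) = (s powr 2) powr (b / 2 - 1)"
        using that by (simp add: powr_numeral)
      also have "\<dots> = s powr (b - 2)" by (simp add: powr_powr algebra_simps)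
      finally show ?thesis using that powr_mult_base[of s "b - 2"] by simp
    qed
    then show "\<forall>s. s \<in> {0<..} \<longrightarrow> 2 * (s powr (b - 1) / (1 + s\<^sup>2)) = \<bar>2 * s\<bar> * f (s\<^sup>2)"
      by (auto simp: f_def)
  qed auto
  also have "\<dots> = pi / sin (pi * (b / 2))"
    using set_borel_integral_eq_integral(2)[OF si] cv by simp
  finally show ?thesis by simp
qed

lemma abs_one_minus_cos_le: "\<bar>1 - cos w\<bar> \<le> 2" "w > 0 \<Longrightarrow> \<bar>1 - cos w\<bar> \<le> w" "\<bar>1 - cos w\<bar> \<le> w\<^sup>2" for w :: real
proof -
  show "\<bar>1 - cos w\<bar> \<le> 2" using cos_ge_minus_one[of w] cos_le_one[of w] by linarith
  have s: "1 - cos w = 2 * (sin (w/2))\<^sup>2" using cos_double_sin[of "w/2"] by simp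
  have q: "\<bar>sin (w/2)\<bar> \<le> \<bar>w/2\<bar>" by (rule abs_sin_x_le_abs_x)
  have "\<bar>sin (w/2)\<bar> * \<bar>sin (w/2)\<bar> \<le> 1 * \<bar>w/2\<bar>" using q by (intro mult_mono) auto
  then show "\<bar>1 - cos w\<bar> \<le> w" if "w > 0" unfolding s using that by (simp add: power2_eq_square)
  have "(sin (w/2))\<^sup>2 \<le> (w/2)\<^sup>2" using q abs_le_square_iff by blast
  then have "4 * (sin (w/2))\<^sup>2 \<le> w\<^sup>2" by (simp add: power_divide)
  then have "2 * (sin (w/2))\<^sup>2 \<le> w\<^sup>2" using zero_le_power2[of "sin (w/2)"] by linarith
  then show "\<bar>1 - cos w\<bar> \<le> w\<^sup>2" unfolding s by simp
qed

text \<open>The two bounds match the exponents \<open>b = 1\<close> and \<open>a = 2\<close> of \<open>set_integrable_between_powers\<close>, as \<open>1 < c < 2\<close>.\<close>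

lemma id_minus_sin_bounds: 
  assumes "w > (0::real)"
  shows "\<bar>w - sin w\<bar> \<le> 2 * w" "\<bar>w - sin w\<bar> \<le> 2 * w\<^sup>2"
proof -
  have a: "\<bar>sin w\<bar> \<le> w" using abs_sin_x_le_abs_x[of w] assms by simp
  then show "\<bar>w - sin w\<bar> \<le> 2 * w" by linarith
  have "\<bar>w - sin w\<bar> \<le> 2 * w\<^sup>2"
  proof (cases "w \<le> 1")
    case True
    have "\<exists>t>0. t < w \<and> (w - sin w) - (0 - sin 0) = (w - 0) * (1 - cos t)"
      using assms by (intro MVT2) (auto intro!: derivative_eq_intros)
    then obtain t where "0 < t" "t < w" "w - sin w = w * (1 - cos t)" by auto
    then have "\<bar>w - sin w\<bar> \<le> w * w"
      using abs_one_minus_cos_le(2)[of t] assms by (simp add: abs_mult)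
    then show ?thesis using assms by (simp add: power2_eq_square)
  next
    case False
    then have "w * 1 \<le> w * w" using assms by (intro mult_left_mono) auto
    then show ?thesis using a by (simp add: power2_eq_square)
  qed
  then show "\<bar>w - sin w\<bar> \<le> 2 * w\<^sup>2" .
qed

lemma integrable_one_minus_cos_powr:
  assumes "0 < c" "c < 2"
  shows "set_integrable lborel {0<..} (\<lambda>w::real. (1 - cos w) * w powr (- c - 1))"
proof (rule set_integrable_between_powers[where a = 2 and b = 0 and B = 2])
  fix w :: real assume "w > 0"
  show "\<bar>1 - cos w\<bar> \<le> 2 * w powr 2"
    using \<open>w > 0\<close> abs_one_minus_cos_le(3)[of w] zero_le_power2[of w]
    unfolding powr_numeral[OF less_imp_le[OF \<open>w > 0\<close>]] by linarith
  show "\<bar>1 - cos w\<bar> \<le> 2 * w powr 0"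
    using \<open>w > 0\<close> abs_one_minus_cos_le(1)[of w] by simp
qed (use assms in auto)

lemma integrable_sin_powr:
  assumes "0 < c" "c < 1"
  shows "set_integrable lborel {0<..} (\<lambda>w::real. sin w * w powr (- c - 1))"
proof (rule set_integrable_between_powers[where a = 1 and b = 0 and B = 1])
  show "\<bar>sin w\<bar> \<le> 1 * w powr 1" if "w > 0" for w :: real
    using that abs_sin_x_le_abs_x[of w] by simp
qed (use assms in auto)

lemma integrable_id_minus_sin_powr:
  assumes "1 < c" "c < 2"
  shows "set_integrable lborel {0<..} (\<lambda>w::real. (w - sin w) * w powr (- c - 1))"
proof (rule set_integrable_between_powers[where a = 2 and b = 1 and B = 2])
  show "\<bar>w - sin w\<bar> \<le> 2 * w powr 2" if "w > 0" for w :: real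
    using that id_minus_sin_bounds(2)[of w] by (simp add: powr_numeral)
  show "\<bar>w - sin w\<bar> \<le> 2 * w powr 1" if "w > 0" for w :: real
    using that id_minus_sin_bounds(1)[of w] by simp
qed (use assms in auto)

text \<open>The common evaluation for the three kernels \<open>1 - cos w\<close>, \<open>sin w\<close> and \<open>w - sin w\<close>: multiplied by \<open>s\<^sup>c\<close>, each
  Laplace transform becomes \<open>s\<^bsup>b-1\<^esup> / (1 + s\<^sup>2)\<close>, with \<open>b\<close> equal to \<open>c\<close>, \<open>c + 1\<close> and \<open>c - 1\<close> respectively.\<close>

lemma Mellin_via_Laplace:
  fixes f :: "real \<Rightarrow> real"
  assumes [measurable]: "f \<in> borel_measurable borel" and "c > 0" "0 < b" "b < 2"
    and int: "set_integrable lborel {0<..} (\<lambda>w. f w * w powr (- c - 1))"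
    and lap: "\<And>s. s > 0 \<Longrightarrow> s powr c * (LBINT w:{0<..}. f w * exp (- s * w)) = s powr (b - 1) / (1 + s\<^sup>2)"
  shows "c * (LBINT w:{0<..}. f w * w powr (- c - 1)) = pi / (2 * Gamma c * sin (pi * b / 2))"
proof -
  have "Gamma (c + 1) = c * Gamma c"
    using Gamma_plus1[of c] assms by (simp add: add.commute nonpos_Ints_def)
  then have "(Gamma c) * (c * (LBINT w:{0<..}. f w * w powr (- c - 1))) = 
      Gamma (c + 1) * (LBINT w:{0<..}. f w * w powr (- c - 1))" by simp
  also have "\<dots> = (LBINT s:{0<..}. s powr c * (LBINT w:{0<..}. f w * exp (- s * w)))"
    by (rule Gamma_times_Mellin_eq_Mellin_Laplace) (use assms in auto)
  also have "\<dots> = (LBINT s:{0<..}. s powr (b - 1) / (1 + s\<^sup>2))"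
    by (rule set_lebesgue_integral_cong) (use lap in auto)
  also have "\<dots> = pi / (2 * sin (pi * b / 2))"
    by (rule integral_powr_over_one_plus_square) fact+
  finally have "Gamma c * (c * (LBINT w:{0<..}. f w * w powr (- c - 1))) = pi / (2 * sin (pi * b / 2))" .
  moreover have "y = x / (2 * g * v)" if "g * y = x / (2 * v)" "g > 0" for g x y v :: real
    using that by (metis divide_divide_eq_left' mult.assoc mult.left_commute nonzero_mult_div_cancel_left less_numeral_extra(3))
  ultimately show ?thesis
    using Gamma_real_pos[OF \<open>c > 0\<close>] by blast
qed

lemma integral_one_minus_cos_powr:
  assumes "0 < c" "c < 2"
  shows "c * (LBINT w:{0<..}. (1 - cos w) * w powr (- c - 1)) = pi / (2 * Gamma c * sin (pi * c / 2))"
proof (rule Mellin_via_Laplace)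
  show "set_integrable lborel {0<..} (\<lambda>w::real. (1 - cos w) * w powr (- c - 1))"
    by (rule integrable_one_minus_cos_powr) fact+
  fix s :: real assume s: "s > 0"
  have pos: "1 + s\<^sup>2 > 0" by (simp add: add_pos_nonneg)
  have "(LBINT w:{0<..}. (1 - cos w) * exp (- s * w)) = 1 / s - s / (1 + s\<^sup>2)"
    using set_integral_diff(2)[OF laplace_const(1)[OF s] laplace_trig(3)[OF s]] laplace_const(2)[OF s] laplace_trig(4)[OF s]
    by (simp add: left_diff_distrib)
  also have "\<dots> = 1 / s / (1 + s\<^sup>2)"
    using s pos by (simp add: field_simps power2_eq_square)
  finally show "s powr c * (LBINT w:{0<..}. (1 - cos w) * exp (- s * w)) = s powr (c - 1) / (1 + s\<^sup>2)"
    using s by (simp add: powr_diff)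
qed (use assms in auto)

lemma integral_sin_powr:
  assumes "0 < c" "c < 1"
  shows "c * (LBINT w:{0<..}. sin w * w powr (- c - 1)) = pi / (2 * Gamma c * cos (pi * c / 2))"
proof -
  have "c * (LBINT w:{0<..}. sin w * w powr (- c - 1)) = pi / (2 * Gamma c * sin (pi * (c + 1) / 2))"
  proof (rule Mellin_via_Laplace)
    show "set_integrable lborel {0<..} (\<lambda>w::real. sin w * w powr (- c - 1))"
      by (rule integrable_sin_powr) fact+
    fix s :: real assume s: "s > 0"
    show "s powr c * (LBINT w:{0<..}. sin w * exp (- s * w)) = s powr ((c + 1) - 1) / (1 + s\<^sup>2)"
      unfolding laplace_trig(2)[OF s] by simp
  qed (use assms in auto)
  also have "sin (pi * (c + 1) / 2) = cos (pi * c / 2)"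
    using sin_add[of "pi * c / 2" "pi / 2"] by (simp add: field_simps)
  finally show ?thesis .
qed

lemma integral_id_minus_sin_powr:
  assumes "1 < c" "c < 2"
  shows "c * (LBINT w:{0<..}. (w - sin w) * w powr (- c - 1)) = - (pi / (2 * Gamma c * cos (pi * c / 2)))"
proof -
  have "c * (LBINT w:{0<..}. (w - sin w) * w powr (- c - 1)) = pi / (2 * Gamma c * sin (pi * (c - 1) / 2))"
  proof (rule Mellin_via_Laplace)
    show "set_integrable lborel {0<..} (\<lambda>w::real. (w - sin w) * w powr (- c - 1))"
      by (rule integrable_id_minus_sin_powr) fact+
    fix s :: real assume s: "s > 0"
    have pos: "1 + s\<^sup>2 > 0" by (simp add: add_pos_nonneg)
    have "(LBINT w:{0<..}. (w - sin w) * exp (- s * w)) = 1 / s\<^sup>2 - 1 / (1 + s\<^sup>2)"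
      using set_integral_diff(2)[OF laplace_id(1)[OF s] laplace_trig(1)[OF s]] laplace_id(2)[OF s] laplace_trig(2)[OF s]
      by (simp add: left_diff_distrib)
    also have "\<dots> = 1 / s\<^sup>2 / (1 + s\<^sup>2)"
      using s pos by (simp add: field_simps power2_eq_square)
    also have "1 / s\<^sup>2 = s powr (-2)"
      using s by (simp add: powr_minus powr_numeral field_simps)
    finally show "s powr c * (LBINT w:{0<..}. (w - sin w) * exp (- s * w)) = s powr ((c - 1) - 1) / (1 + s\<^sup>2)"
      using s by (simp add: powr_add[symmetric])
  qed (use assms in auto)
  also have "sin (pi * (c - 1) / 2) = - cos (pi * c / 2)"
    using sin_diff[of "pi * c / 2" "pi / 2"] by (simp add: field_simps)
  finally show ?thesis by simp
qed

section \<open>Abelian theorems for power tails\<close>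

text \<open>
  For a function \<open>G\<close> with \<open>G(0) = 0\<close> and derivative \<open>g\<close>, integration by parts gives
  \<open>T\<^sup>\<gamma> \<integral> G(x/T) d\<rho>(x) = \<integral> g(z) z\<^bsup>-\<gamma>\<^esup> r(zT) dz\<close>, where \<open>r(x) = x\<^sup>\<gamma> \<rho>(x, \<infinity>)\<close> is bounded and tends to \<open>c\<close>.
  If \<open>g(z) z\<^bsup>-\<gamma>\<^esup>\<close> is integrable, dominated convergence yields the limit \<open>c \<integral> g(z) z\<^bsup>-\<gamma>\<^esup> dz\<close>, and a second
  integration by parts expresses it through \<open>G\<close> again.
\<close>

text \<open>Restricting the density to a set \<open>S\<close> serves two purposes: functions that live on the half line \<open>(0, \<infinity>)\<close>, and functions
  that are frozen beyond a level \<open>L\<close>, as for \<open>S = (0, L]\<close>.\<close>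

definition primitive_on :: "real set \<Rightarrow> (real \<Rightarrow> real) \<Rightarrow> real \<Rightarrow> real" where
  "primitive_on S g y = (LBINT z:S. g z * indicator {..<y} z)"

lemma primitive_on_measurable [measurable]:
  assumes [measurable]: "g \<in> borel_measurable borel" "S \<in> sets borel"
  shows "primitive_on S g \<in> borel_measurable borel"
proof -
  have "(\<lambda>y. LBINT z. indicator S z *\<^sub>R (g z * (if z < y then 1 else 0))) \<in> borel_measurable borel"
    by measurable
  also have "(\<lambda>y. LBINT z. indicator S z *\<^sub>R (g z * (if z < y then 1 else 0))) = primitive_on S g"
    unfolding primitive_on_def set_lebesgue_integral_def
    by (intro ext Bochner_Integration.integral_cong) (auto simp: indicator_def)
  finally show ?thesis .
qed

text \<open>The primitive of a derivative cut off at \<open>L\<close> follows \<open>G\<close> up to \<open>L\<close> and is constant afterwards.\<close>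

lemma primitive_on_Ioc:
  fixes g G :: "real \<Rightarrow> real"
  assumes "\<And>x. (G has_real_derivative g x) (at x)" and "\<And>x. isCont g x" and "G 0 = 0" and "L > 0"
  shows "primitive_on {0<..L} g y = (if y > 0 then G (min y L) else 0)"
proof (cases "y > 0")
  case True
  have ne: "AE z in lborel. z \<noteq> 0 \<and> z \<noteq> min y L"
    by (intro AE_conjI) (auto intro: AE_lborel_singleton)
  have "primitive_on {0<..L} g y = (LBINT z. indicator {0..min y L} z *\<^sub>R g z)"
    unfolding primitive_on_def set_lebesgue_integral_def
  proof (rule integral_cong_AE)
    have [measurable]: "g \<in> borel_measurable borel"
      using assms(2) by (intro borel_measurable_continuous_onI) (simp add: continuous_at_imp_continuous_on)
    show "(\<lambda>x. indicat_real {0<..L} x *\<^sub>R (g x * indicat_real {..<y} x)) \<in> borel_measurable lborel"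
      "(\<lambda>x. indicat_real {0..min y L} x *\<^sub>R g x) \<in> borel_measurable lborel" by measurable
    show "AE x in lborel. indicat_real {0<..L} x *\<^sub>R (g x * indicat_real {..<y} x) = indicat_real {0..min y L} x *\<^sub>R g x"
      using ne by eventually_elim (auto simp: indicator_def)
  qed
  also have "\<dots> = G (min y L) - G 0"
    using True assms
    by (intro integral_FTC_atLeastAtMost)
       (auto simp: has_real_derivative_iff_has_vector_derivative[symmetric]
             intro: has_field_derivative_at_within continuous_at_imp_continuous_on)
  finally show ?thesis using True assms by simp
next
  case False
  have "primitive_on {0<..L} g y = (LBINT z:{0<..L}. 0)"
    unfolding primitive_on_def by (rule set_lebesgue_integral_cong) (use False in \<open>auto simp: indicator_def\<close>)
  then show ?thesis using False by simp
qed

lemma primitive_on_Ioi: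
  fixes g G :: "real \<Rightarrow> real"
  assumes "\<And>x. (G has_real_derivative g x) (at x)" and "\<And>x. isCont g x" and "G 0 = 0"
  shows "primitive_on {0<..} g y = (if y > 0 then G y else 0)"
proof (cases "y > 0")
  case True
  have "primitive_on {0<..} g y = primitive_on {0<..y} g (y + 1) "
  proof -
    have ne: "AE z in lborel. z \<noteq> y"
      by (rule AE_lborel_singleton)
    have [measurable]: "g \<in> borel_measurable borel"
      using assms(2) by (intro borel_measurable_continuous_onI) (simp add: continuous_at_imp_continuous_on)
    show ?thesis
      unfolding primitive_on_def set_lebesgue_integral_def
    proof (rule integral_cong_AE)
      show "AE x in lborel. indicat_real {0<..} x *\<^sub>R (g x * indicat_real {..<y} x)
          = indicat_real {0<..y} x *\<^sub>R (g x * indicat_real {..<y + 1} x)"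
        using ne by eventually_elim (auto simp: indicator_def)
    qed measurable
  qed
  then show ?thesis using primitive_on_Ioc[OF assms True, of "y + 1"] True by simp
next
  case False
  have "primitive_on {0<..} g y = (LBINT z:{0::real<..}. 0)"
    unfolding primitive_on_def by (rule set_lebesgue_integral_cong) (use False in \<open>auto simp: indicator_def\<close>)
  then show ?thesis using False by simp
qed

lemma integral_powr_tail:
  assumes "z > 0" "c > (0::real)"
  shows "has_bochner_integral lborel (\<lambda>w::real. indicator {z<..} w * w powr (- c - 1)) (z powr (- c) / c)"
proof -
  have "- (z powr (- c - 1 + 1)) / (- c - 1 + 1) = z powr (- c) / c" by simp
  then have "((\<lambda>w. w powr (- c - 1)) has_integral (z powr (- c) / c)) {z..}"
    using has_integral_powr_to_inf[of "- c - 1" z] assms by (simp only:)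
  then have "((\<lambda>w. if w \<in> {z..} then w powr (- c - 1) else 0) has_integral (z powr (- c) / c)) UNIV"
    by (simp only: has_integral_restrict_UNIV)
  then have "((\<lambda>w. indicator {z<..} w * w powr (- c - 1)) has_integral (z powr (- c) / c)) UNIV"
    by (rule has_integral_spike[of "{z}", rotated 2]) (auto simp: indicator_def)
  then have "integral\<^sup>N lborel (\<lambda>w. ennreal (indicator {z<..} w * w powr (- c - 1))) = ennreal (z powr (- c) / c)"
    by (intro nn_integral_has_integral_lborel) auto
  then show ?thesis
    using assms by (intro has_bochner_integral_nn_integral) auto
qed

text \<open>Fubini for \<open>z\<^bsup>-c\<^esup> = c \<integral>\<^bsub>w > z\<^esub> w\<^bsup>-c-1\<^esup> dw\<close>.\<close>

lemma integral_by_parts_powr: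
  fixes g :: "real \<Rightarrow> real"
  assumes [measurable]: "g \<in> borel_measurable borel" "S \<in> sets borel" and S: "S \<subseteq> {0<..}" and "c > 0"
    and int: "set_integrable lborel S (\<lambda>z. g z * z powr (- c))"
  shows "(LBINT z:S. g z * z powr (- c)) = c * (LBINT w:{0<..}. primitive_on S g w * w powr (- c - 1))"
proof -
  define h where "h = (\<lambda>(z, w). indicator S z * g z * (indicator {0<..} w * (if z < w then 1 else 0) * w powr (- c - 1)) :: real)"
  have [measurable]: "h \<in> borel_measurable (lborel \<Otimes>\<^sub>M lborel)"
    unfolding h_def by measurable
  have eq: "h (z, w) = indicator S z * g z * (indicator {z<..} w * w powr (- c - 1))" for z w
    using S by (auto simp: h_def indicator_def)
  have G: "has_bochner_integral lborel (\<lambda>w. h (z, w)) (indicator S z * (g z * z powr (- c)) / c)" for z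
  proof (cases "z \<in> S")
    case True
    then have "z > 0" using S by auto
    from has_bochner_integral_mult_right[OF integral_powr_tail[OF this \<open>c > 0\<close>], of "indicator S z * g z"]
    show ?thesis unfolding eq by (simp add: mult.assoc)
  qed (simp add: eq has_bochner_integral_zero)
  have G2: "has_bochner_integral lborel (\<lambda>w. norm (h (z, w))) (indicator S z * (\<bar>g z\<bar> * z powr (- c)) / c)" for z
  proof (cases "z \<in> S")
    case True
    then have "z > 0" using S by auto
    from has_bochner_integral_mult_right[OF integral_powr_tail[OF this \<open>c > 0\<close>], of "indicator S z * \<bar>g z\<bar>"]
    show ?thesis unfolding eq by (simp add: abs_mult mult.assoc)
  qed (simp add: eq has_bochner_integral_zero)
  have int_h: "integrable (lborel \<Otimes>\<^sub>M lborel) h"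
  proof (rule lborel_pair.Fubini_integrable)
    have "integrable lborel (\<lambda>z. norm (indicator S z *\<^sub>R (g z * z powr (- c))) / c)"
      using int unfolding set_integrable_def by (intro integrable_divide integrable_norm)
    then show "integrable lborel (\<lambda>z. LBINT w. norm (h (z, w)))"
      unfolding has_bochner_integral_integral_eq[OF G2] by (simp add: abs_mult)
    show "AE x in lborel. integrable lborel (\<lambda>y. h (x, y))"
      using G by (simp add: has_bochner_integral_iff)
  qed measurable
  have "(LBINT z:S. g z * z powr (- c)) = c * (LBINT z. LBINT w. h (z, w))"
    unfolding set_lebesgue_integral_def has_bochner_integral_integral_eq[OF G] using \<open>c > 0\<close> by simp
  also have "(LBINT z. LBINT w. h (z, w)) = (LBINT w. LBINT z. h (z, w))"
    using lborel_pair.Fubini_integral[of "\<lambda>z w. h (z, w)"] int_h by simp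
  also have "\<dots> = (LBINT w:{0<..}. primitive_on S g w * w powr (- c - 1))"
    unfolding set_lebesgue_integral_def
  proof (rule Bochner_Integration.integral_cong[OF refl])
    fix w :: real
    have "(LBINT z. h (z, w)) = (LBINT z. (indicator {0<..} w * w powr (- c - 1)) * (indicator S z *\<^sub>R (g z * indicator {..<w} z)))"
      by (intro Bochner_Integration.integral_cong) (auto simp: h_def indicator_def)
    then show "(LBINT z. h (z, w)) = indicator {0<..} w *\<^sub>R (primitive_on S g w * w powr (- c - 1))"
      unfolding primitive_on_def set_lebesgue_integral_def by simp
  qed
  finally show ?thesis .
qed

text \<open>Near infinity the tail function is close to its limit; elsewhere it is at most \<open>x\<^sup>\<gamma>\<close>. This bound supplies
  the dominating functions below.\<close>

lemma right_tail_bounded: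
  assumes "real_distribution \<rho>" and "\<gamma> > 0" and lim: "(right_tail \<gamma> \<rho> \<longlongrightarrow> c) at_top"
  obtains K where "K \<ge> 0" "\<And>x. x > 0 \<Longrightarrow> right_tail \<gamma> \<rho> x \<le> K"
proof -
  interpret real_distribution \<rho> by fact
  from order_tendstoD(2)[OF lim, of "c + 1"] obtain X where X: "\<And>x. x \<ge> X \<Longrightarrow> right_tail \<gamma> \<rho> x < c + 1"
    by (auto simp: eventually_at_top_linorder)
  have "right_tail \<gamma> \<rho> x \<le> max (\<bar>c + 1\<bar>) (\<bar>X\<bar> powr \<gamma>)" if "x > 0" for x
  proof (cases "x \<ge> X")
    case True
    then show ?thesis using X[of x] by linarith
  next
    case False
    have "right_tail \<gamma> \<rho> x \<le> x powr \<gamma> * 1"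
      unfolding right_tail_def by (intro mult_left_mono) auto
    also have "\<dots> \<le> \<bar>X\<bar> powr \<gamma>" using that False \<open>\<gamma> > 0\<close> by (auto intro!: powr_mono2)
    finally show ?thesis by linarith
  qed
  then show ?thesis by (intro that[of "max (\<bar>c + 1\<bar>) (\<bar>X\<bar> powr \<gamma>)"]) auto
qed

lemma right_tail_measurable:
  assumes "real_distribution \<rho>"
  shows "right_tail \<gamma> \<rho> \<in> borel_measurable borel"
proof -
  interpret real_distribution \<rho> by fact
  have "measure \<rho> {x<..} = 1 - cdf \<rho> x" for x
  proof -
    have "measure \<rho> (space \<rho> - {..x}) = 1 - measure \<rho> {..x}" by (intro prob_compl) simp
    moreover have "space \<rho> - {..x} = {x<..}" by (auto simp: space_eq_univ)
    ultimately show ?thesis by (simp add: cdf_def)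
  qed
  then have "right_tail \<gamma> \<rho> = (\<lambda>x. x powr \<gamma> * (1 - cdf \<rho> x))" by (auto simp: right_tail_def fun_eq_iff)
  then show ?thesis using borel_measurable_mono[of "cdf \<rho>"] cdf_nondecreasing by (simp add: mono_def)
qed

lemma scaled_tail_eq:
  assumes "T > 0" "z > 0"
  shows "T powr \<gamma> * measure \<rho> {z * T<..} = z powr (- \<gamma>) * right_tail \<gamma> \<rho> (z * T)"
  using assms by (simp add: right_tail_def powr_mult powr_minus field_simps)

text \<open>The layer cake formula, that is, Fubini for \<open>g(z)\<close> on the region \<open>z T < x\<close>.\<close>

lemma integral_primitive_eq:
  fixes g :: "real \<Rightarrow> real"
  assumes "real_distribution \<rho>" and "\<gamma> > 0" and lim: "(right_tail \<gamma> \<rho> \<longlongrightarrow> c) at_top"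
    and [measurable]: "g \<in> borel_measurable borel" "S \<in> sets borel" and S: "S \<subseteq> {0<..}"
    and int: "set_integrable lborel S (\<lambda>z. g z * z powr (- \<gamma>))" and "T > 0"
  shows "integrable \<rho> (\<lambda>x. primitive_on S g (x / T))"
    and "T powr \<gamma> * (\<integral>x. primitive_on S g (x / T) \<partial>\<rho>) = (LBINT z:S. g z * z powr (- \<gamma>) * right_tail \<gamma> \<rho> (z * T))"
proof -
  interpret real_distribution \<rho> by fact
  interpret P: pair_sigma_finite lborel \<rho> ..
  obtain K where K: "K \<ge> 0" "\<And>x. x > 0 \<Longrightarrow> right_tail \<gamma> \<rho> x \<le> K"
    using right_tail_bounded assms(1-3) by blast
  define h where "h = (\<lambda>(z, x). indicator S z * g z * (if z * T < x then 1 else 0) :: real)"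
  have [measurable]: "h \<in> borel_measurable (lborel \<Otimes>\<^sub>M \<rho>)"
    unfolding h_def by measurable
  have [measurable]: "right_tail \<gamma> \<rho> \<in> borel_measurable borel" by (rule right_tail_measurable) fact
  have ind: "(if z * T < x then 1 else 0 :: real) = indicator {z * T<..} x" for z x
    by (auto simp: indicator_def)
  have bi: "has_bochner_integral \<rho> (\<lambda>x. indicator {z * T<..} x) (measure \<rho> {z * T<..})" for z :: real
    by (auto simp: has_bochner_integral_iff emeasure_eq_measure)
  have sc: "indicator S z * measure \<rho> {z * T<..} = indicator S z * (T powr (- \<gamma>) * (z powr (- \<gamma>) * right_tail \<gamma> \<rho> (z * T)))" for z
  proof (cases "z \<in> S")
    case True
    then have "z > 0" using S by auto
    have "measure \<rho> {z * T<..} = T powr (- \<gamma>) * (T powr \<gamma> * measure \<rho> {z * T<..})"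
      using \<open>T > 0\<close> by (simp add: powr_minus)
    then show ?thesis unfolding scaled_tail_eq[OF \<open>T > 0\<close> \<open>z > 0\<close>] by simp
  qed simp
  have i1: "has_bochner_integral \<rho> (\<lambda>x. h (z, x)) (T powr (- \<gamma>) * (indicator S z *\<^sub>R (g z * z powr (- \<gamma>) * right_tail \<gamma> \<rho> (z * T))))" for z
  proof -
    have "indicator S z * g z * measure \<rho> {z * T<..} = T powr (- \<gamma>) * (indicator S z *\<^sub>R (g z * z powr (- \<gamma>) * right_tail \<gamma> \<rho> (z * T)))"
      using sc[of z] by (cases "z \<in> S") auto
    then show ?thesis
      using has_bochner_integral_mult_right[OF bi[of z], of "indicator S z * g z"]
      unfolding h_def prod.case ind by (simp only:)
  qed
  have i2: "(\<integral>x. norm (h (z, x)) \<partial>\<rho>) = T powr (- \<gamma>) * (indicator S z *\<^sub>R (\<bar>g z\<bar> * z powr (- \<gamma>) * right_tail \<gamma> \<rho> (z * T)))" for z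
  proof -
    have "indicator S z * \<bar>g z\<bar> * measure \<rho> {z * T<..} = T powr (- \<gamma>) * (indicator S z *\<^sub>R (\<bar>g z\<bar> * z powr (- \<gamma>) * right_tail \<gamma> \<rho> (z * T)))"
      using sc[of z] by (cases "z \<in> S") auto
    then show ?thesis
      using has_bochner_integral_integral_eq[OF has_bochner_integral_mult_right[OF bi[of z], of "indicator S z * \<bar>g z\<bar>"]]
      unfolding h_def prod.case ind by (simp add: abs_mult)
  qed
  have int_h: "integrable (lborel \<Otimes>\<^sub>M \<rho>) h"
  proof (rule P.Fubini_integrable)
    have "integrable lborel (\<lambda>z. indicator S z *\<^sub>R (\<bar>g z\<bar> * z powr (- \<gamma>) * right_tail \<gamma> \<rho> (z * T)))"
    proof (rule Bochner_Integration.integrable_bound)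
      show "integrable lborel (\<lambda>z. K * (indicator S z *\<^sub>R (g z * z powr (- \<gamma>))))"
        using int unfolding set_integrable_def by (intro integrable_mult_right)
      have "\<bar>right_tail \<gamma> \<rho> (z * T)\<bar> \<le> K" if "z \<in> S" for z
        using K(2)[of "z * T"] that S \<open>T > 0\<close> by (auto simp: right_tail_def)
      then show "AE z in lborel. norm (indicator S z *\<^sub>R (\<bar>g z\<bar> * z powr (- \<gamma>) * right_tail \<gamma> \<rho> (z * T)))
          \<le> norm (K * (indicator S z *\<^sub>R (g z * z powr (- \<gamma>))))"
        using K(1) by (intro AE_I2) (auto simp: indicator_def abs_mult mult.commute[of K] intro!: mult_left_mono)
    qed measurable
    then show "integrable lborel (\<lambda>z. \<integral>x. norm (h (z, x)) \<partial>\<rho>)"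
      unfolding i2 by (rule integrable_mult_right)
    show "AE z in lborel. integrable \<rho> (\<lambda>x. h (z, x))"
      using i1 by (simp add: has_bochner_integral_iff)
  qed measurable
  have i3: "(LBINT z. h (z, x)) = primitive_on S g (x / T)" for x
    unfolding primitive_on_def set_lebesgue_integral_def h_def prod.case
    by (intro Bochner_Integration.integral_cong) (use \<open>T > 0\<close> in \<open>auto simp: indicator_def field_simps\<close>)
  show "integrable \<rho> (\<lambda>x. primitive_on S g (x / T))"
    using P.integrable_snd[of "\<lambda>z x. h (z, x)"] int_h unfolding i3 by simp
  have "(\<integral>x. primitive_on S g (x / T) \<partial>\<rho>) = (\<integral>x. (LBINT z. h (z, x)) \<partial>\<rho>)" unfolding i3 ..
  also have "\<dots> = (LBINT z. (\<integral>x. h (z, x) \<partial>\<rho>))"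
    using P.Fubini_integral[of "\<lambda>z x. h (z, x)"] int_h by simp
  also have "\<dots> = T powr (- \<gamma>) * (LBINT z:S. g z * z powr (- \<gamma>) * right_tail \<gamma> \<rho> (z * T))"
    unfolding has_bochner_integral_integral_eq[OF i1] set_lebesgue_integral_def by simp
  finally show "T powr \<gamma> * (\<integral>x. primitive_on S g (x / T) \<partial>\<rho>) = (LBINT z:S. g z * z powr (- \<gamma>) * right_tail \<gamma> \<rho> (z * T))"
    using \<open>T > 0\<close> by (simp add: powr_minus field_simps)
qed

lemma abelian_primitive:
  fixes g :: "real \<Rightarrow> real"
  assumes "real_distribution \<rho>" and "\<gamma> > 0" and lim: "(right_tail \<gamma> \<rho> \<longlongrightarrow> c) at_top"
    and [measurable]: "g \<in> borel_measurable borel" "S \<in> sets borel" and S: "S \<subseteq> {0<..}"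
    and int: "set_integrable lborel S (\<lambda>z. g z * z powr (- \<gamma>))"
  shows "((\<lambda>T. T powr \<gamma> * (\<integral>x. primitive_on S g (x / T) \<partial>\<rho>)) \<longlongrightarrow>
           c * (\<gamma> * (LBINT w:{0<..}. primitive_on S g w * w powr (- \<gamma> - 1)))) at_top"
proof -
  interpret real_distribution \<rho> by fact
  obtain K where K: "K \<ge> 0" "\<And>x. x > 0 \<Longrightarrow> right_tail \<gamma> \<rho> x \<le> K"
    using right_tail_bounded assms(1-3) by blast
  have [measurable]: "right_tail \<gamma> \<rho> \<in> borel_measurable borel" by (rule right_tail_measurable) fact
  have 1: "((\<lambda>T. LBINT z. indicator S z *\<^sub>R (g z * z powr (- \<gamma>) * right_tail \<gamma> \<rho> (z * T))) \<longlongrightarrow>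
      (LBINT z. indicator S z *\<^sub>R (g z * z powr (- \<gamma>) * c))) at_top"
  proof (rule integral_dominated_convergence_at_top[where w = "\<lambda>z. K * norm (indicator S z *\<^sub>R (g z * z powr (- \<gamma>)))"])
    show "integrable lborel (\<lambda>z. K * norm (indicator S z *\<^sub>R (g z * z powr (- \<gamma>))))"
      using int unfolding set_integrable_def by (intro integrable_mult_right integrable_norm)
    have "\<bar>right_tail \<gamma> \<rho> (z * T)\<bar> \<le> K" if "z \<in> S" "T > 0" for z T
      using K(2)[of "z * T"] that S by (auto simp: right_tail_def)
    then show "\<forall>\<^sub>F T in at_top. AE z in lborel. norm (indicator S z *\<^sub>R (g z * z powr (- \<gamma>) * right_tail \<gamma> \<rho> (z * T)))
        \<le> K * norm (indicator S z *\<^sub>R (g z * z powr (- \<gamma>)))"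
      using K(1) by (intro eventually_mono[OF eventually_gt_at_top[of 0]] AE_I2)
        (auto simp: indicator_def abs_mult mult.commute[of K] intro!: mult_left_mono)
    have "((\<lambda>T. right_tail \<gamma> \<rho> (z * T)) \<longlongrightarrow> c) at_top" if "z \<in> S" for z
    proof (rule filterlim_compose[OF lim])
      show "filterlim ((*) z) at_top at_top"
        using that S by (intro filterlim_tendsto_pos_mult_at_top[OF tendsto_const _ filterlim_ident]) auto
    qed
    then show "AE z in lborel. ((\<lambda>T. indicator S z *\<^sub>R (g z * z powr (- \<gamma>) * right_tail \<gamma> \<rho> (z * T))) \<longlongrightarrow>
         indicator S z *\<^sub>R (g z * z powr (- \<gamma>) * c)) at_top"
      by (intro AE_I2) (auto simp: indicator_def intro!: tendsto_intros)
  qed measurable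
  have 2: "(LBINT z. indicator S z *\<^sub>R (g z * z powr (- \<gamma>) * c)) = c * (LBINT z:S. g z * z powr (- \<gamma>))"
    unfolding set_lebesgue_integral_def by (simp add: mult.assoc[symmetric] mult.commute[of c])
  note 3 = integral_by_parts_powr[OF assms(4,5) S \<open>\<gamma> > 0\<close> int]
  have 4: "\<forall>\<^sub>F T in at_top. (LBINT z. indicator S z *\<^sub>R (g z * z powr (- \<gamma>) * right_tail \<gamma> \<rho> (z * T))) =
     T powr \<gamma> * (\<integral>x. primitive_on S g (x / T) \<partial>\<rho>)"
    using eventually_gt_at_top[of 0]
    by eventually_elim (simp add: integral_primitive_eq(2)[OF assms] set_lebesgue_integral_def)
  show ?thesis
    using Lim_transform_eventually[OF 1 4] unfolding 2 3 .
qed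

text \<open>A limit may be proved up to an error \<open>e\<close> at a time, with a different approximating function for each \<open>e\<close>.\<close>

lemma tendsto_by_approximation:
  fixes X :: "'a \<Rightarrow> 'b::metric_space"
  assumes "\<And>e. e > 0 \<Longrightarrow> \<exists>Y y. (Y \<longlongrightarrow> y) F \<and> dist y a \<le> e \<and> (\<forall>\<^sub>F t in F. dist (X t) (Y t) \<le> e)"
  shows "(X \<longlongrightarrow> a) F"
proof (rule tendstoI)
  fix e :: real assume "e > 0"
  then have "e / 4 > 0" by simp
  from assms[OF this] obtain Y y where Y: "(Y \<longlongrightarrow> y) F" "dist y a \<le> e / 4" "\<forall>\<^sub>F t in F. dist (X t) (Y t) \<le> e / 4"
    by blast
  from tendstoD[OF Y(1) \<open>e / 4 > 0\<close>] Y(3) show "\<forall>\<^sub>F t in F. dist (X t) a < e"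
  proof eventually_elim
    case (elim t)
    have "dist (X t) a \<le> dist (X t) (Y t) + (dist (Y t) y + dist y a)"
      using dist_triangle[of "X t" a "Y t"] dist_triangle[of "Y t" a y] by linarith
    then show ?case using elim Y(2) \<open>e > 0\<close> by linarith
  qed
qed

text \<open>For \<open>G(y) = sin y\<close>, and for \<open>G(y) = 1 - cos y\<close> if \<open>\<gamma> \<le> 1\<close>, the function \<open>g(z) z\<^bsup>-\<gamma>\<^esup>\<close> is not absolutely integrable at
  infinity, so \<open>abelian_primitive\<close> does not apply to \<open>G\<close> directly. Freeze \<open>G\<close> at the level \<open>L\<close>: the error is
  carried by \<open>x > L T\<close> and is at most \<open>4 K L\<^bsup>-\<gamma>\<^esup>\<close> uniformly in \<open>T\<close>, while the limits for fixed \<open>L\<close> converge as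
  \<open>L\<close> grows.\<close>

lemma abelian_bounded:
  fixes g G :: "real \<Rightarrow> real"
  assumes "real_distribution \<rho>" and "\<gamma> > 0" and lim: "(right_tail \<gamma> \<rho> \<longlongrightarrow> c) at_top"
    and dG: "\<And>x. (G has_real_derivative g x) (at x)" and cg: "\<And>x. isCont g x" and "G 0 = 0" 
    and "\<gamma> < a" and G2: "\<And>x. \<bar>G x\<bar> \<le> 2" and Ga: "\<And>x. x > 0 \<Longrightarrow> \<bar>G x\<bar> \<le> 2 * x powr a"
    and ga: "\<And>x. x > 0 \<Longrightarrow> \<bar>g x\<bar> \<le> 2 * x powr (a - 1)"
  shows "((\<lambda>T. T powr \<gamma> * (\<integral>x. (if x > 0 then G (x / T) else 0) \<partial>\<rho>)) \<longlongrightarrow>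
           c * (\<gamma> * (LBINT w:{0<..}. G w * w powr (- \<gamma> - 1)))) at_top"
proof -
  interpret real_distribution \<rho> by fact
  have [measurable]: "g \<in> borel_measurable borel" "G \<in> borel_measurable borel"
    using cg DERIV_isCont[OF dG] by (auto intro!: borel_measurable_continuous_onI simp: continuous_at_imp_continuous_on)
  obtain K where K: "K \<ge> 0" "\<And>x. x > 0 \<Longrightarrow> right_tail \<gamma> \<rho> x \<le> K"
    using right_tail_bounded assms(1-3) by blast
  define I where "I L = (LBINT w:{0<..}. primitive_on {0<..L} g w * w powr (- \<gamma> - 1))" for L
  have prim: "primitive_on {0<..L} g y = (if y > 0 then G (min y L) else 0)" if "L > 0" for y L
    by (rule primitive_on_Ioc) fact+
  have pre: "((\<lambda>T. T powr \<gamma> * (\<integral>x. primitive_on {0<..L} g (x / T) \<partial>\<rho>)) \<longlongrightarrow> c * (\<gamma> * I L)) at_top" if "L > 0" for L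
    unfolding I_def
  proof (rule abelian_primitive)
    have "set_integrable lborel {0<..} (\<lambda>z. (indicator {0<..L} z * g z) * z powr (- (\<gamma> - 1) - 1))"
    proof (rule set_integrable_between_powers[where a = "a - 1" and b = "-1" and B = "max 2 (2 * L powr a)"])
      fix w :: real assume "w > 0"
      have "\<bar>indicator {0<..L} w * g w\<bar> \<le> \<bar>g w\<bar>" by (auto simp: indicator_def)
      then show "\<bar>indicator {0<..L} w * g w\<bar> \<le> max 2 (2 * L powr a) * w powr (a - 1)"
        using ga[OF \<open>w > 0\<close>] mult_right_mono[OF max.cobounded1, of "w powr (a - 1)" 2 "2 * L powr a"] by simp
      show "\<bar>indicator {0<..L} w * g w\<bar> \<le> max 2 (2 * L powr a) * w powr -1"
      proof (cases "w \<le> L")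
        case True
        have "\<bar>g w\<bar> \<le> 2 * w powr (a - 1)" by (rule ga) fact
        also have "w powr (a - 1) = w powr a * w powr -1"
          using powr_add[of w a "- 1"] by (simp only: diff_conv_add_uminus)
        also have "2 * (w powr a * w powr -1) \<le> 2 * (L powr a * w powr -1)"
          using True \<open>w > 0\<close> \<open>\<gamma> > 0\<close> \<open>\<gamma> < a\<close> by (intro mult_left_mono mult_right_mono powr_mono2) auto
        also have "\<dots> \<le> max 2 (2 * L powr a) * w powr -1"
          using mult_right_mono[OF max.cobounded2, of "w powr -1" "2 * L powr a" 2] by simp
        finally show ?thesis using \<open>w > 0\<close> True by simp
      qed auto
    qed (use \<open>\<gamma> > 0\<close> \<open>\<gamma> < a\<close> in auto)
    then show "set_integrable lborel {0<..L} (\<lambda>z. g z * z powr (- \<gamma>))"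
      unfolding set_integrable_def by (rule Bochner_Integration.integrable_cong[THEN iffD1, rotated -1]) (auto simp: indicator_def)
  qed (use assms in auto)
  have I_lim: "(I \<longlongrightarrow> (LBINT w:{0<..}. G w * w powr (- \<gamma> - 1))) at_top"
    unfolding I_def set_lebesgue_integral_def
  proof (rule integral_dominated_convergence_at_top[where w = "\<lambda>w. indicator {0<..} w *\<^sub>R (min 2 (2 * w powr a) * w powr (- \<gamma> - 1))"])
    have "set_integrable lborel {0<..} (\<lambda>w. min 2 (2 * w powr a) * w powr (- \<gamma> - 1))"
      by (rule set_integrable_between_powers[where a = a and b = 0 and B = 2])
         (use \<open>\<gamma> > 0\<close> \<open>\<gamma> < a\<close> in auto)
    then show "integrable lborel (\<lambda>w. indicat_real {0<..} w *\<^sub>R (min 2 (2 * w powr a) * w powr (- \<gamma> - 1)))"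
      by (simp add: set_integrable_def)
    have "\<bar>G (min w L)\<bar> \<le> min 2 (2 * w powr a)" if "w > 0" "L > 0" for w L
    proof -
      have "(min w L) powr a \<le> w powr a" using that \<open>\<gamma> > 0\<close> \<open>\<gamma> < a\<close> by (intro powr_mono2) auto
      then show ?thesis using G2[of "min w L"] Ga[of "min w L"] that by auto
    qed
    then show "\<forall>\<^sub>F L in at_top. AE x in lborel. norm (indicat_real {0<..} x *\<^sub>R (primitive_on {0<..L} g x * x powr (- \<gamma> - 1)))
        \<le> indicat_real {0<..} x *\<^sub>R (min 2 (2 * x powr a) * x powr (- \<gamma> - 1))"
      by (intro eventually_mono[OF eventually_gt_at_top[of 0]] AE_I2)
         (auto simp: indicator_def abs_mult prim simp del: min.bounded_iff intro!: mult_right_mono)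
    have "\<forall>\<^sub>F L in at_top. indicat_real {0<..} w *\<^sub>R (G w * w powr (- \<gamma> - 1)) 
        = indicat_real {0<..} w *\<^sub>R (primitive_on {0<..L} g w * w powr (- \<gamma> - 1))" for w
      using eventually_ge_at_top[of "max 1 w"] 
      by eventually_elim (auto simp: prim indicator_def)
    then show "AE w in lborel. ((\<lambda>L. indicat_real {0<..} w *\<^sub>R (primitive_on {0<..L} g w * w powr (- \<gamma> - 1))) \<longlongrightarrow>
        indicat_real {0<..} w *\<^sub>R (G w * w powr (- \<gamma> - 1))) at_top"
      by (intro AE_I2) (rule Lim_transform_eventually[OF tendsto_const])
  qed measurable
  have close: "\<bar>T powr \<gamma> * (\<integral>x. (if x > 0 then G (x / T) else 0) \<partial>\<rho>) -
       T powr \<gamma> * (\<integral>x. primitive_on {0<..L} g (x / T) \<partial>\<rho>)\<bar> \<le> 4 * K * L powr (- \<gamma>)" if "L > 0" "T > 0" for L T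
  proof -
    have i1: "integrable \<rho> (\<lambda>x. if x > 0 then G (x / T) else 0)"
      by (rule integrable_const_bound[where B = 2]) (use G2 in auto)
    have i2: "integrable \<rho> (\<lambda>x. primitive_on {0<..L} g (x / T))"
      by (rule integrable_const_bound[where B = 2]) (use G2 that in \<open>auto simp: prim\<close>)
    have "\<bar>(\<integral>x. (if x > 0 then G (x / T) else 0) \<partial>\<rho>) - (\<integral>x. primitive_on {0<..L} g (x / T) \<partial>\<rho>)\<bar> =
      \<bar>(\<integral>x. (if x > 0 then G (x / T) else 0) - primitive_on {0<..L} g (x / T) \<partial>\<rho>)\<bar>"
      using i1 i2 by simp
    also have "\<dots> \<le> (\<integral>x. \<bar>(if x > 0 then G (x / T) else 0) - primitive_on {0<..L} g (x / T)\<bar> \<partial>\<rho>)"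
      by (rule integral_abs_bound)
    also have "\<dots> \<le> (\<integral>x. 4 * indicator {L * T<..} x \<partial>\<rho>)"
    proof (rule integral_mono)
      show "integrable \<rho> (\<lambda>x. 4 * indicat_real {L * T<..} x)"
        by (intro integrable_mult_right) (simp add: emeasure_eq_measure)
      have "\<bar>G u - G v\<bar> \<le> 4" for u v using G2[of u] G2[of v] by linarith
      then show "\<bar>(if x > 0 then G (x / T) else 0) - primitive_on {0<..L} g (x / T)\<bar> \<le> 4 * indicator {L * T<..} x" for x
        using that by (auto simp: prim indicator_def min_def divide_simps)
    qed (use i1 i2 in auto)
    also have "\<dots> = 4 * measure \<rho> {L * T<..}" by simp
    finally have "T powr \<gamma> * \<bar>(\<integral>x. (if x > 0 then G (x / T) else 0) \<partial>\<rho>) - (\<integral>x. primitive_on {0<..L} g (x / T) \<partial>\<rho>)\<bar>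
       \<le> T powr \<gamma> * (4 * measure \<rho> {L * T<..})"
      by (intro mult_left_mono) auto
    also have "\<dots> = 4 * (L powr (- \<gamma>) * right_tail \<gamma> \<rho> (L * T))"
      using scaled_tail_eq[OF \<open>T > 0\<close> \<open>L > 0\<close>, of \<gamma> \<rho>] by simp
    also have "\<dots> \<le> 4 * (L powr (- \<gamma>) * K)"
      using K(2)[of "L * T"] that by (intro mult_left_mono) auto
    finally show ?thesis by (simp add: abs_mult right_diff_distrib[symmetric] mult_ac)
  qed
  show ?thesis
  proof (rule tendsto_by_approximation)
    fix e :: real assume "e > 0"
    have "((\<lambda>L. c * (\<gamma> * I L)) \<longlongrightarrow> c * (\<gamma> * (LBINT w:{0<..}. G w * w powr (- \<gamma> - 1)))) at_top"
      by (intro tendsto_intros I_lim)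
    then have e1: "\<forall>\<^sub>F L in at_top. dist (c * (\<gamma> * I L)) (c * (\<gamma> * (LBINT w:{0<..}. G w * w powr (- \<gamma> - 1)))) < e"
      using \<open>e > 0\<close> by (rule tendstoD)
    have "((\<lambda>L. 4 * K * L powr (- \<gamma>)) \<longlongrightarrow> 4 * K * 0) at_top"
      using \<open>\<gamma> > 0\<close> by (intro tendsto_intros tendsto_neg_powr filterlim_ident) auto
    then have e2: "\<forall>\<^sub>F L in at_top. 4 * K * L powr (- \<gamma>) < e"
      using \<open>e > 0\<close> order_tendstoD(2) by fastforce
    obtain L where L: "L > 0" "dist (c * (\<gamma> * I L)) (c * (\<gamma> * (LBINT w:{0<..}. G w * w powr (- \<gamma> - 1)))) < e"
        "4 * K * L powr (- \<gamma>) < e"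
      using eventually_happens[OF eventually_conj[OF eventually_gt_at_top[of 0] eventually_conj[OF e1 e2]]] by auto
    show "\<exists>Y y. (Y \<longlongrightarrow> y) at_top \<and> dist y (c * (\<gamma> * (LBINT w:{0<..}. G w * w powr (- \<gamma> - 1)))) \<le> e \<and>
       (\<forall>\<^sub>F T in at_top. dist (T powr \<gamma> * (\<integral>x. (if x > 0 then G (x / T) else 0) \<partial>\<rho>)) (Y T) \<le> e)"
    proof (intro exI conjI)
      show "\<forall>\<^sub>F T in at_top. dist (T powr \<gamma> * (\<integral>x. (if x > 0 then G (x / T) else 0) \<partial>\<rho>)) 
          (T powr \<gamma> * (\<integral>x. primitive_on {0<..L} g (x / T) \<partial>\<rho>)) \<le> e"
        using eventually_gt_at_top[of 0]
        by eventually_elim (use close[OF L(1)] L(3) in \<open>fastforce simp: dist_real_def intro: order_trans\<close>)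
    qed (use pre[OF L(1)] L(2) in auto)
  qed
qed

lemma abelian_one_minus_cos:
  assumes "real_distribution \<rho>" and "0 < \<gamma>" "\<gamma> < 2" and "(right_tail \<gamma> \<rho> \<longlongrightarrow> c) at_top"
  shows "((\<lambda>T. T powr \<gamma> * (\<integral>x. (if x > 0 then 1 - cos (x / T) else 0) \<partial>\<rho>)) \<longlongrightarrow>
           c * (pi / (2 * Gamma \<gamma> * sin (pi * \<gamma> / 2)))) at_top"
  unfolding integral_one_minus_cos_powr[OF assms(2,3), symmetric]
proof (rule abelian_bounded[where g = sin and a = 2])
  show "\<bar>1 - cos x\<bar> \<le> 2 * x powr 2" if "x > 0" for x :: real
  proof -
    have "x powr 2 = x\<^sup>2" using that by (simp add: powr_numeral)
    then show ?thesis using abs_one_minus_cos_le(3)[of x] zero_le_power2[of x] by linarith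
  qed
  show "\<bar>sin x\<bar> \<le> 2 * x powr (2 - 1)" if "x > 0" for x :: real
    using that abs_sin_x_le_abs_x[of x] by simp
  show "\<bar>1 - cos x\<bar> \<le> 2" for x :: real by (rule abs_one_minus_cos_le)
qed (use assms in \<open>auto intro!: derivative_eq_intros\<close>)

lemma abelian_sin:
  assumes "real_distribution \<rho>" and "0 < \<gamma>" "\<gamma> < 1" and "(right_tail \<gamma> \<rho> \<longlongrightarrow> c) at_top"
  shows "((\<lambda>T. T powr \<gamma> * (\<integral>x. (if x > 0 then sin (x / T) else 0) \<partial>\<rho>)) \<longlongrightarrow>
           c * (pi / (2 * Gamma \<gamma> * cos (pi * \<gamma> / 2)))) at_top"
  unfolding integral_sin_powr[OF assms(2,3), symmetric]
proof (rule abelian_bounded[where g = cos and a = 1])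
  show "\<bar>sin x\<bar> \<le> 2 * x powr 1" if "x > 0" for x :: real
    using that abs_sin_x_le_abs_x[of x] by simp
  show "\<bar>cos x\<bar> \<le> 2 * x powr (1 - 1)" if "x > 0" for x :: real
    using that abs_cos_le_one[of x] by (simp del: abs_cos_le_one)
  show "\<bar>sin x\<bar> \<le> 2" for x :: real using abs_sin_le_one[of x] by linarith
qed (use assms in \<open>auto intro!: derivative_eq_intros\<close>)

text \<open>Here \<open>g(z) = 1 - cos z\<close> and \<open>\<gamma> > 1\<close>, so that \<open>g(z) z\<^bsup>-\<gamma>\<^esup>\<close> is integrable and no truncation is required; on the other
  hand \<open>x - sin x\<close> is unbounded, whence the statement on integrability.\<close>

lemma abelian_id_minus_sin:
  assumes "real_distribution \<rho>" and "1 < \<gamma>" "\<gamma> < 2" and lim: "(right_tail \<gamma> \<rho> \<longlongrightarrow> c) at_top"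
  shows "((\<lambda>T. T powr \<gamma> * (\<integral>x. (if x > 0 then x / T - sin (x / T) else 0) \<partial>\<rho>)) \<longlongrightarrow>
           c * (- (pi / (2 * Gamma \<gamma> * cos (pi * \<gamma> / 2))))) at_top"
    and "T > 0 \<Longrightarrow> integrable \<rho> (\<lambda>x. if x > 0 then x / T - sin (x / T) else 0)"
proof -
  have prim: "primitive_on {0<..} (\<lambda>z. 1 - cos z) = (\<lambda>y. if y > 0 then y - sin y else 0)"
    by (intro ext primitive_on_Ioi) (auto intro!: derivative_eq_intros)
  have int: "set_integrable lborel {0<..} (\<lambda>z. (1 - cos z) * z powr (- \<gamma>))"
    using integrable_one_minus_cos_powr[of "\<gamma> - 1"] assms by simp
  have "((\<lambda>T. T powr \<gamma> * (\<integral>x. primitive_on {0<..} (\<lambda>z. 1 - cos z) (x / T) \<partial>\<rho>)) \<longlongrightarrow>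
      c * (\<gamma> * (LBINT w:{0<..}. primitive_on {0<..} (\<lambda>z. 1 - cos z) w * w powr (- \<gamma> - 1)))) at_top"
    by (rule abelian_primitive) (use assms int in auto)
  moreover have "(LBINT w:{0<..}. primitive_on {0<..} (\<lambda>z. 1 - cos z) w * w powr (- \<gamma> - 1)) =
      (LBINT w:{0<..}. (w - sin w) * w powr (- \<gamma> - 1))"
    by (rule set_lebesgue_integral_cong) (auto simp: prim)
  ultimately have 1: "((\<lambda>T. T powr \<gamma> * (\<integral>x. (if x / T > 0 then x / T - sin (x / T) else 0) \<partial>\<rho>)) \<longlongrightarrow>
           c * (- (pi / (2 * Gamma \<gamma> * cos (pi * \<gamma> / 2))))) at_top"
    using integral_id_minus_sin_powr[OF assms(2,3)] unfolding prim by simp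
  show "((\<lambda>T. T powr \<gamma> * (\<integral>x. (if x > 0 then x / T - sin (x / T) else 0) \<partial>\<rho>)) \<longlongrightarrow>
           c * (- (pi / (2 * Gamma \<gamma> * cos (pi * \<gamma> / 2))))) at_top"
    by (rule Lim_transform_eventually[OF 1])
       (use eventually_gt_at_top[of 0] in eventually_elim, simp add: zero_less_divide_iff)
  show "integrable \<rho> (\<lambda>x. if x > 0 then x / T - sin (x / T) else 0)" if "T > 0"
  proof -
    have "integrable \<rho> (\<lambda>x. primitive_on {0<..} (\<lambda>z. 1 - cos z) (x / T))"
      by (rule integral_primitive_eq(1)) (use assms int that in auto)
    then show ?thesis using that unfolding prim by (simp add: zero_less_divide_iff)
  qed
qed

section \<open>The characteristic function of the initial law at the origin\<close>

text \<open>Reflection reduces statements on the negative half line to the Abelian theorems for right tails.\<close>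

lemma right_tail_uminus:
  assumes "real_distribution \<nu>" and lim: "(left_tail \<gamma> \<nu> \<longlongrightarrow> c) at_bot"
  shows "real_distribution (distr \<nu> borel uminus)"
    and "(right_tail \<gamma> (distr \<nu> borel uminus) \<longlongrightarrow> c) at_top"
    and "x > 0 \<Longrightarrow> right_tail \<gamma> (distr \<nu> borel uminus) x = left_tail \<gamma> \<nu> (- x)"
proof -
  interpret real_distribution \<nu> by fact
  show "real_distribution (distr \<nu> borel uminus)"
    by (intro real_distribution_distr) simp
  have eq: "right_tail \<gamma> (distr \<nu> borel uminus) x = left_tail \<gamma> \<nu> (- x)" if "x > 0" for x
  proof -
    have "(uminus -` {x<..} \<inter> space \<nu>) = {..<- x}" by (auto simp: space_eq_univ)
    then have "measure (distr \<nu> borel uminus) {x<..} = measure \<nu> {..<- x}"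
      by (subst measure_distr) auto
    then show ?thesis using that by (simp add: right_tail_def left_tail_def)
  qed
  then show "x > 0 \<Longrightarrow> right_tail \<gamma> (distr \<nu> borel uminus) x = left_tail \<gamma> \<nu> (- x)" .
  have "((\<lambda>x. left_tail \<gamma> \<nu> (- x)) \<longlongrightarrow> c) at_top"
    by (rule filterlim_compose[OF lim filterlim_uminus_at_bot_at_top])
  then show "(right_tail \<gamma> (distr \<nu> borel uminus) \<longlongrightarrow> c) at_top"
    by (rule Lim_transform_eventually)
       (use eventually_gt_at_top[of 0] in eventually_elim, simp add: eq)
qed

definition real_defect :: "real measure \<Rightarrow> real \<Rightarrow> real" where
  "real_defect \<nu> T = (\<integral>x. 1 - cos (x / T) \<partial>\<nu>)"

definition imag_part :: "real measure \<Rightarrow> real \<Rightarrow> real" where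
  "imag_part \<nu> T = (\<integral>x. sin (x / T) \<partial>\<nu>)"

lemma one_minus_char:
  assumes "real_distribution \<nu>" "\<xi> \<noteq> 0" "T > 0"
  shows "1 - char \<nu> (\<xi> / T) = of_real (real_defect \<nu> (T / \<bar>\<xi>\<bar>)) - \<i> * of_real (sgn \<xi> * imag_part \<nu> (T / \<bar>\<xi>\<bar>))"
proof -
  interpret real_distribution \<nu> by fact
  have ic: "integrable \<nu> (\<lambda>x. cos (x * r))" and is': "integrable \<nu> (\<lambda>x. sin (x * r))" for r
    by (auto intro!: integrable_const_bound[where B = 1])
  have a: "char \<nu> (\<xi> / T) = of_real (\<integral>x. cos (x * (\<xi> / T)) \<partial>\<nu>) + \<i> * of_real (\<integral>x. sin (x * (\<xi> / T)) \<partial>\<nu>)"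
  proof -
    have "char \<nu> (\<xi> / T) = (CLINT x|\<nu>. of_real (cos (x * (\<xi> / T))) + \<i> * of_real (sin (x * (\<xi> / T))))"
    proof -
      have "iexp r = of_real (cos r) + \<i> * of_real (sin r)" for r :: real
        by (simp add: cis_conv_exp[symmetric] complex_eq_iff)
      then show ?thesis
        unfolding char_def by (intro Bochner_Integration.integral_cong) (simp_all only: mult.commute)
    qed
    also have "\<dots> = of_real (\<integral>x. cos (x * (\<xi> / T)) \<partial>\<nu>) + \<i> * of_real (\<integral>x. sin (x * (\<xi> / T)) \<partial>\<nu>)"
      using ic[of "\<xi> / T"] is'[of "\<xi> / T"] by (subst Bochner_Integration.integral_add) (auto intro!: integrable_of_real)
    finally show ?thesis .
  qed
  have b: "(\<integral>x. cos (x * (\<xi> / T)) \<partial>\<nu>) = 1 - real_defect \<nu> (T / \<bar>\<xi>\<bar>)"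
  proof -
    have "cos (x * (\<xi> / T)) = cos (x / (T / \<bar>\<xi>\<bar>))" for x
      by (cases "\<xi> > 0") (auto simp: abs_if)
    then have "(\<integral>x. cos (x * (\<xi> / T)) \<partial>\<nu>) = (\<integral>x. cos (x / (T / \<bar>\<xi>\<bar>)) \<partial>\<nu>)" by simp
    then show ?thesis
      unfolding real_defect_def using ic[of "\<bar>\<xi>\<bar> / T"]
      by (subst Bochner_Integration.integral_diff) (auto simp: prob_space[unfolded space_eq_univ])
  qed
  have c: "(\<integral>x. sin (x * (\<xi> / T)) \<partial>\<nu>) = sgn \<xi> * imag_part \<nu> (T / \<bar>\<xi>\<bar>)"
  proof -
    have "sin (x * (\<xi> / T)) = sgn \<xi> * sin (x / (T / \<bar>\<xi>\<bar>))" for x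
      using \<open>\<xi> \<noteq> 0\<close> by (cases "\<xi> > 0") (auto simp: abs_if)
    then show ?thesis unfolding imag_part_def by simp
  qed
  show ?thesis unfolding a b c by (simp add: algebra_simps)
qed

text \<open>Real and imaginary part are even and odd in \<open>\<xi>\<close>, and a scaling of \<open>T\<close> by \<open>\<bar>\<xi>\<bar>\<close> produces the factor \<open>\<bar>\<xi>\<bar>\<^sup>\<gamma>\<close>; so it
  suffices to study both parts at \<open>\<xi> = 1\<close>.\<close>

lemma char_asymptotics:
  assumes "real_distribution \<nu>" "\<gamma> > 0"
    and k: "((\<lambda>T. T powr \<gamma> * real_defect \<nu> T) \<longlongrightarrow> k) at_top"
    and s: "((\<lambda>T. T powr \<gamma> * imag_part \<nu> T) \<longlongrightarrow> s) at_top"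
  shows "((\<lambda>T. of_real (T powr \<gamma>) * (1 - char \<nu> (\<xi> / T))) \<longlongrightarrow>
     of_real (\<bar>\<xi>\<bar> powr \<gamma>) * (of_real k - \<i> * of_real (s * sgn \<xi>))) at_top"
proof (cases "\<xi> = 0")
  case True
  interpret real_distribution \<nu> by fact
  show ?thesis using True by (simp add: char_zero)
next
  case False
  have sc: "filterlim (\<lambda>T. T / \<bar>\<xi>\<bar>) at_top at_top"
    using False filterlim_tendsto_pos_mult_at_top[OF tendsto_const[of "1 / \<bar>\<xi>\<bar>"] _ filterlim_ident] by simp
  have "((\<lambda>T. of_real (\<bar>\<xi>\<bar> powr \<gamma>) * (of_real ((T / \<bar>\<xi>\<bar>) powr \<gamma> * real_defect \<nu> (T / \<bar>\<xi>\<bar>))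
      - \<i> * of_real ((T / \<bar>\<xi>\<bar>) powr \<gamma> * imag_part \<nu> (T / \<bar>\<xi>\<bar>) * sgn \<xi>))) \<longlongrightarrow>
     of_real (\<bar>\<xi>\<bar> powr \<gamma>) * (of_real k - \<i> * of_real (s * sgn \<xi>))) at_top"
    by (intro tendsto_intros filterlim_compose[OF k sc] filterlim_compose[OF s sc])
  moreover have "\<forall>\<^sub>F T in at_top. of_real (\<bar>\<xi>\<bar> powr \<gamma>) * (of_real ((T / \<bar>\<xi>\<bar>) powr \<gamma> * real_defect \<nu> (T / \<bar>\<xi>\<bar>))
      - \<i> * of_real ((T / \<bar>\<xi>\<bar>) powr \<gamma> * imag_part \<nu> (T / \<bar>\<xi>\<bar>) * sgn \<xi>)) = of_real (T powr \<gamma>) * (1 - char \<nu> (\<xi> / T))"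
    using eventually_gt_at_top[of 0]
  proof eventually_elim
    case (elim T)
    have "T powr \<gamma> = \<bar>\<xi>\<bar> powr \<gamma> * (T / \<bar>\<xi>\<bar>) powr \<gamma>"
      using False elim by (simp add: powr_divide)
    then show ?case
      unfolding one_minus_char[OF assms(1) False elim] by (simp add: algebra_simps)
  qed
  ultimately show ?thesis by (rule Lim_transform_eventually)
qed

lemma split_half_lines:
  fixes f :: "real \<Rightarrow> real"
  assumes "real_distribution \<nu>" and [measurable]: "f \<in> borel_measurable borel" and f: "\<And>x. \<bar>f x\<bar> \<le> B" "f 0 = 0"
  shows "(\<integral>x. f x \<partial>\<nu>) = (\<integral>x. (if x > 0 then f x else 0) \<partial>\<nu>) + (\<integral>x. (if x > 0 then f (- x) else 0) \<partial>(distr \<nu> borel uminus))"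
proof -
  interpret real_distribution \<nu> by fact
  have B: "B \<ge> 0" using f(1)[of 0] by linarith
  have "(\<integral>x. f x \<partial>\<nu>) = (\<integral>x. (if x > 0 then f x else 0) + (if - x > 0 then f x else 0) \<partial>\<nu>)"
    by (intro Bochner_Integration.integral_cong refl) (use f(2) in \<open>auto simp: not_less antisym_conv3\<close>)
  also have "\<dots> = (\<integral>x. (if x > 0 then f x else 0) \<partial>\<nu>) + (\<integral>x. (if - x > 0 then f x else 0) \<partial>\<nu>)"
    by (intro Bochner_Integration.integral_add integrable_const_bound[where B = B]) (use f(1) B in auto)
  also have "(\<integral>x. (if - x > 0 then f x else 0) \<partial>\<nu>) = (\<integral>x. (if x > 0 then f (- x) else 0) \<partial>(distr \<nu> borel uminus))"
    by (subst integral_distr) (auto intro!: Bochner_Integration.integral_cong)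
  finally show ?thesis .
qed

lemma real_defect_asymptotics:
  assumes "real_distribution \<nu>" "0 < \<gamma>" "\<gamma> < 2" "(right_tail \<gamma> \<nu> \<longlongrightarrow> cp) at_top" "(left_tail \<gamma> \<nu> \<longlongrightarrow> cm) at_bot"
  shows "((\<lambda>T. T powr \<gamma> * real_defect \<nu> T) \<longlongrightarrow> (cp + cm) * (pi / (2 * Gamma \<gamma> * sin (pi * \<gamma> / 2)))) at_top"
proof -
  have [simp]: "cos (- x / T) = cos (x / T)" for x T :: real
    using cos_minus[of "x / T"] by (simp del: cos_minus)
  have "real_defect \<nu> T = (\<integral>x. (if x > 0 then 1 - cos (x / T) else 0) \<partial>\<nu>) +
      (\<integral>x. (if x > 0 then 1 - cos (x / T) else 0) \<partial>(distr \<nu> borel uminus))" for T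
    unfolding real_defect_def using split_half_lines[OF assms(1), of "\<lambda>x. 1 - cos (x / T)" 2] abs_one_minus_cos_le(1) by (simp cong: if_cong)
  then show ?thesis
    using tendsto_add[OF abelian_one_minus_cos[OF assms(1-4)]
       abelian_one_minus_cos[OF right_tail_uminus(1)[OF assms(1,5)] assms(2,3) right_tail_uminus(2)[OF assms(1,5)]]]
    by (simp only: distrib_left distrib_right)
qed

text \<open>The sine is odd, so the two tails enter with opposite signs.\<close>

lemma imag_part_asymptotics_less_1:
  assumes "real_distribution \<nu>" "0 < \<gamma>" "\<gamma> < 1" "(right_tail \<gamma> \<nu> \<longlongrightarrow> cp) at_top" "(left_tail \<gamma> \<nu> \<longlongrightarrow> cm) at_bot"
  shows "((\<lambda>T. T powr \<gamma> * imag_part \<nu> T) \<longlongrightarrow> (cp - cm) * (pi / (2 * Gamma \<gamma> * cos (pi * \<gamma> / 2)))) at_top"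
proof -
  have [simp]: "sin (- x / T) = - sin (x / T)" for x T :: real
    using sin_minus[of "x / T"] by (simp del: sin_minus)
  have "imag_part \<nu> T = (\<integral>x. (if x > 0 then sin (x / T) else 0) \<partial>\<nu>) -
      (\<integral>x. (if x > 0 then sin (x / T) else 0) \<partial>(distr \<nu> borel uminus))" for T
  proof -
    have "(\<integral>x. (if x > 0 then - sin (x / T) else 0) \<partial>(distr \<nu> borel uminus)) =
        (\<integral>x. - (if x > 0 then sin (x / T) else 0) \<partial>(distr \<nu> borel uminus))"
      by (intro Bochner_Integration.integral_cong) auto
    then show ?thesis
      unfolding imag_part_def using split_half_lines[OF assms(1), of "\<lambda>x. sin (x / T)" 1] by (simp cong: if_cong)
  qed
  then show ?thesis
    using tendsto_diff[OF abelian_sin[OF assms(1-4)]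
       abelian_sin[OF right_tail_uminus(1)[OF assms(1,5)] assms(2,3) right_tail_uminus(2)[OF assms(1,5)]]]
    by (simp only: right_diff_distrib left_diff_distrib)
qed

text \<open>As the mean is zero, \<open>sin (x/T)\<close> may be replaced by \<open>sin (x/T) - x/T\<close>, whose order at the origin is high enough for
  \<open>\<gamma> > 1\<close>.\<close>

lemma imag_part_asymptotics_greater_1:
  assumes "real_distribution \<nu>" "1 < \<gamma>" "\<gamma> < 2" "(right_tail \<gamma> \<nu> \<longlongrightarrow> cp) at_top" "(left_tail \<gamma> \<nu> \<longlongrightarrow> cm) at_bot"
    and mean: "has_bochner_integral \<nu> (\<lambda>x. x) 0"
  shows "((\<lambda>T. T powr \<gamma> * imag_part \<nu> T) \<longlongrightarrow> (cp - cm) * (pi / (2 * Gamma \<gamma> * cos (pi * \<gamma> / 2)))) at_top"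
proof -
  interpret real_distribution \<nu> by fact
  let ?\<nu> = "distr \<nu> borel uminus"
  define F where "F T = (\<lambda>x::real. if x > 0 then x / T - sin (x / T) else 0)" for T
  have [measurable]: "F T \<in> borel_measurable borel" for T unfolding F_def by measurable
  have eq: "imag_part \<nu> T = (\<integral>x. F T x \<partial>?\<nu>) - (\<integral>x. F T x \<partial>\<nu>)" if "T > 0" for T
  proof -
    have i1: "integrable \<nu> (F T)"
      unfolding F_def by (rule abelian_id_minus_sin(2)[OF assms(1-4) that])
    have "integrable ?\<nu> (F T)"
      unfolding F_def by (rule abelian_id_minus_sin(2)[OF right_tail_uminus(1)[OF assms(1,5)] assms(2,3) right_tail_uminus(2)[OF assms(1,5)] that])
    then have i2: "integrable \<nu> (\<lambda>x. F T (- x))"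
      by (subst (asm) integrable_distr_eq) auto
    have im: "integrable \<nu> (\<lambda>x. x / T)" "(\<integral>x. x / T \<partial>\<nu>) = 0"
      using mean by (auto simp: has_bochner_integral_iff)
    have "imag_part \<nu> T = (\<integral>x. x / T - F T x + F T (- x) \<partial>\<nu>)"
      unfolding imag_part_def F_def
      by (intro Bochner_Integration.integral_cong refl) (auto simp: not_less antisym_conv3)
    also have "\<dots> = (\<integral>x. x / T \<partial>\<nu>) - (\<integral>x. F T x \<partial>\<nu>) + (\<integral>x. F T (- x) \<partial>\<nu>)"
      using i1 i2 im by simp
    also have "(\<integral>x. F T (- x) \<partial>\<nu>) = (\<integral>x. F T x \<partial>?\<nu>)" by (subst integral_distr) auto
    finally show ?thesis using im by simp
  qed
  have ev: "\<forall>\<^sub>F T in at_top. T powr \<gamma> * (\<integral>x. F T x \<partial>?\<nu>) - T powr \<gamma> * (\<integral>x. F T x \<partial>\<nu>) = T powr \<gamma> * imag_part \<nu> T"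
    by (intro eventually_mono[OF eventually_gt_at_top[of 0]]) (simp add: eq right_diff_distrib)
  have "((\<lambda>T. T powr \<gamma> * (\<integral>x. F T x \<partial>?\<nu>) - T powr \<gamma> * (\<integral>x. F T x \<partial>\<nu>)) \<longlongrightarrow>
      cm * (- (pi / (2 * Gamma \<gamma> * cos (pi * \<gamma> / 2)))) - cp * (- (pi / (2 * Gamma \<gamma> * cos (pi * \<gamma> / 2))))) at_top"
    unfolding F_def
    by (intro tendsto_diff abelian_id_minus_sin(1)[OF assms(1-4)]
         abelian_id_minus_sin(1)[OF right_tail_uminus(1)[OF assms(1,5)] assms(2,3) right_tail_uminus(2)[OF assms(1,5)]])
  also have "cm * (- (pi / (2 * Gamma \<gamma> * cos (pi * \<gamma> / 2)))) - cp * (- (pi / (2 * Gamma \<gamma> * cos (pi * \<gamma> / 2))))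
      = (cp - cm) * (pi / (2 * Gamma \<gamma> * cos (pi * \<gamma> / 2)))"
  proof -
    have "cm * (- X) - cp * (- X) = (cp - cm) * X" for X :: real by (simp add: algebra_simps)
    then show ?thesis .
  qed
  finally show ?thesis using ev by (rule Lim_transform_eventually)
qed

text \<open>Both \<open>T (1 - cos (x/T))\<close> and \<open>T sin (x/T)\<close> are dominated by \<open>\<bar>x\<bar>\<close> and converge to \<open>0\<close> and \<open>x\<close>.\<close>

lemma integrable_first_moment_asymptotics:
  assumes "real_distribution \<nu>" and int: "integrable \<nu> (\<lambda>x. x)"
  shows "((\<lambda>T. T powr 1 * real_defect \<nu> T) \<longlongrightarrow> 0) at_top"
    and "((\<lambda>T. T powr 1 * imag_part \<nu> T) \<longlongrightarrow> (\<integral>x. x \<partial>\<nu>)) at_top"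
proof -
  interpret real_distribution \<nu> by fact
  have inv: "filterlim (\<lambda>T::real. x / T) (nhds 0) at_top" for x :: real
    by real_asymp
  have "((\<lambda>T. \<integral>x. T * (1 - cos (x / T)) \<partial>\<nu>) \<longlongrightarrow> (\<integral>x. 0 \<partial>\<nu>)) at_top"
  proof (rule integral_dominated_convergence_at_top[where w = "\<lambda>x. \<bar>x\<bar>"])
    have bnd: "\<bar>1 - cos y\<bar> \<le> \<bar>y\<bar>" for y :: real
      using abs_one_minus_cos_le(2)[of "\<bar>y\<bar>"] by (cases "y = 0") (auto simp: abs_if split: if_splits)
    have "\<bar>T * (1 - cos (x / T))\<bar> \<le> \<bar>x\<bar>" if "T > 0" for x T :: real
      using that mult_left_mono[OF bnd[of "x / T"], of T] by (simp add: abs_mult)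
    then show "\<forall>\<^sub>F T in at_top. AE x in \<nu>. norm (T * (1 - cos (x / T))) \<le> \<bar>x\<bar>"
      by (intro eventually_mono[OF eventually_gt_at_top[of 0]]) auto
    show "AE x in \<nu>. ((\<lambda>T. T * (1 - cos (x / T))) \<longlongrightarrow> 0) at_top"
      by (rule AE_I2) real_asymp
    show "integrable \<nu> (\<lambda>x. \<bar>x\<bar>)" by (rule integrable_abs[OF int])
  qed measurable
  then show "((\<lambda>T. T powr 1 * real_defect \<nu> T) \<longlongrightarrow> 0) at_top"
    unfolding real_defect_def
    by (rule_tac Lim_transform_eventually[OF _ eventually_mono[OF eventually_gt_at_top[of 0]]]) auto
  have "((\<lambda>T. \<integral>x. T * sin (x / T) \<partial>\<nu>) \<longlongrightarrow> (\<integral>x. x \<partial>\<nu>)) at_top"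
  proof (rule integral_dominated_convergence_at_top[where w = "\<lambda>x. \<bar>x\<bar>"])
    have "\<bar>T * sin (x / T)\<bar> \<le> \<bar>x\<bar>" if "T > 0" for x T :: real
      using that mult_left_mono[OF abs_sin_x_le_abs_x[of "x / T"], of T] by (simp add: abs_mult)
    then show "\<forall>\<^sub>F T in at_top. AE x in \<nu>. norm (T * sin (x / T)) \<le> \<bar>x\<bar>"
      by (intro eventually_mono[OF eventually_gt_at_top[of 0]]) auto
    show "AE x in \<nu>. ((\<lambda>T. T * sin (x / T)) \<longlongrightarrow> x) at_top"
    proof (rule AE_I2)
      show "((\<lambda>T. T * sin (x / T)) \<longlongrightarrow> x) at_top" for x :: real
        by (cases "x = 0") (simp, real_asymp)
    qed
    show "integrable \<nu> (\<lambda>x. \<bar>x\<bar>)" by (rule integrable_abs[OF int])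
  qed measurable
  then show "((\<lambda>T. T powr 1 * imag_part \<nu> T) \<longlongrightarrow> (\<integral>x. x \<partial>\<nu>)) at_top"
    unfolding imag_part_def
    by (rule_tac Lim_transform_eventually[OF _ eventually_mono[OF eventually_gt_at_top[of 0]]]) auto
qed

definition clip :: "real \<Rightarrow> real \<Rightarrow> real" where
  "clip L y = max (- L) (min y L)"

text \<open>The clipped variable has integral \<open>\<integral>\<^bsub>[-LT,LT]\<^esub> x d\<nu>\<close> plus \<open>LT\<close> times the difference of the two tail
  probabilities, and the latter product vanishes in the limit since both tails have the same constant \<open>c\<close>.\<close>

lemma clip_asymptotics:
  assumes "real_distribution \<nu>" and cp: "(right_tail 1 \<nu> \<longlongrightarrow> c) at_top" and cm: "(left_tail 1 \<nu> \<longlongrightarrow> c) at_bot"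
    and tm: "(trunc_mean \<nu> \<longlongrightarrow> m) at_top" and "L > 0"
  shows "((\<lambda>T. T * (\<integral>x. clip L (x / T) \<partial>\<nu>)) \<longlongrightarrow> m) at_top"
proof -
  interpret real_distribution \<nu> by fact
  have up: "filterlim (\<lambda>T. L * T) at_top at_top"
    using \<open>L > 0\<close> by (intro filterlim_tendsto_pos_mult_at_top[OF tendsto_const _ filterlim_ident]) auto
  then have dn: "filterlim (\<lambda>T. - (L * T)) at_bot at_top"
    by (rule filterlim_compose[OF filterlim_uminus_at_bot_at_top])
  have "((\<lambda>T. trunc_mean \<nu> (L * T) + right_tail 1 \<nu> (L * T) - left_tail 1 \<nu> (- (L * T))) \<longlongrightarrow> m + c - c) at_top"
    by (intro tendsto_intros filterlim_compose[OF tm up] filterlim_compose[OF cp up] filterlim_compose[OF cm dn])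
  moreover have "\<forall>\<^sub>F T in at_top. trunc_mean \<nu> (L * T) + right_tail 1 \<nu> (L * T) - left_tail 1 \<nu> (- (L * T))
      = T * (\<integral>x. clip L (x / T) \<partial>\<nu>)"
  proof (rule eventually_mono[OF eventually_gt_at_top[of 0]])
    fix T :: real assume "T > 0"
    then have LT: "L * T > 0" using \<open>L > 0\<close> by simp
    let ?R = "L * T"
    have i0: "integrable \<nu> (\<lambda>x. indicator {-?R..?R} x *\<^sub>R x)"
      by (rule integrable_const_bound[where B = ?R]) (use LT in \<open>auto simp: indicator_def\<close>)
    have i1: "integrable \<nu> (\<lambda>x. ?R * indicator {?R<..} x)" and i2: "integrable \<nu> (\<lambda>x. ?R * indicator {..<-?R} x)"
      by (auto intro!: integrable_mult_right simp: emeasure_eq_measure)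
    have "T * (\<integral>x. clip L (x / T) \<partial>\<nu>) = (\<integral>x. T * clip L (x / T) \<partial>\<nu>)" by simp
    also have "\<dots> = (\<integral>x. indicator {-?R..?R} x *\<^sub>R x + ?R * indicator {?R<..} x - ?R * indicator {..<-?R} x \<partial>\<nu>)"
    proof (intro Bochner_Integration.integral_cong refl)
      fix x :: real
      have "T * clip L (x / T) = max (- ?R) (min x ?R)"
        using \<open>T > 0\<close> \<open>L > 0\<close> unfolding clip_def by (auto simp: max_def min_def field_simps)
      then show "T * clip L (x / T) = indicator {-?R..?R} x *\<^sub>R x + ?R * indicator {?R<..} x - ?R * indicator {..<-?R} x"
        using LT by (auto simp: indicator_def max_def min_def)
    qed
    also have "\<dots> = trunc_mean \<nu> ?R + ?R * measure \<nu> {?R<..} - ?R * measure \<nu> {..<-?R}"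
      using i0 i1 i2 unfolding trunc_mean_def set_lebesgue_integral_def by simp
    finally show "trunc_mean \<nu> ?R + right_tail 1 \<nu> ?R - left_tail 1 \<nu> (- ?R) = T * (\<integral>x. clip L (x / T) \<partial>\<nu>)"
      using LT by (simp add: right_tail_def left_tail_def)
  qed
  ultimately show ?thesis using Lim_transform_eventually by fastforce
qed

text \<open>Without a first moment and for \<open>\<gamma> = 1\<close>, neither \<open>abelian_sin\<close> nor \<open>abelian_id_minus_sin\<close> applies. Up to an error carried by
  \<open>\<bar>x\<bar> > L T\<close>, \<open>sin y\<close> is the clipped variable minus the odd function \<open>F(y) - F(-y)\<close>, where \<open>F\<close> is \<open>y - sin y\<close>
  on \<open>(0, L]\<close>, frozen at \<open>L\<close> and zero on the negative half line. The clipped variable contributes \<open>m\<close>, and the two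
  contributions of \<open>F\<close> have the same limit \<open>J\<close> because the tails are asymptotically symmetric, hence cancel.\<close>

lemma imag_part_asymptotics_1:
  assumes "real_distribution \<nu>" and cp: "(right_tail 1 \<nu> \<longlongrightarrow> c) at_top" and cm: "(left_tail 1 \<nu> \<longlongrightarrow> c) at_bot"
    and tm: "(trunc_mean \<nu> \<longlongrightarrow> m) at_top"
  shows "((\<lambda>T. T powr 1 * imag_part \<nu> T) \<longlongrightarrow> m) at_top"
proof (rule tendsto_by_approximation)
  interpret real_distribution \<nu> by fact
  let ?\<nu> = "distr \<nu> borel uminus"
  have rd: "real_distribution ?\<nu>" and cm': "(right_tail 1 ?\<nu> \<longlongrightarrow> c) at_top"
    and rl: "\<And>x. x > 0 \<Longrightarrow> right_tail 1 ?\<nu> x = left_tail 1 \<nu> (- x)"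
    using right_tail_uminus[OF assms(1) cm] by auto
  obtain K1 where K1: "K1 \<ge> 0" "\<And>x. x > 0 \<Longrightarrow> right_tail 1 \<nu> x \<le> K1"
    using right_tail_bounded[OF assms(1) _ cp] by auto
  obtain K2 where K2: "K2 \<ge> 0" "\<And>x. x > 0 \<Longrightarrow> right_tail 1 ?\<nu> x \<le> K2"
    using right_tail_bounded[OF rd _ cm'] by auto
  fix e :: real assume "e > 0"
  \<comment> \<open>the level for which the tails beyond \<open>L T\<close> contribute at most \<open>e\<close>\<close>
  define L where "L = 2 * (K1 + K2) / e + 1"
  have "L > 0" using \<open>e > 0\<close> K1(1) K2(1) by (auto simp: L_def intro!: add_nonneg_pos)
  have Le: "2 * (K1 + K2) / L \<le> e"
  proof -
    have "2 * (K1 + K2) \<le> e * L" using \<open>e > 0\<close> by (simp add: L_def field_simps)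
    then show ?thesis using \<open>L > 0\<close> by (simp add: field_simps)
  qed
  define F where "F = primitive_on {0<..L} (\<lambda>z. 1 - cos z)"
  have F: "F y = (if y > 0 then min y L - sin (min y L) else 0)" for y
    unfolding F_def by (rule primitive_on_Ioc) (use \<open>L > 0\<close> in \<open>auto intro!: derivative_eq_intros\<close>)
  have [measurable]: "F \<in> borel_measurable borel" unfolding F_def by measurable
  have [measurable]: "clip L \<in> borel_measurable borel" unfolding clip_def by measurable
  have si: "set_integrable lborel {0<..L} (\<lambda>z. (1 - cos z) * z powr (- 1))"
  proof -
    have "set_integrable lborel {0<..} (\<lambda>z. (indicator {0<..L} z * (1 - cos z)) * z powr (- 0 - 1))"
    proof (rule set_integrable_between_powers[where a = 1 and b = "-1" and B = "max 1 (2 * L)"])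
      fix w :: real assume w: "w > 0"
      have le: "\<bar>indicator {0<..L} w * (1 - cos w)\<bar> \<le> \<bar>1 - cos w\<bar>" by (auto simp: indicator_def)
      also have "\<dots> \<le> 1 * w" using abs_one_minus_cos_le(2)[OF w] by simp
      also have "\<dots> \<le> max 1 (2 * L) * w powr 1" using w by (intro mult_mono) auto
      finally show "\<bar>indicator {0<..L} w * (1 - cos w)\<bar> \<le> max 1 (2 * L) * w powr 1" .
      show "\<bar>indicator {0<..L} w * (1 - cos w)\<bar> \<le> max 1 (2 * L) * w powr -1"
      proof (cases "w \<le> L")
        case True
        have "\<bar>indicator {0<..L} w * (1 - cos w)\<bar> \<le> 2 * 1" using le abs_one_minus_cos_le(1)[of w] by linarith
        also have "\<dots> \<le> 2 * (L * inverse w)" using True w by (simp add: field_simps)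
        also have "\<dots> \<le> max 1 (2 * L) * w powr -1" using w by (simp add: powr_minus)
        finally show ?thesis .
      qed auto
    qed auto
    then show ?thesis
      unfolding set_integrable_def by (rule Bochner_Integration.integrable_cong[THEN iffD1, rotated -1]) (auto simp: indicator_def)
  qed
  define J where "J = c * (1 * (LBINT w:{0<..}. F w * w powr (- 1 - 1)))"
  have l1: "((\<lambda>T. T powr 1 * (\<integral>x. F (x / T) \<partial>\<nu>)) \<longlongrightarrow> J) at_top"
    unfolding J_def F_def by (rule abelian_primitive) (use assms(1) cp si in auto)
  have l2: "((\<lambda>T. T powr 1 * (\<integral>x. F (x / T) \<partial>?\<nu>)) \<longlongrightarrow> J) at_top"
    unfolding J_def F_def by (rule abelian_primitive) (use rd cm' si in auto)
  define Y where "Y T = T * (\<integral>x. clip L (x / T) \<partial>\<nu>) - T powr 1 * (\<integral>x. F (x / T) \<partial>\<nu>) + T powr 1 * (\<integral>x. F (x / T) \<partial>?\<nu>)" for T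
  have "(Y \<longlongrightarrow> m - J + J) at_top"
    unfolding Y_def by (intro tendsto_add tendsto_diff l1 l2 clip_asymptotics[OF assms \<open>L > 0\<close>])
  moreover have "dist (T powr 1 * imag_part \<nu> T) (Y T) \<le> e" if "T > 0" for T
  proof -
    have Fb: "\<bar>F y\<bar> \<le> L + 1" for y
    proof -
      have "\<bar>min y L - sin (min y L)\<bar> \<le> L + 1" if "y > 0"
      proof -
        define v where "v = min y L"
        have "0 < v" "v \<le> L" using that \<open>L > 0\<close> by (auto simp: v_def)
        then show ?thesis
          unfolding v_def[symmetric] using sin_le_one[of v] sin_ge_minus_one[of v] by linarith
      qed
      then show ?thesis using \<open>L > 0\<close> by (auto simp: F)
    qed
    have i1: "integrable \<nu> (\<lambda>x. clip L (x / T))"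
      by (rule integrable_const_bound[where B = L]) (use \<open>L > 0\<close> in \<open>auto simp: clip_def\<close>)
    have i2: "integrable \<nu> (\<lambda>x. F (x / T))" "integrable \<nu> (\<lambda>x. F (- x / T))"
      by (rule integrable_const_bound[where B = "L + 1"]; use Fb in auto)+
    have i3: "integrable \<nu> (\<lambda>x. sin (x / T))"
      by (rule integrable_const_bound[where B = 1]) auto
    have LT: "L * T > 0" using that \<open>L > 0\<close> by simp
    have "Y T = T * (\<integral>x. clip L (x / T) - F (x / T) + F (- x / T) \<partial>\<nu>)"
      unfolding Y_def using i1 i2 that by (simp add: integral_distr algebra_simps)
    then have "dist (T powr 1 * imag_part \<nu> T) (Y T) = \<bar>T * (\<integral>x. sin (x / T) - (clip L (x / T) - F (x / T) + F (- x / T)) \<partial>\<nu>)\<bar>"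
      unfolding imag_part_def dist_real_def using i1 i2 i3 that by (simp add: algebra_simps)
    also have "\<dots> \<le> T * (\<integral>x. \<bar>sin (x / T) - (clip L (x / T) - F (x / T) + F (- x / T))\<bar> \<partial>\<nu>)"
      using that by (simp add: abs_mult integral_abs_bound)
    also have "\<dots> \<le> T * (\<integral>x. 2 * indicator {L * T<..} x + 2 * indicator {..<-(L * T)} x \<partial>\<nu>)"
    proof (intro mult_left_mono integral_mono)
      fix x :: real
      have d: "\<bar>sin u - sin v\<bar> \<le> 2" for u v :: real using abs_sin_le_one[of u] abs_sin_le_one[of v] by linarith
      define y where "y = x / T"
      have "sin y - (clip L y - F y + F (- y)) = sin y - sin (clip L y)"
        using \<open>L > 0\<close> by (auto simp: F clip_def max_def min_def)
      then have "\<bar>sin y - (clip L y - F y + F (- y))\<bar> \<le> (if \<bar>y\<bar> > L then 2 else 0)"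
        using d[of y "clip L y"] by (auto simp: clip_def max_def min_def)
      also have "\<dots> \<le> 2 * indicator {L * T<..} x + 2 * indicator {..<-(L * T)} x"
        using that by (auto simp: y_def indicator_def abs_if field_simps split: if_splits)
      finally show "\<bar>sin (x / T) - (clip L (x / T) - F (x / T) + F (- x / T))\<bar> \<le> 2 * indicator {L * T<..} x + 2 * indicator {..<-(L * T)} x"
        by (simp add: y_def)
    qed (use i1 i2 i3 that in \<open>auto simp: emeasure_eq_measure\<close>)
    also have "\<dots> = 2 * (T * measure \<nu> {L * T<..}) + 2 * (T * measure \<nu> {..<-(L * T)})"
      by (simp add: emeasure_eq_measure algebra_simps)
    also have "T * measure \<nu> {L * T<..} = right_tail 1 \<nu> (L * T) / L"
      using LT that \<open>L > 0\<close> by (simp add: right_tail_def)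
    also have "T * measure \<nu> {..<-(L * T)} = right_tail 1 ?\<nu> (L * T) / L"
      using LT that \<open>L > 0\<close> by (simp add: rl left_tail_def)
    also have "2 * (right_tail 1 \<nu> (L * T) / L) + 2 * (right_tail 1 ?\<nu> (L * T) / L) \<le> 2 * (K1 / L) + 2 * (K2 / L)"
      using K1(2)[OF LT] K2(2)[OF LT] \<open>L > 0\<close> by (intro add_mono mult_left_mono divide_right_mono) auto
    also have "\<dots> = 2 * (K1 + K2) / L" by (simp add: add_divide_distrib)
    finally show ?thesis using Le by linarith
  qed
  ultimately show "\<exists>Y y. (Y \<longlongrightarrow> y) at_top \<and> dist y m \<le> e \<and> (\<forall>\<^sub>F T in at_top. dist (T powr 1 * imag_part \<nu> T) (Y T) \<le> e)"
    using \<open>e > 0\<close> by (intro exI[of _ Y] exI[of _ m]) (auto intro: eventually_mono[OF eventually_gt_at_top[of 0]])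
qed

lemma tail_limits_nonneg:
  assumes "(right_tail \<gamma> \<nu> \<longlongrightarrow> cp) at_top" and "(left_tail \<gamma> \<nu> \<longlongrightarrow> cm) at_bot"
  shows "cp \<ge> 0" "cm \<ge> 0"
  using tendsto_lowerbound[OF assms(1), of 0] tendsto_lowerbound[OF assms(2), of 0]
  by (auto simp: right_tail_def left_tail_def)

lemma scaled_argument_abs_powr:
  assumes "m \<ge> (0::real)" "\<gamma> > 0"
  shows "\<bar>\<xi> * m powr (1 / \<gamma>)\<bar> powr \<gamma> = \<bar>\<xi>\<bar> powr \<gamma> * m"
  using assms by (simp add: abs_mult powr_mult powr_powr)

text \<open>The constant \<open>\<kappa>\<close> is \<open>\<bar>\<xi>\<bar>\<^sup>\<gamma> (k - i s sgn \<xi>)\<close>, where \<open>k\<close> and \<open>s\<close> are the limits of the normalised real defect and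
  imaginary part. The limit function has the form \<open>exp (- \<bar>\<eta>\<bar>\<^sup>\<gamma> (k - i s sgn \<eta>))\<close>, so that \<open>\<eta> = \<xi> m\<^bsup>1/\<gamma>\<^esup>\<close>
  turns it into \<open>exp (- \<kappa> m)\<close>.\<close>

lemma H_char_expansion:
  assumes "\<nu> \<in> \<H> \<gamma>"
  obtains \<kappa> where "Re \<kappa> \<ge> 0" 
    "((\<lambda>T. of_real (T powr \<gamma>) * (1 - char \<nu> (\<xi> / T))) \<longlongrightarrow> \<kappa>) at_top"
    "\<And>m. m \<ge> 0 \<Longrightarrow> g_hat \<gamma> \<nu> (\<xi> * m powr (1 / \<gamma>)) = exp (- \<kappa> * of_real m)"
proof -
  note witness = that
  have rd: "real_distribution \<nu>" and \<gamma>: "0 < \<gamma>" "\<gamma> < 2" using assms by (auto simp: \<H>_def)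
  have *: thesis if k: "((\<lambda>T. T powr \<gamma> * real_defect \<nu> T) \<longlongrightarrow> k) at_top" "k \<ge> 0"
    and s: "((\<lambda>T. T powr \<gamma> * imag_part \<nu> T) \<longlongrightarrow> s) at_top"
    and g: "\<And>\<eta>. g_hat \<gamma> \<nu> \<eta> = exp (- (of_real (\<bar>\<eta>\<bar> powr \<gamma>) * (of_real k - \<i> * of_real (s * sgn \<eta>))))" for k s
  proof (rule witness)
    show "((\<lambda>T. of_real (T powr \<gamma>) * (1 - char \<nu> (\<xi> / T))) \<longlongrightarrow> of_real (\<bar>\<xi>\<bar> powr \<gamma>) * (of_real k - \<i> * of_real (s * sgn \<xi>))) at_top"
      by (rule char_asymptotics) fact+
    show "0 \<le> Re (of_real (\<bar>\<xi>\<bar> powr \<gamma>) * (of_real k - \<i> * of_real (s * sgn \<xi>)))"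
      using \<open>k \<ge> 0\<close> by simp
    fix m :: real assume "m \<ge> 0"
    then show "g_hat \<gamma> \<nu> (\<xi> * m powr (1 / \<gamma>)) = exp (- (of_real (\<bar>\<xi>\<bar> powr \<gamma>) * (of_real k - \<i> * of_real (s * sgn \<xi>))) * of_real m)"
      unfolding g scaled_argument_abs_powr[OF \<open>m \<ge> 0\<close> \<gamma>(1)]
      by (cases "m = 0") (auto simp: sgn_mult algebra_simps)
  qed
  show thesis
  proof (cases "\<gamma> = 1")
    case True
    show thesis
    proof (cases "integrable \<nu> (\<lambda>x. x)")
      case int: True
      show thesis
      proof (rule *)
        show "g_hat \<gamma> \<nu> \<eta> = exp (- (of_real (\<bar>\<eta>\<bar> powr \<gamma>) * (of_real 0 - \<i> * of_real ((\<integral>x. x \<partial>\<nu>) * sgn \<eta>))))" for \<eta>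
        proof -
          have "- (complex_of_real (\<bar>\<eta>\<bar> powr \<gamma>) * (of_real 0 - \<i> * of_real ((\<integral>x. x \<partial>\<nu>) * sgn \<eta>))) =
              \<i> * of_real ((\<integral>x. x \<partial>\<nu>) * \<eta>)"
            by (simp add: True complex_eq_iff sgn_if)
          then show ?thesis
            using True int unfolding g_hat_def Let_def by (simp only: simp_thms if_True)
        qed
      qed (use integrable_first_moment_asymptotics[OF rd int] True in auto)
    next
      case False
      then obtain c m where c: "c > 0" "(right_tail 1 \<nu> \<longlongrightarrow> c) at_top" "(left_tail 1 \<nu> \<longlongrightarrow> c) at_bot"
        and m: "(trunc_mean \<nu> \<longlongrightarrow> m) at_top"
        using assms True by (auto simp: \<H>_def)
      have lims: "Lim at_top (right_tail 1 \<nu>) = c" "Lim at_top (trunc_mean \<nu>) = m"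
        using c m by (auto intro!: tendsto_Lim)
      show thesis
      proof (rule *)
        show "((\<lambda>T. T powr \<gamma> * real_defect \<nu> T) \<longlongrightarrow> pi * c) at_top"
          using real_defect_asymptotics[OF rd, of 1 c c] c True by (simp add: mult.commute[of c])
        show "((\<lambda>T. T powr \<gamma> * imag_part \<nu> T) \<longlongrightarrow> m) at_top"
          using imag_part_asymptotics_1[OF rd c(2,3) m] True by simp
        show "g_hat \<gamma> \<nu> \<eta> = exp (- (of_real (\<bar>\<eta>\<bar> powr \<gamma>) * (of_real (pi * c) - \<i> * of_real (m * sgn \<eta>))))" for \<eta>
        proof -
          have "complex_of_real \<bar>\<eta>\<bar> * (of_real (pi * c) - \<i> * of_real (m * sgn \<eta>)) = of_real (pi * c * \<bar>\<eta>\<bar>) - \<i> * of_real (m * \<eta>)"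
            by (simp add: complex_eq_iff sgn_if)
          then show ?thesis
            using True False lims unfolding g_hat_def Let_def by simp
        qed
      qed (use c in auto)
    qed
  next
    case False
    then obtain cp cm where c: "(right_tail \<gamma> \<nu> \<longlongrightarrow> cp) at_top" "(left_tail \<gamma> \<nu> \<longlongrightarrow> cm) at_bot" "cp + cm > 0"
      and mean: "\<gamma> > 1 \<Longrightarrow> has_bochner_integral \<nu> (\<lambda>x. x) 0"
      using assms by (auto simp: \<H>_def)
    have lims: "Lim at_top (right_tail \<gamma> \<nu>) = cp" "Lim at_bot (left_tail \<gamma> \<nu>) = cm"
      using c by (auto intro!: tendsto_Lim)
    have s_pos: "sin (pi * \<gamma> / 2) > 0" using \<gamma> by (intro sin_gt_zero) auto
    have cos_ne: "cos (pi * \<gamma> / 2) \<noteq> 0"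
    proof (cases "\<gamma> < 1")
      case True
      then have "cos (pi * \<gamma> / 2) > 0" using \<gamma> by (intro cos_gt_zero) (auto simp: field_simps)
      then show ?thesis by simp
    next
      case ge: False
      then have "cos (pi - pi * \<gamma> / 2) > 0" using \<gamma> False by (intro cos_gt_zero) (auto simp: field_simps)
      then show ?thesis by (simp add: cos_diff)
    qed
    have G: "Gamma \<gamma> > 0" using \<gamma> by (simp add: Gamma_real_pos)
    define k where "k = (cp + cm) * (pi / (2 * Gamma \<gamma> * sin (pi * \<gamma> / 2)))"
    define s where "s = (cp - cm) * (pi / (2 * Gamma \<gamma> * cos (pi * \<gamma> / 2)))"
    \<comment> \<open>the sine in \<open>k\<close> and the tangent combine to the cosine in \<open>s\<close>\<close>
    have s_eq: "k * ((cp - cm) / (cp + cm) * tan (pi * \<gamma> / 2)) = s"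
    proof -
      have "p * (pi / (2 * g * S)) * (d / p * (S / K)) = d * (pi / (2 * g * K))"
        if "p \<noteq> 0" "S \<noteq> 0" "K \<noteq> 0" "g \<noteq> 0" for p d S K g :: real
        using that by (simp add: field_simps)
      then show ?thesis
        using s_pos cos_ne G c(3) unfolding k_def s_def tan_def by simp
    qed
    show thesis
    proof (rule *)
      show "((\<lambda>T. T powr \<gamma> * real_defect \<nu> T) \<longlongrightarrow> k) at_top"
        unfolding k_def by (rule real_defect_asymptotics) fact+
      show "k \<ge> 0" using tail_limits_nonneg[OF c(1,2)] s_pos G by (simp add: k_def)
      show "((\<lambda>T. T powr \<gamma> * imag_part \<nu> T) \<longlongrightarrow> s) at_top"
      proof (cases "\<gamma> < 1")
        case True
        show ?thesis unfolding s_def by (rule imag_part_asymptotics_less_1) (use rd \<gamma> True c in auto)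
      next
        case ge: False
        show ?thesis unfolding s_def by (rule imag_part_asymptotics_greater_1) (use rd \<gamma> ge False c mean in auto)
      qed
      fix \<eta> :: real
      have "complex_of_real (k * \<bar>\<eta>\<bar> powr \<gamma>) * (1 - \<i> * complex_of_real ((cp - cm) / (cp + cm) * tan (pi * \<gamma> / 2) * sgn \<eta>)) =
        of_real (\<bar>\<eta>\<bar> powr \<gamma>) * (of_real k - \<i> * of_real (s * sgn \<eta>))"
        unfolding s_eq[symmetric] by (simp add: algebra_simps)
      then show "g_hat \<gamma> \<nu> \<eta> = exp (- (of_real (\<bar>\<eta>\<bar> powr \<gamma>) * (of_real k - \<i> * of_real (s * sgn \<eta>))))"
        unfolding g_hat_def Let_def lims k_def[symmetric] using False by (simp only: if_False mult_minus_left)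
    qed
  qed
qed

section \<open>Osgood uniqueness and generating functions\<close>

text \<open>The integral equation says \<open>q' = f(q) - q\<close> and \<open>q(0) = 1\<close>. If \<open>q\<close> left the value \<open>1\<close> at some last time \<open>t\<^sub>0\<close>, then
  \<open>G(q(r)) + r\<close> would be constant just after \<open>t\<^sub>0\<close>, where \<open>G\<close> is a primitive of \<open>1 / (u - f u)\<close>. Hence \<open>G\<close> would be bounded
  on the values of \<open>q\<close>, which fill a left neighbourhood of \<open>1\<close>, against the divergence of the integral.\<close>

lemma osgood_uniqueness:
  fixes f q :: "real \<Rightarrow> real"
  assumes cf: "continuous_on {0..1} f" and f1: "f 1 = 1" and "s0 < 1" and f_less: "\<And>s. s0 < s \<Longrightarrow> s < 1 \<Longrightarrow> f s < s"
    and f01: "\<And>s. 0 \<le> s \<Longrightarrow> s \<le> 1 \<Longrightarrow> 0 \<le> f s \<and> f s \<le> 1"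
    and div: "\<forall>\<^sub>F e in at_right (0::real). (\<integral>\<^sup>+ s\<in>{1 - e<..<1}. ennreal (1 / (s - f s)) \<partial>lborel) = \<infinity>"
    and qm: "q \<in> borel_measurable borel" and q01: "\<And>r. 0 \<le> q r \<and> q r \<le> 1"
    and q: "\<And>r. r \<ge> 0 \<Longrightarrow> q r = exp (- r) * (1 + integral {0..r} (\<lambda>s. exp s * f (q s)))"
    and "t1 \<ge> 0"
  shows "q t1 = 1"
proof (rule ccontr)
  assume "q t1 \<noteq> 1"
  then have qt1: "q t1 < 1" using q01[of t1] by simp
  define h where "h s = exp s * f (q s)" for s
  have fq: "f \<circ> q \<in> borel_measurable borel"
  proof -
    have "(\<lambda>x. indicator {0..1} x *\<^sub>R f x) \<in> borel_measurable borel"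
      using cf by (rule borel_measurable_continuous_on_indicator[rotated]) simp
    from measurable_compose[OF qm this] show ?thesis
      using q01 by (simp add: o_def indicator_def)
  qed
  have "h absolutely_integrable_on {0..t1}"
  proof (rule measurable_bounded_by_integrable_imp_absolutely_integrable[where g = "\<lambda>_. exp t1"])
    have "h \<in> borel_measurable borel"
      unfolding h_def using fq[unfolded o_def] by measurable
    then have "h \<in> borel_measurable lebesgue" by (intro measurable_completion) simp
    then show "h \<in> borel_measurable (lebesgue_on {0..t1})" by (rule measurable_restrict_space1)
    show "norm (h x) \<le> exp t1" if "x \<in> {0..t1}" for x
    proof -
      have "exp x * f (q x) \<le> exp t1 * 1" using that f01 q01 by (intro mult_mono) auto
      then show ?thesis using f01 q01 by (auto simp: h_def abs_mult)
    qed
  qed auto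
  then have hi: "h integrable_on {0..t1}" by (rule set_lebesgue_integral_eq_integral(1))
  have q_eq: "q r = exp (- r) * (1 + integral {0..r} h)" if "r \<in> {0..t1}" for r
    using q[of r] that unfolding h_def[abs_def] by simp
  have cq: "continuous_on {0..t1} q"
    unfolding continuous_on_cong[OF refl q_eq, simplified]
    by (subst continuous_on_cong[OF refl q_eq]) (auto intro!: continuous_intros indefinite_integral_continuous_1 hi)
  have ch: "continuous_on {0..t1} h"
    unfolding h_def using q01
    by (intro continuous_intros continuous_on_compose2[OF cf cq]) auto
  have dq: "(q has_real_derivative (f (q r) - q r)) (at r)" if "r \<in> {0<..<t1}" for r
  proof -
    have r: "r \<in> {0..t1}" using that by auto
    have "((\<lambda>x. exp (- x) * (1 + integral {0..x} h)) has_real_derivative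
      - exp (- r) * (1 + integral {0..r} h) + h r * exp (- r)) (at r within {0..t1})"
      using integral_has_real_derivative[OF ch r] by (auto intro!: derivative_eq_intros)
    also have "- exp (- r) * (1 + integral {0..r} h) + h r * exp (- r) = f (q r) - q r"
      using q_eq[OF r] by (simp add: h_def exp_minus)
    finally have "(q has_real_derivative (f (q r) - q r)) (at r within {0..t1})"
      by (rule has_field_derivative_transform_within[where d = 1]) (use r q_eq in auto)
    then show ?thesis using that by (simp add: at_within_Icc_at)
  qed
  have "q 0 = 1" using q[of 0] by simp
  define Z where "Z = {r \<in> {0..t1}. q r = 1}"
  have "closed Z" unfolding Z_def by (intro continuous_closed_preimage_constant cq) auto
  moreover have "0 \<in> Z" using \<open>q 0 = 1\<close> \<open>t1 \<ge> 0\<close> by (simp add: Z_def)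
  moreover have bZ: "bdd_above Z" by (auto simp: Z_def intro!: bdd_aboveI[of _ t1])
  ultimately have t0Z: "Sup Z \<in> Z" by (intro closed_contains_Sup) auto
  define t0 where "t0 = Sup Z"
  have t0: "0 \<le> t0" "q t0 = 1" "t0 < t1" 
    using t0Z qt1 unfolding t0_def[symmetric] by (auto simp: Z_def less_le)
  have q_lim: "(q \<longlongrightarrow> 1) (at t0 within {0..t1})"
    using cq[unfolded continuous_on_def, rule_format, of t0] t0 by simp
  have q_less: "q r < 1" if "t0 < r" "r \<le> t1" for r
  proof -
    have "r \<notin> Z" using cSup_upper[OF _ bZ, of r] that unfolding t0_def by auto
    then show ?thesis using that t0(1) q01[of r] by (auto simp: Z_def less_le)
  qed
  obtain e1 where e1: "e1 > 0" "\<And>e. 0 < e \<Longrightarrow> e < e1 \<Longrightarrow> (\<integral>\<^sup>+ s\<in>{1 - e<..<1}. ennreal (1 / (s - f s)) \<partial>lborel) = \<infinity>"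
    using div unfolding eventually_at_right_field by auto
  obtain b where b: "max (max s0 (1 - e1)) 0 < b" "b < 1"
    using dense[of "max (max s0 (1 - e1)) 0" 1] \<open>s0 < 1\<close> \<open>e1 > 0\<close> by auto
  define \<phi> where "\<phi> u = 1 / (u - f u)" for u
  define G where "G s = integral {b..s} \<phi>" for s
  have \<phi>_pos: "\<phi> u > 0" if "b \<le> u" "u < 1" for u
    using f_less[of u] b that by (auto simp: \<phi>_def)
  have c\<phi>: "continuous_on {b..s} \<phi>" if "s < 1" for s
  proof -
    have "u - f u \<noteq> 0" if "u \<in> {b..s}" for u using f_less[of u] b that \<open>s < 1\<close> by auto
    then show ?thesis unfolding \<phi>_def using b that
      by (intro continuous_intros continuous_on_subset[OF cf]) auto
  qed
  obtain t2 where t2: "t0 < t2" "t2 \<le> t1" "\<And>r. t0 < r \<Longrightarrow> r \<le> t2 \<Longrightarrow> b < q r"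
  proof -
    have "\<forall>\<^sub>F r in at t0 within {0..t1}. b < q r"
      using q_lim b by (intro order_tendstoD) auto
    then obtain d where d: "d > 0" "\<And>r. r \<in> {0..t1} \<Longrightarrow> r \<noteq> t0 \<Longrightarrow> dist r t0 < d \<Longrightarrow> b < q r"
      unfolding eventually_at by blast
    show ?thesis
      by (rule that[of "min t1 (t0 + d / 2)"]) (use d t0 in \<open>auto simp: dist_real_def\<close>)
  qed
  have Gder: "(G has_real_derivative \<phi> s) (at s)" if "b < s" "s < 1" for s
  proof -
    obtain s' where s': "s < s'" "s' < 1" using dense[OF \<open>s < 1\<close>] by auto
    have "(G has_real_derivative \<phi> s) (at s within {b..s'})"
      unfolding G_def using that s' by (intro integral_has_real_derivative c\<phi>) auto
    then show ?thesis using that s' by (simp add: at_within_Icc_at)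
  qed
  \<comment> \<open>the constant of motion, evaluated at \<open>t2\<close> and estimated by \<open>r \<ge> t0\<close>\<close>
  define Cst where "Cst = G (q t2) + t2 - t0"
  have Gq: "G (q r) \<le> Cst" if "t0 < r" "r \<le> t2" for r
  proof -
    have "G (q t2) + t2 = G (q r) + r"
    proof (cases "r < t2")
      case True
      have dGq: "((\<lambda>r. G (q r) + r) has_real_derivative 0) (at x)" if "r \<le> x" "x < t2" for x
      proof -
        have x: "x \<in> {0<..<t1}" "b < q x" "q x < 1"
          using that \<open>t0 < r\<close> t0 t2 q_less by auto
        have "((\<lambda>r. G (q r) + r) has_real_derivative (\<phi> (q x) * (f (q x) - q x) + 1)) (at x)"
          by (intro DERIV_add DERIV_chain2[OF Gder dq] x DERIV_ident)
        moreover have "\<phi> (q x) * (f (q x) - q x) = - 1"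
          using \<phi>_pos[of "q x"] x by (auto simp: \<phi>_def divide_simps)
        ultimately show ?thesis by simp
      qed
      have "continuous_on {r..t2} (\<lambda>r. G (q r) + r)"
      proof -
        have "continuous_on {b<..<1} G"
          by (rule DERIV_continuous_on[where D = \<phi>]) (rule has_field_derivative_at_within[OF Gder], auto)
        moreover have "continuous_on {r..t2} q"
          using that t0 t2 by (intro continuous_on_subset[OF cq]) auto
        moreover have "q ` {r..t2} \<subseteq> {b<..<1}"
          using that t0 t2 q_less by auto
        ultimately have "continuous_on {r..t2} (\<lambda>r. G (q r))"
          by (rule continuous_on_compose2)
        then show ?thesis
          by (rule continuous_on_add) (rule continuous_on_id)
      qed
      then show ?thesis using True dGq by (intro DERIV_isconst_end) auto
    qed (use that in auto)
    then show ?thesis using that by (simp add: Cst_def)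
  qed
  have G_bound: "G s \<le> Cst" if s: "b < s" "s < 1" for s
  proof -
    have "\<forall>\<^sub>F r in at t0 within {0..t1}. s < q r"
      using q_lim s by (intro order_tendstoD) auto
    then obtain d where d: "d > 0" "\<And>r. r \<in> {0..t1} \<Longrightarrow> r \<noteq> t0 \<Longrightarrow> dist r t0 < d \<Longrightarrow> s < q r"
      unfolding eventually_at by blast
    define r where "r = min t2 (t0 + d / 2)"
    have r: "t0 < r" "r \<le> t2" "s < q r"
      using d t0 t2 by (auto simp: r_def dist_real_def)
    have "q r < 1" using q_less r t2 by auto
    have "G s \<le> G (q r)"
      unfolding G_def using r s \<open>q r < 1\<close> \<phi>_pos
      by (intro integral_subset_le integrable_continuous_real c\<phi>) (auto intro: less_imp_le)
    also have "\<dots> \<le> Cst" using r by (intro Gq)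
    finally show ?thesis .
  qed
  \<comment> \<open>exhaust \<open>(b, 1)\<close> from the left; the factor keeps all points above \<open>b\<close>\<close>
  define sq where "sq n = 1 - (1 - b) / (real n + 2)" for n :: nat
  have sq: "b < sq n" "sq n < 1" for n
  proof -
    have "(1 - b) / (real n + 2) < (1 - b) / 1" using b by (intro divide_strict_left_mono) auto
    then show "b < sq n" by (simp add: sq_def)
    show "sq n < 1" using b by (auto simp: sq_def)
  qed
  have sq_lim: "sq \<longlonglongrightarrow> 1"
    unfolding sq_def by real_asymp
  have sq_mono: "sq m \<le> sq n" if "m \<le> n" for m n
    using that b unfolding sq_def by (intro diff_left_mono divide_left_mono) auto
  have \<phi>m: "(\<lambda>u. ennreal (\<phi> u) * indicator {b..sq n} u) \<in> borel_measurable lborel" for n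
  proof -
    have "(\<lambda>x. indicator {b..sq n} x *\<^sub>R \<phi> x) \<in> borel_measurable borel"
      by (intro borel_measurable_continuous_on_indicator c\<phi> sq) simp
    then have "(\<lambda>x. ennreal (indicator {b..sq n} x *\<^sub>R \<phi> x)) \<in> borel_measurable lborel" by simp
    also have "(\<lambda>x. ennreal (indicator {b..sq n} x *\<^sub>R \<phi> x)) = (\<lambda>u. ennreal (\<phi> u) * indicator {b..sq n} u)"
      by (auto simp: indicator_def)
    finally show ?thesis .
  qed
  have "\<infinity> = (\<integral>\<^sup>+ u\<in>{b<..<1}. ennreal (\<phi> u) \<partial>lborel)"
    using e1(2)[of "1 - b"] b by (simp add: \<phi>_def)
  also have "\<dots> \<le> (\<integral>\<^sup>+ u. (SUP n. ennreal (\<phi> u) * indicator {b..sq n} u) \<partial>lborel)"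
  proof (rule nn_integral_mono)
    fix u :: real
    show "ennreal (\<phi> u) * indicator {b<..<1} u \<le> (SUP n. ennreal (\<phi> u) * indicator {b..sq n} u)"
    proof (cases "u \<in> {b<..<1}")
      case True
      then have "\<forall>\<^sub>F n in sequentially. u < sq n"
        using sq_lim by (intro order_tendstoD) auto
      then obtain n where "u < sq n" by (auto simp: eventually_sequentially)
      then show ?thesis using True by (intro SUP_upper2[of n]) auto
    qed auto
  qed
  also have "\<dots> = (SUP n. (\<integral>\<^sup>+ u. ennreal (\<phi> u) * indicator {b..sq n} u \<partial>lborel))"
    using sq_mono \<phi>m by (intro nn_integral_monotone_convergence_SUP)
      (auto simp: incseq_def le_fun_def indicator_def intro: order_trans)
  also have "\<dots> \<le> ennreal Cst"
  proof (rule SUP_least)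
    fix n
    have "(\<phi> has_integral G (sq n)) {b..sq n}"
      unfolding G_def by (intro integrable_integral integrable_continuous_real c\<phi> sq)
    then have "(\<integral>\<^sup>+ u. ennreal (\<phi> u) * indicator {b..sq n} u \<partial>lborel) = ennreal (G (sq n))"
      using \<phi>_pos sq by (intro nn_integral_has_integral_lebesgue') (auto intro!: less_imp_le simp: le_less_trans)
    then show "(\<integral>\<^sup>+ u. ennreal (\<phi> u) * indicator {b..sq n} u \<partial>lborel) \<le> ennreal Cst"
      using G_bound[OF sq] by (simp add: ennreal_leI)
  qed
  finally show False by (simp add: top_unique)
qed

lemma expectation_power_continuous:
  fixes N :: "'a \<Rightarrow> nat" and s :: real
  assumes "prob_space P" and [measurable]: "N \<in> measurable P (count_space UNIV)"
  shows "continuous_on {0..1::real} (\<lambda>s. \<integral>\<omega>. s ^ N \<omega> \<partial>P)"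
    and "0 \<le> s \<Longrightarrow> s \<le> 1 \<Longrightarrow> integrable P (\<lambda>\<omega>. s ^ N \<omega>)"
    and "0 \<le> s \<Longrightarrow> s \<le> 1 \<Longrightarrow> 0 \<le> (\<integral>\<omega>. s ^ N \<omega> \<partial>P) \<and> (\<integral>\<omega>. s ^ N \<omega> \<partial>P) \<le> 1"
proof -
  interpret prob_space P by fact
  have *: "norm (s ^ N \<omega>) \<le> 1" if "s \<in> {0..1}" for s :: real and \<omega>
    using that by (simp add: power_abs power_le_one)
  have int: "0 \<le> s \<Longrightarrow> s \<le> 1 \<Longrightarrow> integrable P (\<lambda>\<omega>. s ^ N \<omega>)" for s :: real
    using * by (intro integrable_const_bound[where B = 1]) auto
  then show "0 \<le> s \<Longrightarrow> s \<le> 1 \<Longrightarrow> integrable P (\<lambda>\<omega>. s ^ N \<omega>)" by simp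
  show "0 \<le> s \<Longrightarrow> s \<le> 1 \<Longrightarrow> 0 \<le> (\<integral>\<omega>. s ^ N \<omega> \<partial>P) \<and> (\<integral>\<omega>. s ^ N \<omega> \<partial>P) \<le> 1"
    by (intro conjI integral_ge_const integral_le_const int AE_I2) (simp_all add: power_le_one)
  show "continuous_on {0..1::real} (\<lambda>s. \<integral>\<omega>. s ^ N \<omega> \<partial>P)"
    unfolding continuous_on_sequentially
  proof (intro allI ballI impI, elim conjE)
    fix x :: "nat \<Rightarrow> real" and a assume x: "a \<in> {0..1}" "\<forall>n. x n \<in> {0..1}" "x \<longlonglongrightarrow> a"
    show "((\<lambda>s. \<integral>\<omega>. s ^ N \<omega> \<partial>P) \<circ> x) \<longlonglongrightarrow> (\<integral>\<omega>. a ^ N \<omega> \<partial>P)"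
      unfolding o_def
    proof (rule integral_dominated_convergence[where w = "\<lambda>_. 1"])
      show "AE \<omega> in P. (\<lambda>i. x i ^ N \<omega>) \<longlonglongrightarrow> a ^ N \<omega>"
        using x by (intro AE_I2 tendsto_intros)
      show "AE \<omega> in P. norm (x i ^ N \<omega>) \<le> 1" for i
        using * x by (intro AE_I2) blast
    qed auto
  qed
qed

text \<open>Dividing by \<open>1 - s\<close>, the claim says that the expectation of \<open>(1 - s\<^sup>N) / (1 - s) = \<Sum>\<^bsub>k<N\<^esub> s\<^sup>k\<close> exceeds \<open>1\<close>. By monotone
  convergence it tends to \<open>E N > 1\<close>, also when \<open>E N = \<infinity>\<close>.\<close>

lemma expectation_power_less:
  fixes N :: "'a \<Rightarrow> nat"
  assumes "prob_space P" and [measurable]: "N \<in> measurable P (count_space UNIV)"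
    and mean: "(\<integral>\<^sup>+ \<omega>. of_nat (N \<omega>) \<partial>P) > 1"
  obtains s0 where "s0 < 1" "\<And>s. s0 < s \<Longrightarrow> s < 1 \<Longrightarrow> (\<integral>\<omega>. s ^ N \<omega> \<partial>P) < (s::real)"
proof -
  interpret prob_space P by fact
  define g where "g s \<omega> = ennreal (\<Sum>k<N \<omega>. s ^ k)" for s :: real and \<omega>
  have [measurable]: "g s \<in> borel_measurable P" for s
    unfolding g_def by measurable
  have g_mono: "g s \<omega> \<le> g s' \<omega>" if "0 \<le> s" "s \<le> s'" for s s' \<omega>
    unfolding g_def using that by (intro ennreal_leI sum_mono power_mono)
  define sq where "sq n = 1 - 1 / (real n + 1)" for n :: nat
  have sq01: "0 \<le> sq n" "sq n < 1" for n by (auto simp: sq_def)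
  have sq_mono: "sq m \<le> sq n" if "m \<le> n" for m n
    using that unfolding sq_def by (intro diff_left_mono divide_left_mono) auto
  have sq_lim: "sq \<longlonglongrightarrow> 1" unfolding sq_def by real_asymp
  have "(\<integral>\<^sup>+ \<omega>. of_nat (N \<omega>) \<partial>P) = (\<integral>\<^sup>+ \<omega>. (SUP n. g (sq n) \<omega>) \<partial>P)"
  proof (rule nn_integral_cong)
    fix \<omega>
    have "(\<lambda>n. g (sq n) \<omega>) \<longlonglongrightarrow> ennreal (\<Sum>k<N \<omega>. 1 ^ k)"
      unfolding g_def by (intro tendsto_intros sq_lim)
    moreover have "(\<lambda>n. g (sq n) \<omega>) \<longlonglongrightarrow> (SUP n. g (sq n) \<omega>)"
      by (intro LIMSEQ_SUP) (auto simp: incseq_def intro!: g_mono sq_mono sq01)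
    ultimately show "of_nat (N \<omega>) = (SUP n. g (sq n) \<omega>)"
      using LIMSEQ_unique by (fastforce simp: ennreal_of_nat_eq_real_of_nat)
  qed
  also have "\<dots> = (SUP n. \<integral>\<^sup>+ \<omega>. g (sq n) \<omega> \<partial>P)"
    by (intro nn_integral_monotone_convergence_SUP) (auto simp: incseq_def le_fun_def intro!: g_mono sq_mono sq01)
  finally obtain n where n: "(\<integral>\<^sup>+ \<omega>. g (sq n) \<omega> \<partial>P) > 1"
    using mean by (auto simp: less_SUP_iff)
  show thesis
  proof (rule that[of "sq n"])
    fix s :: real assume s: "sq n < s" "s < 1"
    have s01: "0 \<le> s" "s \<le> 1" using s sq01[of n] by auto
    note int = expectation_power_continuous(2)[OF assms(1,2) s01]
    have "1 < (\<integral>\<^sup>+ \<omega>. g s \<omega> \<partial>P)"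
      using n s sq01 by (intro less_le_trans[OF n] nn_integral_mono g_mono) auto
    also have "(\<integral>\<^sup>+ \<omega>. g s \<omega> \<partial>P) = (\<integral>\<^sup>+ \<omega>. ennreal ((1 - s ^ N \<omega>) / (1 - s)) \<partial>P)"
      unfolding g_def using s by (intro nn_integral_cong) (simp add: one_diff_power_eq)
    also have "\<dots> = ennreal (\<integral>\<omega>. (1 - s ^ N \<omega>) / (1 - s) \<partial>P)"
      using int s01 s by (intro nn_integral_eq_integral) (auto simp: power_le_one)
    also have "(\<integral>\<omega>. (1 - s ^ N \<omega>) / (1 - s) \<partial>P) = (1 - (\<integral>\<omega>. s ^ N \<omega> \<partial>P)) / (1 - s)"
      using int by (simp add: prob_space)
    finally have "1 < (1 - (\<integral>\<omega>. s ^ N \<omega> \<partial>P)) / (1 - s)"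
      by (simp add: ennreal_1[symmetric] ennreal_less_iff del: ennreal_1)
    then show "(\<integral>\<omega>. s ^ N \<omega> \<partial>P) < s" using s by (simp add: field_simps)
  qed (use sq01 in auto)
qed

section \<open>The product space of marks and resampling\<close>

lemma distr_snd_pair:
  assumes "prob_space A" "prob_space B"
  shows "distr (A \<Otimes>\<^sub>M B) B snd = B"
proof (rule measure_eqI)
  interpret A: prob_space A by fact
  interpret B: prob_space B by fact
  fix X assume "X \<in> sets (distr (A \<Otimes>\<^sub>M B) B snd)"
  then have X [measurable]: "X \<in> sets B" by simp
  have "snd -` X \<inter> space (A \<Otimes>\<^sub>M B) = space A \<times> X"
    using sets.sets_into_space[OF X] by (auto simp: space_pair_measure)
  then show "emeasure (distr (A \<Otimes>\<^sub>M B) B snd) X = emeasure B X"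
    by (simp add: emeasure_distr B.emeasure_pair_measure_Times A.emeasure_space_1)
qed simp

type_synonym mark = "real \<times> real \<times> nat \<times> real \<times> (nat \<Rightarrow> real)"

text \<open>A point of the space is the family of all marks; the component functions make the definitions of trees and positions
  applicable to it. The fields of a mark are, in order, life time, initial value, number of
  children, immigration and weights.\<close>

definition mark_E :: "nat list \<Rightarrow> (nat list \<Rightarrow> mark) \<Rightarrow> real" where "mark_E x w = fst (w x)"
definition mark_R :: "nat list \<Rightarrow> (nat list \<Rightarrow> mark) \<Rightarrow> real" where "mark_R x w = fst (snd (w x))"
definition mark_N :: "nat list \<Rightarrow> (nat list \<Rightarrow> mark) \<Rightarrow> nat" where "mark_N x w = fst (snd (snd (w x)))"
definition mark_C :: "nat list \<Rightarrow> (nat list \<Rightarrow> mark) \<Rightarrow> real" where "mark_C x w = fst (snd (snd (snd (w x))))"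
definition mark_A :: "nat list \<Rightarrow> nat \<Rightarrow> (nat list \<Rightarrow> mark) \<Rightarrow> real" where "mark_A x i w = snd (snd (snd (snd (w x)))) i"

lemmas mark_defs = mark_E_def mark_R_def mark_N_def mark_C_def mark_A_def

abbreviation "tree \<equiv> in_tree mark_N"
abbreviation "birth_time \<equiv> birth mark_E"
abbreviation "pos \<equiv> position mark_A"

lemma labels_Nil [simp]: "[] \<in> labels" and labels_Cons [simp]: "i # x \<in> labels \<longleftrightarrow> 1 \<le> i \<and> x \<in> labels"
  by (auto simp: labels_def)

lemma in_tree_labels: "in_tree N x \<omega> \<Longrightarrow> x \<in> labels"
  by (induction x) auto

lemma countable_labels: "countable labels"
  by (auto simp: labels_def)

lemma path_data_Nil:
  "in_tree N [] = (\<lambda>_. True)" "birth E [] = (\<lambda>_. 0)" "position A [] = (\<lambda>_. 0)"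
  by (auto simp: fun_eq_iff)

lemma path_data_Cons:
  "in_tree N (i # x) = (\<lambda>\<omega>. in_tree N x \<omega> \<and> 1 \<le> i \<and> i \<le> N x \<omega>)"
  "birth E (i # x) = (\<lambda>\<omega>. birth E x \<omega> + E x \<omega>)"
  "position A (i # x) = (\<lambda>\<omega>. position A x \<omega> + ln (A x i \<omega>))"
  by (auto simp: fun_eq_iff)

text \<open>The data of a particle depend only on the marks of its proper ancestors, which are shorter labels. So they do not
  notice a new mark at \<open>x\<close> unless they belong to a strictly later generation.\<close>

lemma path_data_upd [simp]:
  assumes "length x' \<le> length x"
  shows "tree x' (w(x := y)) = tree x' w" and "birth_time x' (w(x := y)) = birth_time x' w"
    and "pos x' (w(x := y)) = pos x' w"
proof -
  have "tree x' (w(x := y)) = tree x' w \<and> birth_time x' (w(x := y)) = birth_time x' w \<and> pos x' (w(x := y)) = pos x' w"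
    using assms
  proof (induction x')
    case (Cons i x')
    then have "x' \<noteq> x" by auto
    with Cons show ?case by (simp add: mark_defs)
  qed simp
  then show "tree x' (w(x := y)) = tree x' w" and "birth_time x' (w(x := y)) = birth_time x' w"
    and "pos x' (w(x := y)) = pos x' w" by auto
qed

lemma exponential_law_prob: "prob_space (density lborel (exponential_density 1))"
  by (rule prob_space_exponential_density) simp

locale mark_space =
  fixes \<nu>\<^sub>0 :: "real measure" and Off :: "(nat \<times> real \<times> (nat \<Rightarrow> real)) measure"
  assumes real_distribution_\<nu>\<^sub>0: "real_distribution \<nu>\<^sub>0"
    and prob_space_Off: "prob_space Off" and sets_Off: "sets Off = sets offspring_space"
begin

abbreviation "expo \<equiv> density lborel (exponential_density 1 :: real \<Rightarrow> real)"

definition Mark :: "mark measure" where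
  "Mark = expo \<Otimes>\<^sub>M \<nu>\<^sub>0 \<Otimes>\<^sub>M Off"

definition \<Omega> :: "(nat list \<Rightarrow> mark) measure" where
  "\<Omega> = PiM labels (\<lambda>_. Mark)"

sublocale R: real_distribution \<nu>\<^sub>0 by (rule real_distribution_\<nu>\<^sub>0)
sublocale O: prob_space Off by (rule prob_space_Off)
sublocale E: prob_space expo by (rule exponential_law_prob)

lemma sets_Mark: "sets Mark = sets (borel \<Otimes>\<^sub>M borel \<Otimes>\<^sub>M offspring_space)"
  unfolding Mark_def by (intro sets_pair_measure_cong) (auto simp: sets_Off)

sublocale RO: pair_prob_space \<nu>\<^sub>0 Off ..
sublocale ERO: pair_prob_space expo "\<nu>\<^sub>0 \<Otimes>\<^sub>M Off" ..

sublocale Mk: prob_space Mark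
  unfolding Mark_def by (rule ERO.prob_space_axioms)

sublocale W: prob_space \<Omega>
  unfolding \<Omega>_def by (intro prob_space_PiM Mk.prob_space_axioms)

lemma measurable_coordinate [measurable]:
  "x \<in> labels \<Longrightarrow> (\<lambda>w. w x) \<in> measurable \<Omega> Mark"
  unfolding \<Omega>_def by (rule measurable_component_singleton)

lemma measurable_coordinate_compose [measurable (raw)]:
  "f \<in> measurable M \<Omega> \<Longrightarrow> x \<in> labels \<Longrightarrow> (\<lambda>z. f z x) \<in> measurable M Mark"
  by (rule measurable_compose[OF _ measurable_coordinate])

lemma measurable_fields [measurable]:
  "fst \<in> borel_measurable Mark"
  "(\<lambda>y. fst (snd y)) \<in> borel_measurable Mark"
  "(\<lambda>y. fst (snd (snd y))) \<in> measurable Mark (count_space UNIV)"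
  "(\<lambda>y. fst (snd (snd (snd y)))) \<in> borel_measurable Mark"
  unfolding measurable_cong_sets[OF sets_Mark refl] offspring_space_def by measurable

lemma measurable_weight [measurable]:
  "1 \<le> i \<Longrightarrow> (\<lambda>y. snd (snd (snd (snd y))) i) \<in> borel_measurable Mark"
  unfolding measurable_cong_sets[OF sets_Mark refl] offspring_space_def by measurable

lemma measurable_marks [measurable]:
  assumes [measurable]: "x \<in> labels"
  shows "mark_E x \<in> borel_measurable \<Omega>" "mark_R x \<in> borel_measurable \<Omega>"
    "mark_N x \<in> measurable \<Omega> (count_space UNIV)" "mark_C x \<in> borel_measurable \<Omega>"
  unfolding mark_defs[abs_def] by measurable

lemma measurable_mark_A [measurable]:
  assumes [measurable]: "x \<in> labels" "1 \<le> i"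
  shows "mark_A x i \<in> borel_measurable \<Omega>"
  unfolding mark_defs[abs_def] by measurable

lemma measurable_path_data [measurable]:
  assumes "x \<in> labels"
  shows "Measurable.pred \<Omega> (tree x)" "birth_time x \<in> borel_measurable \<Omega>" "pos x \<in> borel_measurable \<Omega>"
proof -
  have "Measurable.pred \<Omega> (\<lambda>w. tree x w) \<and> (\<lambda>w. birth_time x w) \<in> borel_measurable \<Omega> \<and> (\<lambda>w. pos x w) \<in> borel_measurable \<Omega>"
    using assms
  proof (induction x)
    case (Cons i x)
    then have [measurable]: "x \<in> labels" "1 \<le> i"
      "Measurable.pred \<Omega> (\<lambda>w. tree x w)" "(\<lambda>w. birth_time x w) \<in> borel_measurable \<Omega>" "(\<lambda>w. pos x w) \<in> borel_measurable \<Omega>"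
      by auto
    show ?case unfolding path_data_Cons by measurable
  qed (simp add: path_data_Nil)
  then show "Measurable.pred \<Omega> (tree x)" "birth_time x \<in> borel_measurable \<Omega>" "pos x \<in> borel_measurable \<Omega>"
    by auto
qed

lemma measurable_upd [measurable]:
  assumes "x \<in> labels"
  shows "(\<lambda>(w, y). w(x := y)) \<in> measurable (\<Omega> \<Otimes>\<^sub>M Mark) \<Omega>"
  using measurable_add_dim[of x labels "\<lambda>_. Mark"] assms
  unfolding \<Omega>_def by (simp add: insert_absorb)

lemma measurable_upd' [measurable (raw)]:
  assumes "x \<in> labels" "f \<in> measurable M \<Omega>" "g \<in> measurable M Mark"
  shows "(\<lambda>z. (f z)(x := g z)) \<in> measurable M \<Omega>"
  using measurable_compose[OF measurable_Pair[OF assms(2,3)] measurable_upd[OF assms(1)]] by simp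

text \<open>Drawing the mark of one label anew leaves the law of the whole family unchanged. The identity replaces conditioning on
  all marks other than that of \<open>x\<close>.\<close>

lemma nn_integral_resample:
  assumes "x \<in> labels" and [measurable]: "f \<in> borel_measurable \<Omega>"
  shows "(\<integral>\<^sup>+ w. \<integral>\<^sup>+ y. f (w(x := y)) \<partial>Mark \<partial>\<Omega>) = (\<integral>\<^sup>+ w. f w \<partial>\<Omega>)"
proof -
  let ?I = "labels - {x}"
  let ?P = "PiM ?I (\<lambda>_. Mark)"
  interpret P: prob_space ?P by (intro prob_space_PiM Mk.prob_space_axioms)
  interpret PM: pair_prob_space Mark ?P ..
  have eq: "distr (Mark \<Otimes>\<^sub>M ?P) \<Omega> (\<lambda>(y, X). X(x := y)) = \<Omega>"
    using distr_pair_PiM_eq_PiM[of ?I "\<lambda>_. Mark" x] \<open>x \<in> labels\<close> Mk.prob_space_axioms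
    unfolding \<Omega>_def by (simp add: insert_absorb)
  have m: "(\<lambda>(y, X). X(x := y)) \<in> measurable (Mark \<Otimes>\<^sub>M ?P) \<Omega>"
  proof -
    have "(\<lambda>(X, y). X(x := y)) \<in> measurable (?P \<Otimes>\<^sub>M Mark) \<Omega>"
      using measurable_add_dim[of x ?I "\<lambda>_. Mark"] \<open>x \<in> labels\<close> unfolding \<Omega>_def by (simp add: insert_absorb)
    from measurable_compose[OF measurable_pair_swap' this] show ?thesis by (simp add: case_prod_beta')
  qed
  have *: "(\<integral>\<^sup>+ w. g w \<partial>\<Omega>) = (\<integral>\<^sup>+ y. \<integral>\<^sup>+ X. g (X(x := y)) \<partial>?P \<partial>Mark)" if [measurable]: "g \<in> borel_measurable \<Omega>" for g
  proof -
    have "(\<integral>\<^sup>+ w. g w \<partial>\<Omega>) = (\<integral>\<^sup>+ z. g ((\<lambda>(y, X). X(x := y)) z) \<partial>(Mark \<Otimes>\<^sub>M ?P))"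
      by (subst eq[symmetric], subst nn_integral_distr[OF m]) auto
    also have "\<dots> = (\<integral>\<^sup>+ y. \<integral>\<^sup>+ X. g (X(x := y)) \<partial>?P \<partial>Mark)"
      using measurable_compose[OF m that] by (subst P.nn_integral_fst[symmetric]) (auto simp: case_prod_beta')
    finally show ?thesis .
  qed
  have [measurable]: "(\<lambda>w. \<integral>\<^sup>+ y. f (w(x := y)) \<partial>Mark) \<in> borel_measurable \<Omega>"
    using \<open>x \<in> labels\<close> by measurable
  have "(\<integral>\<^sup>+ w. \<integral>\<^sup>+ y. f (w(x := y)) \<partial>Mark \<partial>\<Omega>) = (\<integral>\<^sup>+ y'. \<integral>\<^sup>+ X. \<integral>\<^sup>+ y. f ((X(x := y'))(x := y)) \<partial>Mark \<partial>?P \<partial>Mark)"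
    by (subst *) auto
  also have "\<dots> = (\<integral>\<^sup>+ X. \<integral>\<^sup>+ y. f (X(x := y)) \<partial>Mark \<partial>?P)"
    by (simp add: Mk.emeasure_space_1)
  also have "\<dots> = (\<integral>\<^sup>+ y. \<integral>\<^sup>+ X. f (X(x := y)) \<partial>?P \<partial>Mark)"
    using measurable_compose[OF m, of f borel] by (intro PM.Fubini') (auto simp: case_prod_beta')
  also have "\<dots> = (\<integral>\<^sup>+ w. f w \<partial>\<Omega>)" by (subst *) auto
  finally show ?thesis .
qed

text \<open>The general form of resampling: \<open>T\<close> modifies the family of marks with the help of an extra random
  element of law \<open>Q\<close> and preserves its law. It covers redrawing a whole mark (for the generations of
  the tree) as well as redrawing only the initial value \<open>R\<close> (for the characteristic functions).\<close>

definition redraws :: "'q measure \<Rightarrow> ((nat list \<Rightarrow> mark) \<times> 'q \<Rightarrow> (nat list \<Rightarrow> mark)) \<Rightarrow> bool" where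
  "redraws Q T \<longleftrightarrow> prob_space Q \<and> T \<in> measurable (\<Omega> \<Otimes>\<^sub>M Q) \<Omega> \<and> distr (\<Omega> \<Otimes>\<^sub>M Q) \<Omega> T = \<Omega>"

lemma redraws_single_mark:
  assumes "x \<in> labels" and "prob_space Q" and [measurable]: "S \<in> measurable (Mark \<Otimes>\<^sub>M Q) Mark"
    and law: "distr (Mark \<Otimes>\<^sub>M Q) Mark S = Mark"
  shows "redraws Q (\<lambda>(w, q). w(x := S (w x, q)))"
  unfolding redraws_def
proof (intro conjI)
  interpret Q: prob_space Q by fact
  note [measurable] = \<open>x \<in> labels\<close>
  show m [measurable]: "(\<lambda>(w, q). w(x := S (w x, q))) \<in> measurable (\<Omega> \<Otimes>\<^sub>M Q) \<Omega>"
    by measurable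
  show "distr (\<Omega> \<Otimes>\<^sub>M Q) \<Omega> (\<lambda>(w, q). w(x := S (w x, q))) = \<Omega>"
  proof (rule measure_eqI)
    fix A assume "A \<in> sets (distr (\<Omega> \<Otimes>\<^sub>M Q) \<Omega> (\<lambda>(w, q). w(x := S (w x, q))))"
    then have [measurable]: "A \<in> sets \<Omega>" by simp
    let ?f = "indicator A :: _ \<Rightarrow> ennreal"
    have "emeasure (distr (\<Omega> \<Otimes>\<^sub>M Q) \<Omega> (\<lambda>(w, q). w(x := S (w x, q)))) A =
        (\<integral>\<^sup>+ w. ?f w \<partial>(distr (\<Omega> \<Otimes>\<^sub>M Q) \<Omega> (\<lambda>(w, q). w(x := S (w x, q)))))" by simp
    also have "\<dots> = (\<integral>\<^sup>+ z. ?f ((\<lambda>(w, q). w(x := S (w x, q))) z) \<partial>(\<Omega> \<Otimes>\<^sub>M Q))"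
      by (rule nn_integral_distr) measurable
    also have "\<dots> = (\<integral>\<^sup>+ w. \<integral>\<^sup>+ q. ?f (w(x := S (w x, q))) \<partial>Q \<partial>\<Omega>)"
      by (subst Q.nn_integral_fst[symmetric]) (auto simp: case_prod_beta')
    also have "\<dots> = (\<integral>\<^sup>+ w. \<integral>\<^sup>+ y. \<integral>\<^sup>+ q. ?f ((w(x := y))(x := S ((w(x := y)) x, q))) \<partial>Q \<partial>Mark \<partial>\<Omega>)"
      by (rule nn_integral_resample[symmetric]) (use \<open>x \<in> labels\<close> in measurable)
    also have "\<dots> = (\<integral>\<^sup>+ w. \<integral>\<^sup>+ y. \<integral>\<^sup>+ q. ?f (w(x := S (y, q))) \<partial>Q \<partial>Mark \<partial>\<Omega>)"
      by simp
    also have "\<dots> = (\<integral>\<^sup>+ w. \<integral>\<^sup>+ y. ?f (w(x := y)) \<partial>Mark \<partial>\<Omega>)"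
    proof (rule nn_integral_cong)
      fix w assume w: "w \<in> space \<Omega>"
      have "(\<lambda>y. w(x := y)) \<in> measurable Mark \<Omega>"
        using measurable_upd'[OF \<open>x \<in> labels\<close> measurable_const[OF w] measurable_ident] by simp
      then have [measurable]: "(\<lambda>y. ?f (w(x := y))) \<in> borel_measurable Mark"
        by (rule measurable_compose) measurable
      have "(\<integral>\<^sup>+ y. \<integral>\<^sup>+ q. ?f (w(x := S (y, q))) \<partial>Q \<partial>Mark) = (\<integral>\<^sup>+ z. ?f (w(x := S z)) \<partial>(Mark \<Otimes>\<^sub>M Q))"
        using measurable_compose[OF \<open>S \<in> _\<close> \<open>(\<lambda>y. ?f (w(x := y))) \<in> _\<close>]
        by (subst Q.nn_integral_fst[symmetric]) auto
      also have "\<dots> = (\<integral>\<^sup>+ y. ?f (w(x := y)) \<partial>(distr (Mark \<Otimes>\<^sub>M Q) Mark S))"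
        by (rule nn_integral_distr[symmetric]) (simp_all add: law)
      finally show "(\<integral>\<^sup>+ y. \<integral>\<^sup>+ q. ?f (w(x := S (y, q))) \<partial>Q \<partial>Mark) = (\<integral>\<^sup>+ y. ?f (w(x := y)) \<partial>Mark)"
        unfolding law .
    qed
    also have "\<dots> = (\<integral>\<^sup>+ w. ?f w \<partial>\<Omega>)"
      by (rule nn_integral_resample) (use \<open>x \<in> labels\<close> in measurable)
    finally show "emeasure (distr (\<Omega> \<Otimes>\<^sub>M Q) \<Omega> (\<lambda>(w, q). w(x := S (w x, q)))) A = emeasure \<Omega> A" by simp
  qed simp
qed fact

lemma redraws_mark:
  assumes "x \<in> labels"
  shows "redraws Mark (\<lambda>(w, y). w(x := y))"
  using redraws_single_mark[OF assms Mk.prob_space_axioms, of snd] distr_snd_pair[OF Mk.prob_space_axioms Mk.prob_space_axioms]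
  by simp

lemma nn_integral_Mark:
  assumes "g \<in> borel_measurable Mark"
  shows "(\<integral>\<^sup>+ y. g y \<partial>Mark) = (\<integral>\<^sup>+ e. \<integral>\<^sup>+ r. \<integral>\<^sup>+ u. g (e, r, u) \<partial>Off \<partial>\<nu>\<^sub>0 \<partial>expo)"
proof -
  note [measurable] = assms[unfolded Mark_def]
  have "(\<integral>\<^sup>+ y. g y \<partial>Mark) = (\<integral>\<^sup>+ e. \<integral>\<^sup>+ y. g (e, y) \<partial>(\<nu>\<^sub>0 \<Otimes>\<^sub>M Off) \<partial>expo)"
    unfolding Mark_def by (rule RO.P.nn_integral_fst[symmetric]) measurable
  also have "\<dots> = (\<integral>\<^sup>+ e. \<integral>\<^sup>+ r. \<integral>\<^sup>+ u. g (e, r, u) \<partial>Off \<partial>\<nu>\<^sub>0 \<partial>expo)"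
    by (intro nn_integral_cong O.nn_integral_fst[symmetric]) measurable
  finally show ?thesis .
qed

lemma redraws_R:
  assumes "x \<in> labels"
  shows "redraws \<nu>\<^sub>0 (\<lambda>(w, r). w(x := (fst (w x), r, snd (snd (w x)))))"
proof -
  let ?S = "\<lambda>(y, r). (fst y, r, snd (snd y)) :: mark"
  have S: "?S \<in> measurable (Mark \<Otimes>\<^sub>M \<nu>\<^sub>0) Mark"
    unfolding Mark_def by measurable
  have "distr (Mark \<Otimes>\<^sub>M \<nu>\<^sub>0) Mark ?S = Mark"
  proof (rule measure_eqI)
    fix X assume "X \<in> sets (distr (Mark \<Otimes>\<^sub>M \<nu>\<^sub>0) Mark ?S)"
    then have X [measurable]: "X \<in> sets Mark" by simp
    let ?f = "indicator X :: _ \<Rightarrow> ennreal"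
    have f [measurable]: "?f \<in> borel_measurable Mark" by measurable
    note [measurable] = f[unfolded Mark_def]
    have Sf: "(\<lambda>(y, r). ?f (fst y, r, snd (snd y))) \<in> borel_measurable (Mark \<Otimes>\<^sub>M \<nu>\<^sub>0)"
      using measurable_compose[OF S f] by (simp add: case_prod_beta')
    have "emeasure (distr (Mark \<Otimes>\<^sub>M \<nu>\<^sub>0) Mark ?S) X = (\<integral>\<^sup>+ y. ?f y \<partial>(distr (Mark \<Otimes>\<^sub>M \<nu>\<^sub>0) Mark ?S))"
      by simp
    also have "\<dots> = (\<integral>\<^sup>+ z. ?f (?S z) \<partial>(Mark \<Otimes>\<^sub>M \<nu>\<^sub>0))"
      by (rule nn_integral_distr[OF S]) (use f in simp)
    also have "\<dots> = (\<integral>\<^sup>+ y. \<integral>\<^sup>+ r. ?f (fst y, r, snd (snd y)) \<partial>\<nu>\<^sub>0 \<partial>Mark)"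
      using R.nn_integral_fst[OF Sf] by (simp add: case_prod_beta')
    also have "\<dots> = (\<integral>\<^sup>+ e. \<integral>\<^sup>+ r'. \<integral>\<^sup>+ u. \<integral>\<^sup>+ r. ?f (e, r, u) \<partial>\<nu>\<^sub>0 \<partial>Off \<partial>\<nu>\<^sub>0 \<partial>expo)"
      using R.borel_measurable_nn_integral_fst[OF Sf] by (subst nn_integral_Mark) simp_all
    also have "\<dots> = (\<integral>\<^sup>+ e. \<integral>\<^sup>+ u. \<integral>\<^sup>+ r. ?f (e, r, u) \<partial>\<nu>\<^sub>0 \<partial>Off \<partial>expo)"
      by (simp only: nn_integral_const R.emeasure_space_1 mult_1_right)
    also have "\<dots> = (\<integral>\<^sup>+ e. \<integral>\<^sup>+ r. \<integral>\<^sup>+ u. ?f (e, r, u) \<partial>Off \<partial>\<nu>\<^sub>0 \<partial>expo)"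
    proof (rule nn_integral_cong)
      fix e :: real
      have "(\<lambda>(r, u). ?f (e, r, u)) \<in> borel_measurable (\<nu>\<^sub>0 \<Otimes>\<^sub>M Off)"
        by measurable
      then show "(\<integral>\<^sup>+ u. \<integral>\<^sup>+ r. ?f (e, r, u) \<partial>\<nu>\<^sub>0 \<partial>Off) = (\<integral>\<^sup>+ r. \<integral>\<^sup>+ u. ?f (e, r, u) \<partial>Off \<partial>\<nu>\<^sub>0)"
        by (rule RO.Fubini')
    qed
    also have "\<dots> = emeasure Mark X"
      using nn_integral_Mark[OF f] by simp
    finally show "emeasure (distr (Mark \<Otimes>\<^sub>M \<nu>\<^sub>0) Mark ?S) X = emeasure Mark X" .
  qed simp
  from redraws_single_mark[OF assms R.prob_space_axioms S this] show ?thesis by simp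
qed

end

section \<open>Boxes of labels and products over them\<close>

text \<open>The labels of generation \<open>n\<close> with entries at most \<open>k\<close>. They exhaust the generation as \<open>k\<close> grows, and their
  finiteness allows sums and products without convergence questions.\<close>

definition gen :: "nat \<Rightarrow> nat \<Rightarrow> nat list set" where
  "gen n k = {x \<in> labels. length x = n \<and> set x \<subseteq> {..k}}"

definition label_box :: "nat \<Rightarrow> nat list set" where
  "label_box k = (\<Union>n\<le>k. gen n k)"

lemma gen_0: "gen 0 k = {[]}"
  by (auto simp: gen_def)

lemma gen_Suc: "gen (Suc n) k = (\<lambda>(x, i). i # x) ` (gen n k \<times> {1..k})"
proof -
  have "y \<in> gen (Suc n) k \<longleftrightarrow> (\<exists>x i. y = i # x \<and> x \<in> gen n k \<and> i \<in> {1..k})" for y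
    by (cases y) (auto simp: gen_def)
  then show ?thesis by (auto simp: image_iff)
qed

lemma finite_gen [simp]: "finite (gen n k)"
  by (rule finite_subset[OF _ finite_lists_length_eq[of "{..k}" n]]) (auto simp: gen_def)

lemma finite_box [simp]: "finite (label_box k)"
  by (auto simp: label_box_def)

lemma gen_labels: "x \<in> gen n k \<Longrightarrow> x \<in> labels" and gen_length: "x \<in> gen n k \<Longrightarrow> length x = n"
  by (auto simp: gen_def)

lemma box_labels: "x \<in> label_box k \<Longrightarrow> x \<in> labels"
  by (auto simp: label_box_def gen_def)

lemma mem_label_box: "x \<in> label_box k \<longleftrightarrow> x \<in> labels \<and> length x \<le> k \<and> set x \<subseteq> {..k}"
  by (auto simp: label_box_def gen_def)

lemma box_mono:
  assumes "k \<le> k'"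
  shows "label_box k \<subseteq> label_box k'"
proof
  fix x assume x: "x \<in> label_box k"
  have "set x \<subseteq> {..k}" using x by (simp add: mem_label_box)
  moreover have "{..k} \<subseteq> {..k'}" using assms by simp
  ultimately have "set x \<subseteq> {..k'}" by (rule subset_trans)
  with x assms show "x \<in> label_box k'" unfolding mem_label_box by simp
qed

lemma in_some_gen: "x \<in> labels \<Longrightarrow> \<exists>k. x \<in> gen (length x) k"
  by (rule exI[of _ "sum_list x"]) (auto simp: gen_def member_le_sum_list)

lemma in_some_box: "x \<in> labels \<Longrightarrow> \<exists>k. x \<in> label_box k"
proof -
  assume "x \<in> labels"
  then obtain k where "x \<in> gen (length x) k" using in_some_gen by blast
  then have "set x \<subseteq> {..k}" by (simp add: gen_def)
  moreover have "{..k} \<subseteq> {..max (length x) k}" by simp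
  ultimately have "set x \<subseteq> {..max (length x) k}" by (rule subset_trans)
  then have "x \<in> label_box (max (length x) k)" unfolding mem_label_box using \<open>x \<in> labels\<close> by simp
  then show ?thesis by blast
qed

lemma finite_subset_box:
  assumes "finite F" "F \<subseteq> labels"
  shows "\<exists>k. F \<subseteq> label_box k"
  using assms
proof (induction F)
  case (insert x F)
  then obtain k where "F \<subseteq> label_box k" by auto
  moreover obtain k' where "x \<in> label_box k'" using in_some_box insert.prems by auto
  ultimately have "insert x F \<subseteq> label_box (max k k')" using box_mono[of k "max k k'"] box_mono[of k' "max k k'"] by auto
  then show ?case by blast
qed simp

lemma sum_box: "sum f (label_box k) = (\<Sum>n\<le>k. sum f (gen n k))"
  unfolding label_box_def by (rule sum.UNION_disjoint) (auto dest: gen_length)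

lemma finite_tree_generation: "finite {x. tree x w \<and> length x = n}"
proof (induction n)
  case (Suc n)
  have "{x. tree x w \<and> length x = Suc n} \<subseteq> (\<Union>x\<in>{x. tree x w \<and> length x = n}. (\<lambda>i. i # x) ` {1..mark_N x w})"
  proof
    fix y assume "y \<in> {x. tree x w \<and> length x = Suc n}"
    then show "y \<in> (\<Union>x\<in>{x. tree x w \<and> length x = n}. (\<lambda>i. i # x) ` {1..mark_N x w})"
      by (cases y) auto
  qed
  then show ?case by (rule finite_subset) (use Suc in auto)
qed simp

context mark_space
begin

lemma redraws_integral:
  fixes f :: "_ \<Rightarrow> 'c::{banach, second_countable_topology}"
  assumes "redraws Q T" and f: "integrable \<Omega> f"
  shows "(\<integral>w. f w \<partial>\<Omega>) = (\<integral>w. (\<integral>q. f (T (w, q)) \<partial>Q) \<partial>\<Omega>)"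
proof -
  have Q: "prob_space Q" and T: "T \<in> measurable (\<Omega> \<Otimes>\<^sub>M Q) \<Omega>" and law: "distr (\<Omega> \<Otimes>\<^sub>M Q) \<Omega> T = \<Omega>"
    using assms(1) by (auto simp: redraws_def)
  interpret Q: prob_space Q by fact
  interpret pair_prob_space \<Omega> Q ..
  have fm: "f \<in> borel_measurable \<Omega>" using f by auto
  have "integrable (\<Omega> \<Otimes>\<^sub>M Q) (\<lambda>z. f (T z))"
    using f integrable_distr_eq[OF T, of f] fm by (simp add: law)
  have "(\<integral>w. f w \<partial>\<Omega>) = (\<integral>z. f (T z) \<partial>(\<Omega> \<Otimes>\<^sub>M Q))"
    by (subst law[symmetric], rule integral_distr[OF T]) (simp add: fm)
  also have "\<dots> = (\<integral>w. (\<integral>q. f (T (w, q)) \<partial>Q) \<partial>\<Omega>)"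
    using \<open>integrable (\<Omega> \<Otimes>\<^sub>M Q) (\<lambda>z. f (T z))\<close> by (rule integral_fst'[symmetric])
  finally show ?thesis .
qed

lemma norm_prod_le_1:
  fixes g :: "'i \<Rightarrow> 'c::real_normed_field"
  assumes "\<And>x. x \<in> F \<Longrightarrow> norm (g x) \<le> 1"
  shows "norm (\<Prod>x\<in>F. g x) \<le> 1"
  using assms by (simp add: prod_norm[symmetric] prod_le_1)

text \<open>Redraw the marks of the labels in \<open>F\<close> one after the other. Each step integrates one factor; it leaves the other factors
  alone because they are invariant under the redrawing at \<open>x\<close>. In effect, the factors are
  conditionally independent.\<close>

lemma integral_prod_redraw:
  fixes g g' :: "nat list \<Rightarrow> (nat list \<Rightarrow> mark) \<Rightarrow> 'c::{real_normed_field, banach, second_countable_topology}"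
  assumes "finite F" and T: "\<And>x. x \<in> F \<Longrightarrow> redraws Q (T x)"
    and [measurable]: "\<And>x. x \<in> F \<Longrightarrow> g x \<in> borel_measurable \<Omega>" "\<And>x. x \<in> F \<Longrightarrow> g' x \<in> borel_measurable \<Omega>"
    and n: "\<And>x w. x \<in> F \<Longrightarrow> w \<in> space \<Omega> \<Longrightarrow> norm (g x w) \<le> 1" "\<And>x w. x \<in> F \<Longrightarrow> w \<in> space \<Omega> \<Longrightarrow> norm (g' x w) \<le> 1"
    and g': "\<And>x w. x \<in> F \<Longrightarrow> w \<in> space \<Omega> \<Longrightarrow> (\<integral>q. g x (T x (w, q)) \<partial>Q) = g' x w"
    and inv: "\<And>x x' w q. x \<in> F \<Longrightarrow> x' \<in> F \<Longrightarrow> x \<noteq> x' \<Longrightarrow> g x' (T x (w, q)) = g x' w"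
      "\<And>x x' w q. x \<in> F \<Longrightarrow> x' \<in> F \<Longrightarrow> x \<noteq> x' \<Longrightarrow> g' x' (T x (w, q)) = g' x' w"
  shows "(\<integral>w. (\<Prod>x\<in>F. g x w) \<partial>\<Omega>) = (\<integral>w. (\<Prod>x\<in>F. g' x w) \<partial>\<Omega>)"
proof -
  have "(\<integral>w. (\<Prod>x\<in>F. g x w) \<partial>\<Omega>) = (\<integral>w. (\<Prod>x\<in>G. g' x w) * (\<Prod>x\<in>F - G. g x w) \<partial>\<Omega>)" if "G \<subseteq> F" for G
    using finite_subset[OF that \<open>finite F\<close>] that
  proof (induction G)
    case (insert x0 G)
    then have x0: "x0 \<in> F" "x0 \<notin> G" "G \<subseteq> F" by auto
    define H where "H w = (\<Prod>x\<in>G. g' x w) * (\<Prod>x\<in>F - insert x0 G. g x w)" for w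
    have split: "(\<Prod>x\<in>F - G. g x w) = g x0 w * (\<Prod>x\<in>F - insert x0 G. g x w)" for w
    proof -
      have "F - G = insert x0 (F - insert x0 G)" using x0 by auto
      then show ?thesis using \<open>finite F\<close> by (metis Diff_iff finite_Diff insertI1 prod.insert)
    qed
    have [measurable]: "H \<in> borel_measurable \<Omega>"
      unfolding H_def using x0 by (intro borel_measurable_times borel_measurable_prod) auto
    have Hn: "norm (H w) \<le> 1" if "w \<in> space \<Omega>" for w
      unfolding H_def norm_mult using x0 n that by (intro mult_le_one norm_prod_le_1) auto
    have HT: "H (T x0 (w, q)) = H w" for w q
    proof -
      have "g' x (T x0 (w, q)) = g' x w" if "x \<in> G" for x
        using inv(2)[of x0 x] x0 that by auto
      moreover have "g x (T x0 (w, q)) = g x w" if "x \<in> F - insert x0 G" for x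
        using inv(1)[of x0 x] x0 that by auto
      ultimately show ?thesis unfolding H_def by simp
    qed
    have [measurable]: "g x0 \<in> borel_measurable \<Omega>" using x0 by simp
    have "integrable \<Omega> (\<lambda>w. g x0 w * H w)"
    proof (rule W.integrable_const_bound[where B = 1])
      show "AE w in \<Omega>. norm (g x0 w * H w) \<le> 1"
        unfolding norm_mult using n x0 Hn by (intro AE_I2 mult_le_one) auto
    qed measurable
    then have "(\<integral>w. g x0 w * H w \<partial>\<Omega>) = (\<integral>w. (\<integral>q. g x0 (T x0 (w, q)) * H (T x0 (w, q)) \<partial>Q) \<partial>\<Omega>)"
      by (rule redraws_integral[OF T[OF x0(1)]])
    also have "\<dots> = (\<integral>w. g' x0 w * H w \<partial>\<Omega>)"
      by (intro Bochner_Integration.integral_cong refl) (simp add: HT g'[OF x0(1)])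
    finally have "(\<integral>w. g x0 w * H w \<partial>\<Omega>) = (\<integral>w. g' x0 w * H w \<partial>\<Omega>)" .
    moreover have "(\<Prod>x\<in>G. g' x w) * (\<Prod>x\<in>F - G. g x w) = g x0 w * H w" for w
      unfolding split H_def by (simp add: mult_ac)
    moreover have "(\<Prod>x\<in>insert x0 G. g' x w) * (\<Prod>x\<in>F - insert x0 G. g x w) = g' x0 w * H w" for w
      using insert.hyps x0 unfolding H_def by (simp add: mult_ac)
    ultimately show ?case using insert.IH x0 by simp
  qed simp
  from this[of F] show ?thesis by simp
qed

lemma integral_Mark:
  fixes g :: "mark \<Rightarrow> 'c::{banach, second_countable_topology}"
  assumes "integrable Mark g"
  shows "(\<integral>y. g y \<partial>Mark) = (\<integral>e. (\<integral>y. g (e, y) \<partial>(\<nu>\<^sub>0 \<Otimes>\<^sub>M Off)) \<partial>expo)"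
  using assms unfolding Mark_def by (rule ERO.integral_fst'[symmetric])

lemma integral_RO_snd:
  fixes g :: "_ \<Rightarrow> 'c::{banach, second_countable_topology}"
  assumes [measurable]: "g \<in> borel_measurable Off"
  shows "(\<integral>y. g (snd y) \<partial>(\<nu>\<^sub>0 \<Otimes>\<^sub>M Off)) = (\<integral>u. g u \<partial>Off)"
proof -
  have "(\<integral>u. g u \<partial>Off) = (\<integral>u. g u \<partial>(distr (\<nu>\<^sub>0 \<Otimes>\<^sub>M Off) Off snd))"
    by (simp only: distr_snd_pair[OF R.prob_space_axioms prob_space_Off])
  also have "\<dots> = (\<integral>y. g (snd y) \<partial>(\<nu>\<^sub>0 \<Otimes>\<^sub>M Off))"
    by (rule integral_distr) auto
  finally show ?thesis ..
qed

lemma nn_integral_Mark_mult: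
  assumes [measurable]: "f \<in> borel_measurable borel" "g \<in> borel_measurable Off"
  shows "(\<integral>\<^sup>+ y. f (fst y) * g (snd (snd y)) \<partial>Mark) = (\<integral>\<^sup>+ e. f e \<partial>expo) * (\<integral>\<^sup>+ u. g u \<partial>Off)"
proof -
  have "(\<lambda>y. f (fst y) * g (snd (snd y))) \<in> borel_measurable Mark"
    unfolding Mark_def by measurable
  then have "(\<integral>\<^sup>+ y. f (fst y) * g (snd (snd y)) \<partial>Mark) = (\<integral>\<^sup>+ e. \<integral>\<^sup>+ r. \<integral>\<^sup>+ u. f e * g u \<partial>Off \<partial>\<nu>\<^sub>0 \<partial>expo)"
    by (simp add: nn_integral_Mark)
  also have "\<dots> = (\<integral>\<^sup>+ e. \<integral>\<^sup>+ u. f e * g u \<partial>Off \<partial>expo)"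
    by (simp only: nn_integral_const R.emeasure_space_1 mult_1_right)
  also have "\<dots> = (\<integral>\<^sup>+ e. f e \<partial>expo) * (\<integral>\<^sup>+ u. g u \<partial>Off)"
    by (simp add: nn_integral_cmult nn_integral_multc)
  finally show ?thesis .
qed

lemma fst_measurable_Off [measurable]: "fst \<in> measurable Off (count_space UNIV)"
  unfolding measurable_cong_sets[OF sets_Off refl] offspring_space_def by measurable

lemma C_measurable_Off [measurable]: "(\<lambda>u. fst (snd u)) \<in> borel_measurable Off"
  unfolding measurable_cong_sets[OF sets_Off refl] offspring_space_def by measurable

lemma A_measurable_Off [measurable]: "1 \<le> i \<Longrightarrow> (\<lambda>u. snd (snd u) i) \<in> borel_measurable Off"
  unfolding measurable_cong_sets[OF sets_Off refl] offspring_space_def by measurable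

end

section \<open>Non-explosion\<close>

text \<open>
  The probability that no particle of generation \<open>n\<close> is born by time \<open>t\<close> is computed backwards from generation
  \<open>n\<close>: if \<open>v(b)\<close> is the value attached to a particle born at time \<open>b\<close>, then its parent, born at time \<open>b\<close>,
  receives the value \<open>E [f(v(b + E))]\<close> with the generating function \<open>f\<close> of the number of children. The
  limit of the iterates is a fixed point of this map, and Osgood uniqueness identifies it as the constant \<open>1\<close>.
\<close>

lemma nn_integral_expo:
  assumes [measurable]: "f \<in> borel_measurable borel"
  shows "(\<integral>\<^sup>+ e. f e \<partial>density lborel (exponential_density 1)) = (\<integral>\<^sup>+ e. ennreal (exp (- e) * indicator {0..} e) * f e \<partial>lborel)"
  by (subst nn_integral_density) (auto simp: exponential_density_def indicator_def intro!: nn_integral_cong)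

lemma integral_expo:
  fixes f :: "real \<Rightarrow> real"
  assumes [measurable]: "f \<in> borel_measurable borel"
  shows "(\<integral>e. f e \<partial>density lborel (exponential_density 1)) = (LBINT e:{0..}. exp (- e) * f e)"
  unfolding set_lebesgue_integral_def
  by (subst integral_density) (auto simp: exponential_density_def indicator_def intro!: Bochner_Integration.integral_cong)

context mark_space
begin

definition pgf :: "real \<Rightarrow> real" where "pgf s = (\<integral>u. s ^ fst u \<partial>Off)"

definition next_gen :: "(real \<Rightarrow> real) \<Rightarrow> real \<Rightarrow> real" where
  "next_gen v b = (\<integral>e. pgf (v (b + e)) \<partial>expo)"

lemma pgf_continuous: "continuous_on {0..1} pgf"
  and pgf_01: "0 \<le> s \<Longrightarrow> s \<le> 1 \<Longrightarrow> 0 \<le> pgf s \<and> pgf s \<le> 1"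
  unfolding pgf_def using expectation_power_continuous[OF prob_space_Off fst_measurable_Off] by auto

lemma pgf_measurable_compose:
  assumes [measurable]: "v \<in> borel_measurable M" and v: "\<And>z. 0 \<le> v z \<and> v z \<le> 1"
  shows "(\<lambda>z. pgf (v z)) \<in> borel_measurable M"
proof -
  have "(\<lambda>s. indicator {0..1} s *\<^sub>R pgf s) \<in> borel_measurable borel"
    by (intro borel_measurable_continuous_on_indicator pgf_continuous) simp
  from measurable_compose[OF assms(1) this] show ?thesis using v by (simp add: indicator_def)
qed

lemma pgf_mono: "0 \<le> s \<Longrightarrow> s \<le> s' \<Longrightarrow> s' \<le> 1 \<Longrightarrow> pgf s \<le> pgf s'"
  unfolding pgf_def
  using expectation_power_continuous(2)[OF prob_space_Off fst_measurable_Off]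
  by (intro integral_mono power_mono) auto

lemma next_gen_props:
  assumes [measurable]: "v \<in> borel_measurable borel" and v: "\<And>b. 0 \<le> v b \<and> v b \<le> 1"
  shows "next_gen v \<in> borel_measurable borel" "0 \<le> next_gen v b \<and> next_gen v b \<le> 1"
    "integrable expo (\<lambda>e. pgf (v (b + e)))"
proof -
  have [measurable]: "(\<lambda>z. pgf (v (f z))) \<in> borel_measurable M" if [measurable]: "f \<in> borel_measurable M" for f :: "'x \<Rightarrow> real" and M
    by (rule pgf_measurable_compose) (use v in auto)
  show "next_gen v \<in> borel_measurable borel"
    unfolding next_gen_def by measurable
  show int: "integrable expo (\<lambda>e. pgf (v (b + e)))"
    by (rule E.integrable_const_bound[where B = 1]) (use v pgf_01 in auto)
  show "0 \<le> next_gen v b \<and> next_gen v b \<le> 1"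
    unfolding next_gen_def
    by (intro conjI E.integral_ge_const E.integral_le_const int AE_I2) (use v pgf_01 in auto)
qed

definition absent :: "(real \<Rightarrow> real) \<Rightarrow> nat \<Rightarrow> nat \<Rightarrow> real" where
  "absent v n k = (\<integral>w. (\<Prod>x\<in>gen n k. if tree x w then v (birth_time x w) else 1) \<partial>\<Omega>)"

text \<open>Collect the factors by parents and integrate the mark of each parent. Restricting a parent to its first \<open>k\<close>
  children only increases a product of numbers in \<open>[0, 1]\<close>, which is why the result is an inequality.\<close>

lemma absent_Suc:
  assumes [measurable]: "v \<in> borel_measurable borel" and v: "\<And>b. 0 \<le> v b \<and> v b \<le> 1"
  shows "absent v (Suc n) k \<ge> absent (next_gen v) n k"
proof -
  define g where "g x w = (if tree x w then v (birth_time x w + mark_E x w) ^ min (mark_N x w) k else 1)" for x w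
  define g' where "g' x w = (if tree x w then (\<integral>y. v (birth_time x w + fst y) ^ min (fst (snd (snd y))) k \<partial>Mark) else 1)" for x w
  have "(\<Prod>x\<in>gen (Suc n) k. if tree x w then v (birth_time x w) else 1) = (\<Prod>x\<in>gen n k. g x w)" for w
  proof -
    have "(\<Prod>x\<in>gen (Suc n) k. if tree x w then v (birth_time x w) else 1) =
       (\<Prod>(x, i)\<in>gen n k \<times> {1..k}. if tree (i # x) w then v (birth_time (i # x) w) else 1)"
      unfolding gen_Suc by (subst prod.reindex) (auto simp: inj_on_def case_prod_beta')
    also have "\<dots> = (\<Prod>x\<in>gen n k. \<Prod>i\<in>{1..k}. if tree (i # x) w then v (birth_time (i # x) w) else 1)"
      by (rule prod.cartesian_product[symmetric])
    also have "\<dots> = (\<Prod>x\<in>gen n k. g x w)"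
    proof (rule prod.cong[OF refl])
      fix x
      show "(\<Prod>i\<in>{1..k}. if tree (i # x) w then v (birth_time (i # x) w) else 1) = g x w"
      proof (cases "tree x w")
        case True
        have "(\<Prod>i\<in>{1..k}. if tree (i # x) w then v (birth_time (i # x) w) else 1) =
          (\<Prod>i\<in>{1..k}. if i \<in> {1..mark_N x w} then v (birth_time x w + mark_E x w) else 1)"
          using True by (intro prod.cong) auto
        also have "\<dots> = (\<Prod>i\<in>{1..k} \<inter> {1..mark_N x w}. v (birth_time x w + mark_E x w))"
          by (rule prod.inter_restrict[symmetric]) simp
        also have "{1..k} \<inter> {1..mark_N x w} = {1..min (mark_N x w) k}" by auto
        finally show ?thesis using True by (simp add: g_def)
      qed (simp add: g_def)
    qed
    finally show ?thesis .
  qed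
  then have "absent v (Suc n) k = (\<integral>w. (\<Prod>x\<in>gen n k. g x w) \<partial>\<Omega>)" by (simp add: absent_def)
  also have "\<dots> = (\<integral>w. (\<Prod>x\<in>gen n k. g' x w) \<partial>\<Omega>)"
  proof (rule integral_prod_redraw[where Q = Mark and T = "\<lambda>x (w, y). w(x := y)"])
    fix x assume x: "x \<in> gen n k"
    then have [measurable]: "x \<in> labels" by (rule gen_labels)
    show "redraws Mark (\<lambda>(w, y). w(x := y))" by (rule redraws_mark) fact
    show "g x \<in> borel_measurable \<Omega>" "g' x \<in> borel_measurable \<Omega>"
      unfolding g_def[abs_def] g'_def[abs_def] by measurable
    have v1: "v b ^ j \<le> 1" "\<bar>v b ^ j\<bar> \<le> 1" "0 \<le> v b ^ j" for b j using v[of b] by (auto simp: power_le_one)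
    show "norm (g x w) \<le> 1" for w using v1 by (auto simp: g_def)
    have int: "integrable Mark (\<lambda>y. v (b + fst y) ^ min (fst (snd (snd y))) k)" for b
      by (rule Mk.integrable_const_bound[where B = 1]) (use v1 in auto)
    show "norm (g' x w) \<le> 1" for w
    proof -
      have "0 \<le> (\<integral>y. v (b + fst y) ^ min (fst (snd (snd y))) k \<partial>Mark)" "(\<integral>y. v (b + fst y) ^ min (fst (snd (snd y))) k \<partial>Mark) \<le> 1" for b
        by (intro Mk.integral_ge_const Mk.integral_le_const int AE_I2 v1)+
      then show ?thesis by (auto simp: g'_def)
    qed
    show "(\<integral>q. g x ((\<lambda>(w, y). w(x := y)) (w, q)) \<partial>Mark) = g' x w" for w
      using Mk.prob_space by (simp add: g_def g'_def mark_defs)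
    fix x' w q assume "x' \<in> gen n k" "x \<noteq> x'"
    then have "length x' \<le> length x" using gen_length[OF x] gen_length[of x' n k] by simp
    then show "g x' ((\<lambda>(w, y). w(x := y)) (w, q)) = g x' w" "g' x' ((\<lambda>(w, y). w(x := y)) (w, q)) = g' x' w"
      using \<open>x \<noteq> x'\<close> by (simp_all add: g_def g'_def mark_defs)
  qed simp
  also have "\<dots> \<ge> absent (next_gen v) n k"
    unfolding absent_def
  proof (rule integral_mono)
    note ng = next_gen_props[OF assms(1) v]
    have [measurable]: "next_gen v \<in> borel_measurable borel" by (rule ng)
    have ge: "next_gen v b \<le> (\<integral>y. v (b + fst y) ^ min (fst (snd (snd y))) k \<partial>Mark)"
      and le1: "(\<integral>y. v (b + fst y) ^ min (fst (snd (snd y))) k \<partial>Mark) \<le> 1" for b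
    proof -
      have v1: "v b ^ j \<le> 1" "\<bar>v b ^ j\<bar> \<le> 1" "0 \<le> v b ^ j" for b j using v[of b] by (auto simp: power_le_one)
      have int: "integrable Mark (\<lambda>y. v (b + fst y) ^ min (fst (snd (snd y))) k)" 
        "integrable Mark (\<lambda>y. v (b + fst y) ^ (fst (snd (snd y))))" for b
        by (rule Mk.integrable_const_bound[where B = 1]; use v1 in auto)+
      have "next_gen v b = (\<integral>y. v (b + fst y) ^ fst (snd (snd y)) \<partial>Mark)"
        unfolding next_gen_def pgf_def integral_Mark[OF int(2)] fst_conv snd_conv
        by (subst integral_RO_snd) auto
      also have "\<dots> \<le> (\<integral>y. v (b + fst y) ^ min (fst (snd (snd y))) k \<partial>Mark)"
        using v by (intro integral_mono int power_decreasing) auto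
      finally show "next_gen v b \<le> (\<integral>y. v (b + fst y) ^ min (fst (snd (snd y))) k \<partial>Mark)" .
      show "(\<integral>y. v (b + fst y) ^ min (fst (snd (snd y))) k \<partial>Mark) \<le> 1"
        by (intro Mk.integral_le_const int AE_I2 v1)
    qed
    have g'01: "0 \<le> g' x w" "g' x w \<le> 1" for x w
      using order_trans[OF conjunct1[OF ng(2)] ge] le1 by (auto simp: g'_def)
    show "(\<Prod>x\<in>gen n k. if tree x w then next_gen v (birth_time x w) else 1) \<le> (\<Prod>x\<in>gen n k. g' x w)" for w
      using ge ng(2) by (intro prod_mono) (auto simp: g'_def)
    have [measurable]: "g' x \<in> borel_measurable \<Omega>" if "x \<in> gen n k" for x
      using gen_labels[OF that] unfolding g'_def[abs_def] by measurable
    show "integrable \<Omega> (\<lambda>w. \<Prod>x\<in>gen n k. g' x w)"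
    proof (rule W.integrable_const_bound[where B = 1])
      show "AE w in \<Omega>. norm (\<Prod>x\<in>gen n k. g' x w) \<le> 1"
        by (intro AE_I2 norm_prod_le_1) (use g'01 in auto)
    qed (auto intro!: borel_measurable_prod)
    show "integrable \<Omega> (\<lambda>w. \<Prod>x\<in>gen n k. if tree x w then next_gen v (birth_time x w) else 1)"
    proof (rule W.integrable_const_bound[where B = 1])
      show "AE w in \<Omega>. norm (\<Prod>x\<in>gen n k. if tree x w then next_gen v (birth_time x w) else 1) \<le> 1"
        by (intro AE_I2 norm_prod_le_1) (use ng in auto)
      have "(\<lambda>w. if tree x w then next_gen v (birth_time x w) else 1) \<in> borel_measurable \<Omega>" if "x \<in> gen n k" for x
        using gen_labels[OF that] by measurable
      then show "(\<lambda>w. \<Prod>x\<in>gen n k. if tree x w then next_gen v (birth_time x w) else 1) \<in> borel_measurable \<Omega>"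
        by (rule borel_measurable_prod)
    qed
  qed
  finally show ?thesis .
qed

text \<open>The probability that a particle born at time \<open>b\<close> has no descendant, \<open>n\<close> generations later, that is
  born by time \<open>t\<close>.\<close>

fun early_free :: "real \<Rightarrow> nat \<Rightarrow> real \<Rightarrow> real" where
  "early_free t 0 = (\<lambda>b. if b \<le> t then 0 else 1)"
| "early_free t (Suc n) = next_gen (early_free t n)"

lemma early_free_props: "early_free t n \<in> borel_measurable borel" "0 \<le> early_free t n b \<and> early_free t n b \<le> 1"
proof -
  have "early_free t n \<in> borel_measurable borel \<and> (\<forall>b. 0 \<le> early_free t n b \<and> early_free t n b \<le> 1)"
  proof (induction n)
    case (Suc n)
    then show ?case using next_gen_props[of "early_free t n"] by simp
  qed auto
  then show "early_free t n \<in> borel_measurable borel" "0 \<le> early_free t n b \<and> early_free t n b \<le> 1" by auto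
qed

lemma absent_ge: "absent (early_free t m) n k \<ge> early_free t (n + m) 0"
proof (induction n arbitrary: m)
  case 0
  show ?case by (simp add: absent_def gen_0 W.prob_space)
next
  case (Suc n)
  have "early_free t (Suc n + m) 0 \<le> absent (early_free t (Suc m)) n k" using Suc[of "Suc m"] by simp
  also have "\<dots> \<le> absent (early_free t m) (Suc n) k"
    using absent_Suc[OF early_free_props] by simp
  finally show ?case .
qed

text \<open>Descendants are born even later.\<close>

lemma early_free_past: "b > t \<Longrightarrow> early_free t n b = 1"
proof (induction n arbitrary: b)
  case (Suc n)
  have "early_free t (Suc n) b = (LBINT e:{0..}. exp (- e) * pgf (early_free t n (b + e)))"
    using early_free_props by (simp add: next_gen_def integral_expo pgf_measurable_compose)
  also have "\<dots> = (LBINT e:{0..}. exp (- e) * 1)"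
    by (rule set_lebesgue_integral_cong) (use Suc in \<open>auto simp: pgf_def O.prob_space\<close>)
  also have "\<dots> = (\<integral>e. 1 \<partial>expo)" by (rule integral_expo[symmetric]) simp
  finally show ?case using E.prob_space by simp
qed simp

lemma early_free_mono: "early_free t n b \<le> early_free t (Suc n) b"
proof (induction n arbitrary: b)
  case 0
  show ?case
  proof (cases "b \<le> t")
    case True
    then show ?thesis using early_free_props(2)[of t "Suc 0" b] by simp
  next
    case False
    then show ?thesis using early_free_past[of t b "Suc 0"] by simp
  qed
next
  case (Suc n)
  have "next_gen (early_free t n) b \<le> next_gen (early_free t (Suc n)) b"
    unfolding next_gen_def
    by (intro integral_mono next_gen_props(3) early_free_props pgf_mono Suc.IH)
       (use early_free_props in blast)+
  then show ?case by simp
qed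

end

lemma gen_mono:
  assumes "k \<le> k'"
  shows "gen n k \<subseteq> gen n k'"
proof
  fix x assume x: "x \<in> gen n k"
  then have "set x \<subseteq> {..k}" by (simp add: gen_def)
  moreover have "{..k} \<subseteq> {..k'}" using assms by simp
  ultimately have "set x \<subseteq> {..k'}" by (rule subset_trans)
  with x show "x \<in> gen n k'" by (simp add: gen_def)
qed

context mark_space
begin

text \<open>The limit \<open>v\<close> of the increasing iterates satisfies \<open>v(b) = \<integral> e\<^bsup>-e\<^esup> f(v(b + e)) de\<close>, with \<open>v = 1\<close> after time \<open>t\<close>.
  In terms of the remaining time \<open>r = t - b\<close> this is the integral equation of \<open>osgood_uniqueness\<close>.\<close>

lemma early_free_tendsto_1:
  assumes div: "\<forall>\<^sub>F e in at_right (0::real). (\<integral>\<^sup>+ s\<in>{1 - e<..<1}. ennreal (1 / (s - pgf s)) \<partial>lborel) = \<infinity>"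
    and mean: "(\<integral>\<^sup>+ u. of_nat (fst u) \<partial>Off) > 1" and "t \<ge> 0"
  shows "(\<lambda>n. early_free t n 0) \<longlonglongrightarrow> 1"
proof -
  define v where "v b = (SUP n. early_free t n b)" for b
  have v_lim: "(\<lambda>n. early_free t n b) \<longlonglongrightarrow> v b" for b
    unfolding v_def
    by (rule LIMSEQ_incseq_SUP) (use early_free_mono early_free_props(2) in \<open>auto simp: incseq_Suc_iff intro!: bdd_aboveI[of _ 1]\<close>)
  have v01: "0 \<le> v b \<and> v b \<le> 1" for b
    using LIMSEQ_le_const[OF v_lim, of 0 b] LIMSEQ_le_const2[OF v_lim, of b 1] early_free_props(2) by blast
  have [measurable]: "v \<in> borel_measurable borel"
    using v_lim by (rule borel_measurable_LIMSEQ_real) (rule early_free_props)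
  have [measurable]: "(\<lambda>z. pgf (v (f z))) \<in> borel_measurable M" if [measurable]: "f \<in> borel_measurable M" for f :: "'x \<Rightarrow> real" and M
    by (rule pgf_measurable_compose) (use v01 in auto)
  have pgf1: "pgf 1 = 1" by (simp add: pgf_def O.prob_space)
  have v_past: "v b = 1" if "b > t" for b
    using LIMSEQ_unique[OF v_lim[of b], of 1] early_free_past[OF that] by simp
  have v_fix: "v b = next_gen v b" for b
  proof (rule LIMSEQ_unique)
    show "(\<lambda>n. early_free t (Suc n) b) \<longlonglongrightarrow> v b" by (rule LIMSEQ_Suc[OF v_lim])
    have "(\<lambda>n. \<integral>e. pgf (early_free t n (b + e)) \<partial>expo) \<longlonglongrightarrow> (\<integral>e. pgf (v (b + e)) \<partial>expo)"
    proof (rule integral_dominated_convergence[where w = "\<lambda>_. 1"])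
      have "(\<lambda>n. pgf (early_free t n c)) \<longlonglongrightarrow> pgf (v c)" for c
        by (rule continuous_on_tendsto_compose[OF pgf_continuous v_lim]) (use v01 early_free_props in auto)
      then show "AE e in expo. (\<lambda>n. pgf (early_free t n (b + e))) \<longlonglongrightarrow> pgf (v (b + e))" by simp
      show "AE e in expo. norm (pgf (early_free t n (b + e))) \<le> 1" for n
        using pgf_01 early_free_props(2) by (intro AE_I2) fastforce
      show "(\<lambda>e. pgf (early_free t n (b + e))) \<in> borel_measurable expo" for n
        using next_gen_props(3)[OF early_free_props] by auto
    qed auto
    then show "(\<lambda>n. early_free t (Suc n) b) \<longlonglongrightarrow> next_gen v b"
      by (simp add: next_gen_def)
  qed
  define q where "q r = v (t - r)" for r
  \<comment> \<open>substitute \<open>s = r - e\<close>; the part \<open>s < 0\<close> lies after time \<open>t\<close> and contributes the summand \<open>1\<close>\<close>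
  have q_eq: "q r = exp (- r) * (1 + integral {0..r} (\<lambda>s. exp s * pgf (q s)))" if "r \<ge> 0" for r
  proof -
    have [measurable]: "q \<in> borel_measurable borel" unfolding q_def by measurable
    have [measurable]: "(\<lambda>s. pgf (q s)) \<in> borel_measurable borel" unfolding q_def by measurable
    have q01: "0 \<le> q s" "q s \<le> 1" for s using v01 by (auto simp: q_def)
    have si: "set_integrable lborel {0..r} (\<lambda>s. exp s * pgf (q s))"
      unfolding set_integrable_def
    proof (rule integrableI_bounded_set_indicator[where B = "exp r", of "{0..r}" _ "\<lambda>s. exp s * pgf (q s)"])
      have "exp s * pgf (q s) \<le> exp r * 1" if "s \<le> r" for s
        using that pgf_01 q01 by (intro mult_mono) auto
      then show "AE s in lborel. s \<in> {0..r} \<longrightarrow> norm (exp s * pgf (q s)) \<le> exp r"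
        using pgf_01 q01 by (intro AE_I2) (auto simp: abs_mult)
    qed (use that in auto)
    have neg: "(LBINT s. indicator {..0::real} s *\<^sub>R exp s) = 1"
    proof -
      have "1 = (\<integral>e. (1::real) \<partial>expo)" using E.prob_space by simp
      also have "\<dots> = (LBINT e. indicator {0..} e *\<^sub>R exp (- e))"
        using integral_expo[of "\<lambda>_. 1"] by (simp add: set_lebesgue_integral_def)
      also have "\<dots> = (LBINT s. indicator {0..} (0 + (-1) * s) *\<^sub>R exp (- (0 + (-1) * s)))"
        using lborel_integral_real_affine[of "-1" "\<lambda>e. indicator {0..} e *\<^sub>R exp (- e)" 0] by simp
      also have "\<dots> = (LBINT s. indicator {..0} s *\<^sub>R exp s)"
        by (intro Bochner_Integration.integral_cong) (auto simp: indicator_def)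
      finally show ?thesis ..
    qed
    then have neg_int: "integrable lborel (\<lambda>s::real. indicator {..0} s *\<^sub>R exp s)"
      using not_integrable_integral_eq by fastforce
    have "q r = (LBINT e. indicator {0..} e *\<^sub>R (exp (- e) * pgf (v (t - r + e))))"
      unfolding q_def by (subst v_fix) (simp add: next_gen_def integral_expo set_lebesgue_integral_def)
    also have "\<dots> = (LBINT s. indicator {0..} (r + (-1) * s) *\<^sub>R (exp (- (r + (-1) * s)) * pgf (v (t - r + (r + (-1) * s)))))"
      using lborel_integral_real_affine[of "-1" "\<lambda>e. indicator {0..} e *\<^sub>R (exp (- e) * pgf (v (t - r + e)))" r] by simp
    also have "\<dots> = (LBINT s. exp (- r) * (indicator {..0} s *\<^sub>R exp s + indicator {0..r} s *\<^sub>R (exp s * pgf (q s))))"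
    proof (rule integral_cong_AE)
      have "AE s in lborel. s \<noteq> (0::real)" by (rule AE_lborel_singleton)
      then show "AE s in lborel. indicator {0..} (r + (-1) * s) *\<^sub>R (exp (- (r + (-1) * s)) * pgf (v (t - r + (r + (-1) * s)))) =
          exp (- r) * (indicator {..0} s *\<^sub>R exp s + indicator {0..r} s *\<^sub>R (exp s * pgf (q s)))"
      proof eventually_elim
        case (elim s)
        have "exp (s - r) = exp (- r) * exp s" by (simp add: exp_diff exp_minus field_simps)
        then show ?case
          using elim that v_past[of "t - s"] pgf1 by (auto simp: indicator_def q_def)
      qed
    qed measurable
    also have "\<dots> = exp (- r) * ((LBINT s. indicator {..0} s *\<^sub>R exp s) + (LBINT s:{0..r}. exp s * pgf (q s)))"
      using neg_int si unfolding set_integrable_def set_lebesgue_integral_def by simp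
    also have "(LBINT s:{0..r}. exp s * pgf (q s)) = integral {0..r} (\<lambda>s. exp s * pgf (q s))"
      by (rule set_borel_integral_eq_integral[OF si])
    finally show ?thesis using neg by simp
  qed
  obtain s0 where s0: "s0 < 1" "\<And>s. s0 < s \<Longrightarrow> s < 1 \<Longrightarrow> pgf s < s"
    using expectation_power_less[OF prob_space_Off fst_measurable_Off mean] unfolding pgf_def by blast
  have "q t = 1"
    by (rule osgood_uniqueness[OF pgf_continuous pgf1 s0 pgf_01 div])
       (use v01 q_eq \<open>t \<ge> 0\<close> in \<open>auto simp: q_def\<close>)
  then show ?thesis using v_lim[of 0] by (simp add: q_def)
qed

lemma AE_E_nonneg: "AE w in \<Omega>. \<forall>x\<in>labels. mark_E x w \<ge> 0"
proof -
  have h1: "AE e in expo. e \<ge> 0"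
    by (subst AE_density) (auto simp: exponential_density_def)
  have h2: "distr Mark expo fst = expo"
    unfolding Mark_def by (rule prob_space.distr_pair_fst[OF RO.P.prob_space_axioms])
  have "AE e in distr Mark expo fst. e \<ge> 0" unfolding h2 by (rule h1)
  then have "AE y in Mark. fst y \<ge> 0"
    by (rule AE_distrD[rotated]) (simp add: measurable_fields)
  then have "AE w in \<Omega>. mark_E x w \<ge> 0" if "x \<in> labels" for x
    using AE_PiM_component[OF Mk.prob_space_axioms that] unfolding \<Omega>_def mark_E_def by blast
  then show ?thesis by (subst AE_ball_countable[OF countable_labels]) auto
qed

text \<open>Almost surely some generation \<open>n\<close> has no member born by time \<open>t\<close>, and then neither has any later one. The
  earlier generations are finite.\<close>

lemma finitely_many_births:
  assumes div: "\<forall>\<^sub>F e in at_right (0::real). (\<integral>\<^sup>+ s\<in>{1 - e<..<1}. ennreal (1 / (s - pgf s)) \<partial>lborel) = \<infinity>"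
    and mean: "(\<integral>\<^sup>+ u. of_nat (fst u) \<partial>Off) > 1" and "t \<ge> 0"
  shows "AE w in \<Omega>. finite {x. tree x w \<and> birth_time x w \<le> t}"
proof -
  define A where "A n k = {w \<in> space \<Omega>. \<forall>x\<in>gen n k. tree x w \<longrightarrow> t < birth_time x w}" for n k
  have A [measurable]: "A n k \<in> sets \<Omega>" for n k
  proof -
    have "Measurable.pred \<Omega> (\<lambda>w. tree x w \<longrightarrow> t < birth_time x w)" if "x \<in> gen n k" for x
      using gen_labels[OF that] by measurable
    then show ?thesis unfolding A_def pred_def[symmetric] by (intro pred_intros_finite) auto
  qed
  have prob_A: "W.prob (A n k) \<ge> early_free t n 0" for n k
  proof -
    have "early_free t n 0 \<le> absent (early_free t 0) n k" using absent_ge[of t n 0 k] by simp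
    also have "\<dots> = (\<integral>w. indicator (A n k) w \<partial>\<Omega>)"
      unfolding absent_def
    proof (intro Bochner_Integration.integral_cong refl)
      fix w assume "w \<in> space \<Omega>"
      show "(\<Prod>x\<in>gen n k. if tree x w then early_free t 0 (birth_time x w) else 1) = indicator (A n k) w"
      proof (cases "w \<in> A n k")
        case True
        then have "(\<Prod>x\<in>gen n k. if tree x w then early_free t 0 (birth_time x w) else 1) = (\<Prod>x\<in>gen n k. 1)"
          by (intro prod.cong) (auto simp: A_def not_le)
        then show ?thesis using True by simp
      next
        case False
        then have "\<exists>x\<in>gen n k. (if tree x w then early_free t 0 (birth_time x w) else 1) = 0"
          using \<open>w \<in> space \<Omega>\<close> by (auto simp: A_def not_less)
        then have "(\<Prod>x\<in>gen n k. if tree x w then early_free t 0 (birth_time x w) else 1) = 0"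
          by (intro prod_zero) auto
        then show ?thesis using False by simp
      qed
    qed
    finally show ?thesis by simp
  qed
  \<comment> \<open>no particle of generation \<open>n\<close>, with labels of any size, is born by time \<open>t\<close>\<close>
  define S where "S n = (\<Inter>k. A n k)" for n
  have [measurable]: "S n \<in> sets \<Omega>" for n unfolding S_def by measurable
  have prob_S: "W.prob (S n) \<ge> early_free t n 0" for n
  proof -
    have "decseq (A n)"
      using gen_mono[of _ _ n] by (fastforce simp: decseq_def A_def)
    then have "(\<lambda>k. W.prob (A n k)) \<longlonglongrightarrow> W.prob (S n)"
      unfolding S_def by (intro W.finite_Lim_measure_decseq) auto
    then show ?thesis by (rule LIMSEQ_le_const) (use prob_A in auto)
  qed
  have "W.prob (\<Union>n. S n) = 1"
  proof (rule antisym)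
    show "1 \<le> W.prob (\<Union>n. S n)"
    proof (rule LIMSEQ_le_const2[OF early_free_tendsto_1[OF assms]])
      have "early_free t n 0 \<le> W.prob (\<Union>n. S n)" for n
        by (rule order_trans[OF prob_S W.finite_measure_mono]) auto
      then show "\<exists>N. \<forall>n\<ge>N. early_free t n 0 \<le> W.prob (\<Union>n. S n)" by auto
    qed
  qed simp
  then have "AE w in \<Omega>. w \<in> (\<Union>n. S n)" by (subst (asm) W.prob_eq_1) auto
  with AE_E_nonneg show ?thesis
  proof eventually_elim
    case (elim w)
    then obtain n where n: "w \<in> S n" by auto
    have none: "\<not> (tree x w \<and> birth_time x w \<le> t)" if len: "length x = n" for x
    proof
      assume "tree x w \<and> birth_time x w \<le> t"
      moreover from this have "\<exists>k. x \<in> gen n k"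
        using in_some_gen[of x] in_tree_labels[of mark_N x w] len by simp
      then obtain k where "x \<in> gen n k" ..
      moreover have "w \<in> A n k" using n by (auto simp: S_def)
      ultimately show False by (auto simp: A_def)
    qed
    have "length x < n" if "tree x w" "birth_time x w \<le> t" for x
      using that
    proof (induction x)
      case Nil
      then show ?case using none[of "[]"] by (cases n) auto
    next
      case (Cons i x)
      have "x \<in> labels" using Cons.prems in_tree_labels[of mark_N x w] by auto
      then have "birth_time x w \<le> t" using Cons.prems elim(1) by force
      then have "length x < n" using Cons by simp
      moreover have "length (i # x) \<noteq> n" using none[of "i # x"] Cons.prems by blast
      ultimately show ?case by simp
    qed
    then have "{x. tree x w \<and> birth_time x w \<le> t} \<subseteq> (\<Union>m<n. {x. tree x w \<and> length x = m})" by auto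
    then show ?case by (rule finite_subset) (use finite_tree_generation in auto)
  qed
qed

end

section \<open>Moments of the weights of born and living particles\<close>

lemma nn_integral_expo_exp:
  assumes "b \<le> t" "c > -1"
  shows "(\<integral>\<^sup>+ e. ennreal (if b + e \<le> t then exp (c * (t - (b + e))) else 0) \<partial>density lborel (exponential_density 1)) =
    ennreal ((exp (c * (t - b)) - exp (- (t - b))) / (1 + c))"
proof -
  define r where "r = t - b"
  have "r \<ge> 0" using assms by (simp add: r_def)
  have "(\<integral>\<^sup>+ e. ennreal (if b + e \<le> t then exp (c * (t - (b + e))) else 0) \<partial>density lborel (exponential_density 1)) =
    (\<integral>\<^sup>+ e. ennreal (exp (c * r - (1 + c) * e)) * indicator {0..r} e \<partial>lborel)"
    by (subst nn_integral_expo)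
       (auto simp: indicator_def ennreal_mult[symmetric] exp_add[symmetric] r_def algebra_simps intro!: nn_integral_cong)
  also have "\<dots> = ennreal (- exp (c * r - (1 + c) * r) / (1 + c) - (- exp (c * r - (1 + c) * 0) / (1 + c)))"
  proof (rule nn_integral_FTC_Icc)
    show "((\<lambda>e. - exp (c * r - (1 + c) * e) / (1 + c)) has_real_derivative exp (c * r - (1 + c) * e)) (at e)" for e
    proof -
      have "((\<lambda>e. - exp (c * r - (1 + c) * e)) has_real_derivative (1 + c) * exp (c * r - (1 + c) * e)) (at e)"
        by (auto intro!: derivative_eq_intros simp: algebra_simps)
      from DERIV_cdivide[OF this, of "1 + c"] show ?thesis using assms(2) by simp
    qed
  qed (use \<open>r \<ge> 0\<close> in auto)
  also have "- exp (c * r - (1 + c) * r) / (1 + c) - (- exp (c * r - (1 + c) * 0) / (1 + c)) = (exp (c * r) - exp (- r)) / (1 + c)"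
    by (simp add: algebra_simps diff_divide_distrib)
  finally show ?thesis by (simp add: r_def)
qed

context mark_space
begin

definition weight_sum :: "real \<Rightarrow> nat \<times> real \<times> (nat \<Rightarrow> real) \<Rightarrow> ennreal" where
  "weight_sum \<theta> u = (\<Sum>i = 1..fst u. ennreal (exp (\<theta> * ln (snd (snd u) i))))"

definition weight_moment :: "real \<Rightarrow> ennreal" where
  "weight_moment \<theta> = (\<integral>\<^sup>+ u. weight_sum \<theta> u \<partial>Off)"

lemma weight_sum_measurable [measurable]: "weight_sum \<theta> \<in> borel_measurable Off"
proof -
  have "(\<lambda>u. \<Sum>i = 1..n. ennreal (exp (\<theta> * ln (snd (snd u) i)))) \<in> borel_measurable Off" for n
    by (intro borel_measurable_sum) (auto intro!: measurable_compose[OF A_measurable_Off])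
  then show ?thesis
    unfolding weight_sum_def[abs_def]
    by (rule measurable_compose_countable) (rule fst_measurable_Off)
qed

definition tree_weight :: "real \<Rightarrow> nat list \<Rightarrow> (nat list \<Rightarrow> mark) \<Rightarrow> ennreal" where
  "tree_weight \<theta> x w = ennreal (if tree x w then exp (\<theta> * pos x w) else 0)"

lemma tree_weight_measurable [measurable]: "x \<in> labels \<Longrightarrow> tree_weight \<theta> x \<in> borel_measurable \<Omega>"
  unfolding tree_weight_def[abs_def] by measurable

lemma tree_weight_upd [simp]: "tree_weight \<theta> x (w(x := y)) = tree_weight \<theta> x w"
  by (simp add: tree_weight_def)

text \<open>The mark of the parent \<open>x\<close> is independent of its weight and of its birth time; it supplies the weights of the children,
  of total mean \<open>weight_moment \<theta>\<close>, and the common delay of their births.\<close>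

lemma tree_weight_children:
  assumes x: "x \<in> labels" and [measurable]: "u \<in> borel_measurable borel"
  shows "(\<Sum>i = 1..k. \<integral>\<^sup>+ w. tree_weight \<theta> (i # x) w * u (birth_time (i # x) w) \<partial>\<Omega>)
    \<le> weight_moment \<theta> * (\<integral>\<^sup>+ w. tree_weight \<theta> x w * (\<integral>\<^sup>+ e. u (birth_time x w + e) \<partial>expo) \<partial>\<Omega>)"
proof -
  note [measurable] = x
  define Z where "Z y = (\<Sum>i = 1..k. ennreal (if i \<le> fst (snd (snd y)) then exp (\<theta> * ln (snd (snd (snd (snd y))) i)) else 0))" for y :: mark
  have [measurable]: "Z \<in> borel_measurable Mark"
  proof -
    have "(\<lambda>y. ennreal (if i \<le> fst (snd (snd y)) then exp (\<theta> * ln (snd (snd (snd (snd y))) i)) else 0)) \<in> borel_measurable Mark"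
      if "i \<in> {1..k}" for i
    proof -
      have [measurable]: "1 \<le> i" using that by simp
      show ?thesis by measurable
    qed
    then show ?thesis unfolding Z_def[abs_def] by (rule borel_measurable_sum)
  qed
  have Zle: "Z y \<le> weight_sum \<theta> (snd (snd y))" for y
  proof -
    have "Z y = (\<Sum>i\<in>{1..k} \<inter> {..fst (snd (snd y))}. ennreal (exp (\<theta> * ln (snd (snd (snd (snd y))) i))))"
      unfolding Z_def by (subst sum.inter_restrict, simp, rule sum.cong) auto
    also have "\<dots> \<le> weight_sum \<theta> (snd (snd y))"
      unfolding weight_sum_def by (intro sum_mono2) auto
    finally show ?thesis .
  qed
  have child_labels: "i # x \<in> labels" if "i \<in> {1..k}" for i using that x by simp
  have "(\<Sum>i = 1..k. \<integral>\<^sup>+ w. tree_weight \<theta> (i # x) w * u (birth_time (i # x) w) \<partial>\<Omega>) =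
      (\<integral>\<^sup>+ w. (\<Sum>i = 1..k. tree_weight \<theta> (i # x) w * u (birth_time (i # x) w)) \<partial>\<Omega>)"
  proof (rule nn_integral_sum[symmetric])
    fix i assume "i \<in> {1..k}"
    then have [measurable]: "i # x \<in> labels" by (rule child_labels)
    show "(\<lambda>w. tree_weight \<theta> (i # x) w * u (birth_time (i # x) w)) \<in> borel_measurable \<Omega>" by measurable
  qed
  also have "\<dots> = (\<integral>\<^sup>+ w. tree_weight \<theta> x w * (u (birth_time x w + fst (w x)) * Z (w x)) \<partial>\<Omega>)"
  proof (rule nn_integral_cong)
    fix w
    have "tree_weight \<theta> (i # x) w * u (birth_time (i # x) w) =
       tree_weight \<theta> x w * (u (birth_time x w + fst (w x)) * ennreal (if i \<le> fst (snd (snd (w x))) then exp (\<theta> * ln (snd (snd (snd (snd (w x)))) i)) else 0))"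
      if "i \<in> {1..k}" for i
      using that by (auto simp: tree_weight_def mark_defs exp_add distrib_left ennreal_mult mult_ac)
    then show "(\<Sum>i = 1..k. tree_weight \<theta> (i # x) w * u (birth_time (i # x) w)) = tree_weight \<theta> x w * (u (birth_time x w + fst (w x)) * Z (w x))"
      unfolding Z_def sum_distrib_left by (rule sum.cong[OF refl])
  qed
  also have "\<dots> = (\<integral>\<^sup>+ w. \<integral>\<^sup>+ y. tree_weight \<theta> x w * (u (birth_time x w + fst y) * Z y) \<partial>Mark \<partial>\<Omega>)"
    by (subst nn_integral_resample[OF x, symmetric]) simp_all
  also have "\<dots> \<le> (\<integral>\<^sup>+ w. \<integral>\<^sup>+ y. tree_weight \<theta> x w * (u (birth_time x w + fst y) * weight_sum \<theta> (snd (snd y))) \<partial>Mark \<partial>\<Omega>)"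
    by (intro nn_integral_mono mult_left_mono Zle) auto
  also have "\<dots> = (\<integral>\<^sup>+ w. weight_moment \<theta> * (tree_weight \<theta> x w * (\<integral>\<^sup>+ e. u (birth_time x w + e) \<partial>expo)) \<partial>\<Omega>)"
  proof (rule nn_integral_cong)
    fix w
    have [measurable]: "(\<lambda>y. weight_sum \<theta> (snd (snd y))) \<in> borel_measurable Mark"
      unfolding Mark_def by measurable
    have [measurable]: "(\<lambda>y. u (birth_time x w + fst y)) \<in> borel_measurable Mark"
      unfolding Mark_def by measurable
    have "(\<integral>\<^sup>+ y. tree_weight \<theta> x w * (u (birth_time x w + fst y) * weight_sum \<theta> (snd (snd y))) \<partial>Mark) =
       tree_weight \<theta> x w * (\<integral>\<^sup>+ y. u (birth_time x w + fst y) * weight_sum \<theta> (snd (snd y)) \<partial>Mark)"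
      by (intro nn_integral_cmult) measurable
    also have "(\<integral>\<^sup>+ y. u (birth_time x w + fst y) * weight_sum \<theta> (snd (snd y)) \<partial>Mark) =
       (\<integral>\<^sup>+ e. u (birth_time x w + e) \<partial>expo) * weight_moment \<theta>"
      unfolding weight_moment_def by (rule nn_integral_Mark_mult) measurable
    finally show "(\<integral>\<^sup>+ y. tree_weight \<theta> x w * (u (birth_time x w + fst y) * weight_sum \<theta> (snd (snd y))) \<partial>Mark) =
       weight_moment \<theta> * (tree_weight \<theta> x w * (\<integral>\<^sup>+ e. u (birth_time x w + e) \<partial>expo))"
      by (simp add: mult_ac)
  qed
  also have "\<dots> = weight_moment \<theta> * (\<integral>\<^sup>+ w. tree_weight \<theta> x w * (\<integral>\<^sup>+ e. u (birth_time x w + e) \<partial>expo) \<partial>\<Omega>)"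
    by (rule nn_integral_cmult) measurable
  finally show ?thesis .
qed

text \<open>Let \<open>U n\<close> be the expected sum of \<open>e\<^bsup>\<theta>V(x)\<^esup> u(B(x))\<close> over generation \<open>n\<close>, and \<open>S n\<close> the same with \<open>h\<close>. The
  hypothesis says \<open>S n + U (n + 1) \<le> U n\<close>, and summation telescopes from \<open>U 0 = u(0)\<close>. Thus a bound on the
  expected total follows from a guess \<open>u\<close> for its value as a function of the birth time of the root.\<close>

lemma supersolution_bound:
  assumes [measurable]: "u \<in> borel_measurable borel" "h \<in> borel_measurable borel"
    and super: "\<And>b. h b + weight_moment \<theta> * (\<integral>\<^sup>+ e. u (b + e) \<partial>expo) \<le> u b"
  shows "(\<Sum>x\<in>label_box k. \<integral>\<^sup>+ w. tree_weight \<theta> x w * h (birth_time x w) \<partial>\<Omega>) \<le> u 0"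
proof -
  define U where "U n = (\<Sum>x\<in>gen n k. \<integral>\<^sup>+ w. tree_weight \<theta> x w * u (birth_time x w) \<partial>\<Omega>)" for n
  define S where "S n = (\<Sum>x\<in>gen n k. \<integral>\<^sup>+ w. tree_weight \<theta> x w * h (birth_time x w) \<partial>\<Omega>)" for n
  have step: "S n + U (Suc n) \<le> U n" for n
  proof -
    have "U (Suc n) = (\<Sum>(x, i)\<in>gen n k \<times> {1..k}. \<integral>\<^sup>+ w. tree_weight \<theta> (i # x) w * u (birth_time (i # x) w) \<partial>\<Omega>)"
      unfolding U_def gen_Suc by (subst sum.reindex) (auto simp: inj_on_def case_prod_beta')
    also have "\<dots> = (\<Sum>x\<in>gen n k. \<Sum>i = 1..k. \<integral>\<^sup>+ w. tree_weight \<theta> (i # x) w * u (birth_time (i # x) w) \<partial>\<Omega>)"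
      by (rule sum.cartesian_product[symmetric])
    also have "\<dots> \<le> (\<Sum>x\<in>gen n k. weight_moment \<theta> * (\<integral>\<^sup>+ w. tree_weight \<theta> x w * (\<integral>\<^sup>+ e. u (birth_time x w + e) \<partial>expo) \<partial>\<Omega>))"
      by (intro sum_mono tree_weight_children) (auto dest: gen_labels)
    finally have "S n + U (Suc n) \<le> (\<Sum>x\<in>gen n k. (\<integral>\<^sup>+ w. tree_weight \<theta> x w * h (birth_time x w) \<partial>\<Omega>) +
        weight_moment \<theta> * (\<integral>\<^sup>+ w. tree_weight \<theta> x w * (\<integral>\<^sup>+ e. u (birth_time x w + e) \<partial>expo) \<partial>\<Omega>))"
      unfolding S_def sum.distrib by (rule add_left_mono)
    also have "\<dots> \<le> U n"
      unfolding U_def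
    proof (rule sum_mono)
      fix x assume "x \<in> gen n k"
      then have [measurable]: "x \<in> labels" by (rule gen_labels)
      have "(\<integral>\<^sup>+ w. tree_weight \<theta> x w * h (birth_time x w) \<partial>\<Omega>) +
        weight_moment \<theta> * (\<integral>\<^sup>+ w. tree_weight \<theta> x w * (\<integral>\<^sup>+ e. u (birth_time x w + e) \<partial>expo) \<partial>\<Omega>) =
        (\<integral>\<^sup>+ w. tree_weight \<theta> x w * h (birth_time x w) + weight_moment \<theta> * (tree_weight \<theta> x w * (\<integral>\<^sup>+ e. u (birth_time x w + e) \<partial>expo)) \<partial>\<Omega>)"
        by (subst nn_integral_add) (auto simp: nn_integral_cmult)
      also have "\<dots> \<le> (\<integral>\<^sup>+ w. tree_weight \<theta> x w * u (birth_time x w) \<partial>\<Omega>)"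
      proof (rule nn_integral_mono)
        fix w
        show "tree_weight \<theta> x w * h (birth_time x w) + weight_moment \<theta> * (tree_weight \<theta> x w * (\<integral>\<^sup>+ e. u (birth_time x w + e) \<partial>expo))
          \<le> tree_weight \<theta> x w * u (birth_time x w)"
          using mult_left_mono[OF super[of "birth_time x w"], of "tree_weight \<theta> x w"]
          by (simp add: distrib_left mult_ac)
      qed
      finally show "(\<integral>\<^sup>+ w. tree_weight \<theta> x w * h (birth_time x w) \<partial>\<Omega>) +
        weight_moment \<theta> * (\<integral>\<^sup>+ w. tree_weight \<theta> x w * (\<integral>\<^sup>+ e. u (birth_time x w + e) \<partial>expo) \<partial>\<Omega>)
        \<le> (\<integral>\<^sup>+ w. tree_weight \<theta> x w * u (birth_time x w) \<partial>\<Omega>)" .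
    qed
    finally show ?thesis .
  qed
  have "(\<Sum>j<n. S j) + U n \<le> u 0" for n
  proof (induction n)
    case 0
    show ?case by (simp add: U_def gen_0 tree_weight_def W.emeasure_space_1)
  next
    case (Suc n)
    have "(\<Sum>j<Suc n. S j) + U (Suc n) = (\<Sum>j<n. S j) + (S n + U (Suc n))" by (simp add: add.assoc)
    also have "\<dots> \<le> (\<Sum>j<n. S j) + U n" by (intro add_left_mono step)
    finally show ?case using Suc by (rule order_trans)
  qed
  from this[of "Suc k"] have "(\<Sum>j<Suc k. S j) \<le> u 0"
    by (rule order_trans[rotated]) simp
  then show ?thesis
    unfolding sum_box S_def lessThan_Suc_atMost .
qed

text \<open>Supersolution \<open>u(b) = K e\<^bsup>c(t-b)\<^esup>\<close> for \<open>b \<le> t\<close>. The exponential waiting time turns \<open>e\<^bsup>c(t-b)\<^esup>\<close> into at most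
  \<open>e\<^bsup>c(t-b)\<^esup> / (1 + c)\<close>, so \<open>u\<close> absorbs the source \<open>1\<close> when \<open>K (1 - m / (1 + c)) = 1\<close>.\<close>

lemma born_moment_bound:
  assumes m: "weight_moment \<theta> = ennreal m" "m \<ge> 0" and c: "c \<ge> 0" "c > m - 1"
  shows "(\<Sum>x\<in>label_box k. \<integral>\<^sup>+ w. tree_weight \<theta> x w * indicator {..t} (birth_time x w) \<partial>\<Omega>)
    \<le> ennreal ((1 + c) / (1 + c - m) * exp (c * t))"
proof -
  define K where "K = (1 + c) / (1 + c - m)"
  have "K \<ge> 0" using c m by (simp add: K_def)
  define u where "u b = ennreal (if b \<le> t then K * exp (c * (t - b)) else 0)" for b
  have [measurable]: "u \<in> borel_measurable borel" unfolding u_def[abs_def] by measurable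
  have "(\<Sum>x\<in>label_box k. \<integral>\<^sup>+ w. tree_weight \<theta> x w * indicator {..t} (birth_time x w) \<partial>\<Omega>) \<le> u 0"
  proof (rule supersolution_bound)
    fix b
    show "indicator {..t} b + weight_moment \<theta> * (\<integral>\<^sup>+ e. u (b + e) \<partial>expo) \<le> u b"
    proof (cases "b \<le> t")
      case True
      have "(\<integral>\<^sup>+ e. u (b + e) \<partial>expo) = (\<integral>\<^sup>+ e. ennreal K * ennreal (if b + e \<le> t then exp (c * (t - (b + e))) else 0) \<partial>expo)"
        unfolding u_def using \<open>K \<ge> 0\<close> by (intro nn_integral_cong) (auto simp: ennreal_mult)
      also have "\<dots> = ennreal K * ennreal ((exp (c * (t - b)) - exp (- (t - b))) / (1 + c))"
        using True c by (subst nn_integral_cmult) (auto simp: nn_integral_expo_exp)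
      also have "\<dots> \<le> ennreal K * ennreal (exp (c * (t - b)) / (1 + c))"
        using c by (intro mult_left_mono ennreal_leI divide_right_mono) auto
      also have "\<dots> = ennreal (K * (exp (c * (t - b)) / (1 + c)))" using \<open>K \<ge> 0\<close> c by (simp add: ennreal_mult[symmetric])
      finally have "indicator {..t} b + weight_moment \<theta> * (\<integral>\<^sup>+ e. u (b + e) \<partial>expo) \<le>
          ennreal 1 + ennreal m * ennreal (K * (exp (c * (t - b)) / (1 + c)))"
        unfolding m(1) using True by (intro add_mono mult_left_mono) auto
      also have "\<dots> = ennreal (1 + m * (K * (exp (c * (t - b)) / (1 + c))))"
      proof -
        have "ennreal 1 + ennreal m * ennreal X = ennreal (1 + m * X)" if "X \<ge> 0" for X
          using that m by (simp add: ennreal_mult)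
        then show ?thesis using \<open>K \<ge> 0\<close> c by simp
      qed
      also have "\<dots> \<le> ennreal (K * exp (c * (t - b)))"
      proof (rule ennreal_leI)
        have "1 \<le> exp (c * (t - b))" using True c by simp
        also have "exp (c * (t - b)) = (K - m * K / (1 + c)) * exp (c * (t - b))"
        proof -
          have "1 + c \<noteq> 0" "1 + c - m \<noteq> 0" using c m by auto
          then have "K - m * K / (1 + c) = 1" by (simp add: K_def divide_simps)
          then show ?thesis by simp
        qed
        finally show "1 + m * (K * (exp (c * (t - b)) / (1 + c))) \<le> K * exp (c * (t - b))"
          by (simp add: algebra_simps)
      qed
      also have "\<dots> = u b" using True by (simp add: u_def)
      finally show ?thesis .
    next
      case False
      have "ennreal (exp (- e) * indicator {0..} e) * u (b + e) = 0" for e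
        using False by (auto simp: u_def indicator_def)
      then have "(\<integral>\<^sup>+ e. u (b + e) \<partial>expo) = 0"
        by (subst nn_integral_expo) (measurable, simp only: nn_integral_const mult_zero_left)
      then show ?thesis using False by simp
    qed
  qed measurable
  also have "u 0 \<le> ennreal ((1 + c) / (1 + c - m) * exp (c * t))"
    using \<open>K \<ge> 0\<close> by (auto simp: u_def K_def)
  finally show ?thesis .
qed

text \<open>A particle born at \<open>b\<close> is alive at \<open>t\<close> with probability \<open>e\<^bsup>-(t-b)\<^esup>\<close>, and with this source
  \<open>u(b) = e\<^bsup>(m-1)(t-b)\<^esup>\<close> solves the equation exactly.\<close>

lemma alive_moment_bound:
  assumes m: "weight_moment \<theta> = ennreal m" "m \<ge> 0" and "t \<ge> 0"
  shows "(\<Sum>x\<in>label_box k. \<integral>\<^sup>+ w. tree_weight \<theta> x w * indicator {w. birth_time x w \<le> t \<and> t < birth_time x w + mark_E x w} w \<partial>\<Omega>)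
    \<le> ennreal (exp ((m - 1) * t))"
proof -
  define h where "h b = ennreal (if b \<le> t then exp (- (t - b)) else 0)" for b
  define u where "u b = ennreal (if b \<le> t then exp ((m - 1) * (t - b)) else 0)" for b
  have [measurable]: "u \<in> borel_measurable borel" "h \<in> borel_measurable borel"
    unfolding u_def[abs_def] h_def[abs_def] by measurable
  have tail: "(\<integral>\<^sup>+ y. indicator {y. b \<le> t \<and> t < b + fst y} y \<partial>Mark) = h b" for b
  proof -
    have "(\<integral>\<^sup>+ y. indicator {y. b \<le> t \<and> t < b + fst y} y \<partial>Mark) =
        (\<integral>\<^sup>+ y. indicator {e. b \<le> t \<and> t < b + e} (fst y) * (\<lambda>_. 1) (snd (snd y)) \<partial>Mark)"
      by (intro nn_integral_cong) (auto simp: indicator_def)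
    also have "\<dots> = (\<integral>\<^sup>+ e. indicator {e. b \<le> t \<and> t < b + e} e \<partial>expo) * (\<integral>\<^sup>+ u. 1 \<partial>Off)"
      by (rule nn_integral_Mark_mult) measurable
    also have "\<dots> = (\<integral>\<^sup>+ e. indicator {e. b \<le> t \<and> t < b + e} e \<partial>expo)"
      by (simp add: O.emeasure_space_1)
    also have "\<dots> = h b"
    proof (cases "b \<le> t")
      case True
      have "AE e in lborel. e \<noteq> t - b" by (rule AE_lborel_singleton)
      then have "(\<integral>\<^sup>+ e. indicator {e. b \<le> t \<and> t < b + e} e \<partial>expo) =
          (\<integral>\<^sup>+ e. ennreal (exp (- e)) * indicator {t - b..} e \<partial>lborel)"
        using True by (subst nn_integral_expo, measurable)
           (auto simp: indicator_def intro!: nn_integral_cong_AE elim!: eventually_mono)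
      also have "\<dots> = ennreal (0 - (- exp (- (t - b))))"
      proof (rule nn_integral_FTC_atLeast)
        show "((\<lambda>e::real. - exp (- e)) \<longlongrightarrow> 0) at_top" by real_asymp
      qed (auto intro!: derivative_eq_intros)
      finally show ?thesis using True by (simp add: h_def)
    qed (simp add: h_def)
    finally show ?thesis .
  qed
  have "(\<integral>\<^sup>+ w. tree_weight \<theta> x w * indicator {w. birth_time x w \<le> t \<and> t < birth_time x w + mark_E x w} w \<partial>\<Omega>)
      = (\<integral>\<^sup>+ w. tree_weight \<theta> x w * h (birth_time x w) \<partial>\<Omega>)" if "x \<in> label_box k" for x
  proof -
    have x [measurable]: "x \<in> labels" using that by (rule box_labels)
    have "(\<integral>\<^sup>+ w. tree_weight \<theta> x w * indicator {w. birth_time x w \<le> t \<and> t < birth_time x w + mark_E x w} w \<partial>\<Omega>) =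
      (\<integral>\<^sup>+ w. tree_weight \<theta> x w * (if birth_time x w \<le> t \<and> t < birth_time x w + mark_E x w then 1 else 0) \<partial>\<Omega>)"
      by (intro nn_integral_cong) (auto simp: indicator_def)
    also have "\<dots> = (\<integral>\<^sup>+ w. \<integral>\<^sup>+ y. tree_weight \<theta> x w * (if birth_time x w \<le> t \<and> t < birth_time x w + fst y then 1 else 0) \<partial>Mark \<partial>\<Omega>)"
      by (subst nn_integral_resample[OF x, symmetric]) (simp_all add: mark_E_def)
    also have "\<dots> = (\<integral>\<^sup>+ w. tree_weight \<theta> x w * h (birth_time x w) \<partial>\<Omega>)"
    proof (rule nn_integral_cong)
      fix w
      have "(\<integral>\<^sup>+ y. tree_weight \<theta> x w * (if birth_time x w \<le> t \<and> t < birth_time x w + fst y then 1 else 0) \<partial>Mark) =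
        tree_weight \<theta> x w * (\<integral>\<^sup>+ y. (if birth_time x w \<le> t \<and> t < birth_time x w + fst y then 1 else 0) \<partial>Mark)"
        by (rule nn_integral_cmult) measurable
      also have "(\<integral>\<^sup>+ y. (if birth_time x w \<le> t \<and> t < birth_time x w + fst y then 1 else 0) \<partial>Mark) =
         (\<integral>\<^sup>+ y. indicator {y. birth_time x w \<le> t \<and> t < birth_time x w + fst y} y \<partial>Mark)"
        by (intro nn_integral_cong) (auto simp: indicator_def)
      finally show "(\<integral>\<^sup>+ y. tree_weight \<theta> x w * (if birth_time x w \<le> t \<and> t < birth_time x w + fst y then 1 else 0) \<partial>Mark) =
        tree_weight \<theta> x w * h (birth_time x w)" unfolding tail .
    qed
    finally show ?thesis .
  qed
  then have "(\<Sum>x\<in>label_box k. \<integral>\<^sup>+ w. tree_weight \<theta> x w * indicator {w. birth_time x w \<le> t \<and> t < birth_time x w + mark_E x w} w \<partial>\<Omega>) =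
     (\<Sum>x\<in>label_box k. \<integral>\<^sup>+ w. tree_weight \<theta> x w * h (birth_time x w) \<partial>\<Omega>)"
    by (rule sum.cong[OF refl])
  also have "\<dots> \<le> u 0"
  proof (rule supersolution_bound)
    fix b
    show "h b + weight_moment \<theta> * (\<integral>\<^sup>+ e. u (b + e) \<partial>expo) \<le> u b"
    proof (cases "b \<le> t")
      case True
      show ?thesis
      proof (cases "m = 0")
        case True
        then show ?thesis using m \<open>b \<le> t\<close> by (simp add: h_def u_def)
      next
        case False
        then have "m > 0" using m by simp
        define d where "d = exp ((m - 1) * (t - b)) - exp (- (t - b))"
        have "d \<ge> 0"
          using True \<open>m > 0\<close> by (simp add: d_def algebra_simps mult_right_mono)
        have "(\<integral>\<^sup>+ e. u (b + e) \<partial>expo) = ennreal (d / m)"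
          unfolding u_def d_def using True \<open>m > 0\<close> by (subst nn_integral_expo_exp) auto
        then have "h b + weight_moment \<theta> * (\<integral>\<^sup>+ e. u (b + e) \<partial>expo) = ennreal (exp (- (t - b))) + ennreal d"
          unfolding m(1) h_def using True \<open>m > 0\<close> \<open>d \<ge> 0\<close> by (simp add: ennreal_mult[symmetric])
        also have "\<dots> = ennreal (exp ((m - 1) * (t - b)))"
          using \<open>d \<ge> 0\<close> by (subst ennreal_plus[symmetric]) (auto simp: d_def)
        also have "\<dots> = u b" using True \<open>m > 0\<close> by (simp add: u_def)
        finally show ?thesis by simp
      qed
    next
      case False
      have "ennreal (exp (- e) * indicator {0..} e) * u (b + e) = 0" for e
        using False by (auto simp: u_def indicator_def)
      then have "(\<integral>\<^sup>+ e. u (b + e) \<partial>expo) = 0"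
        by (subst nn_integral_expo) (measurable, simp only: nn_integral_const mult_zero_left)
      then show ?thesis using False by (simp add: h_def)
    qed
  qed measurable
  also have "u 0 = ennreal (exp ((m - 1) * t))" using \<open>t \<ge> 0\<close> by (simp add: u_def)
  finally show ?thesis .
qed

end

section \<open>A p-th power expansion\<close>

lemma powr_subadditive:
  fixes u v q :: real
  assumes "0 \<le> u" "0 \<le> v" "0 < q" "q \<le> 1"
  shows "(u + v) powr q \<le> u powr q + v powr q"
proof (cases "u + v = 0")
  case False
  then have s: "u + v > 0" using assms by simp
  have *: "r \<le> r powr q" if "0 \<le> r" "r \<le> 1" for r :: real
  proof (cases "r = 0")
    case False
    then have "r powr 1 \<le> r powr q" using that assms by (intro powr_mono') auto
    then show ?thesis using that False by simp
  qed simp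
  have "1 = u / (u + v) + v / (u + v)" using s by (simp add: add_divide_distrib[symmetric])
  also have "\<dots> \<le> (u / (u + v)) powr q + (v / (u + v)) powr q"
    using assms s by (intro add_mono *) (auto simp: divide_simps)
  also have "\<dots> = (u powr q + v powr q) / (u + v) powr q"
    using assms s by (simp add: powr_divide add_divide_distrib)
  finally show ?thesis using s by (simp add: field_simps)
qed (use assms in auto)

text \<open>Up to the factor \<open>q + 1\<close> the derivative of \<open>\<bar>x\<bar>\<^bsup>q+1\<^esup>\<close>.\<close>

definition signed_powr :: "real \<Rightarrow> real \<Rightarrow> real" where
  "signed_powr q x = sgn x * \<bar>x\<bar> powr q"

lemma signed_powr_Hoelder:
  assumes q: "0 < q" "q \<le> 1"
  shows "\<bar>signed_powr q x - signed_powr q y\<bar> \<le> 2 * \<bar>x - y\<bar> powr q"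
proof -
  have same: "\<bar>x powr q - y powr q\<bar> \<le> \<bar>x - y\<bar> powr q" if "0 \<le> x" "0 \<le> y" for x y :: real
  proof -
    have "x powr q - y powr q \<le> \<bar>x - y\<bar> powr q" if "0 \<le> x" "0 \<le> y" for x y :: real
    proof -
      have "x powr q \<le> (y + \<bar>x - y\<bar>) powr q" using that q by (intro powr_mono2) auto
      also have "\<dots> \<le> y powr q + \<bar>x - y\<bar> powr q" using that q by (intro powr_subadditive) auto
      finally show ?thesis by simp
    qed
    from this[of x y] this[of y x] that show ?thesis by (auto simp: abs_le_iff abs_minus_commute)
  qed
  have opp: "x powr q + y powr q \<le> 2 * (x + y) powr q" if "0 \<le> x" "0 \<le> y" for x y :: real
  proof -
    have "x powr q \<le> (x + y) powr q" "y powr q \<le> (x + y) powr q"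
      using that q by (auto intro!: powr_mono2)
    then show ?thesis by simp
  qed
  have nn: "0 \<le> \<bar>x - y\<bar> powr q" by simp
  consider "x \<ge> 0" "y \<ge> 0" | "x < 0" "y < 0" | "x \<ge> 0" "y < 0" | "x < 0" "y \<ge> 0" by linarith
  then show ?thesis
  proof cases
    case 1
    then have "signed_powr q x = x powr q" "signed_powr q y = y powr q" by (auto simp: signed_powr_def sgn_if)
    then show ?thesis using same[OF 1] nn by simp
  next
    case 2
    then have "signed_powr q x = - ((- x) powr q)" "signed_powr q y = - ((- y) powr q)" by (auto simp: signed_powr_def sgn_if)
    then show ?thesis using same[of "- x" "- y"] 2 nn by (simp add: abs_minus_commute)
  next
    case 3
    then have "signed_powr q x = x powr q" "signed_powr q y = - ((- y) powr q)" by (auto simp: signed_powr_def sgn_if)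
    then show ?thesis using opp[of x "- y"] 3 by simp
  next
    case 4
    then have "signed_powr q x = - ((- x) powr q)" "signed_powr q y = y powr q" by (auto simp: signed_powr_def sgn_if)
    moreover have "\<bar>- ((- x) powr q) - y powr q\<bar> = (- x) powr q + y powr q"
    proof -
      have "0 \<le> (- x) powr q + y powr q" by simp
      then show ?thesis by linarith
    qed
    moreover have "\<bar>x - y\<bar> = - x + y" using 4 by simp
    ultimately show ?thesis using opp[of "- x" y] 4 by simp
  qed
qed

lemma DERIV_abs_powr:
  assumes "p > (1::real)"
  shows "((\<lambda>x. \<bar>x\<bar> powr p) has_real_derivative p * signed_powr (p - 1) x) (at x)"
proof -
  consider "x > 0" | "x < 0" | "x = 0" by linarith
  then show ?thesis
  proof cases
    case 1
    have "((\<lambda>x. x powr p) has_real_derivative p * x powr (p - 1)) (at x)"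
      using 1 by (rule has_real_derivative_powr)
    then have "((\<lambda>x. \<bar>x\<bar> powr p) has_real_derivative p * x powr (p - 1)) (at x)"
      by (rule has_field_derivative_transform_within_open[of _ _ _ "{0<..}"]) (use 1 in auto)
    then show ?thesis using 1 by (simp add: signed_powr_def)
  next
    case 2
    have "((\<lambda>x. (- x) powr p) has_real_derivative (p * (- x) powr (p - 1)) * (- 1)) (at x)"
      using 2 by (intro DERIV_chain2[OF has_real_derivative_powr]) (auto intro!: derivative_eq_intros)
    then have "((\<lambda>x. \<bar>x\<bar> powr p) has_real_derivative (p * (- x) powr (p - 1)) * (- 1)) (at x)"
      by (rule has_field_derivative_transform_within_open[of _ _ _ "{..<0}"]) (use 2 in auto)
    then show ?thesis using 2 by (simp add: signed_powr_def)
  next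
    case 3
    have "((\<lambda>h::real. \<bar>h\<bar> powr (p - 1)) \<longlongrightarrow> 0) (at 0)"
      using assms by (intro tendsto_zero_powrI[where b = "p - 1"] tendsto_rabs_zero tendsto_ident_at tendsto_const) auto
    then have "((\<lambda>h::real. (\<bar>0 + h\<bar> powr p - \<bar>0\<bar> powr p) / h) \<longlongrightarrow> 0) (at 0)"
    proof (rule Lim_null_comparison[rotated])
      show "\<forall>\<^sub>F h in at 0. norm ((\<bar>0 + h\<bar> powr p - \<bar>0\<bar> powr p) / h) \<le> \<bar>h\<bar> powr (p - 1)"
        by (auto simp: eventually_at_filter powr_diff abs_divide)
    qed
    then show ?thesis using 3 by (simp add: DERIV_def signed_powr_def)
  qed
qed

text \<open>Mean value theorem, with the derivative compared to its value at \<open>a\<close> by Hoelder continuity. The middle term is linear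
  in \<open>b\<close> and therefore has mean zero when \<open>b\<close> is centred given \<open>a\<close>. This is the inequality behind the moment
  bound of von Bahr and Esseen.\<close>

lemma abs_add_powr_le:
  fixes a b p :: real
  assumes p: "1 < p" "p \<le> 2"
  shows "\<bar>a + b\<bar> powr p \<le> \<bar>a\<bar> powr p + p * signed_powr (p - 1) a * b + 4 * \<bar>b\<bar> powr p"
proof -
  have mvt: "\<exists>z. \<bar>z - a\<bar> \<le> \<bar>b\<bar> \<and> \<bar>a + b\<bar> powr p - \<bar>a\<bar> powr p = b * (p * signed_powr (p - 1) z)"
  proof (cases b "0::real" rule: linorder_cases)
    case less
    have "\<exists>z>a + b. z < a \<and> \<bar>a\<bar> powr p - \<bar>a + b\<bar> powr p = (a - (a + b)) * (p * signed_powr (p - 1) z)"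
      using less by (intro MVT2 DERIV_abs_powr p) auto
    then obtain z where "a + b < z" "z < a" "\<bar>a\<bar> powr p - \<bar>a + b\<bar> powr p = (a - (a + b)) * (p * signed_powr (p - 1) z)" by auto
    then show ?thesis by (intro exI[of _ z]) auto
  next
    case equal
    then show ?thesis by (intro exI[of _ a]) auto
  next
    case greater
    have "\<exists>z>a. z < a + b \<and> \<bar>a + b\<bar> powr p - \<bar>a\<bar> powr p = ((a + b) - a) * (p * signed_powr (p - 1) z)"
      using greater by (intro MVT2 DERIV_abs_powr p) auto
    then obtain z where "a < z" "z < a + b" "\<bar>a + b\<bar> powr p - \<bar>a\<bar> powr p = ((a + b) - a) * (p * signed_powr (p - 1) z)" by auto
    then show ?thesis by (intro exI[of _ z]) auto
  qed
  then obtain z where z: "\<bar>z - a\<bar> \<le> \<bar>b\<bar>" "\<bar>a + b\<bar> powr p - \<bar>a\<bar> powr p = b * (p * signed_powr (p - 1) z)" by blast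
  have "b * (p * (signed_powr (p - 1) z - signed_powr (p - 1) a)) \<le> \<bar>b\<bar> * (p * \<bar>signed_powr (p - 1) z - signed_powr (p - 1) a\<bar>)"
  proof -
    have "b * (p * (signed_powr (p - 1) z - signed_powr (p - 1) a)) \<le> \<bar>b * (p * (signed_powr (p - 1) z - signed_powr (p - 1) a))\<bar>" by simp
    also have "\<dots> = \<bar>b\<bar> * (p * \<bar>signed_powr (p - 1) z - signed_powr (p - 1) a\<bar>)" using p by (simp add: abs_mult)
    finally show ?thesis .
  qed
  also have "\<dots> \<le> \<bar>b\<bar> * (p * (2 * \<bar>z - a\<bar> powr (p - 1)))"
    using p by (intro mult_left_mono signed_powr_Hoelder) auto
  also have "\<dots> \<le> \<bar>b\<bar> * (2 * (2 * \<bar>b\<bar> powr (p - 1)))"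
    using p z by (intro mult_left_mono mult_mono powr_mono2) auto
  also have "\<dots> = 4 * \<bar>b\<bar> powr p"
    using powr_mult_base[of "\<bar>b\<bar>" "p - 1"] by simp
  finally show ?thesis using z(2) by (simp add: algebra_simps)
qed

section \<open>Sums over the dead and the living particles\<close>

lemma eventually_restrict_box:
  assumes "finite D" "D \<subseteq> labels"
  shows "\<forall>\<^sub>F k in sequentially. D \<subseteq> label_box k"
proof -
  obtain k0 where "D \<subseteq> label_box k0" using finite_subset_box[OF assms] by auto
  then show ?thesis
    using box_mono by (intro eventually_sequentiallyI[of k0]) blast
qed

lemma sum_box_restrict:
  assumes "D \<subseteq> label_box k"
  shows "(\<Sum>x\<in>label_box k. if x \<in> D then f x else 0) = (\<Sum>x\<in>D. f x)"
  using assms by (simp add: sum.inter_restrict[symmetric] Int_absorb1)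

lemma prod_box_restrict:
  assumes "D \<subseteq> label_box k"
  shows "(\<Prod>x\<in>label_box k. if x \<in> D then f x else 1) = (\<Prod>x\<in>D. f x)"
  using assms by (simp add: prod.inter_restrict[symmetric] Int_absorb1)

definition is_alive :: "real \<Rightarrow> nat list \<Rightarrow> (nat list \<Rightarrow> mark) \<Rightarrow> bool" where
  "is_alive t x w \<longleftrightarrow> tree x w \<and> birth_time x w \<le> t \<and> t < birth_time x w + mark_E x w"

text \<open>Life times are nonnegative almost surely but not everywhere. Requiring the birth before \<open>t\<close> as well makes dead
  particles a subset of the particles born by time \<open>t\<close> at every point.\<close>

definition is_dead :: "real \<Rightarrow> nat list \<Rightarrow> (nat list \<Rightarrow> mark) \<Rightarrow> bool" where
  "is_dead t x w \<longleftrightarrow> tree x w \<and> birth_time x w \<le> t \<and> birth_time x w + mark_E x w \<le> t"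

lemma alive_eq: "alive mark_E mark_N t w = {x. is_alive t x w}"
  by (auto simp: alive_def is_alive_def death_def)

lemma dead_eq:
  assumes "\<forall>x\<in>labels. mark_E x w \<ge> 0"
  shows "dead mark_E mark_N t w = {x. is_dead t x w}"
  using assms by (force simp: dead_def is_dead_def death_def dest: in_tree_labels)

lemma is_alive_labels: "is_alive t x w \<Longrightarrow> x \<in> labels" and is_dead_labels: "is_dead t x w \<Longrightarrow> x \<in> labels"
  by (auto simp: is_alive_def is_dead_def dest: in_tree_labels)

context mark_space
begin

text \<open>A functional of a random set of labels is the limit of its versions on boxes. The value \<open>c\<close> for infinite sets is the
  convention for sums and products (\<open>0\<close> and \<open>1\<close>).\<close>

lemma measurable_of_finite_label_set:
  fixes v :: "(nat list \<Rightarrow> mark) \<Rightarrow> 'c::metric_space"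
  assumes D: "\<And>x. x \<in> labels \<Longrightarrow> Measurable.pred \<Omega> (D x)" "\<And>x w. D x w \<Longrightarrow> x \<in> labels"
    and u [measurable]: "\<And>k. u k \<in> borel_measurable \<Omega>"
    and fin: "\<And>k w. {x. D x w} \<subseteq> label_box k \<Longrightarrow> v w = u k w"
    and inf: "\<And>w. infinite {x. D x w} \<Longrightarrow> v w = c"
  shows "v \<in> borel_measurable \<Omega>"
proof -
  define in_box where "in_box k w \<longleftrightarrow> (\<forall>x\<in>labels. D x w \<longrightarrow> x \<in> label_box k)" for k w
  have [measurable]: "Measurable.pred \<Omega> (in_box k)" for k
    unfolding in_box_def[abs_def] using D(1)
    by (intro pred_intros_countable_bounded countable_labels pred_intros_logic) auto
  have in_box: "in_box k w \<longleftrightarrow> {x. D x w} \<subseteq> label_box k" for k w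
    using D(2) by (auto simp: in_box_def)
  show ?thesis
  proof (rule borel_measurable_LIMSEQ_metric)
    show "(\<lambda>w. if in_box k w then u k w else c) \<in> borel_measurable \<Omega>" for k by measurable
    fix w
    show "(\<lambda>k. if in_box k w then u k w else c) \<longlonglongrightarrow> v w"
    proof (cases "finite {x. D x w}")
      case True
      then have "\<forall>\<^sub>F k in sequentially. {x. D x w} \<subseteq> label_box k"
        using D(2) by (intro eventually_restrict_box) auto
      then have "\<forall>\<^sub>F k in sequentially. v w = (if in_box k w then u k w else c)"
        by eventually_elim (simp add: in_box fin)
      then show ?thesis by (rule Lim_transform_eventually[OF tendsto_const])
    next
      case False
      then have "\<not> in_box k w" for k
        using finite_subset[of "{x. D x w}" "label_box k"] by (auto simp: in_box)
      then show ?thesis using False by (simp add: inf)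
    qed
  qed
qed

lemma random_sum_measurable:
  fixes f :: "nat list \<Rightarrow> (nat list \<Rightarrow> mark) \<Rightarrow> real"
  assumes D: "\<And>x. x \<in> labels \<Longrightarrow> Measurable.pred \<Omega> (D x)" "\<And>x w. D x w \<Longrightarrow> x \<in> labels"
    and f: "\<And>x. x \<in> labels \<Longrightarrow> f x \<in> borel_measurable \<Omega>"
  shows "(\<lambda>w. \<Sum>x | D x w. f x w) \<in> borel_measurable \<Omega>"
proof (rule measurable_of_finite_label_set[OF D])
  show "(\<lambda>w. \<Sum>x\<in>label_box k. if D x w then f x w else 0) \<in> borel_measurable \<Omega>" for k
    by (intro borel_measurable_sum measurable_If f D(1)[unfolded pred_def] borel_measurable_const) (auto dest: box_labels)
  show "(\<Sum>x | D x w. f x w) = (\<Sum>x\<in>label_box k. if D x w then f x w else 0)" if "{x. D x w} \<subseteq> label_box k" for k w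
    using sum_box_restrict[OF that, of "\<lambda>x. f x w"] by simp
qed auto

lemma random_prod_measurable:
  fixes f :: "nat list \<Rightarrow> (nat list \<Rightarrow> mark) \<Rightarrow> complex"
  assumes D: "\<And>x. x \<in> labels \<Longrightarrow> Measurable.pred \<Omega> (D x)" "\<And>x w. D x w \<Longrightarrow> x \<in> labels"
    and f: "\<And>x. x \<in> labels \<Longrightarrow> f x \<in> borel_measurable \<Omega>"
  shows "(\<lambda>w. \<Prod>x | D x w. f x w) \<in> borel_measurable \<Omega>"
proof (rule measurable_of_finite_label_set[OF D])
  show "(\<lambda>w. \<Prod>x\<in>label_box k. if D x w then f x w else 1) \<in> borel_measurable \<Omega>" for k
    by (intro borel_measurable_prod measurable_If f D(1)[unfolded pred_def] borel_measurable_const) (auto dest: box_labels)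
  show "(\<Prod>x | D x w. f x w) = (\<Prod>x\<in>label_box k. if D x w then f x w else 1)" if "{x. D x w} \<subseteq> label_box k" for k w
    using prod_box_restrict[OF that, of "\<lambda>x. f x w"] by simp
qed auto

lemma is_alive_measurable [measurable]: "x \<in> labels \<Longrightarrow> Measurable.pred \<Omega> (is_alive t x)"
  unfolding is_alive_def[abs_def] by measurable

lemma is_dead_measurable [measurable]: "x \<in> labels \<Longrightarrow> Measurable.pred \<Omega> (is_dead t x)"
  unfolding is_dead_def[abs_def] by measurable

text \<open>The box bounds are uniform; monotone convergence removes the box. An inequality suffices because the sum over an
  infinite set is \<open>0\<close>.\<close>

lemma alive_sum_moment:
  assumes m: "weight_moment \<theta> = ennreal m" "m \<ge> 0" and "t \<ge> 0"
  shows "(\<integral>\<^sup>+ w. ennreal (\<Sum>x | is_alive t x w. exp (\<theta> * pos x w)) \<partial>\<Omega>) \<le> ennreal (exp ((m - 1) * t))"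
proof -
  define g where "g k w = (\<Sum>x\<in>label_box k. tree_weight \<theta> x w * indicator {w. birth_time x w \<le> t \<and> t < birth_time x w + mark_E x w} w)" for k w
  have meas: "(\<lambda>w. tree_weight \<theta> x w * indicator {w. birth_time x w \<le> t \<and> t < birth_time x w + mark_E x w} w) \<in> borel_measurable \<Omega>"
    if [measurable]: "x \<in> labels" for x
  proof -
    have "(\<lambda>w. tree_weight \<theta> x w * (if birth_time x w \<le> t \<and> t < birth_time x w + mark_E x w then 1 else 0)) \<in> borel_measurable \<Omega>"
      by measurable
    also have "(\<lambda>w. tree_weight \<theta> x w * (if birth_time x w \<le> t \<and> t < birth_time x w + mark_E x w then 1 else 0)) =
       (\<lambda>w. tree_weight \<theta> x w * indicator {w. birth_time x w \<le> t \<and> t < birth_time x w + mark_E x w} w)"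
      by (auto simp: indicator_def)
    finally show ?thesis .
  qed
  have gm [measurable]: "g k \<in> borel_measurable \<Omega>" for k
    unfolding g_def[abs_def] by (intro borel_measurable_sum meas) (auto dest: box_labels)
  have g_eq: "g k w = (\<Sum>x\<in>label_box k. ennreal (if is_alive t x w then exp (\<theta> * pos x w) else 0))" for k w
    unfolding g_def by (intro sum.cong) (auto simp: tree_weight_def is_alive_def indicator_def)
  have "(\<integral>\<^sup>+ w. ennreal (\<Sum>x | is_alive t x w. exp (\<theta> * pos x w)) \<partial>\<Omega>) \<le> (\<integral>\<^sup>+ w. (SUP k. g k w) \<partial>\<Omega>)"
  proof (rule nn_integral_mono)
    fix w
    show "ennreal (\<Sum>x | is_alive t x w. exp (\<theta> * pos x w)) \<le> (SUP k. g k w)"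
    proof (cases "finite {x. is_alive t x w}")
      case True
      then obtain k where k: "{x. is_alive t x w} \<subseteq> label_box k"
        using finite_subset_box[of "{x. is_alive t x w}"] is_alive_labels by auto
      have "ennreal (\<Sum>x | is_alive t x w. exp (\<theta> * pos x w)) = g k w"
        unfolding g_eq using sum_box_restrict[OF k, of "\<lambda>x. exp (\<theta> * pos x w)"] by simp
      then show ?thesis by (intro SUP_upper2[of k]) auto
    qed simp
  qed
  also have "\<dots> = (SUP k. \<integral>\<^sup>+ w. g k w \<partial>\<Omega>)"
  proof (rule nn_integral_monotone_convergence_SUP)
    show "incseq g"
      unfolding incseq_def le_fun_def g_def using box_mono by (auto intro!: sum_mono2)
  qed measurable
  also have "\<dots> \<le> ennreal (exp ((m - 1) * t))"
  proof (rule SUP_least)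
    fix k
    have "(\<integral>\<^sup>+ w. g k w \<partial>\<Omega>) = (\<Sum>x\<in>label_box k. \<integral>\<^sup>+ w. tree_weight \<theta> x w * indicator {w. birth_time x w \<le> t \<and> t < birth_time x w + mark_E x w} w \<partial>\<Omega>)"
      unfolding g_def by (intro nn_integral_sum meas) (auto dest: box_labels)
    also have "\<dots> \<le> ennreal (exp ((m - 1) * t))" by (rule alive_moment_bound) fact+
    finally show "(\<integral>\<^sup>+ w. g k w \<partial>\<Omega>) \<le> ennreal (exp ((m - 1) * t))" .
  qed
  finally show ?thesis .
qed

definition dead_term :: "real \<Rightarrow> nat list \<Rightarrow> (nat list \<Rightarrow> mark) \<Rightarrow> real" where
  "dead_term t x w = (if is_dead t x w then exp (pos x w) * mark_C x w else 0)"

lemma dead_term_measurable [measurable]: "x \<in> labels \<Longrightarrow> dead_term t x \<in> borel_measurable \<Omega>"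
  unfolding dead_term_def[abs_def] by measurable

lemma dead_term_moment:
  assumes x: "x \<in> labels" and p: "p > 0"
  shows "(\<integral>\<^sup>+ w. ennreal (\<bar>dead_term t x w\<bar> powr p) \<partial>\<Omega>) \<le>
    (\<integral>\<^sup>+ w. tree_weight p x w * indicator {..t} (birth_time x w) \<partial>\<Omega>) * (\<integral>\<^sup>+ u. ennreal (\<bar>fst (snd u)\<bar> powr p) \<partial>Off)"
proof -
  note [measurable] = x
  have "(\<integral>\<^sup>+ w. ennreal (\<bar>dead_term t x w\<bar> powr p) \<partial>\<Omega>) \<le>
     (\<integral>\<^sup>+ w. tree_weight p x w * indicator {..t} (birth_time x w) * ennreal (\<bar>mark_C x w\<bar> powr p) \<partial>\<Omega>)"
  proof (rule nn_integral_mono)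
    fix w
    have "exp (pos x w) powr p = exp (p * pos x w)" by (simp add: powr_def mult.commute)
    then show "ennreal (\<bar>dead_term t x w\<bar> powr p) \<le> tree_weight p x w * indicator {..t} (birth_time x w) * ennreal (\<bar>mark_C x w\<bar> powr p)"
      by (auto simp: dead_term_def is_dead_def tree_weight_def abs_mult powr_mult ennreal_mult)
  qed
  also have "\<dots> = (\<integral>\<^sup>+ w. \<integral>\<^sup>+ y. tree_weight p x w * indicator {..t} (birth_time x w) * ennreal (\<bar>fst (snd (snd (snd y)))\<bar> powr p) \<partial>Mark \<partial>\<Omega>)"
    by (subst nn_integral_resample[OF x, symmetric]) (simp_all add: mark_C_def)
  also have "\<dots> = (\<integral>\<^sup>+ w. (tree_weight p x w * indicator {..t} (birth_time x w)) * (\<integral>\<^sup>+ u. ennreal (\<bar>fst (snd u)\<bar> powr p) \<partial>Off) \<partial>\<Omega>)"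
  proof (rule nn_integral_cong)
    fix w
    have "(\<integral>\<^sup>+ y. ennreal (\<bar>fst (snd (snd (snd y)))\<bar> powr p) \<partial>Mark) = (\<integral>\<^sup>+ y. (\<lambda>_. 1) (fst y) * ennreal (\<bar>fst (snd (snd (snd y)))\<bar> powr p) \<partial>Mark)"
      by simp
    also have "\<dots> = (\<integral>\<^sup>+ e. 1 \<partial>expo) * (\<integral>\<^sup>+ u. ennreal (\<bar>fst (snd u)\<bar> powr p) \<partial>Off)"
      by (rule nn_integral_Mark_mult) measurable
    finally have eq: "(\<integral>\<^sup>+ y. ennreal (\<bar>fst (snd (snd (snd y)))\<bar> powr p) \<partial>Mark) = (\<integral>\<^sup>+ u. ennreal (\<bar>fst (snd u)\<bar> powr p) \<partial>Off)"
      using E.emeasure_space_1 by simp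
    show "(\<integral>\<^sup>+ y. tree_weight p x w * indicator {..t} (birth_time x w) * ennreal (\<bar>fst (snd (snd (snd y)))\<bar> powr p) \<partial>Mark) =
       (tree_weight p x w * indicator {..t} (birth_time x w)) * (\<integral>\<^sup>+ u. ennreal (\<bar>fst (snd u)\<bar> powr p) \<partial>Off)"
      by (subst nn_integral_cmult) (auto simp: eq)
  qed
  also have "\<dots> = (\<integral>\<^sup>+ w. tree_weight p x w * indicator {..t} (birth_time x w) \<partial>\<Omega>) * (\<integral>\<^sup>+ u. ennreal (\<bar>fst (snd u)\<bar> powr p) \<partial>Off)"
    by (rule nn_integral_multc) measurable
  finally show ?thesis .
qed

text \<open>The event that \<open>x\<close> is dead by time \<open>t\<close> depends on the life time of \<open>x\<close> and on its ancestors but not on \<open>C(x)\<close>.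
  Redrawing the mark of \<open>x\<close> therefore integrates \<open>C(x)\<close> to zero.\<close>

lemma dead_term_centred:
  assumes x: "x \<in> labels" and C: "integrable Off (\<lambda>u. fst (snd u))" "(\<integral>u. fst (snd u) \<partial>Off) = 0"
    and a: "a \<in> borel_measurable \<Omega>" "\<And>w y. a (w(x := y)) = a w" and int: "integrable \<Omega> (\<lambda>w. a w * dead_term t x w)"
  shows "(\<integral>w. a w * dead_term t x w \<partial>\<Omega>) = 0"
proof -
  have "(\<integral>w. a w * dead_term t x w \<partial>\<Omega>) = (\<integral>w. (\<integral>y. a (w(x := y)) * dead_term t x (w(x := y)) \<partial>Mark) \<partial>\<Omega>)"
    using redraws_integral[OF redraws_mark[OF x] int] by simp
  also have "\<dots> = (\<integral>w. 0 \<partial>\<Omega>)"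
  proof (rule Bochner_Integration.integral_cong[OF refl])
    fix w
    define b where "b = birth_time x w"
    define Y where "Y y = (if b \<le> t \<and> b + fst y \<le> t then 1 else 0) * fst (snd (snd (snd y)))" for y :: mark
    have CM: "integrable Mark (\<lambda>y. fst (snd (snd (snd y))))"
    proof -
      have "distr Mark Off (\<lambda>y. snd (snd y)) = Off"
      proof -
        have "distr Mark Off (\<lambda>y. snd (snd y)) = distr (distr Mark (\<nu>\<^sub>0 \<Otimes>\<^sub>M Off) snd) Off snd"
          unfolding Mark_def by (subst distr_distr) (auto simp: comp_def)
        also have "\<dots> = Off"
          unfolding Mark_def distr_snd_pair[OF E.prob_space_axioms RO.P.prob_space_axioms]
          by (rule distr_snd_pair[OF R.prob_space_axioms prob_space_Off])
        finally show ?thesis .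
      qed
      moreover have "(\<lambda>y. snd (snd y)) \<in> measurable Mark Off" unfolding Mark_def by measurable
      ultimately show ?thesis using integrable_distr_eq[of "\<lambda>y. snd (snd y)" Mark Off "\<lambda>u. fst (snd u)"] C(1) by simp
    qed
    have "integrable Mark Y"
    proof (rule Bochner_Integration.integrable_bound[OF CM])
      show "Y \<in> borel_measurable Mark" unfolding Y_def[abs_def] by measurable
    qed (auto simp: Y_def)
    then have "(\<integral>y. Y y \<partial>Mark) = (\<integral>e. (\<integral>y. Y (e, y) \<partial>(\<nu>\<^sub>0 \<Otimes>\<^sub>M Off)) \<partial>expo)"
      by (rule integral_Mark)
    also have "\<dots> = (\<integral>e. 0 \<partial>expo)"
    proof (rule Bochner_Integration.integral_cong[OF refl])
      fix e
      have "(\<integral>y. Y (e, y) \<partial>(\<nu>\<^sub>0 \<Otimes>\<^sub>M Off)) = (if b \<le> t \<and> b + e \<le> t then 1 else 0) * (\<integral>y. fst (snd (snd y)) \<partial>(\<nu>\<^sub>0 \<Otimes>\<^sub>M Off))"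
        by (simp add: Y_def)
      then show "(\<integral>y. Y (e, y) \<partial>(\<nu>\<^sub>0 \<Otimes>\<^sub>M Off)) = 0"
        using integral_RO_snd[of "\<lambda>u. fst (snd u)"] C(2) by simp
    qed
    finally have Y0: "(\<integral>y. Y y \<partial>Mark) = 0" by simp
    have "(\<integral>y. a (w(x := y)) * dead_term t x (w(x := y)) \<partial>Mark) = (\<integral>y. (a w * (if tree x w then exp (pos x w) else 0)) * Y y \<partial>Mark)"
      by (intro Bochner_Integration.integral_cong refl)
         (auto simp: a(2) dead_term_def is_dead_def Y_def b_def mark_defs)
    also have "\<dots> = 0" using Y0 by simp
    finally show "(\<integral>y. a (w(x := y)) * dead_term t x (w(x := y)) \<partial>Mark) = 0" .
  qed
  finally show ?thesis by simp
qed

lemma dead_term_upd: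
  assumes "y \<noteq> x" "length y \<le> length x"
  shows "dead_term t y (w(x := z)) = dead_term t y w"
  using assms by (simp add: dead_term_def is_dead_def mark_defs)

text \<open>Add the labels in order of length. A new term at \<open>x\<close> is centred given the terms at labels not longer than \<open>x\<close>, which
  are all invariant under redrawing the mark of \<open>x\<close>; so the linear term of \<open>abs_add_powr_le\<close> integrates to zero
  and each label costs at most four times its own moment. For \<open>p = 1\<close> this is the triangle inequality.\<close>

lemma dead_sum_moment_finite:
  assumes p: "p = 1 \<or> (1 < p \<and> p \<le> 2 \<and> (\<integral>u. fst (snd u) \<partial>Off) = 0)"
    and C: "integrable Off (\<lambda>u. fst (snd u))"
    and fin: "\<And>x. x \<in> F \<Longrightarrow> integrable \<Omega> (\<lambda>w. \<bar>dead_term t x w\<bar> powr p)"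
    and "finite F" "F \<subseteq> labels"
  shows "integrable \<Omega> (\<lambda>w. \<bar>\<Sum>x\<in>F. dead_term t x w\<bar> powr p) \<and>
    (\<integral>w. \<bar>\<Sum>x\<in>F. dead_term t x w\<bar> powr p \<partial>\<Omega>) \<le> 4 * (\<Sum>x\<in>F. \<integral>w. \<bar>dead_term t x w\<bar> powr p \<partial>\<Omega>)"
  using \<open>finite F\<close> fin \<open>F \<subseteq> labels\<close>
proof (induction F rule: finite_ranking_induct[where f = length])
  case (insert x F)
  show ?case
  proof (cases "x \<in> F")
    case True
    then show ?thesis using insert by (simp add: insert_absorb)
  next
    case False
    have x [measurable]: "x \<in> labels" using insert by simp
    have F: "y \<in> labels" if "y \<in> F" for y using insert that by auto
    define a where "a w = (\<Sum>y\<in>F. dead_term t y w)" for w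
    have [measurable]: "a \<in> borel_measurable \<Omega>"
      unfolding a_def[abs_def] using F by (intro borel_measurable_sum dead_term_measurable)
    have a_upd: "a (w(x := z)) = a w" for w z
      unfolding a_def using False insert.hyps by (intro sum.cong dead_term_upd) auto
    have IH: "integrable \<Omega> (\<lambda>w. \<bar>a w\<bar> powr p)"
      "(\<integral>w. \<bar>a w\<bar> powr p \<partial>\<Omega>) \<le> 4 * (\<Sum>x\<in>F. \<integral>w. \<bar>dead_term t x w\<bar> powr p \<partial>\<Omega>)"
      using insert unfolding a_def by auto
    have ib: "integrable \<Omega> (\<lambda>w. \<bar>dead_term t x w\<bar> powr p)" using insert by simp
    have "\<exists>g. integrable \<Omega> g \<and> (\<integral>w. g w \<partial>\<Omega>) = 0 \<and>
      (\<forall>w. \<bar>a w + dead_term t x w\<bar> powr p \<le> \<bar>a w\<bar> powr p + g w + 4 * \<bar>dead_term t x w\<bar> powr p)"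
    proof (cases "p = 1")
      case True
      have "\<bar>a w + dead_term t x w\<bar> \<le> \<bar>a w\<bar> + 4 * \<bar>dead_term t x w\<bar>" for w by linarith
      then show ?thesis using True by (intro exI[of _ "\<lambda>_. 0"]) simp
    next
      case False
      then have p': "1 < p" "p \<le> 2" and C0: "(\<integral>u. fst (snd u) \<partial>Off) = 0" using p by auto
      define s where "s w = p * signed_powr (p - 1) (a w)" for w
      have s_meas [measurable]: "s \<in> borel_measurable \<Omega>"
        unfolding s_def[abs_def] signed_powr_def by measurable
      \<comment> \<open>\<open>\<bar>a\<bar>\<^bsup>p-1\<^esup> \<bar>d\<bar>\<close> is at most the \<open>p\<close>-th power of the larger of \<open>\<bar>a\<bar>\<close> and \<open>\<bar>d\<bar>\<close>\<close>
      have young: "\<bar>s w * dead_term t x w\<bar> \<le> 2 * (\<bar>a w\<bar> powr p + \<bar>dead_term t x w\<bar> powr p)" for w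
      proof -
        have "\<bar>a w\<bar> powr (p - 1) * \<bar>d\<bar> \<le> \<bar>a w\<bar> powr p + \<bar>d\<bar> powr p" for d
        proof (cases "\<bar>d\<bar> \<le> \<bar>a w\<bar>")
          case True
          have "\<bar>a w\<bar> powr (p - 1) * \<bar>d\<bar> \<le> \<bar>a w\<bar> powr (p - 1) * \<bar>a w\<bar>" using True by (intro mult_left_mono) auto
          also have "\<dots> = \<bar>a w\<bar> powr p" using powr_mult_base[of "\<bar>a w\<bar>" "p - 1"] by (simp add: mult.commute)
          finally show ?thesis by (simp add: add_increasing2)
        next
          case False
          have "\<bar>a w\<bar> powr (p - 1) * \<bar>d\<bar> \<le> \<bar>d\<bar> powr (p - 1) * \<bar>d\<bar>" using False p' by (intro mult_right_mono powr_mono2) auto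
          also have "\<dots> = \<bar>d\<bar> powr p" using powr_mult_base[of "\<bar>d\<bar>" "p - 1"] by (simp add: mult.commute)
          finally show ?thesis by (simp add: add_increasing)
        qed
        note base = this[of "dead_term t x w"]
        have "\<bar>s w * dead_term t x w\<bar> \<le> p * (\<bar>a w\<bar> powr (p - 1) * \<bar>dead_term t x w\<bar>)"
          using p' by (auto simp: s_def signed_powr_def abs_mult sgn_if)
        also have "\<dots> \<le> 2 * (\<bar>a w\<bar> powr p + \<bar>dead_term t x w\<bar> powr p)"
          using p' base by (intro mult_mono) auto
        finally show ?thesis .
      qed
      have "integrable \<Omega> (\<lambda>w. s w * dead_term t x w)"
      proof (rule Bochner_Integration.integrable_bound)
        show "integrable \<Omega> (\<lambda>w. 2 * (\<bar>a w\<bar> powr p + \<bar>dead_term t x w\<bar> powr p))" using IH ib by simp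
        show "AE w in \<Omega>. norm (s w * dead_term t x w) \<le> norm (2 * (\<bar>a w\<bar> powr p + \<bar>dead_term t x w\<bar> powr p))"
          using young by (intro AE_I2) (simp add: abs_of_nonneg)
      qed measurable
      moreover have "(\<integral>w. s w * dead_term t x w \<partial>\<Omega>) = 0"
        by (rule dead_term_centred[OF x C C0 s_meas _ calculation]) (simp add: s_def a_upd)
      moreover have "\<bar>a w + dead_term t x w\<bar> powr p \<le> \<bar>a w\<bar> powr p + s w * dead_term t x w + 4 * \<bar>dead_term t x w\<bar> powr p" for w
        unfolding s_def by (rule abs_add_powr_le[OF p'])
      ultimately show ?thesis by blast
    qed
    then obtain g where g: "integrable \<Omega> g" "(\<integral>w. g w \<partial>\<Omega>) = 0"
      "\<And>w. \<bar>a w + dead_term t x w\<bar> powr p \<le> \<bar>a w\<bar> powr p + g w + 4 * \<bar>dead_term t x w\<bar> powr p" by blast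
    have sum_eq: "(\<Sum>y\<in>insert x F. dead_term t y w) = a w + dead_term t x w" for w
      using False insert.hyps by (simp add: a_def)
    have int: "integrable \<Omega> (\<lambda>w. \<bar>a w + dead_term t x w\<bar> powr p)"
    proof (rule Bochner_Integration.integrable_bound)
      show "integrable \<Omega> (\<lambda>w. \<bar>a w\<bar> powr p + g w + 4 * \<bar>dead_term t x w\<bar> powr p)" using IH ib g by simp
      show "AE w in \<Omega>. norm (\<bar>a w + dead_term t x w\<bar> powr p) \<le> norm (\<bar>a w\<bar> powr p + g w + 4 * \<bar>dead_term t x w\<bar> powr p)"
        using order_trans[OF g(3) abs_ge_self] by (intro AE_I2) simp
    qed measurable
    have "(\<integral>w. \<bar>a w + dead_term t x w\<bar> powr p \<partial>\<Omega>) \<le> (\<integral>w. \<bar>a w\<bar> powr p + g w + 4 * \<bar>dead_term t x w\<bar> powr p \<partial>\<Omega>)"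
      using int IH ib g by (intro integral_mono) auto
    also have "\<dots> = (\<integral>w. \<bar>a w\<bar> powr p \<partial>\<Omega>) + 4 * (\<integral>w. \<bar>dead_term t x w\<bar> powr p \<partial>\<Omega>)"
      using IH ib g by simp
    also have "\<dots> \<le> 4 * (\<Sum>x\<in>insert x F. \<integral>w. \<bar>dead_term t x w\<bar> powr p \<partial>\<Omega>)"
      using IH(2) False insert.hyps by simp
    finally show ?thesis unfolding sum_eq using int by blast
  qed
qed simp

end

section \<open>Characteristic functions of the two parts\<close>

text \<open>Markov's inequality: the perturbation moves the exponential by at most \<open>\<bar>Y\<bar> \<le> e\<close>, or else by at most \<open>2\<close>.\<close>

lemma (in prob_space) char_perturbation:
  assumes [measurable]: "X \<in> borel_measurable M" "Y \<in> borel_measurable M"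
    and "p > 0" "e > 0" and Y: "(\<integral>\<^sup>+ \<omega>. ennreal (\<bar>Y \<omega>\<bar> powr p) \<partial>M) \<le> ennreal B" and "B \<ge> 0"
  shows "norm ((CLINT \<omega>|M. iexp (X \<omega> + Y \<omega>)) - (CLINT \<omega>|M. iexp (X \<omega>))) \<le> e + 2 * e powr (- p) * B"
proof -
  have int: "integrable M (\<lambda>\<omega>. \<bar>Y \<omega>\<bar> powr p)"
    using Y by (intro integrableI_bounded) (auto simp: le_less_trans[OF _ ennreal_less_top])
  have "ennreal (\<integral>\<omega>. \<bar>Y \<omega>\<bar> powr p \<partial>M) = (\<integral>\<^sup>+ \<omega>. ennreal (\<bar>Y \<omega>\<bar> powr p) \<partial>M)"
    using int by (intro nn_integral_eq_integral[symmetric]) auto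
  with Y \<open>B \<ge> 0\<close> have intB: "(\<integral>\<omega>. \<bar>Y \<omega>\<bar> powr p \<partial>M) \<le> B" by (metis ennreal_le_iff)
  have i1: "complex_integrable M (\<lambda>\<omega>. iexp (X \<omega> + Y \<omega>))" "complex_integrable M (\<lambda>\<omega>. iexp (X \<omega>))"
    by (rule integrable_const_bound[where B = 1]; auto)+
  have pt: "norm (iexp (x + y) - iexp x) \<le> e + 2 * e powr (- p) * \<bar>y\<bar> powr p" for x y :: real
  proof -
    have eq: "norm (iexp (x + y) - iexp x) = norm (iexp y - 1)"
    proof -
      have "iexp (x + y) - iexp x = iexp x * (iexp y - 1)" by (simp add: distrib_left exp_add algebra_simps)
      then show ?thesis by (simp add: norm_mult)
    qed
    show ?thesis
    proof (cases "\<bar>y\<bar> \<le> e")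
      case True
      have "norm (iexp y - 1) \<le> \<bar>y\<bar>"
        using iexp_approx1[of y 0] by simp
      then show ?thesis using True eq \<open>e > 0\<close> by (smt (verit) powr_ge_zero mult_nonneg_nonneg)
    next
      case False
      then have "1 \<le> (\<bar>y\<bar> / e) powr p" using \<open>e > 0\<close> \<open>p > 0\<close> by (intro ge_one_powr_ge_zero) (auto simp: field_simps)
      also have "\<dots> = e powr (- p) * \<bar>y\<bar> powr p" using \<open>e > 0\<close> by (simp add: powr_divide powr_minus field_simps)
      finally have "2 \<le> 2 * e powr (- p) * \<bar>y\<bar> powr p" by simp
      moreover have "norm (iexp y - 1) \<le> 2" using norm_triangle_ineq4[of "iexp y" 1] by simp
      ultimately show ?thesis using eq \<open>e > 0\<close> by linarith
    qed
  qed
  have "norm ((CLINT \<omega>|M. iexp (X \<omega> + Y \<omega>)) - (CLINT \<omega>|M. iexp (X \<omega>))) = norm (CLINT \<omega>|M. iexp (X \<omega> + Y \<omega>) - iexp (X \<omega>))"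
    by (simp only: Bochner_Integration.integral_diff[OF i1])
  also have "\<dots> \<le> (\<integral>\<omega>. norm (iexp (X \<omega> + Y \<omega>) - iexp (X \<omega>)) \<partial>M)" by (rule integral_norm_bound)
  also have "\<dots> \<le> (\<integral>\<omega>. e + 2 * e powr (- p) * \<bar>Y \<omega>\<bar> powr p \<partial>M)"
    using i1 int pt by (intro integral_mono) auto
  also have "\<dots> = e + 2 * e powr (- p) * (\<integral>\<omega>. \<bar>Y \<omega>\<bar> powr p \<partial>M)"
    using int by (simp add: prob_space)
  also have "\<dots> \<le> e + 2 * e powr (- p) * B"
    using intB by (intro add_left_mono mult_left_mono) auto
  finally show ?thesis .
qed

context mark_space
begin

text \<open>Fatou's lemma extends the uniform box bounds to all dead particles, since for almost every family of marks the boxes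
  eventually contain them all.\<close>

lemma dead_sum_moment:
  assumes p: "p = 1 \<or> (1 < p \<and> p \<le> 2 \<and> (\<integral>u. fst (snd u) \<partial>Off) = 0)"
    and C: "integrable Off (\<lambda>u. fst (snd u))" and Cp: "(\<integral>\<^sup>+ u. ennreal (\<bar>fst (snd u)\<bar> powr p) \<partial>Off) = ennreal cp" "cp \<ge> 0"
    and m: "weight_moment p = ennreal m" "m \<ge> 0" and c: "c \<ge> 0" "c > m - 1"
    and fin: "AE w in \<Omega>. finite {x. tree x w \<and> birth_time x w \<le> t}"
  shows "(\<integral>\<^sup>+ w. ennreal (\<bar>\<Sum>x | is_dead t x w. exp (pos x w) * mark_C x w\<bar> powr p) \<partial>\<Omega>) \<le>
     ennreal (4 * ((1 + c) / (1 + c - m) * exp (c * t) * cp))"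
proof -
  have "p > 0" using p by auto
  define B where "B = (1 + c) / (1 + c - m) * exp (c * t)"
  have "B \<ge> 0" using c m by (simp add: B_def)
  define b where "b x = (\<integral>\<^sup>+ w. tree_weight p x w * indicator {..t} (birth_time x w) \<partial>\<Omega>)" for x
  have b: "(\<Sum>x\<in>label_box k. b x) \<le> ennreal B" for k
    unfolding b_def B_def by (rule born_moment_bound) fact+
  have term_le: "(\<integral>\<^sup>+ w. ennreal (\<bar>dead_term t x w\<bar> powr p) \<partial>\<Omega>) \<le> b x * ennreal cp" if "x \<in> labels" for x
    using dead_term_moment[OF that \<open>p > 0\<close>] unfolding b_def Cp(1) .
  have int: "integrable \<Omega> (\<lambda>w. \<bar>dead_term t x w\<bar> powr p)" if x: "x \<in> labels" for x
  proof (rule integrableI_bounded)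
    show "(\<lambda>w. \<bar>dead_term t x w\<bar> powr p) \<in> borel_measurable \<Omega>" using x by measurable
    obtain k where "x \<in> label_box k" using in_some_box[OF x] by auto
    then have "b x \<le> (\<Sum>x\<in>label_box k. b x)" by (intro member_le_sum) auto
    then have "b x \<le> ennreal B" using b by (rule order_trans)
    then have "b x * ennreal cp \<le> ennreal B * ennreal cp" by (rule mult_right_mono) simp
    also have "\<dots> < \<infinity>" by (simp add: ennreal_mult_less_top)
    finally have "b x * ennreal cp < \<infinity>" .
    with term_le[OF x] show "(\<integral>\<^sup>+ w. ennreal (norm (\<bar>dead_term t x w\<bar> powr p)) \<partial>\<Omega>) < \<infinity>" by simp
  qed
  have box_bound: "(\<integral>\<^sup>+ w. ennreal (\<bar>\<Sum>x\<in>label_box k. dead_term t x w\<bar> powr p) \<partial>\<Omega>) \<le> ennreal (4 * (B * cp))" for k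
  proof -
    have *: "integrable \<Omega> (\<lambda>w. \<bar>\<Sum>x\<in>label_box k. dead_term t x w\<bar> powr p) \<and>
      (\<integral>w. \<bar>\<Sum>x\<in>label_box k. dead_term t x w\<bar> powr p \<partial>\<Omega>) \<le> 4 * (\<Sum>x\<in>label_box k. \<integral>w. \<bar>dead_term t x w\<bar> powr p \<partial>\<Omega>)"
      by (rule dead_sum_moment_finite[OF p C]) (use int box_labels in auto)
    have "ennreal (\<Sum>x\<in>label_box k. \<integral>w. \<bar>dead_term t x w\<bar> powr p \<partial>\<Omega>) = (\<Sum>x\<in>label_box k. ennreal (\<integral>w. \<bar>dead_term t x w\<bar> powr p \<partial>\<Omega>))"
      by (rule sum_ennreal[symmetric]) simp
    also have "\<dots> = (\<Sum>x\<in>label_box k. \<integral>\<^sup>+ w. ennreal (\<bar>dead_term t x w\<bar> powr p) \<partial>\<Omega>)"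
      using int box_labels by (intro sum.cong refl nn_integral_eq_integral[symmetric]) auto
    also have "\<dots> \<le> (\<Sum>x\<in>label_box k. b x * ennreal cp)"
      using box_labels by (intro sum_mono term_le) auto
    also have "\<dots> = (\<Sum>x\<in>label_box k. b x) * ennreal cp" by (rule sum_distrib_right[symmetric])
    also have "\<dots> \<le> ennreal B * ennreal cp" by (intro mult_right_mono b) simp
    also have "\<dots> = ennreal (B * cp)" using \<open>B \<ge> 0\<close> Cp by (simp add: ennreal_mult)
    finally have "(\<Sum>x\<in>label_box k. \<integral>w. \<bar>dead_term t x w\<bar> powr p \<partial>\<Omega>) \<le> B * cp"
      using \<open>B \<ge> 0\<close> Cp by (simp add: ennreal_le_iff)
    then have "(\<integral>w. \<bar>\<Sum>x\<in>label_box k. dead_term t x w\<bar> powr p \<partial>\<Omega>) \<le> 4 * (B * cp)" using * by linarith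
    then have "ennreal (\<integral>w. \<bar>\<Sum>x\<in>label_box k. dead_term t x w\<bar> powr p \<partial>\<Omega>) \<le> ennreal (4 * (B * cp))" by (rule ennreal_leI)
    then show ?thesis using * by (subst nn_integral_eq_integral) auto
  qed
  have "(\<integral>\<^sup>+ w. ennreal (\<bar>\<Sum>x | is_dead t x w. exp (pos x w) * mark_C x w\<bar> powr p) \<partial>\<Omega>) =
     (\<integral>\<^sup>+ w. liminf (\<lambda>k. ennreal (\<bar>\<Sum>x\<in>label_box k. dead_term t x w\<bar> powr p)) \<partial>\<Omega>)"
  proof (rule nn_integral_cong_AE)
    show "AE w in \<Omega>. ennreal (\<bar>\<Sum>x | is_dead t x w. exp (pos x w) * mark_C x w\<bar> powr p) =
        liminf (\<lambda>k. ennreal (\<bar>\<Sum>x\<in>label_box k. dead_term t x w\<bar> powr p))"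
      using fin
    proof eventually_elim
      case (elim w)
      then have "finite {x. is_dead t x w}"
        by (rule rev_finite_subset) (auto simp: is_dead_def)
      then have "\<forall>\<^sub>F k in sequentially. {x. is_dead t x w} \<subseteq> label_box k"
        using is_dead_labels by (intro eventually_restrict_box) auto
      then have ev: "\<forall>\<^sub>F k in sequentially. ennreal (\<bar>\<Sum>x | is_dead t x w. exp (pos x w) * mark_C x w\<bar> powr p) =
         ennreal (\<bar>\<Sum>x\<in>label_box k. dead_term t x w\<bar> powr p)"
        by eventually_elim (use sum_box_restrict[of "{x. is_dead t x w}" _ "\<lambda>x. exp (pos x w) * mark_C x w"] in \<open>simp add: dead_term_def\<close>)
      have "(\<lambda>k. ennreal (\<bar>\<Sum>x\<in>label_box k. dead_term t x w\<bar> powr p)) \<longlonglongrightarrow> ennreal (\<bar>\<Sum>x | is_dead t x w. exp (pos x w) * mark_C x w\<bar> powr p)"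
        by (rule Lim_transform_eventually[OF tendsto_const ev])
      then show ?case by (rule lim_imp_Liminf[OF sequentially_bot, symmetric])
    qed
  qed
  also have "\<dots> \<le> liminf (\<lambda>k. \<integral>\<^sup>+ w. ennreal (\<bar>\<Sum>x\<in>label_box k. dead_term t x w\<bar> powr p) \<partial>\<Omega>)"
  proof (rule nn_integral_liminf)
    have "(\<lambda>w. \<Sum>x\<in>label_box k. dead_term t x w) \<in> borel_measurable \<Omega>" for k
      by (intro borel_measurable_sum dead_term_measurable box_labels)
    then show "(\<lambda>w. ennreal (\<bar>\<Sum>x\<in>label_box k. dead_term t x w\<bar> powr p)) \<in> borel_measurable \<Omega>" for k
      by measurable
  qed
  also have "\<dots> \<le> liminf (\<lambda>k::nat. ennreal (4 * (B * cp)))"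
    by (intro Liminf_mono always_eventually allI box_bound)
  also have "\<dots> = ennreal (4 * (B * cp))" by (rule Liminf_const[OF sequentially_bot])
  finally show ?thesis by (simp add: B_def)
qed

text \<open>The tree, the birth times, the life times and the positions do not involve the initial values.\<close>

lemma path_data_redraw_R:
  fixes w :: "nat list \<Rightarrow> mark" and x :: "nat list" and r :: real
  defines "w' \<equiv> w(x := (fst (w x), r, snd (snd (w x))))"
  shows "tree y w' = tree y w" "birth_time y w' = birth_time y w" "pos y w' = pos y w" "mark_E y w' = mark_E y w"
    "is_alive t y w' = is_alive t y w"
proof -
  have E: "mark_E y w' = mark_E y w" "mark_N y w' = mark_N y w" "mark_A y i w' = mark_A y i w" for y i
    by (auto simp: w'_def mark_defs)
  have "tree y w' = tree y w \<and> birth_time y w' = birth_time y w \<and> pos y w' = pos y w"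
    by (induction y) (simp_all add: E)
  then show "tree y w' = tree y w" "birth_time y w' = birth_time y w" "pos y w' = pos y w" "mark_E y w' = mark_E y w"
    "is_alive t y w' = is_alive t y w"
    by (simp_all add: E is_alive_def)
qed

text \<open>Redraw the initial value of each living particle in a box; the factor \<open>exp (i s e\<^bsup>V(x)\<^esup> R(x))\<close> becomes the characteristic function
  of \<open>\<nu>\<^sub>0\<close>. Both products are bounded by \<open>1\<close>, so the box can be removed by dominated convergence.\<close>

lemma alive_char:
  assumes fin: "AE w in \<Omega>. finite {x. tree x w \<and> birth_time x w \<le> t}"
  shows "(CLINT w|\<Omega>. iexp (s * (\<Sum>x | is_alive t x w. exp (pos x w) * mark_R x w))) =
     (CLINT w|\<Omega>. (\<Prod>x | is_alive t x w. char \<nu>\<^sub>0 (s * exp (pos x w))))"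
proof -
  define g where "g x w = (if is_alive t x w then iexp (s * (exp (pos x w) * mark_R x w)) else 1)" for x w
  define g' where "g' x w = (if is_alive t x w then char \<nu>\<^sub>0 (s * exp (pos x w)) else 1)" for x w
  have meas: "g x \<in> borel_measurable \<Omega>" "g' x \<in> borel_measurable \<Omega>" if [measurable]: "x \<in> labels" for x
    unfolding g_def[abs_def] g'_def[abs_def] by measurable
  have norms: "norm (g x w) \<le> 1" "norm (g' x w) \<le> 1" for x w
    using R.cmod_char_le_1 by (auto simp: g_def g'_def)
  have eq: "(CLINT w|\<Omega>. (\<Prod>x\<in>label_box k. g x w)) = (CLINT w|\<Omega>. (\<Prod>x\<in>label_box k. g' x w))" for k
  proof (rule integral_prod_redraw[where Q = \<nu>\<^sub>0 and T = "\<lambda>x (w, r). w(x := (fst (w x), r, snd (snd (w x))))"])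
    fix x assume "x \<in> label_box k"
    then have x: "x \<in> labels" by (rule box_labels)
    show "redraws \<nu>\<^sub>0 (\<lambda>(w, r). w(x := (fst (w x), r, snd (snd (w x)))))" by (rule redraws_R[OF x])
    show "g x \<in> borel_measurable \<Omega>" "g' x \<in> borel_measurable \<Omega>" by (rule meas[OF x])+
    show "(CLINT q|\<nu>\<^sub>0. g x ((\<lambda>(w, r). w(x := (fst (w x), r, snd (snd (w x))))) (w, q))) = g' x w" for w
    proof (cases "is_alive t x w")
      case True
      then show ?thesis
        by (simp add: g_def g'_def path_data_redraw_R mark_R_def char_def mult_ac)
    next
      case False
      then show ?thesis using R.prob_space by (simp add: g_def g'_def path_data_redraw_R)
    qed
    fix x' w q assume "x \<noteq> x'"
    then show "g x' ((\<lambda>(w, r). w(x := (fst (w x), r, snd (snd (w x))))) (w, q)) = g x' w"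
      "g' x' ((\<lambda>(w, r). w(x := (fst (w x), r, snd (snd (w x))))) (w, q)) = g' x' w"
      by (simp_all add: g_def g'_def path_data_redraw_R mark_R_def)
  qed (use norms in auto)
  have lim: "(\<lambda>k. CLINT w|\<Omega>. (\<Prod>x\<in>label_box k. if is_alive t x w then f x w else 1)) \<longlonglongrightarrow> (CLINT w|\<Omega>. (\<Prod>x | is_alive t x w. f x w))"
    if f: "\<And>x. x \<in> labels \<Longrightarrow> f x \<in> borel_measurable \<Omega>" "\<And>x w. norm (f x w) \<le> 1" for f :: "nat list \<Rightarrow> _ \<Rightarrow> complex"
  proof (rule integral_dominated_convergence[where w = "\<lambda>_. 1"])
    show "(\<lambda>w. \<Prod>x | is_alive t x w. f x w) \<in> borel_measurable \<Omega>"
      by (rule random_prod_measurable) (use f is_alive_labels is_alive_measurable in auto)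
    show "(\<lambda>w. \<Prod>x\<in>label_box k. if is_alive t x w then f x w else 1) \<in> borel_measurable \<Omega>" for k
    proof (rule borel_measurable_prod)
      fix x assume "x \<in> label_box k"
      then have [measurable]: "x \<in> labels" by (rule box_labels)
      then have [measurable]: "f x \<in> borel_measurable \<Omega>" by (rule f(1))
      show "(\<lambda>w. if is_alive t x w then f x w else 1) \<in> borel_measurable \<Omega>" by measurable
    qed
    show "AE w in \<Omega>. norm (\<Prod>x\<in>label_box k. if is_alive t x w then f x w else 1) \<le> 1" for k
      by (intro AE_I2 norm_prod_le_1) (use f(2) in auto)
    show "AE w in \<Omega>. (\<lambda>k. \<Prod>x\<in>label_box k. if is_alive t x w then f x w else 1) \<longlonglongrightarrow> (\<Prod>x | is_alive t x w. f x w)"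
      using fin
    proof eventually_elim
      case (elim w)
      then have "finite {x. is_alive t x w}"
        by (rule rev_finite_subset) (auto simp: is_alive_def)
      then have "\<forall>\<^sub>F k in sequentially. {x. is_alive t x w} \<subseteq> label_box k"
        using is_alive_labels by (intro eventually_restrict_box) auto
      then have "\<forall>\<^sub>F k in sequentially. (\<Prod>x | is_alive t x w. f x w) = (\<Prod>x\<in>label_box k. if is_alive t x w then f x w else 1)"
        by eventually_elim (use prod_box_restrict[of "{x. is_alive t x w}" _ "\<lambda>x. f x w" for w] in simp)
      then show ?case by (rule Lim_transform_eventually[OF tendsto_const])
    qed
  qed simp
  have l1: "(\<lambda>k. CLINT w|\<Omega>. (\<Prod>x\<in>label_box k. g x w)) \<longlonglongrightarrow> (CLINT w|\<Omega>. (\<Prod>x | is_alive t x w. iexp (s * (exp (pos x w) * mark_R x w))))"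
  proof -
    have "(\<lambda>w. iexp (s * (exp (pos x w) * mark_R x w))) \<in> borel_measurable \<Omega>" if [measurable]: "x \<in> labels" for x
      by measurable
    then show ?thesis unfolding g_def by (rule lim) simp_all
  qed
  have l2: "(\<lambda>k. CLINT w|\<Omega>. (\<Prod>x\<in>label_box k. g' x w)) \<longlonglongrightarrow> (CLINT w|\<Omega>. (\<Prod>x | is_alive t x w. char \<nu>\<^sub>0 (s * exp (pos x w))))"
  proof -
    have "(\<lambda>w. char \<nu>\<^sub>0 (s * exp (pos x w))) \<in> borel_measurable \<Omega>" if [measurable]: "x \<in> labels" for x
      by measurable
    then show ?thesis unfolding g'_def by (rule lim) (simp_all add: R.cmod_char_le_1)
  qed
  have "iexp (s * (\<Sum>x | is_alive t x w. exp (pos x w) * mark_R x w)) =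
      (if finite {x. is_alive t x w} then (\<Prod>x | is_alive t x w. iexp (s * (exp (pos x w) * mark_R x w))) else 1)" for w
    by (simp add: exp_sum sum_distrib_left)
  then have "iexp (s * (\<Sum>x | is_alive t x w. exp (pos x w) * mark_R x w)) = (\<Prod>x | is_alive t x w. iexp (s * (exp (pos x w) * mark_R x w)))" for w
    by simp
  then show ?thesis using LIMSEQ_unique[OF l1 l2[folded eq]] by simp
qed

end

section \<open>Approximation by a functional of the martingale\<close>

lemma norm_exp_minus_le_1:
  assumes "Re \<kappa> \<ge> 0" "m \<ge> 0"
  shows "norm (exp (- \<kappa> * of_real m)) \<le> 1"
  using assms by (simp add: norm_exp_eq_Re)

text \<open>For small \<open>a\<close> both functions are \<open>1 - \<kappa> a\<^sup>\<gamma> + o(a\<^sup>\<gamma>)\<close>. For the other \<open>a\<close> they differ by at most \<open>2\<close>, and \<open>K a\<^sup>p\<close>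
  is as large as that.\<close>

lemma char_local_error:
  fixes \<kappa> :: complex
  assumes "real_distribution \<nu>" and \<kappa>: "Re \<kappa> \<ge> 0" and \<gamma>: "\<gamma> > 0" "\<gamma> < p" and "e > 0"
    and lim: "((\<lambda>T. of_real (T powr \<gamma>) * (1 - char \<nu> (\<xi> / T))) \<longlongrightarrow> \<kappa>) at_top"
  shows "\<exists>K\<ge>0. \<forall>a>0. norm (char \<nu> (\<xi> * a) - exp (- \<kappa> * of_real (a powr \<gamma>))) \<le> e * a powr \<gamma> + K * a powr p"
proof -
  interpret real_distribution \<nu> by fact
  have expo: "((\<lambda>T. of_real (T powr \<gamma>) * (1 - exp (- \<kappa> * of_real (T powr (- \<gamma>))))) \<longlongrightarrow> \<kappa>) at_top"
  proof -
    have "((\<lambda>z. (1 - exp (- \<kappa> * z)) / z) \<longlongrightarrow> \<kappa>) (at 0)"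
    proof -
      have "((\<lambda>z. exp (- \<kappa> * z)) has_field_derivative - \<kappa>) (at 0)"
        by (auto intro!: derivative_eq_intros)
      then have "((\<lambda>z. - ((exp (- \<kappa> * (0 + z)) - exp (- \<kappa> * 0)) / z)) \<longlongrightarrow> - (- \<kappa>)) (at 0)"
        unfolding DERIV_def by (rule tendsto_minus)
      moreover have "- ((exp (- \<kappa> * (0 + z)) - exp (- \<kappa> * 0)) / z) = (1 - exp (- \<kappa> * z)) / z" for z
        by (simp add: minus_divide_left)
      ultimately show ?thesis by simp
    qed
    moreover have "filterlim (\<lambda>T. of_real (T powr (- \<gamma>)) :: complex) (at 0) at_top"
    proof (rule filterlim_atI)
      have "((\<lambda>T. T powr (- \<gamma>)) \<longlongrightarrow> 0) at_top"
        using \<gamma> by (intro tendsto_neg_powr filterlim_ident) auto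
      then show "((\<lambda>T. of_real (T powr (- \<gamma>)) :: complex) \<longlongrightarrow> 0) at_top"
        using tendsto_of_real by fastforce
      show "\<forall>\<^sub>F T in at_top. complex_of_real (T powr (- \<gamma>)) \<noteq> 0"
        using eventually_gt_at_top[of 0] by eventually_elim auto
    qed
    ultimately have "((\<lambda>T. (1 - exp (- \<kappa> * of_real (T powr (- \<gamma>)))) / of_real (T powr (- \<gamma>))) \<longlongrightarrow> \<kappa>) at_top"
      by (rule filterlim_compose)
    moreover have "(1 - exp (- \<kappa> * of_real (T powr (- \<gamma>)))) / of_real (T powr (- \<gamma>)) = of_real (T powr \<gamma>) * (1 - exp (- \<kappa> * of_real (T powr (- \<gamma>))))" for T :: real
      by (simp add: powr_minus field_simps)
    ultimately show ?thesis by simp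
  qed
  have "((\<lambda>T. of_real (T powr \<gamma>) * (1 - exp (- \<kappa> * of_real (T powr (- \<gamma>)))) - of_real (T powr \<gamma>) * (1 - char \<nu> (\<xi> / T))) \<longlongrightarrow> \<kappa> - \<kappa>) at_top"
    by (intro tendsto_diff expo lim)
  from tendstoD[OF this \<open>e > 0\<close>]
  have "\<forall>\<^sub>F T in at_top. norm (of_real (T powr \<gamma>) * (1 - exp (- \<kappa> * of_real (T powr (- \<gamma>)))) - of_real (T powr \<gamma>) * (1 - char \<nu> (\<xi> / T))) < e"
    by (simp only: dist_norm diff_self diff_zero)
  then obtain T0 where T0: "\<And>T. T \<ge> T0 \<Longrightarrow> norm (of_real (T powr \<gamma>) * (1 - exp (- \<kappa> * of_real (T powr (- \<gamma>)))) - of_real (T powr \<gamma>) * (1 - char \<nu> (\<xi> / T))) < e"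
    by (auto simp: eventually_at_top_linorder)
  define T1 where "T1 = max T0 1"
  have "T1 > 0" by (simp add: T1_def)
  show ?thesis
  proof (intro exI[of _ "2 * T1 powr p"] conjI allI impI)
    fix a :: real assume "a > 0"
    show "norm (char \<nu> (\<xi> * a) - exp (- \<kappa> * of_real (a powr \<gamma>))) \<le> e * a powr \<gamma> + 2 * T1 powr p * a powr p"
    proof (cases "1 / a \<ge> T0")
      case True
      have eq: "of_real ((1 / a) powr \<gamma>) * (1 - exp (- \<kappa> * of_real ((1 / a) powr (- \<gamma>)))) - of_real ((1 / a) powr \<gamma>) * (1 - char \<nu> (\<xi> / (1 / a)))
          = of_real ((1 / a) powr \<gamma>) * (char \<nu> (\<xi> * a) - exp (- \<kappa> * of_real (a powr \<gamma>)))"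
        using \<open>a > 0\<close> by (simp add: powr_divide powr_minus algebra_simps)
      have "(1 / a) powr \<gamma> * norm (char \<nu> (\<xi> * a) - exp (- \<kappa> * of_real (a powr \<gamma>))) < e"
        using T0[OF True] unfolding eq norm_mult by simp
      then have "norm (char \<nu> (\<xi> * a) - exp (- \<kappa> * of_real (a powr \<gamma>))) \<le> e * a powr \<gamma>"
        using \<open>a > 0\<close> by (simp add: powr_divide field_simps)
      then show ?thesis by (rule order_trans) simp
    next
      case False
      then have "1 / a < T1" by (simp add: T1_def)
      then have "1 \<le> T1 * a" using \<open>a > 0\<close> by (simp add: field_simps)
      then have "1 \<le> (T1 * a) powr p" using \<gamma> by (intro ge_one_powr_ge_zero) auto
      then have "2 \<le> 2 * T1 powr p * a powr p" using \<open>a > 0\<close> \<open>T1 > 0\<close> by (simp add: powr_mult)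
      moreover have "norm (char \<nu> (\<xi> * a) - exp (- \<kappa> * of_real (a powr \<gamma>))) \<le> 2"
        using norm_triangle_ineq4[of "char \<nu> (\<xi> * a)" "exp (- \<kappa> * of_real (a powr \<gamma>))"] cmod_char_le_1[of "\<xi> * a"]
          norm_exp_minus_le_1[OF \<kappa>, of "a powr \<gamma>", OF powr_ge_zero] by linarith
      moreover have "0 \<le> e * a powr \<gamma>" using \<open>e > 0\<close> by simp
      ultimately show ?thesis by linarith
    qed
  qed simp
qed

context mark_space
begin

definition total :: "real \<Rightarrow> (nat list \<Rightarrow> mark) \<Rightarrow> real" where
  "total t = W mark_E mark_R mark_N mark_C mark_A t"

definition power_sum :: "real \<Rightarrow> real \<Rightarrow> (nat list \<Rightarrow> mark) \<Rightarrow> real" where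
  "power_sum \<theta> t w = (\<Sum>x | is_alive t x w. exp (\<theta> * pos x w))"

lemma power_sum_measurable [measurable]: "power_sum \<theta> t \<in> borel_measurable \<Omega>"
  unfolding power_sum_def[abs_def]
  by (rule random_sum_measurable) (use is_alive_labels is_alive_measurable in \<open>auto intro!: measurable_compose[OF measurable_path_data(3)]\<close>)

lemma power_sum_nonneg: "power_sum \<theta> t w \<ge> 0"
  unfolding power_sum_def by (intro sum_nonneg) simp

lemma power_sum_moment:
  assumes m: "weight_moment \<theta> = ennreal m" "m \<ge> 0" and "t \<ge> 0"
  shows "integrable \<Omega> (power_sum \<theta> t)" "(\<integral>w. power_sum \<theta> t w \<partial>\<Omega>) \<le> exp ((m - 1) * t)"
proof -
  have le: "(\<integral>\<^sup>+ w. ennreal (power_sum \<theta> t w) \<partial>\<Omega>) \<le> ennreal (exp ((m - 1) * t))"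
    unfolding power_sum_def by (rule alive_sum_moment) fact+
  show int: "integrable \<Omega> (power_sum \<theta> t)"
    using le power_sum_nonneg by (intro integrableI_bounded) (auto intro: le_less_trans[OF _ ennreal_less_top])
  have "ennreal (\<integral>w. power_sum \<theta> t w \<partial>\<Omega>) = (\<integral>\<^sup>+ w. ennreal (power_sum \<theta> t w) \<partial>\<Omega>)"
    using int power_sum_nonneg by (intro nn_integral_eq_integral[symmetric]) auto
  with le show "(\<integral>w. power_sum \<theta> t w \<partial>\<Omega>) \<le> exp ((m - 1) * t)"
    by (metis ennreal_le_iff exp_ge_zero)
qed

text \<open>Both products have factors of modulus at most \<open>1\<close>, so they differ by at most the sum of the differences of the factors,
  to which \<open>char_local_error\<close> applies at \<open>a\<^sub>x = e\<^bsup>V(x)-\<mu>t\<^esup>\<close>. The expectation of \<open>\<Sum> a\<^sub>x\<^sup>\<gamma>\<close> is at most \<open>1\<close>, that of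
  \<open>\<Sum> a\<^sub>x\<^sup>p\<close> at most \<open>e\<^bsup>(mp - 1 - p\<mu>)t\<^esup>\<close>, and this exponent is negative.\<close>

lemma alive_product_approximation:
  fixes \<kappa> :: complex
  assumes \<kappa>: "Re \<kappa> \<ge> 0" and \<gamma>: "\<gamma> > 0" "\<gamma> < p"
    and lim: "((\<lambda>T. of_real (T powr \<gamma>) * (1 - char \<nu>\<^sub>0 (\<xi> / T))) \<longlongrightarrow> \<kappa>) at_top"
    and m\<gamma>: "weight_moment \<gamma> = ennreal m\<gamma>" "m\<gamma> \<ge> 0" and mp: "weight_moment p = ennreal mp" "mp \<ge> 0"
    and \<mu>: "\<mu> = (m\<gamma> - 1) / \<gamma>" and slower: "mp - 1 < p * \<mu>"
  shows "((\<lambda>t. (CLINT w|\<Omega>. (\<Prod>x | is_alive t x w. char \<nu>\<^sub>0 (\<xi> * exp (- \<mu> * t) * exp (pos x w)))) -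
      (CLINT w|\<Omega>. exp (- \<kappa> * of_real (exp (- (m\<gamma> - 1) * t) * power_sum \<gamma> t w)))) \<longlongrightarrow> 0) at_top"
proof (rule tendsto_by_approximation)
  fix e :: real assume "e > 0"
  then have e2: "e / 2 > 0" by simp
  obtain K where K: "K \<ge> 0" "\<And>a. a > 0 \<Longrightarrow> norm (char \<nu>\<^sub>0 (\<xi> * a) - exp (- \<kappa> * of_real (a powr \<gamma>))) \<le> e / 2 * a powr \<gamma> + K * a powr p"
    using char_local_error[OF R.real_distribution_axioms \<kappa> \<gamma> e2 lim] by blast
  have \<mu>\<gamma>: "\<gamma> * \<mu> = m\<gamma> - 1" using \<gamma> by (simp add: \<mu>)
  define X where "X t = (CLINT w|\<Omega>. (\<Prod>x | is_alive t x w. char \<nu>\<^sub>0 (\<xi> * exp (- \<mu> * t) * exp (pos x w))))" for t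
  define Y where "Y t = (CLINT w|\<Omega>. exp (- \<kappa> * of_real (exp (- (m\<gamma> - 1) * t) * power_sum \<gamma> t w)))" for t
  have bound: "norm (X t - Y t) \<le> e / 2 + K * exp ((mp - 1 - p * \<mu>) * t)" if "t \<ge> 0" for t
  proof -
    define a where "a x w = exp (- \<mu> * t) * exp (pos x w)" for x w
    have a_pos: "a x w > 0" for x w by (simp add: a_def)
    have a_powr: "a x w powr \<theta> = exp (- \<theta> * \<mu> * t) * exp (\<theta> * pos x w)" for x w \<theta>
      by (simp add: a_def powr_def exp_add[symmetric] algebra_simps)
    define P where "P w = (\<Prod>x | is_alive t x w. char \<nu>\<^sub>0 (\<xi> * a x w))" for w
    define Q where "Q w = (\<Prod>x | is_alive t x w. exp (- \<kappa> * of_real (a x w powr \<gamma>)))" for w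
    have sums: "(\<Sum>x | is_alive t x w. a x w powr \<theta>) = exp (- \<theta> * \<mu> * t) * power_sum \<theta> t w" for \<theta> w
      by (simp add: a_powr power_sum_def sum_distrib_left)
    have Qeq: "Q w = exp (- \<kappa> * of_real (exp (- (m\<gamma> - 1) * t) * power_sum \<gamma> t w))" for w
    proof -
      have "Q w = exp (\<Sum>x | is_alive t x w. - \<kappa> * of_real (a x w powr \<gamma>))"
      proof (cases "finite {x. is_alive t x w}")
        case True
        then show ?thesis unfolding Q_def by (rule exp_sum[symmetric])
      qed (simp add: Q_def)
      also have "(\<Sum>x | is_alive t x w. - \<kappa> * of_real (a x w powr \<gamma>)) = - \<kappa> * of_real (\<Sum>x | is_alive t x w. a x w powr \<gamma>)"
        by (simp add: sum_distrib_left)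
      finally show ?thesis unfolding sums \<mu>\<gamma>[symmetric] by simp
    qed
    have [measurable]: "P \<in> borel_measurable \<Omega>" "Q \<in> borel_measurable \<Omega>"
    proof -
      have "(\<lambda>w. char \<nu>\<^sub>0 (\<xi> * a x w)) \<in> borel_measurable \<Omega>" if [measurable]: "x \<in> labels" for x
        unfolding a_def by measurable
      then show "P \<in> borel_measurable \<Omega>"
        unfolding P_def[abs_def] by (intro random_prod_measurable is_alive_measurable) (auto dest: is_alive_labels)
      show "Q \<in> borel_measurable \<Omega>" unfolding Qeq[abs_def] by measurable
    qed
    have Pn: "norm (P w) \<le> 1" and Qn: "norm (Q w) \<le> 1" for w
      unfolding P_def Q_def using R.cmod_char_le_1 norm_exp_minus_le_1[OF \<kappa>] by (auto intro!: norm_prod_le_1)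
    have pointwise: "norm (P w - Q w) \<le> e / 2 * (exp (- \<gamma> * \<mu> * t) * power_sum \<gamma> t w) + K * (exp (- p * \<mu> * t) * power_sum p t w)" for w
    proof -
      have "norm (P w - Q w) \<le> (\<Sum>x | is_alive t x w. norm (char \<nu>\<^sub>0 (\<xi> * a x w) - exp (- \<kappa> * of_real (a x w powr \<gamma>))))"
        unfolding P_def Q_def using R.cmod_char_le_1 norm_exp_minus_le_1[OF \<kappa>] by (intro norm_prod_diff) auto
      also have "\<dots> \<le> (\<Sum>x | is_alive t x w. e / 2 * a x w powr \<gamma> + K * a x w powr p)"
        by (intro sum_mono K a_pos)
      also have "\<dots> = e / 2 * (\<Sum>x | is_alive t x w. a x w powr \<gamma>) + K * (\<Sum>x | is_alive t x w. a x w powr p)"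
        by (simp only: sum.distrib sum_distrib_left)
      finally show ?thesis unfolding sums .
    qed
    have intP: "integrable \<Omega> P" by (rule W.integrable_const_bound[where B = 1]) (use Pn in auto)
    have intQ: "integrable \<Omega> Q" by (rule W.integrable_const_bound[where B = 1]) (use Qn in auto)
    note pg = power_sum_moment[OF m\<gamma> that] and pp = power_sum_moment[OF mp that]
    have XP: "X t = (CLINT w|\<Omega>. P w)"
      unfolding X_def P_def a_def by (simp add: mult.assoc)
    have YQ: "Y t = (CLINT w|\<Omega>. Q w)"
      unfolding Y_def Qeq ..
    have "X t - Y t = (CLINT w|\<Omega>. P w - Q w)"
      unfolding XP YQ by (rule Bochner_Integration.integral_diff[OF intP intQ, symmetric])
    also have "norm \<dots> \<le> (\<integral>w. norm (P w - Q w) \<partial>\<Omega>)" by (rule integral_norm_bound)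
    also have "\<dots> \<le> (\<integral>w. e / 2 * (exp (- \<gamma> * \<mu> * t) * power_sum \<gamma> t w) + K * (exp (- p * \<mu> * t) * power_sum p t w) \<partial>\<Omega>)"
      using intP intQ pg(1) pp(1) pointwise by (intro integral_mono) auto
    also have "\<dots> = e / 2 * (exp (- \<gamma> * \<mu> * t) * (\<integral>w. power_sum \<gamma> t w \<partial>\<Omega>)) + K * (exp (- p * \<mu> * t) * (\<integral>w. power_sum p t w \<partial>\<Omega>))"
      using pg(1) pp(1) by simp
    also have "\<dots> \<le> e / 2 * (exp (- \<gamma> * \<mu> * t) * exp ((m\<gamma> - 1) * t)) + K * (exp (- p * \<mu> * t) * exp ((mp - 1) * t))"
      using pg(2) pp(2) \<open>e > 0\<close> K(1) by (intro add_mono mult_left_mono) auto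
    also have "\<dots> = e / 2 + K * exp ((mp - 1 - p * \<mu>) * t)"
      unfolding exp_add[symmetric] \<mu>\<gamma>[symmetric] by (simp add: algebra_simps)
    finally show ?thesis .
  qed
  have "((\<lambda>t. K * exp ((mp - 1 - p * \<mu>) * t)) \<longlongrightarrow> K * 0) at_top"
  proof (intro tendsto_intros filterlim_compose[OF exp_at_bot])
    show "filterlim (\<lambda>t. (mp - 1 - p * \<mu>) * t) at_bot at_top"
      using slower by (intro filterlim_tendsto_neg_mult_at_bot[OF tendsto_const _ filterlim_ident]) auto
  qed
  then have "\<forall>\<^sub>F t in at_top. K * exp ((mp - 1 - p * \<mu>) * t) < e / 2"
    using order_tendstoD(2)[of _ "K * 0" at_top "e / 2"] e2 by simp
  then have "\<forall>\<^sub>F t in at_top. dist (X t - Y t) 0 \<le> e"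
    using eventually_ge_at_top[of 0]
  proof eventually_elim
    case (elim t)
    then show ?case using bound[of t] by (simp add: dist_norm)
  qed
  then show "\<exists>Z z. (Z \<longlongrightarrow> z) at_top \<and> dist z 0 \<le> e \<and> (\<forall>\<^sub>F t in at_top. dist
       ((CLINT w|\<Omega>. (\<Prod>x | is_alive t x w. char \<nu>\<^sub>0 (\<xi> * exp (- \<mu> * t) * exp (pos x w)))) -
      (CLINT w|\<Omega>. exp (- \<kappa> * of_real (exp (- (m\<gamma> - 1) * t) * power_sum \<gamma> t w)))) (Z t) \<le> e)"
    using \<open>e > 0\<close> unfolding X_def Y_def by (intro exI[of _ "\<lambda>_. 0"] exI[of _ 0]) auto
qed

lemma total_measurable [measurable]: "total t \<in> borel_measurable \<Omega>"
proof -
  have "(\<lambda>w. exp (pos x w) * mark_R x w) \<in> borel_measurable \<Omega>" "(\<lambda>w. exp (pos x w) * mark_C x w) \<in> borel_measurable \<Omega>"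
    "Measurable.pred \<Omega> (\<lambda>w. tree x w \<and> death mark_E x w \<le> t)" if [measurable]: "x \<in> labels" for x
    unfolding death_def by measurable
  then show ?thesis
    unfolding total_def[abs_def] W_def alive_eq dead_def
    by (intro borel_measurable_add random_sum_measurable is_alive_measurable) (auto dest: is_alive_labels in_tree_labels)
qed

lemma total_split:
  assumes "\<forall>x\<in>labels. mark_E x w \<ge> 0"
  shows "total t w = (\<Sum>x | is_alive t x w. exp (pos x w) * mark_R x w) + (\<Sum>x | is_dead t x w. exp (pos x w) * mark_C x w)"
  unfolding total_def W_def alive_eq dead_eq[OF assms] ..

text \<open>First drop the dead particles, by the moment bound and \<open>char_perturbation\<close>; then integrate out the initial values of
  the living ones and use \<open>alive_product_approximation\<close>.\<close>

lemma total_char_approximation: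
  fixes \<kappa> :: complex
  assumes div: "\<forall>\<^sub>F e in at_right (0::real). (\<integral>\<^sup>+ s\<in>{1 - e<..<1}. ennreal (1 / (s - pgf s)) \<partial>lborel) = \<infinity>"
    and mean: "(\<integral>\<^sup>+ u. of_nat (fst u) \<partial>Off) > 1"
    and \<kappa>: "Re \<kappa> \<ge> 0" and \<gamma>: "\<gamma> > 0" "\<gamma> < p"
    and lim: "((\<lambda>T. of_real (T powr \<gamma>) * (1 - char \<nu>\<^sub>0 (\<xi> / T))) \<longlongrightarrow> \<kappa>) at_top"
    and p: "p = 1 \<or> (1 < p \<and> p \<le> 2 \<and> (\<integral>u. fst (snd u) \<partial>Off) = 0)"
    and C: "integrable Off (\<lambda>u. fst (snd u))" and Cp: "(\<integral>\<^sup>+ u. ennreal (\<bar>fst (snd u)\<bar> powr p) \<partial>Off) = ennreal cp" "cp \<ge> 0"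
    and m\<gamma>: "weight_moment \<gamma> = ennreal m\<gamma>" "m\<gamma> \<ge> 0" and mp: "weight_moment p = ennreal mp" "mp \<ge> 0"
    and \<mu>: "\<mu> = (m\<gamma> - 1) / \<gamma>" and slower: "mp - 1 < p * \<mu>" and "\<mu> > 0"
  shows "((\<lambda>t. (CLINT w|\<Omega>. iexp (\<xi> * exp (- \<mu> * t) * total t w)) -
      (CLINT w|\<Omega>. exp (- \<kappa> * of_real (exp (- (m\<gamma> - 1) * t) * power_sum \<gamma> t w)))) \<longlongrightarrow> 0) at_top"
proof -
  have p0: "p > 0" using p by auto
  define A where "A t w = (\<Sum>x | is_alive t x w. exp (pos x w) * mark_R x w)" for t w
  define D where "D t w = (\<Sum>x | is_dead t x w. exp (pos x w) * mark_C x w)" for t w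
  have [measurable]: "A t \<in> borel_measurable \<Omega>" for t
  proof -
    have "(\<lambda>w. exp (pos x w) * mark_R x w) \<in> borel_measurable \<Omega>" if [measurable]: "x \<in> labels" for x by measurable
    then show ?thesis unfolding A_def[abs_def]
      by (intro random_sum_measurable is_alive_measurable) (auto dest: is_alive_labels)
  qed
  have [measurable]: "D t \<in> borel_measurable \<Omega>" for t
  proof -
    have "(\<lambda>w. exp (pos x w) * mark_C x w) \<in> borel_measurable \<Omega>" if [measurable]: "x \<in> labels" for x by measurable
    then show ?thesis unfolding D_def[abs_def]
      by (intro random_sum_measurable is_dead_measurable) (auto dest: is_dead_labels)
  qed
  define s where "s t = \<xi> * exp (- \<mu> * t)" for t
  define \<phi> where "\<phi> t = (CLINT w|\<Omega>. iexp (s t * total t w))" for t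
  define \<phi>A where "\<phi>A t = (CLINT w|\<Omega>. iexp (s t * A t w))" for t
  have split: "\<phi> t = (CLINT w|\<Omega>. iexp (s t * A t w + s t * D t w))" for t
    unfolding \<phi>_def
  proof (rule integral_cong_AE)
    have ae: "AE w in \<Omega>. iexp (s t * A t w + s t * D t w) = iexp (s t * total t w)"
      using AE_E_nonneg by eventually_elim (simp add: total_split A_def D_def distrib_left)
    then show "AE w in \<Omega>. iexp (s t * total t w) = iexp (s t * A t w + s t * D t w)"
      by eventually_elim simp
    show "(\<lambda>w. iexp (s t * A t w + s t * D t w)) \<in> borel_measurable \<Omega>" by measurable
    show "(\<lambda>w. iexp (s t * total t w)) \<in> borel_measurable \<Omega>" by measurable
  qed
  \<comment> \<open>a growth rate that dominates the dead particles but is beaten by the normalisation\<close>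
  obtain c where c: "max (mp - 1) 0 < c" "c < p * \<mu>"
    using dense[of "max (mp - 1) 0" "p * \<mu>"] slower \<open>\<mu> > 0\<close> p0 by auto
  define K where "K = 4 * ((1 + c) / (1 + c - mp) * cp)"
  have K0: "K \<ge> 0" using c mp Cp by (simp add: K_def)
  have first: "norm (\<phi> t - \<phi>A t) \<le> e + 2 * e powr (- p) * (\<bar>\<xi>\<bar> powr p * K * exp ((c - p * \<mu>) * t))" if "t \<ge> 0" "e > 0" for t e
    unfolding split \<phi>A_def
  proof (rule W.char_perturbation)
    have "(\<integral>\<^sup>+ w. ennreal (\<bar>s t * D t w\<bar> powr p) \<partial>\<Omega>) = (\<integral>\<^sup>+ w. ennreal (\<bar>s t\<bar> powr p) * ennreal (\<bar>D t w\<bar> powr p) \<partial>\<Omega>)"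
      by (intro nn_integral_cong) (simp add: abs_mult powr_mult ennreal_mult)
    also have "\<dots> = ennreal (\<bar>s t\<bar> powr p) * (\<integral>\<^sup>+ w. ennreal (\<bar>D t w\<bar> powr p) \<partial>\<Omega>)"
      by (rule nn_integral_cmult) measurable
    also have "\<dots> \<le> ennreal (\<bar>s t\<bar> powr p) * ennreal (4 * ((1 + c) / (1 + c - mp) * exp (c * t) * cp))"
      unfolding D_def
      by (intro mult_left_mono dead_sum_moment p C Cp mp finitely_many_births div mean that) (use c in auto)
    also have "\<dots> = ennreal (\<bar>s t\<bar> powr p * (4 * ((1 + c) / (1 + c - mp) * exp (c * t) * cp)))"
      using c Cp by (intro ennreal_mult[symmetric]) auto
    also have "\<bar>s t\<bar> powr p * (4 * ((1 + c) / (1 + c - mp) * exp (c * t) * cp)) = \<bar>\<xi>\<bar> powr p * K * exp ((c - p * \<mu>) * t)"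
    proof -
      have "\<bar>s t\<bar> powr p = \<bar>\<xi>\<bar> powr p * exp (- p * \<mu> * t)"
        by (simp add: s_def abs_mult powr_mult) (simp add: powr_def)
      moreover have "exp ((c - p * \<mu>) * t) = exp (c * t) * exp (- p * \<mu> * t)"
        by (simp add: exp_add[symmetric] algebra_simps)
      ultimately show ?thesis by (simp add: K_def)
    qed
    finally show "(\<integral>\<^sup>+ w. ennreal (\<bar>s t * D t w\<bar> powr p) \<partial>\<Omega>) \<le> ennreal (\<bar>\<xi>\<bar> powr p * K * exp ((c - p * \<mu>) * t))" .
  qed (use that p0 K0 in auto)
  have l1: "((\<lambda>t. \<phi> t - \<phi>A t) \<longlongrightarrow> 0) at_top"
  proof (rule tendsto_by_approximation)
    fix e :: real assume "e > 0"
    then have e2: "e / 2 > 0" by simp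
    have "((\<lambda>t. 2 * (e / 2) powr (- p) * (\<bar>\<xi>\<bar> powr p * K * exp ((c - p * \<mu>) * t))) \<longlongrightarrow> 2 * (e / 2) powr (- p) * (\<bar>\<xi>\<bar> powr p * K * 0)) at_top"
    proof (intro tendsto_intros filterlim_compose[OF exp_at_bot])
      show "filterlim (\<lambda>t. (c - p * \<mu>) * t) at_bot at_top"
        using c by (intro filterlim_tendsto_neg_mult_at_bot[OF tendsto_const _ filterlim_ident]) auto
    qed
    then have "\<forall>\<^sub>F t in at_top. 2 * (e / 2) powr (- p) * (\<bar>\<xi>\<bar> powr p * K * exp ((c - p * \<mu>) * t)) < e / 2"
      using e2 by (intro order_tendstoD(2)) auto
    then have "\<forall>\<^sub>F t in at_top. dist (\<phi> t - \<phi>A t) 0 \<le> e"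
      using eventually_ge_at_top[of 0]
    proof eventually_elim
      case (elim t)
      then show ?case using first[of t "e / 2"] e2 by (simp add: dist_norm)
    qed
    then show "\<exists>Z z. (Z \<longlongrightarrow> z) at_top \<and> dist z 0 \<le> e \<and> (\<forall>\<^sub>F t in at_top. dist (\<phi> t - \<phi>A t) (Z t) \<le> e)"
      using \<open>e > 0\<close> by (intro exI[of _ "\<lambda>_. 0"] exI[of _ 0]) auto
  qed
  have l2: "((\<lambda>t. \<phi>A t - (CLINT w|\<Omega>. exp (- \<kappa> * of_real (exp (- (m\<gamma> - 1) * t) * power_sum \<gamma> t w)))) \<longlongrightarrow> 0) at_top"
  proof (rule Lim_transform_eventually[OF alive_product_approximation[OF \<kappa> \<gamma> lim m\<gamma> mp \<mu> slower]])
    show "\<forall>\<^sub>F t in at_top. (CLINT w|\<Omega>. (\<Prod>x | is_alive t x w. char \<nu>\<^sub>0 (\<xi> * exp (- \<mu> * t) * exp (pos x w)))) -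
      (CLINT w|\<Omega>. exp (- \<kappa> * of_real (exp (- (m\<gamma> - 1) * t) * power_sum \<gamma> t w))) =
      \<phi>A t - (CLINT w|\<Omega>. exp (- \<kappa> * of_real (exp (- (m\<gamma> - 1) * t) * power_sum \<gamma> t w)))"
      using eventually_ge_at_top[of 0]
    proof eventually_elim
      case (elim t)
      show ?case
        using alive_char[OF finitely_many_births[OF div mean elim], of "s t"] by (simp add: \<phi>A_def A_def s_def)
    qed
  qed
  from tendsto_add[OF l1 l2] show ?thesis by (simp add: \<phi>_def s_def)
qed

end

section \<open>Convexity of the moment function\<close>

definition weight_mean :: "'b measure \<Rightarrow> ('b \<Rightarrow> nat) \<Rightarrow> (nat \<Rightarrow> 'b \<Rightarrow> real) \<Rightarrow> real \<Rightarrow> real" where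
  "weight_mean P N A s = enn2real (\<integral>\<^sup>+ \<omega>. ennreal (\<Sum>k=1..N \<omega>. A k \<omega> powr s) \<partial>P)"

lemma weight_mean_Dom:
  assumes "s \<in> Dom P N A"
  shows "(\<integral>\<^sup>+ \<omega>. ennreal (\<Sum>k=1..N \<omega>. A k \<omega> powr s) \<partial>P) = ennreal (weight_mean P N A s)"
    and "weight_mean P N A s \<ge> 0" and "Phi P N A s = ereal (weight_mean P N A s - 1)"
    and "mu P N A s = (weight_mean P N A s - 1) / s"
proof -
  show 1: "(\<integral>\<^sup>+ \<omega>. ennreal (\<Sum>k=1..N \<omega>. A k \<omega> powr s) \<partial>P) = ennreal (weight_mean P N A s)"
    using assms by (simp add: Dom_def weight_mean_def)
  show 2: "weight_mean P N A s \<ge> 0" by (simp add: weight_mean_def)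
  show 3: "Phi P N A s = ereal (weight_mean P N A s - 1)"
    unfolding Phi_def 1 using 2 by (simp add: one_ereal_def)
  show "mu P N A s = (weight_mean P N A s - 1) / s"
    unfolding mu_def 3 by simp
qed

lemma powr_convex_exponent:
  fixes a x y l :: real
  assumes "a > 0" "0 \<le> l" "l \<le> 1"
  shows "a powr (l * x + (1 - l) * y) \<le> l * a powr x + (1 - l) * a powr y"
proof -
  have "exp (l * (x * ln a) + (1 - l) * (y * ln a)) \<le> l * exp (x * ln a) + (1 - l) * exp (y * ln a)"
    using convex_onD[OF exp_convex, of "1 - l" "x * ln a" "y * ln a"] assms by simp
  then show ?thesis using assms by (simp add: powr_def algebra_simps)
qed

lemma weight_mean_convex:
  assumes A: "\<And>i. i \<ge> 1 \<Longrightarrow> A i \<in> borel_measurable P" "\<And>i \<omega>. i \<ge> 1 \<Longrightarrow> \<omega> \<in> space P \<Longrightarrow> A i \<omega> > 0"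
    and N [measurable]: "N \<in> measurable P (count_space UNIV)"
    and xy: "x \<in> Dom P N A" "y \<in> Dom P N A" and l: "0 \<le> l" "l \<le> 1"
  shows "l * x + (1 - l) * y \<in> Dom P N A"
    and "weight_mean P N A (l * x + (1 - l) * y) \<le> l * weight_mean P N A x + (1 - l) * weight_mean P N A y"
proof -
  let ?S = "\<lambda>s \<omega>. ennreal (\<Sum>k=1..N \<omega>. A k \<omega> powr s)"
  have [measurable]: "?S s \<in> borel_measurable P" for s
  proof -
    have "(\<lambda>\<omega>. \<Sum>k=1..n. A k \<omega> powr s) \<in> borel_measurable P" for n
    proof (rule borel_measurable_sum)
      fix k assume "k \<in> {1..n}"
      then have [measurable]: "A k \<in> borel_measurable P" by (intro A(1)) simp
      show "(\<lambda>\<omega>. A k \<omega> powr s) \<in> borel_measurable P" by measurable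
    qed
    then have "(\<lambda>\<omega>. \<Sum>k=1..N \<omega>. A k \<omega> powr s) \<in> borel_measurable P"
      by (rule measurable_compose_countable) (rule N)
    then show ?thesis by simp
  qed
  have "(\<integral>\<^sup>+ \<omega>. ?S (l * x + (1 - l) * y) \<omega> \<partial>P) \<le> (\<integral>\<^sup>+ \<omega>. ennreal l * ?S x \<omega> + ennreal (1 - l) * ?S y \<omega> \<partial>P)"
  proof (rule nn_integral_mono)
    fix \<omega> assume w: "\<omega> \<in> space P"
    have "(\<Sum>k=1..N \<omega>. A k \<omega> powr (l * x + (1 - l) * y)) \<le> (\<Sum>k=1..N \<omega>. l * A k \<omega> powr x + (1 - l) * A k \<omega> powr y)"
      by (intro sum_mono powr_convex_exponent l) (use A(2)[OF _ w] in auto)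
    also have "\<dots> = l * (\<Sum>k=1..N \<omega>. A k \<omega> powr x) + (1 - l) * (\<Sum>k=1..N \<omega>. A k \<omega> powr y)"
      by (simp only: sum.distrib sum_distrib_left)
    finally have "?S (l * x + (1 - l) * y) \<omega> \<le> ennreal (l * (\<Sum>k=1..N \<omega>. A k \<omega> powr x) + (1 - l) * (\<Sum>k=1..N \<omega>. A k \<omega> powr y))"
      by (rule ennreal_leI)
    also have "\<dots> = ennreal l * ?S x \<omega> + ennreal (1 - l) * ?S y \<omega>"
      using l by (subst ennreal_plus) (auto simp: ennreal_mult sum_nonneg)
    finally show "?S (l * x + (1 - l) * y) \<omega> \<le> ennreal l * ?S x \<omega> + ennreal (1 - l) * ?S y \<omega>" .
  qed
  also have "\<dots> = ennreal l * ennreal (weight_mean P N A x) + ennreal (1 - l) * ennreal (weight_mean P N A y)"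
  proof -
    have "(\<integral>\<^sup>+ \<omega>. ennreal r * ?S s \<omega> \<partial>P) = ennreal r * ennreal (weight_mean P N A s)" if "s \<in> Dom P N A" for r s
      unfolding weight_mean_Dom(1)[OF that, symmetric] by (rule nn_integral_cmult) measurable
    note parts = this[OF xy(1), of l] this[OF xy(2), of "1 - l"]
    have "(\<integral>\<^sup>+ \<omega>. ennreal l * ?S x \<omega> + ennreal (1 - l) * ?S y \<omega> \<partial>P) =
        (\<integral>\<^sup>+ \<omega>. ennreal l * ?S x \<omega> \<partial>P) + (\<integral>\<^sup>+ \<omega>. ennreal (1 - l) * ?S y \<omega> \<partial>P)"
      by (rule nn_integral_add) measurable
    then show ?thesis unfolding parts .
  qed
  also have "\<dots> = ennreal (l * weight_mean P N A x + (1 - l) * weight_mean P N A y)"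
    using l weight_mean_Dom(2)[OF xy(1)] weight_mean_Dom(2)[OF xy(2)] by (simp add: ennreal_mult)
  finally have le: "(\<integral>\<^sup>+ \<omega>. ?S (l * x + (1 - l) * y) \<omega> \<partial>P) \<le> ennreal (l * weight_mean P N A x + (1 - l) * weight_mean P N A y)" .
  have "0 < l * x + (1 - l) * y"
    using xy l by (cases "l = 0") (auto simp: Dom_def intro: add_pos_nonneg)
  moreover have "(\<integral>\<^sup>+ \<omega>. ?S (l * x + (1 - l) * y) \<omega> \<partial>P) < \<infinity>"
    using le by (rule le_less_trans) simp
  ultimately show D: "l * x + (1 - l) * y \<in> Dom P N A" by (simp add: Dom_def)
  show "weight_mean P N A (l * x + (1 - l) * y) \<le> l * weight_mean P N A x + (1 - l) * weight_mean P N A y"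
    using le l weight_mean_Dom(2)[OF xy(1)] weight_mean_Dom(2)[OF xy(2)] unfolding weight_mean_Dom(1)[OF D]
    by (subst (asm) ennreal_le_iff) auto
qed

text \<open>Suppose \<open>\<mu>(\<gamma>) \<le> \<mu>(p)\<close>. At \<open>\<gamma>\<close> and at \<open>p\<close> the convex function \<open>\<Phi>\<close> lies below the line through the origin of slope
  \<open>\<mu>(p)\<close>, hence so it does between them; that is, \<open>\<mu> \<le> \<mu>(p)\<close> on \<open>[\<gamma>, p]\<close>, which excludes a negative derivative
  at \<open>p\<close>. Convexity also puts the whole segment into the domain.\<close>

lemma mu_greater_left_of_decrease:
  assumes A: "\<And>i. i \<ge> 1 \<Longrightarrow> A i \<in> borel_measurable P" "\<And>i \<omega>. i \<ge> 1 \<Longrightarrow> \<omega> \<in> space P \<Longrightarrow> A i \<omega> > 0"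
    and N: "N \<in> measurable P (count_space UNIV)"
    and "\<gamma> \<in> Dom P N A" "\<gamma> < p" and dec: "mu_deriv_neg P N A p"
  shows "mu P N A p < mu P N A \<gamma>"
proof (rule ccontr)
  assume "\<not> ?thesis"
  then have le: "mu P N A \<gamma> \<le> mu P N A p" by simp
  obtain d where pD: "p \<in> Dom P N A" and d: "d < 0" "(mu P N A has_real_derivative d) (at p within Dom P N A)"
    using dec by (auto simp: mu_deriv_neg_def)
  have pos: "0 < \<gamma>" "0 < p" using \<open>\<gamma> \<in> _\<close> pD by (auto simp: Dom_def)
  have seg: "\<theta> \<in> Dom P N A \<and> mu P N A \<theta> \<le> mu P N A p" if th: "\<gamma> \<le> \<theta>" "\<theta> \<le> p" for \<theta>
  proof -
    define l where "l = (p - \<theta>) / (p - \<gamma>)"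
    have l: "0 \<le> l" "l \<le> 1" using th \<open>\<gamma> < p\<close> by (auto simp: l_def divide_simps)
    have eq: "\<theta> = l * \<gamma> + (1 - l) * p"
    proof -
      have "l * (p - \<gamma>) = p - \<theta>" using \<open>\<gamma> < p\<close> by (simp add: l_def)
      then show ?thesis by (simp add: algebra_simps)
    qed
    have D: "\<theta> \<in> Dom P N A" unfolding eq by (rule weight_mean_convex(1)[OF A N \<open>\<gamma> \<in> _\<close> pD l])
    let ?m = "mu P N A p"
    have "weight_mean P N A \<theta> - 1 \<le> l * (weight_mean P N A \<gamma> - 1) + (1 - l) * (weight_mean P N A p - 1)"
      using weight_mean_convex(2)[OF A N \<open>\<gamma> \<in> _\<close> pD l] unfolding eq[symmetric] by (simp add: algebra_simps)
    also have "\<dots> \<le> l * (\<gamma> * ?m) + (1 - l) * (p * ?m)"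
    proof (intro add_mono mult_left_mono l)
      show "weight_mean P N A \<gamma> - 1 \<le> \<gamma> * ?m"
        using le pos unfolding weight_mean_Dom(4)[OF \<open>\<gamma> \<in> _\<close>] by (simp add: field_simps)
      show "weight_mean P N A p - 1 \<le> p * ?m"
        using pos unfolding weight_mean_Dom(4)[OF pD] by simp
    qed (use l in auto)
    also have "\<dots> = \<theta> * ?m" unfolding eq by (simp add: algebra_simps)
    finally have "mu P N A \<theta> \<le> ?m"
      unfolding weight_mean_Dom(4)[OF D] using th pos by (simp add: field_simps)
    with D show ?thesis by blast
  qed
  have "((\<lambda>y. (mu P N A y - mu P N A p) / (y - p)) \<longlongrightarrow> d) (at p within Dom P N A)"
    using d(2) by (simp add: has_field_derivative_iff)
  from order_tendstoD(2)[OF this d(1)] obtain \<delta> where \<delta>: "\<delta> > 0"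
    "\<And>y. y \<in> Dom P N A \<Longrightarrow> y \<noteq> p \<Longrightarrow> dist y p < \<delta> \<Longrightarrow> (mu P N A y - mu P N A p) / (y - p) < 0"
    unfolding eventually_at by blast
  define \<theta> where "\<theta> = max \<gamma> (p - \<delta> / 2)"
  have th: "\<gamma> \<le> \<theta>" "\<theta> < p" "dist \<theta> p < \<delta>" using \<delta>(1) \<open>\<gamma> < p\<close> by (auto simp: \<theta>_def dist_real_def)
  have "(mu P N A \<theta> - mu P N A p) / (\<theta> - p) < 0"
    using seg[of \<theta>] th by (intro \<delta>(2)) auto
  then have "mu P N A \<theta> > mu P N A p" using th by (simp add: divide_less_0_iff)
  then show False using seg[of \<theta>] th by simp
qed

section \<open>Transfer from the product space of marks\<close>

lemma offspring_measurable:
  assumes "N \<in> measurable P (count_space UNIV)" "C \<in> borel_measurable P" "\<And>i. i \<ge> 1 \<Longrightarrow> A i \<in> borel_measurable P"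
  shows "offspring N C A \<in> measurable P offspring_space"
  unfolding offspring_def[abs_def] offspring_space_def using assms
  by (intro measurable_Pair measurable_restrict) auto

text \<open>Trees, birth times and positions see the marks only at Ulam-Harris labels, and the weights only at positive
  indices.\<close>

lemma path_data_agree:
  assumes "\<And>x. x \<in> labels \<Longrightarrow> E x \<omega> = E' x \<omega>' \<and> N x \<omega> = N' x \<omega>' \<and> (\<forall>i\<ge>1. A x i \<omega> = A' x i \<omega>')"
  shows "in_tree N x \<omega> = in_tree N' x \<omega>'"
    and "x \<in> labels \<Longrightarrow> birth E x \<omega> = birth E' x \<omega>'" and "x \<in> labels \<Longrightarrow> position A x \<omega> = position A' x \<omega>'"
proof -
  show tr: "in_tree N x \<omega> = in_tree N' x \<omega>'"
  proof (induction x)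
    case (Cons i x)
    then show ?case using assms[of x] in_tree_labels[of N x \<omega>] in_tree_labels[of N' x \<omega>'] by auto
  qed simp
  show "x \<in> labels \<Longrightarrow> birth E x \<omega> = birth E' x \<omega>'"
    by (induction x) (use assms in auto)
  show "x \<in> labels \<Longrightarrow> position A x \<omega> = position A' x \<omega>'"
    by (induction x) (use assms in auto)
qed

context marked_brw
begin

definition Off where "Off = distr P offspring_space (offspring N C A)"

definition mark_map :: "'a \<Rightarrow> nat list \<Rightarrow> mark" where
  "mark_map \<omega> = (\<lambda>x\<in>labels. (Ev x \<omega>, Rv x \<omega>, offspring (Nv x) (Cv x) (Av x) \<omega>))"

lemma mark_map_fields:
  assumes "x \<in> labels"
  shows "mark_E x (mark_map \<omega>) = Ev x \<omega>" "mark_R x (mark_map \<omega>) = Rv x \<omega>" "mark_N x (mark_map \<omega>) = Nv x \<omega>"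
    "mark_C x (mark_map \<omega>) = Cv x \<omega>" "i \<ge> 1 \<Longrightarrow> mark_A x i (mark_map \<omega>) = Av x i \<omega>"
  using assms by (auto simp: mark_defs mark_map_def offspring_def)

lemma path_data_mark_map:
  "tree x (mark_map \<omega>) = in_tree Nv x \<omega>"
  "x \<in> labels \<Longrightarrow> birth_time x (mark_map \<omega>) = birth Ev x \<omega>" "x \<in> labels \<Longrightarrow> pos x (mark_map \<omega>) = position Av x \<omega>"
proof -
  have agree: "mark_E x (mark_map \<omega>) = Ev x \<omega> \<and> mark_N x (mark_map \<omega>) = Nv x \<omega> \<and> (\<forall>i\<ge>1. mark_A x i (mark_map \<omega>) = Av x i \<omega>)"
    if "x \<in> labels" for x using that by (simp add: mark_map_fields)
  show "tree x (mark_map \<omega>) = in_tree Nv x \<omega>"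
    "x \<in> labels \<Longrightarrow> birth_time x (mark_map \<omega>) = birth Ev x \<omega>" "x \<in> labels \<Longrightarrow> pos x (mark_map \<omega>) = position Av x \<omega>"
    using path_data_agree[of mark_E "mark_map \<omega>" Ev \<omega> mark_N Nv mark_A Av x, OF agree] by auto
qed

lemma alive_mark_map: "{x. is_alive t x (mark_map \<omega>)} = alive Ev Nv t \<omega>"
  by (auto simp: is_alive_def alive_def death_def path_data_mark_map mark_map_fields dest: in_tree_labels)

lemma dead_mark_map: "dead mark_E mark_N t (mark_map \<omega>) = dead Ev Nv t \<omega>"
  by (auto simp: dead_def death_def path_data_mark_map mark_map_fields dest: in_tree_labels)

lemma W_mark_map: "W mark_E mark_R mark_N mark_C mark_A t (mark_map \<omega>) = W Ev Rv Nv Cv Av t \<omega>"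
proof -
  have "x \<in> labels" if "x \<in> alive Ev Nv t \<omega>" for x using that by (auto simp: alive_def dest: in_tree_labels)
  moreover have "x \<in> labels" if "x \<in> dead Ev Nv t \<omega>" for x using that by (auto simp: dead_def dest: in_tree_labels)
  ultimately show ?thesis
    unfolding W_def alive_eq alive_mark_map dead_mark_map
    by (intro arg_cong2[where f = "(+)"] sum.cong) (auto simp: path_data_mark_map mark_map_fields)
qed

end

context marked_brw
begin

text \<open>Independence and the prescribed law of each mark say exactly that the family of marks has the product law; so every expectation of a function of
  the marks may be computed on the product space.\<close>

lemma mark_map_law:
  assumes \<nu>: "real_distribution \<nu>\<^sub>0" and P: "prob_space P" and off: "offspring N C A \<in> measurable P offspring_space"
  shows "mark_space \<nu>\<^sub>0 Off" 
    and "mark_map \<in> measurable M (mark_space.\<Omega> \<nu>\<^sub>0 Off)"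
    and "distr M (mark_space.\<Omega> \<nu>\<^sub>0 Off) mark_map = mark_space.\<Omega> \<nu>\<^sub>0 Off"
proof -
  show ms: "mark_space \<nu>\<^sub>0 Off"
    unfolding mark_space_def Off_def using \<nu> prob_space.prob_space_distr[OF P off] by simp
  interpret S: mark_space \<nu>\<^sub>0 Off by (rule ms)
  let ?M' = "borel \<Otimes>\<^sub>M borel \<Otimes>\<^sub>M offspring_space :: mark measure"
  have sets_eq: "sets (PiM labels (\<lambda>_. ?M')) = sets S.\<Omega>"
    unfolding S.\<Omega>_def by (intro sets_PiM_cong refl S.sets_Mark[symmetric])
  have rv: "(\<lambda>\<omega>. (Ev x \<omega>, Rv x \<omega>, offspring (Nv x) (Cv x) (Av x) \<omega>)) \<in> measurable M ?M'" if "x \<in> labels" for x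
    using indep_marks that by (auto simp: indep_vars_def)
  have X: "mark_map \<in> measurable M (PiM labels (\<lambda>_. ?M'))"
    unfolding mark_map_def[abs_def] by (intro measurable_restrict rv)
  then show "mark_map \<in> measurable M S.\<Omega>"
    by (simp only: measurable_cong_sets[OF refl sets_eq])
  have "distr M S.\<Omega> mark_map = distr M (PiM labels (\<lambda>_. ?M')) mark_map"
    by (intro distr_cong refl sets_eq[symmetric])
  also have "\<dots> = PiM labels (\<lambda>x. distr M ?M' (\<lambda>\<omega>. (Ev x \<omega>, Rv x \<omega>, offspring (Nv x) (Cv x) (Av x) \<omega>)))"
    using indep_marks indep_vars_iff_distr_eq_PiM'[of labels "\<lambda>x \<omega>. (Ev x \<omega>, Rv x \<omega>, offspring (Nv x) (Cv x) (Av x) \<omega>)" "\<lambda>_. ?M'"] rv labels_Nil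
    unfolding mark_map_def[abs_def] by blast
  also have "\<dots> = S.\<Omega>"
    unfolding S.\<Omega>_def S.Mark_def unfolding Off_def by (intro PiM_cong refl law_marks)
  finally show "distr M S.\<Omega> mark_map = S.\<Omega>" .
qed

lemma transfer_total_char:
  fixes \<kappa> :: complex and \<gamma> p \<xi> :: real
  assumes \<nu>: "real_distribution \<nu>\<^sub>0" and P: "prob_space P"
    and N [measurable]: "N \<in> measurable P (count_space UNIV)" and C [measurable]: "C \<in> borel_measurable P"
    and A: "\<And>i. i \<ge> 1 \<Longrightarrow> A i \<in> borel_measurable P" and A_pos: "\<And>i \<omega>. i \<ge> 1 \<Longrightarrow> \<omega> \<in> space P \<Longrightarrow> A i \<omega> > 0"
    and div: "\<forall>\<^sub>F \<epsilon> in at_right (0::real). (\<integral>\<^sup>+ s\<in>{1 - \<epsilon><..<1}. ennreal (1 / (s - (\<integral>\<omega>. s ^ N \<omega> \<partial>P))) \<partial>lborel) = \<infinity>"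
    and mean: "(\<integral>\<^sup>+ \<omega>. of_nat (N \<omega>) \<partial>P) > 1"
    and \<kappa>: "Re \<kappa> \<ge> 0" and \<gamma>: "\<gamma> \<in> Dom P N A" "\<gamma> < p" and pD: "p \<in> Dom P N A"
    and lim: "((\<lambda>T. of_real (T powr \<gamma>) * (1 - char \<nu>\<^sub>0 (\<xi> / T))) \<longlongrightarrow> \<kappa>) at_top"
    and p: "p = 1 \<or> (1 < p \<and> p \<le> 2 \<and> (\<integral>\<omega>. C \<omega> \<partial>P) = 0)"
    and Ci: "integrable P C" and Cp: "integrable P (\<lambda>\<omega>. \<bar>C \<omega>\<bar> powr p)"
    and slower: "mu P N A p < mu P N A \<gamma>" and pos: "mu P N A \<gamma> > 0"
  shows "((\<lambda>t. char (distr M borel (W Ev Rv Nv Cv Av t)) (\<xi> * exp (- mu P N A \<gamma> * t)) -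
     (CLINT \<omega>|M. exp (- \<kappa> * of_real (brw_martingale P N A Ev Nv Av \<gamma> t \<omega>)))) \<longlongrightarrow> 0) at_top"
    and "brw_martingale P N A Ev Nv Av \<gamma> t \<in> borel_measurable M"
proof -
  interpret P: prob_space P by fact
  have off: "offspring N C A \<in> measurable P offspring_space" by (rule offspring_measurable[OF N C A])
  interpret S: mark_space \<nu>\<^sub>0 Off by (rule mark_map_law[OF \<nu> P off])
  note X = mark_map_law(2)[OF \<nu> P off] and law = mark_map_law(3)[OF \<nu> P off]
  have to_Off: "offspring N C A \<in> measurable P Off" using off by (simp add: Off_def)
  have Off_int: "(\<integral>u. f u \<partial>Off) = (\<integral>\<omega>. f (offspring N C A \<omega>) \<partial>P)" if "f \<in> borel_measurable Off" for f :: "_ \<Rightarrow> real"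
    unfolding Off_def using that by (intro integral_distr off) (simp add: Off_def)
  have Off_nn: "(\<integral>\<^sup>+ u. f u \<partial>Off) = (\<integral>\<^sup>+ \<omega>. f (offspring N C A \<omega>) \<partial>P)" if "f \<in> borel_measurable Off" for f
    unfolding Off_def using that by (intro nn_integral_distr off) (simp add: Off_def)
  have pgf: "S.pgf s = (\<integral>\<omega>. s ^ N \<omega> \<partial>P)" for s
    unfolding S.pgf_def by (subst Off_int) (auto simp: offspring_def)
  have mean': "(\<integral>\<^sup>+ u. of_nat (fst u) \<partial>Off) > 1"
    using mean by (subst Off_nn) (auto simp: offspring_def)
  have wm: "S.weight_moment \<theta> = ennreal (weight_mean P N A \<theta>)" if "\<theta> \<in> Dom P N A" for \<theta>
  proof -
    have "S.weight_moment \<theta> = (\<integral>\<^sup>+ \<omega>. S.weight_sum \<theta> (offspring N C A \<omega>) \<partial>P)"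
      unfolding S.weight_moment_def by (rule Off_nn) measurable
    also have "\<dots> = (\<integral>\<^sup>+ \<omega>. ennreal (\<Sum>k=1..N \<omega>. A k \<omega> powr \<theta>) \<partial>P)"
    proof (rule nn_integral_cong)
      fix \<omega> assume w: "\<omega> \<in> space P"
      have "S.weight_sum \<theta> (offspring N C A \<omega>) = (\<Sum>k=1..N \<omega>. ennreal (A k \<omega> powr \<theta>))"
        unfolding S.weight_sum_def using A_pos[OF _ w]
        by (intro sum.cong) (auto simp: offspring_def powr_def less_le)
      then show "S.weight_sum \<theta> (offspring N C A \<omega>) = ennreal (\<Sum>k=1..N \<omega>. A k \<omega> powr \<theta>)" by (simp add: sum_ennreal)
    qed
    also have "\<dots> = ennreal (weight_mean P N A \<theta>)" by (rule weight_mean_Dom(1)[OF that])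
    finally show ?thesis .
  qed
  have C_int: "integrable Off (\<lambda>u. fst (snd u))"
    unfolding Off_def using Ci by (subst integrable_distr_eq[OF off]) (auto simp: offspring_def offspring_space_def)
  have C_mean: "(\<integral>u. fst (snd u) \<partial>Off) = (\<integral>\<omega>. C \<omega> \<partial>P)"
    by (subst Off_int) (auto simp: offspring_def)
  have C_p: "(\<integral>\<^sup>+ u. ennreal (\<bar>fst (snd u)\<bar> powr p) \<partial>Off) = ennreal (\<integral>\<omega>. \<bar>C \<omega>\<bar> powr p \<partial>P)"
    by (subst Off_nn) (auto simp: offspring_def intro!: nn_integral_eq_integral Cp)
  have g0: "\<gamma> > 0" "p > 0" using \<gamma> pD by (auto simp: Dom_def)
  have S_lim: "((\<lambda>t. (CLINT w|S.\<Omega>. iexp (\<xi> * exp (- mu P N A \<gamma> * t) * S.total t w)) -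
      (CLINT w|S.\<Omega>. exp (- \<kappa> * of_real (exp (- (weight_mean P N A \<gamma> - 1) * t) * S.power_sum \<gamma> t w)))) \<longlongrightarrow> 0) at_top"
  proof (rule S.total_char_approximation[OF _ mean' \<kappa> g0(1) \<gamma>(2) lim _ C_int C_p _ wm[OF \<gamma>(1)] _ wm[OF pD] _ weight_mean_Dom(4)[OF \<gamma>(1)] _ pos])
    show "weight_mean P N A p - 1 < p * mu P N A \<gamma>"
      using slower g0 unfolding weight_mean_Dom(4)[OF pD] by (simp add: field_simps)
  qed (use div p C_mean weight_mean_Dom(2)[OF \<gamma>(1)] weight_mean_Dom(2)[OF pD] in \<open>auto simp: pgf\<close>)
  have total: "S.total t (mark_map \<omega>) = W Ev Rv Nv Cv Av t \<omega>" for t \<omega>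
    unfolding S.total_def by (rule W_mark_map)
  have mart: "exp (- (weight_mean P N A \<gamma> - 1) * t) * S.power_sum \<gamma> t (mark_map \<omega>) = brw_martingale P N A Ev Nv Av \<gamma> t \<omega>" for t \<omega>
  proof -
    have "S.power_sum \<gamma> t (mark_map \<omega>) = (\<Sum>x\<in>alive Ev Nv t \<omega>. exp (\<gamma> * position Av x \<omega>))"
      unfolding S.power_sum_def alive_mark_map
      by (intro sum.cong refl) (auto simp: path_data_mark_map alive_def dest: in_tree_labels)
    then show ?thesis
      unfolding brw_martingale_def weight_mean_Dom(3)[OF \<gamma>(1)] by simp
  qed
  have W_meas: "W Ev Rv Nv Cv Av t \<in> borel_measurable M" for t
    using measurable_compose[OF X S.total_measurable[of t]] by (simp add: total)
  show "brw_martingale P N A Ev Nv Av \<gamma> t \<in> borel_measurable M"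
  proof -
    have "(\<lambda>w. exp (- (weight_mean P N A \<gamma> - 1) * t) * S.power_sum \<gamma> t w) \<in> borel_measurable S.\<Omega>" by measurable
    from measurable_compose[OF X this] show ?thesis unfolding mart .
  qed
  have 1: "(CLINT w|S.\<Omega>. iexp (\<xi> * exp (- mu P N A \<gamma> * t) * S.total t w)) =
     char (distr M borel (W Ev Rv Nv Cv Av t)) (\<xi> * exp (- mu P N A \<gamma> * t))" for t
  proof -
    have "(CLINT w|S.\<Omega>. iexp (\<xi> * exp (- mu P N A \<gamma> * t) * S.total t w)) =
        (CLINT w|distr M S.\<Omega> mark_map. iexp (\<xi> * exp (- mu P N A \<gamma> * t) * S.total t w))" by (simp only: law)
    also have "\<dots> = (CLINT \<omega>|M. iexp (\<xi> * exp (- mu P N A \<gamma> * t) * S.total t (mark_map \<omega>)))"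
      by (rule integral_distr[OF X]) measurable
    also have "\<dots> = char (distr M borel (W Ev Rv Nv Cv Av t)) (\<xi> * exp (- mu P N A \<gamma> * t))"
      unfolding char_def total by (rule integral_distr[OF W_meas, symmetric]) measurable
    finally show ?thesis .
  qed
  have 2: "(CLINT w|S.\<Omega>. exp (- \<kappa> * of_real (exp (- (weight_mean P N A \<gamma> - 1) * t) * S.power_sum \<gamma> t w))) =
     (CLINT \<omega>|M. exp (- \<kappa> * of_real (brw_martingale P N A Ev Nv Av \<gamma> t \<omega>)))" for t
  proof -
    have "(CLINT w|S.\<Omega>. exp (- \<kappa> * of_real (exp (- (weight_mean P N A \<gamma> - 1) * t) * S.power_sum \<gamma> t w))) =
      (CLINT w|distr M S.\<Omega> mark_map. exp (- \<kappa> * of_real (exp (- (weight_mean P N A \<gamma> - 1) * t) * S.power_sum \<gamma> t w)))" by (simp only: law)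
    also have "\<dots> = (CLINT \<omega>|M. exp (- \<kappa> * of_real (exp (- (weight_mean P N A \<gamma> - 1) * t) * S.power_sum \<gamma> t (mark_map \<omega>))))"
      by (rule integral_distr[OF X]) measurable
    finally show ?thesis unfolding mart .
  qed
  show "((\<lambda>t. char (distr M borel (W Ev Rv Nv Cv Av t)) (\<xi> * exp (- mu P N A \<gamma> * t)) -
     (CLINT \<omega>|M. exp (- \<kappa> * of_real (brw_martingale P N A Ev Nv Av \<gamma> t \<omega>)))) \<longlongrightarrow> 0) at_top"
    using S_lim unfolding 1 2 .
qed

text \<open>As \<open>Re \<kappa> \<ge> 0\<close> and the martingale is nonnegative, the integrands are bounded by \<open>1\<close>. The limit is nonnegative
  almost surely, which matters because \<open>g\<close> is prescribed only there.\<close>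

lemma martingale_limit_functional:
  fixes \<kappa> :: complex
  assumes \<kappa>: "Re \<kappa> \<ge> 0" and meas: "\<And>t. brw_martingale P N A Ev Nv Av \<gamma> t \<in> borel_measurable M"
    and M_inf: "M_inf \<in> borel_measurable M" "AE \<omega> in M. ((\<lambda>t. brw_martingale P N A Ev Nv Av \<gamma> t \<omega>) \<longlongrightarrow> M_inf \<omega>) at_top"
    and g: "g \<in> borel_measurable borel" "\<And>m. m \<ge> 0 \<Longrightarrow> g m = exp (- \<kappa> * of_real m)"
  shows "((\<lambda>t. CLINT \<omega>|M. exp (- \<kappa> * of_real (brw_martingale P N A Ev Nv Av \<gamma> t \<omega>))) \<longlongrightarrow> (CLINT \<omega>|M. g (M_inf \<omega>))) at_top"
proof -
  note [measurable] = meas M_inf(1) g(1)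
  have nn: "brw_martingale P N A Ev Nv Av \<gamma> t \<omega> \<ge> 0" for t \<omega>
    by (auto simp: brw_martingale_def intro!: mult_nonneg_nonneg sum_nonneg)
  have "((\<lambda>t. CLINT \<omega>|M. exp (- \<kappa> * of_real (brw_martingale P N A Ev Nv Av \<gamma> t \<omega>))) \<longlongrightarrow> (CLINT \<omega>|M. exp (- \<kappa> * of_real (M_inf \<omega>)))) at_top"
  proof (rule integral_dominated_convergence_at_top[where w = "\<lambda>_. 1"])
    show "\<forall>\<^sub>F t in at_top. AE \<omega> in M. norm (exp (- \<kappa> * of_real (brw_martingale P N A Ev Nv Av \<gamma> t \<omega>))) \<le> 1"
      by (intro always_eventually allI AE_I2 norm_exp_minus_le_1 \<kappa> nn)
    show "AE \<omega> in M. ((\<lambda>t. exp (- \<kappa> * of_real (brw_martingale P N A Ev Nv Av \<gamma> t \<omega>))) \<longlongrightarrow> exp (- \<kappa> * of_real (M_inf \<omega>))) at_top"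
      using M_inf(2) by eventually_elim (intro tendsto_intros)
    show "(\<lambda>\<omega>. exp (- \<kappa> * of_real (M_inf \<omega>))) \<in> borel_measurable M" by measurable
    show "(\<lambda>\<omega>. exp (- \<kappa> * of_real (brw_martingale P N A Ev Nv Av \<gamma> t \<omega>))) \<in> borel_measurable M" for t by measurable
  qed simp
  also have "(CLINT \<omega>|M. exp (- \<kappa> * of_real (M_inf \<omega>))) = (CLINT \<omega>|M. g (M_inf \<omega>))"
  proof (rule Bochner_Integration.integral_cong_AE)
    have nonneg: "AE \<omega> in M. M_inf \<omega> \<ge> 0"
      using M_inf(2) by eventually_elim (rule tendsto_lowerbound, assumption, use nn in auto)
    show "AE \<omega> in M. exp (- \<kappa> * of_real (M_inf \<omega>)) = g (M_inf \<omega>)"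
      using nonneg by eventually_elim (simp add: g(2))
  qed measurable
  finally show ?thesis .
qed

end

section \<open>The limit theorem\<close>

lemma g_hat_measurable: "g_hat \<gamma> \<nu> \<in> borel_measurable borel"
  unfolding g_hat_def[abs_def] Let_def by measurable

lemma integrable_of_powr_integrable:
  fixes f :: "'a \<Rightarrow> real"
  assumes "prob_space P" and [measurable]: "f \<in> borel_measurable P" and "p \<ge> 1" and int: "integrable P (\<lambda>\<omega>. \<bar>f \<omega>\<bar> powr p)"
  shows "integrable P f"
proof (rule Bochner_Integration.integrable_bound)
  interpret prob_space P by fact
  show "integrable P (\<lambda>\<omega>. 1 + \<bar>f \<omega>\<bar> powr p)" using int by simp
  have "\<bar>x\<bar> \<le> 1 + \<bar>x\<bar> powr p" for x :: real
  proof (cases "\<bar>x\<bar> \<le> 1")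
    case False
    then have "\<bar>x\<bar> powr 1 \<le> \<bar>x\<bar> powr p" using \<open>p \<ge> 1\<close> by (intro powr_mono) auto
    then show ?thesis using False by simp
  qed (simp add: add_increasing2)
  then show "AE \<omega> in P. norm (f \<omega>) \<le> norm (1 + \<bar>f \<omega>\<bar> powr p)"
    by (intro AE_I2) (simp add: abs_of_nonneg)
qed measurable

theorem theorem2p8:
  fixes P :: "'b measure" and N :: "'b \<Rightarrow> nat" and C :: "'b \<Rightarrow> real" and A :: "nat \<Rightarrow> 'b \<Rightarrow> real"
    and \<nu>\<^sub>0 :: "real measure"
    and M :: "'a measure"
    and Ev Rv :: "nat list \<Rightarrow> 'a \<Rightarrow> real" and Nv :: "nat list \<Rightarrow> 'a \<Rightarrow> nat"
    and Cv :: "nat list \<Rightarrow> 'a \<Rightarrow> real" and Av :: "nat list \<Rightarrow> nat \<Rightarrow> 'a \<Rightarrow> real"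
    and M_inf :: "'a \<Rightarrow> real" and \<gamma> \<xi> :: real
  assumes "real_distribution \<nu>\<^sub>0"
    and "prob_space P"
    and "N \<in> measurable P (count_space UNIV)"
    and "C \<in> borel_measurable P"
    and "\<And>i. i \<ge> 1 \<Longrightarrow> A i \<in> borel_measurable P"
    and "\<And>i \<omega>. i \<ge> 1 \<Longrightarrow> \<omega> \<in> space P \<Longrightarrow> A i \<omega> > 0"
    and cond_i: "\<forall>\<^sub>F \<epsilon> in at_right (0::real).
      (\<integral>\<^sup>+ s\<in>{1 - \<epsilon><..<1}. ennreal (1 / (s - (\<integral>\<omega>. s ^ N \<omega> \<partial>P))) \<partial>lborel) = \<infinity>"
    and cond_ii: "\<And>m. \<P>(\<omega> in P. N \<omega> = m) > 0 \<Longrightarrow>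
      \<P>(\<omega> in P. (\<forall>k\<in>{1..m}. A k \<omega> > 0) \<bar> N \<omega> = m) = 1"
    and cond_iii: "\<exists>m. \<P>(\<omega> in P. N \<omega> = m) > 0 \<and>
      \<P>(\<omega> in P. (\<forall>k\<in>{1..m}. A k \<omega> = 1) \<bar> N \<omega> = m) < 1"
    and cond_iv: "(\<integral>\<^sup>+ \<omega>. of_nat (N \<omega>) \<partial>P) > 1"
    and brw: "marked_brw P N C A \<nu>\<^sub>0 M Ev Rv Nv Cv Av"
    and "\<gamma> \<in> Dom P N A"
    and M_inf: "M_inf \<in> borel_measurable M"
      "AE \<omega> in M. ((\<lambda>t. brw_martingale P N A Ev Nv Av \<gamma> t \<omega>)
         \<longlongrightarrow> M_inf \<omega>) at_top"
    and cases:
      "((\<integral>\<omega>. C \<omega> \<partial>P) \<noteq> 0 \<and> (\<exists>p>1. integrable P (\<lambda>\<omega>. \<bar>C \<omega>\<bar> powr p)) \<and>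
        1 \<in> interior (Dom P N A) \<and> mu_deriv_neg P N A 1 \<and> Phi P N A 1 > 0 \<and>
        \<nu>\<^sub>0 \<in> \<H> \<gamma> \<and> \<gamma> < 1)
     \<or> ((\<integral>\<omega>. C \<omega> \<partial>P) \<noteq> 0 \<and> (\<exists>p>1. integrable P (\<lambda>\<omega>. \<bar>C \<omega>\<bar> powr p)) \<and>
        1 \<in> interior (Dom P N A) \<and> mu_deriv_neg P N A 1 \<and> Phi P N A 1 = 0 \<and>
        \<nu>\<^sub>0 \<in> \<H> \<gamma> \<and> \<gamma> < 1)
     \<or> ((\<integral>\<omega>. C \<omega> \<partial>P) \<noteq> 0 \<and> (\<exists>p>1. integrable P (\<lambda>\<omega>. \<bar>C \<omega>\<bar> powr p)) \<and>
        1 \<in> interior (Dom P N A) \<and> mu_deriv_neg P N A 1 \<and> Phi P N A 1 < 0 \<and>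
        \<nu>\<^sub>0 \<in> \<H> \<gamma> \<and> \<gamma> < 1 \<and> Phi P N A \<gamma> > 0)
     \<or> ((\<integral>\<omega>. C \<omega> \<partial>P) = 0 \<and> mu_deriv_neg P N A 1 \<and>
        (\<exists>p. 1 < p \<and> p \<le> 2 \<and> integrable P (\<lambda>\<omega>. \<bar>C \<omega>\<bar> powr p) \<and> Phi P N A p < 0 \<and>
          \<nu>\<^sub>0 \<in> \<H> \<gamma> \<and> \<gamma> < p \<and> Phi P N A \<gamma> > 0))
     \<or> ((\<integral>\<omega>. C \<omega> \<partial>P) = 0 \<and> 2 \<in> interior (Dom P N A) \<and> Phi P N A 2 > 0 \<and>
        mu_deriv_neg P N A 2 \<and>
        integrable P (\<lambda>\<omega>. (C \<omega>)\<^sup>2) \<and> (\<integral>\<omega>. (C \<omega>)\<^sup>2 \<partial>P) > 0 \<and>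
        \<nu>\<^sub>0 \<in> \<H> \<gamma> \<and> \<gamma> < 2)"
  shows "((\<lambda>t. char (distr M borel (W Ev Rv Nv Cv Av t)) (\<xi> * exp (- mu P N A \<gamma> * t)))
           \<longlongrightarrow> (CLINT \<omega>|M. g_hat \<gamma> \<nu>\<^sub>0 (\<xi> * M_inf \<omega> powr (1 / \<gamma>)))) at_top"
proof -
  interpret B: marked_brw P N C A \<nu>\<^sub>0 M Ev Rv Nv Cv Av by (rule brw)
  note gD = \<open>\<gamma> \<in> Dom P N A\<close>
  have decrease: "mu P N A p < mu P N A \<gamma>" if "\<gamma> < p" "mu_deriv_neg P N A p" for p
    by (rule mu_greater_left_of_decrease[OF _ _ assms(3) gD that]) (use assms(5,6) in auto)
  have \<gamma>_pos: "\<gamma> > 0" using gD by (simp add: Dom_def)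
  have Phi_pos: "mu P N A s > 0 \<longleftrightarrow> Phi P N A s > 0" and Phi_neg: "mu P N A s < 0 \<longleftrightarrow> Phi P N A s < 0"
    if "s \<in> Dom P N A" for s
  proof -
    have "s > 0" using that by (simp add: Dom_def)
    then show "mu P N A s > 0 \<longleftrightarrow> Phi P N A s > 0" "mu P N A s < 0 \<longleftrightarrow> Phi P N A s < 0"
      unfolding weight_mean_Dom(3,4)[OF that] by (simp_all add: zero_less_divide_iff divide_less_0_iff zero_ereal_def)
  qed
  have C_int: "integrable P C" if "integrable P (\<lambda>\<omega>. \<bar>C \<omega>\<bar> powr p)" "p \<ge> 1" for p
    by (rule integrable_of_powr_integrable[OF assms(2,4)]) (use that in auto)
  \<comment> \<open>The exponent \<open>p\<close> is \<open>1\<close>, \<open>1\<close>, \<open>1\<close>, the given one, and \<open>2\<close> in the five cases. In the first, the second and the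
     fifth, \<open>\<mu>(\<gamma>) > 0\<close> follows from \<open>\<Phi>(p) \<ge> 0\<close> and \<open>\<mu>(\<gamma>) > \<mu>(p)\<close>.\<close>
  have "\<nu>\<^sub>0 \<in> \<H> \<gamma> \<and> (\<exists>p. \<gamma> < p \<and> p \<in> Dom P N A \<and> (p = 1 \<or> (1 < p \<and> p \<le> 2 \<and> (\<integral>\<omega>. C \<omega> \<partial>P) = 0)) \<and>
      integrable P C \<and> integrable P (\<lambda>\<omega>. \<bar>C \<omega>\<bar> powr p) \<and> mu P N A p < mu P N A \<gamma> \<and> mu P N A \<gamma> > 0)"
    using cases
  proof (elim disjE conjE exE)
    fix p assume *: "p > 1" "integrable P (\<lambda>\<omega>. \<bar>C \<omega>\<bar> powr p)" "mu_deriv_neg P N A 1" "Phi P N A 1 > 0" "\<nu>\<^sub>0 \<in> \<H> \<gamma>" "\<gamma> < 1"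
    have "1 \<in> Dom P N A" using * by (simp add: mu_deriv_neg_def)
    then show ?thesis using * decrease[of 1] C_int[of p] Phi_pos[of 1] by (intro conjI exI[of _ 1]) auto
  next
    fix p assume *: "p > 1" "integrable P (\<lambda>\<omega>. \<bar>C \<omega>\<bar> powr p)" "mu_deriv_neg P N A 1" "Phi P N A 1 = 0" "\<nu>\<^sub>0 \<in> \<H> \<gamma>" "\<gamma> < 1"
    have "1 \<in> Dom P N A" using * by (simp add: mu_deriv_neg_def)
    then show ?thesis using * decrease[of 1] C_int[of p] by (intro conjI exI[of _ 1]) (auto simp: mu_def)
  next
    fix p assume *: "p > 1" "integrable P (\<lambda>\<omega>. \<bar>C \<omega>\<bar> powr p)" "mu_deriv_neg P N A 1" "\<nu>\<^sub>0 \<in> \<H> \<gamma>" "\<gamma> < 1" "Phi P N A \<gamma> > 0"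
    have "1 \<in> Dom P N A" using * by (simp add: mu_deriv_neg_def)
    then show ?thesis using * decrease[of 1] C_int[of p] Phi_pos[OF gD] by (intro conjI exI[of _ 1]) auto
  next
    fix p assume *: "(\<integral>\<omega>. C \<omega> \<partial>P) = 0" "1 < p" "p \<le> 2" "integrable P (\<lambda>\<omega>. \<bar>C \<omega>\<bar> powr p)" "Phi P N A p < 0" "\<nu>\<^sub>0 \<in> \<H> \<gamma>" "\<gamma> < p" "Phi P N A \<gamma> > 0"
    have pD: "p \<in> Dom P N A"
    proof -
      have "(\<integral>\<^sup>+ \<omega>. ennreal (\<Sum>k=1..N \<omega>. A k \<omega> powr p) \<partial>P) \<noteq> \<infinity>"
        using \<open>Phi P N A p < 0\<close> by (auto simp: Phi_def)
      then show ?thesis using \<open>1 < p\<close> by (simp add: Dom_def less_top)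
    qed
    then have "mu P N A p < 0" "mu P N A \<gamma> > 0" using * Phi_neg[OF pD] Phi_pos[OF gD] by auto
    then show ?thesis using * pD C_int[of p] by (intro conjI exI[of _ p]) auto
  next
    assume *: "(\<integral>\<omega>. C \<omega> \<partial>P) = 0" "Phi P N A 2 > 0" "mu_deriv_neg P N A 2" "integrable P (\<lambda>\<omega>. (C \<omega>)\<^sup>2)" "\<nu>\<^sub>0 \<in> \<H> \<gamma>" "\<gamma> < 2"
    have "2 \<in> Dom P N A" using * by (simp add: mu_deriv_neg_def)
    moreover have "\<bar>x\<bar> powr 2 = x\<^sup>2" for x :: real by (cases "x = 0") (simp_all add: powr_numeral)
    ultimately show ?thesis using * decrease[of 2] C_int[of 2] Phi_pos[of 2] by (intro conjI exI[of _ 2]) auto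
  qed
  then obtain p where H: "\<nu>\<^sub>0 \<in> \<H> \<gamma>" and p: "\<gamma> < p" "p \<in> Dom P N A" "p = 1 \<or> (1 < p \<and> p \<le> 2 \<and> (\<integral>\<omega>. C \<omega> \<partial>P) = 0)"
    "integrable P C" "integrable P (\<lambda>\<omega>. \<bar>C \<omega>\<bar> powr p)" "mu P N A p < mu P N A \<gamma>" "mu P N A \<gamma> > 0" by blast
  obtain \<kappa> where \<kappa>: "Re \<kappa> \<ge> 0" "((\<lambda>T. of_real (T powr \<gamma>) * (1 - char \<nu>\<^sub>0 (\<xi> / T))) \<longlongrightarrow> \<kappa>) at_top"
    "\<And>m. m \<ge> 0 \<Longrightarrow> g_hat \<gamma> \<nu>\<^sub>0 (\<xi> * m powr (1 / \<gamma>)) = exp (- \<kappa> * of_real m)"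
    using H_char_expansion[OF H] by blast
  have T: "((\<lambda>t. char (distr M borel (W Ev Rv Nv Cv Av t)) (\<xi> * exp (- mu P N A \<gamma> * t)) -
      (CLINT \<omega>|M. exp (- \<kappa> * of_real (brw_martingale P N A Ev Nv Av \<gamma> t \<omega>)))) \<longlongrightarrow> 0) at_top"
    by (rule B.transfer_total_char(1)[OF assms(1-4) _ _ cond_i cond_iv \<kappa>(1) gD p(1,2) \<kappa>(2) p(3-7)]) (use assms(5,6) in auto)
  have T_meas: "brw_martingale P N A Ev Nv Av \<gamma> t \<in> borel_measurable M" for t
    by (rule B.transfer_total_char(2)[OF assms(1-4) _ _ cond_i cond_iv \<kappa>(1) gD p(1,2) \<kappa>(2) p(3-7)]) (use assms(5,6) in auto)
  have "((\<lambda>t. CLINT \<omega>|M. exp (- \<kappa> * of_real (brw_martingale P N A Ev Nv Av \<gamma> t \<omega>))) \<longlongrightarrow>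
      (CLINT \<omega>|M. g_hat \<gamma> \<nu>\<^sub>0 (\<xi> * M_inf \<omega> powr (1 / \<gamma>)))) at_top"
  proof (rule B.martingale_limit_functional[OF \<kappa>(1) T_meas M_inf, where g = "\<lambda>m. g_hat \<gamma> \<nu>\<^sub>0 (\<xi> * m powr (1 / \<gamma>))"])
    show "(\<lambda>m. g_hat \<gamma> \<nu>\<^sub>0 (\<xi> * m powr (1 / \<gamma>))) \<in> borel_measurable borel"
      by (rule measurable_compose[OF _ g_hat_measurable]) measurable
  qed (rule \<kappa>(3))
  from tendsto_add[OF T this] show ?thesis by simp
qed

end
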